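(* Let $\Omega$ be a bounded domain in $\mathbb{R}^N$ ($N=2$ or $3$) with $C^3$ boundary, let $\nu>0$, and let $X_h\subset H^2\cap H^1_0(\Omega,\mathbb{R}^N)$ and $Y_h\subset H^1(\Omega)/\mathbb{R}$ be finite-dimensional subspaces. Assume $\vec f\in L^2(0,T;L^2(\Omega,\mathbb{R}^N))$ for some given $T>0$ and $\vec u_h^0\in X_h$. For a time step $\Delta t>0$, consider the finite-element scheme which, given $\vec u_h^n\in X_h$, determines $p_h^n\in Y_h$ and $\vec u_h^{n+1}\in X_h$ by requiring $$\big\langle\nabla p_h^n+\nu\nabla(\nabla\cdot\vec u_h^n)-\nu\Delta\vec u_h^n+\vec u_h^n\cdot\nabla\vec u_h^n-\vec f^n,\ \nabla\phi_h\big\rangle=0\qquad\text{for all }\phi_h\in Y_h,$$ $$\Big\langle\frac{\nabla\vec u_h^{n+1}-\nabla\vec u_h^n}{\Delta t},\nabla\vec v_h\Big\rangle+\big\langle\nu\Delta\vec u_h^{n+1},\Delta\vec v_h\big\rangle=\big\langle\nabla p_h^n+\vec u_h^n\cdot\nabla\vec u_h^n-\vec f^n,\ \Delta\vec v_h\big\rangle\qquad\text{for all }\vec v_h\in X_h,$$ where $\vec f^n=\frac1{\Delta t}\int_{n\Delta t}^{(n+1)\Delta t}\vec f(t)\,dt$. Then there exist positive constants $T^*$ and $C_4$ such that whenever $n\Delta t\le T^*$ (and $n\Delta t\le T$), we have $$\sup_{0\le k\le n}\|\nabla\vec u_h^k\|^2+\sum_{k=0}^n\|\Delta\vec u_h^k\|^2\,\Delta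 t\le C_4 .$$ The constants $T^*$ and $C_4$ depend only upon $\Omega$, $\nu$ and $$M_{0h}:=\|\nabla\vec u_h^0\|^2+\nu\Delta t\|\Delta\vec u_h^0\|^2+\int_0^T\|\vec f(t)\|^2\,dt .$$
   Context: $\langle\cdot,\cdot\rangle$ and $\|\cdot\|$ denote the $L^2(\Omega)$ inner product and norm (for scalar-, vector- or matrix-valued functions). $H^1(\Omega)/\mathbb{R}$ is $H^1(\Omega)$ modulo constants. No compatibility (inf-sup) condition between $X_h$ and $Y_h$ is assumed, and "depend only upon" means in particular that $T^*$ and $C_4$ do not depend otherwise on $X_h$, $Y_h$ or $\Delta t$. *)

theory Defs
  imports "HOL-Analysis.Analysis"
begin

abbreviation pdiff :: "'n::finite \<Rightarrow> (real ^ 'n \<Rightarrow> real) \<Rightarrow> real ^ 'n \<Rightarrow> real"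
  where "pdiff i f x \<equiv> frechet_derivative f (at x) (axis i 1)"

primrec Ck :: "nat \<Rightarrow> (real ^ 'n::finite \<Rightarrow> real) \<Rightarrow> bool" where
  "Ck 0 f \<longleftrightarrow> continuous_on UNIV f"
| "Ck (Suc k) f \<longleftrightarrow> (\<forall>x. f differentiable (at x)) \<and> (\<forall>i. Ck k (pdiff i f))"

text \<open>Near each boundary point the domain is the region above a \<open>C\<^sup>k\<close> graph.  The graph
  is taken over the hyperplane orthogonal to a unit vector \<open>e\<close>; its height \<open>\<gamma>\<close> is
  evaluated only at points of that hyperplane, onto which \<open>x - (x \<bullet> e) *\<^sub>R e\<close> is the
  orthogonal projection.\<close>

definition Ck_boundary :: "nat \<Rightarrow> (real ^ 'n::finite) set \<Rightarrow> bool" where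
  "Ck_boundary k \<Omega> \<longleftrightarrow>
     (\<forall>x0 \<in> frontier \<Omega>. \<exists>r>0. \<exists>e \<gamma>. norm e = 1 \<and> Ck k \<gamma> \<and>
        \<Omega> \<inter> ball x0 r = {x \<in> ball x0 r. x \<bullet> e > \<gamma> (x - (x \<bullet> e) *\<^sub>R e)})"

definition bounded_domain :: "(real ^ 'n::finite) set \<Rightarrow> bool" where
  "bounded_domain \<Omega> \<longleftrightarrow> open \<Omega> \<and> connected \<Omega> \<and> \<Omega> \<noteq> {} \<and> bounded \<Omega>"

text \<open>Elements of \<open>L\<^sup>2(\<Omega>)\<close> and of the Sobolev spaces are represented by functions on the
  whole space, of which only the values almost everywhere in \<open>\<Omega>\<close> matter.  For matrix-valued
  functions the inner product on \<^typ>\<open>real ^ 'n ^ 'n\<close> is the Frobenius one.\<close>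

definition L2 :: "'a::euclidean_space set \<Rightarrow> ('a \<Rightarrow> 'b::euclidean_space) set" where
  "L2 S = {f. f \<in> borel_measurable (lebesgue_on S) \<and>
              integrable (lebesgue_on S) (\<lambda>x. (norm (f x))\<^sup>2)}"

definition L2_inner ::
  "'a::euclidean_space set \<Rightarrow> ('a \<Rightarrow> 'b::euclidean_space) \<Rightarrow> ('a \<Rightarrow> 'b) \<Rightarrow> real" where
  "L2_inner S f g = (LINT x|lebesgue_on S. f x \<bullet> g x)"

definition L2_norm ::
  "'a::euclidean_space set \<Rightarrow> ('a \<Rightarrow> 'b::euclidean_space) \<Rightarrow> real" where
  "L2_norm S f = sqrt (L2_inner S f f)"

definition test_function :: "(real ^ 'n::finite) set \<Rightarrow> (real ^ 'n \<Rightarrow> real) \<Rightarrow> bool" where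
  "test_function \<Omega> \<phi> \<longleftrightarrow>
     (\<forall>k. Ck k \<phi>) \<and> compact (closure {x. \<phi> x \<noteq> 0}) \<and> closure {x. \<phi> x \<noteq> 0} \<subseteq> \<Omega>"

definition locally_integrable ::
  "(real ^ 'n::finite) set \<Rightarrow> (real ^ 'n \<Rightarrow> real) \<Rightarrow> bool" where
  "locally_integrable \<Omega> f \<longleftrightarrow>
     (\<forall>K. compact K \<and> K \<subseteq> \<Omega> \<longrightarrow> f absolutely_integrable_on K)"

definition has_weak_pderiv ::
  "(real ^ 'n::finite) set \<Rightarrow> 'n \<Rightarrow> (real ^ 'n \<Rightarrow> real) \<Rightarrow> (real ^ 'n \<Rightarrow> real) \<Rightarrow> bool" where
  "has_weak_pderiv \<Omega> i f g \<longleftrightarrow>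
     locally_integrable \<Omega> f \<and> locally_integrable \<Omega> g \<and>
     (\<forall>\<phi>. test_function \<Omega> \<phi> \<longrightarrow>
        (LINT x|lebesgue_on \<Omega>. f x * pdiff i \<phi> x) = - (LINT x|lebesgue_on \<Omega>. g x * \<phi> x))"

text \<open>A weak derivative is unique up to a null set, so the choice below is immaterial
  wherever a weak derivative exists.\<close>

definition weak_pderiv ::
  "(real ^ 'n::finite) set \<Rightarrow> 'n \<Rightarrow> (real ^ 'n \<Rightarrow> real) \<Rightarrow> real ^ 'n \<Rightarrow> real" where
  "weak_pderiv \<Omega> i f = (SOME g. has_weak_pderiv \<Omega> i f g)"

primrec sobolev :: "(real ^ 'n::finite) set \<Rightarrow> nat \<Rightarrow> (real ^ 'n \<Rightarrow> real) set" where
  "sobolev \<Omega> 0 = L2 \<Omega>"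
| "sobolev \<Omega> (Suc k) = {f \<in> L2 \<Omega>. \<forall>i. \<exists>g \<in> sobolev \<Omega> k. has_weak_pderiv \<Omega> i f g}"

definition grad :: "(real ^ 'n::finite) set \<Rightarrow> (real ^ 'n \<Rightarrow> real) \<Rightarrow> real ^ 'n \<Rightarrow> real ^ 'n" where
  "grad \<Omega> f x = (\<chi> i. weak_pderiv \<Omega> i f x)"

definition laplace :: "(real ^ 'n::finite) set \<Rightarrow> (real ^ 'n \<Rightarrow> real) \<Rightarrow> real ^ 'n \<Rightarrow> real" where
  "laplace \<Omega> f x = (\<Sum>i\<in>UNIV. weak_pderiv \<Omega> i (weak_pderiv \<Omega> i f) x)"

definition vgrad ::
  "(real ^ 'n::finite) set \<Rightarrow> (real ^ 'n \<Rightarrow> real ^ 'n) \<Rightarrow> real ^ 'n \<Rightarrow> real ^ 'n ^ 'n" where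
  "vgrad \<Omega> u x = (\<chi> i. grad \<Omega> (\<lambda>y. u y $ i) x)"

definition vlaplace ::
  "(real ^ 'n::finite) set \<Rightarrow> (real ^ 'n \<Rightarrow> real ^ 'n) \<Rightarrow> real ^ 'n \<Rightarrow> real ^ 'n" where
  "vlaplace \<Omega> u x = (\<chi> i. laplace \<Omega> (\<lambda>y. u y $ i) x)"

definition diverg :: "(real ^ 'n::finite) set \<Rightarrow> (real ^ 'n \<Rightarrow> real ^ 'n) \<Rightarrow> real ^ 'n \<Rightarrow> real" where
  "diverg \<Omega> u x = (\<Sum>i\<in>UNIV. weak_pderiv \<Omega> i (\<lambda>y. u y $ i) x)"

definition convect ::
  "(real ^ 'n::finite) set \<Rightarrow> (real ^ 'n \<Rightarrow> real ^ 'n) \<Rightarrow> (real ^ 'n \<Rightarrow> real ^ 'n) \<Rightarrow>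
   real ^ 'n \<Rightarrow> real ^ 'n" where
  "convect \<Omega> u v x = (\<chi> i. \<Sum>j\<in>UNIV. u x $ j * weak_pderiv \<Omega> j (\<lambda>y. v y $ i) x)"

definition H1_norm :: "(real ^ 'n::finite) set \<Rightarrow> (real ^ 'n \<Rightarrow> real) \<Rightarrow> real" where
  "H1_norm \<Omega> f = sqrt ((L2_norm \<Omega> f)\<^sup>2 + (L2_norm \<Omega> (grad \<Omega> f))\<^sup>2)"

definition H1_0 :: "(real ^ 'n::finite) set \<Rightarrow> (real ^ 'n \<Rightarrow> real) set" where
  "H1_0 \<Omega> = {f \<in> sobolev \<Omega> 1. \<exists>\<phi>. (\<forall>k::nat. test_function \<Omega> (\<phi> k)) \<and>
               (\<lambda>k. H1_norm \<Omega> (\<lambda>x. f x - \<phi> k x)) \<longlonglongrightarrow> 0}"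

definition velocity_space :: "(real ^ 'n::finite) set \<Rightarrow> (real ^ 'n \<Rightarrow> real ^ 'n) set" where
  "velocity_space \<Omega> = {u. \<forall>i. (\<lambda>x. u x $ i) \<in> sobolev \<Omega> 2 \<inter> H1_0 \<Omega>}"

definition null_functions ::
  "'a::euclidean_space set \<Rightarrow> ('a \<Rightarrow> 'b::euclidean_space) set" where
  "null_functions S = {z. AE x in lebesgue_on S. z x = 0}"

definition constant_functions ::
  "'a::euclidean_space set \<Rightarrow> ('a \<Rightarrow> 'b::euclidean_space) set" where
  "constant_functions S = {z. \<exists>c. AE x in lebesgue_on S. z x = c}"

text \<open>\<open>fin_dim_subspace_mod Z V W\<close>: \<open>W\<close> is the set of all representatives of the elements of a
  finite-dimensional subspace of \<open>V / Z\<close> (\<open>B\<close> represents a finite spanning set).  With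
  \<open>Z\<close> the null functions this is a finite-dimensional space of equivalence classes of
  functions; with \<open>Z\<close> the functions constant almost everywhere and \<open>V = H\<^sup>1(\<Omega>)\<close> it
  is a finite-dimensional subspace of \<open>H\<^sup>1(\<Omega>)/\<real>\<close>.\<close>

definition fin_dim_subspace_mod ::
  "('a \<Rightarrow> 'b::real_vector) set \<Rightarrow> ('a \<Rightarrow> 'b) set \<Rightarrow> ('a \<Rightarrow> 'b) set \<Rightarrow> bool" where
  "fin_dim_subspace_mod Z V W \<longleftrightarrow>
     (\<exists>B. finite B \<and> B \<subseteq> V \<and>
          W = {(\<lambda>x. (\<Sum>b\<in>B. c b *\<^sub>R b x) + z x) | c z. z \<in> Z})"

text \<open>\<open>L\<^sup>2(0,T; L\<^sup>2(\<Omega>))\<close> is identified with \<open>L\<^sup>2((0,T) \<times> \<Omega>)\<close>, so that the time averages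
  of the force can be formed pointwise in space.\<close>

definition L2_L2 ::
  "real \<Rightarrow> (real ^ 'n::finite) set \<Rightarrow> (real \<Rightarrow> real ^ 'n \<Rightarrow> real ^ 'n) set" where
  "L2_L2 T \<Omega> = {f. (\<lambda>(t, x). f t x) \<in> L2 ({0<..<T} \<times> \<Omega>)}"

definition time_avg ::
  "(real \<Rightarrow> real ^ 'n::finite \<Rightarrow> real ^ 'n) \<Rightarrow> real \<Rightarrow> nat \<Rightarrow> real ^ 'n \<Rightarrow> real ^ 'n" where
  "time_avg f dt n x =
     (1 / dt) *\<^sub>R (LINT t|lebesgue_on {real n * dt<..<real (n + 1) * dt}. f t x)"

definition pressure_eq ::
  "(real ^ 'n::finite) set \<Rightarrow> real \<Rightarrow> (real ^ 'n \<Rightarrow> real) set \<Rightarrow> (real ^ 'n \<Rightarrow> real ^ 'n) \<Rightarrow>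
   (real ^ 'n \<Rightarrow> real ^ 'n) \<Rightarrow> (real ^ 'n \<Rightarrow> real) \<Rightarrow> bool" where
  "pressure_eq \<Omega> \<nu> Y fn u p \<longleftrightarrow>
     (\<forall>\<phi>\<in>Y. L2_inner \<Omega>
        (\<lambda>x. grad \<Omega> p x + \<nu> *\<^sub>R grad \<Omega> (diverg \<Omega> u) x - \<nu> *\<^sub>R vlaplace \<Omega> u x
              + convect \<Omega> u u x - fn x)
        (grad \<Omega> \<phi>) = 0)"

definition velocity_eq ::
  "(real ^ 'n::finite) set \<Rightarrow> real \<Rightarrow> real \<Rightarrow> (real ^ 'n \<Rightarrow> real ^ 'n) set \<Rightarrow>
   (real ^ 'n \<Rightarrow> real ^ 'n) \<Rightarrow> (real ^ 'n \<Rightarrow> real ^ 'n) \<Rightarrow> (real ^ 'n \<Rightarrow> real) \<Rightarrow>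
   (real ^ 'n \<Rightarrow> real ^ 'n) \<Rightarrow> bool" where
  "velocity_eq \<Omega> \<nu> dt X fn u p u' \<longleftrightarrow>
     (\<forall>v\<in>X. L2_inner \<Omega> (\<lambda>x. (1 / dt) *\<^sub>R (vgrad \<Omega> u' x - vgrad \<Omega> u x)) (vgrad \<Omega> v)
            + L2_inner \<Omega> (\<lambda>x. \<nu> *\<^sub>R vlaplace \<Omega> u' x) (vlaplace \<Omega> v)
          = L2_inner \<Omega> (\<lambda>x. grad \<Omega> p x + convect \<Omega> u u x - fn x) (vlaplace \<Omega> v))"

text \<open>A step is required only when the interval over which the force is averaged lies
  in \<open>[0,T]\<close>.\<close>

definition fem_scheme ::
  "(real ^ 'n::finite) set \<Rightarrow> real \<Rightarrow> (real ^ 'n \<Rightarrow> real ^ 'n) set \<Rightarrow> (real ^ 'n \<Rightarrow> real) set \<Rightarrow>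
   real \<Rightarrow> (real \<Rightarrow> real ^ 'n \<Rightarrow> real ^ 'n) \<Rightarrow> real \<Rightarrow>
   (nat \<Rightarrow> real ^ 'n \<Rightarrow> real ^ 'n) \<Rightarrow> (nat \<Rightarrow> real ^ 'n \<Rightarrow> real) \<Rightarrow> bool" where
  "fem_scheme \<Omega> \<nu> X Y T f dt u p \<longleftrightarrow>
     u 0 \<in> X \<and>
     (\<forall>n. real (n + 1) * dt \<le> T \<longrightarrow>
        p n \<in> Y \<and> u (n + 1) \<in> X \<and>
        pressure_eq \<Omega> \<nu> Y (time_avg f dt n) (u n) (p n) \<and>
        velocity_eq \<Omega> \<nu> dt X (time_avg f dt n) (u n) (p n) (u (n + 1)))"

definition M0h ::
  "(real ^ 'n::finite) set \<Rightarrow> real \<Rightarrow> real \<Rightarrow> (real \<Rightarrow> real ^ 'n \<Rightarrow> real ^ 'n) \<Rightarrow> real \<Rightarrow>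
   (real ^ 'n \<Rightarrow> real ^ 'n) \<Rightarrow> real" where
  "M0h \<Omega> \<nu> T f dt u0 =
     (L2_norm \<Omega> (vgrad \<Omega> u0))\<^sup>2 + \<nu> * dt * (L2_norm \<Omega> (vlaplace \<Omega> u0))\<^sup>2
     + (LINT t|lebesgue_on {0<..<T}. (L2_norm \<Omega> (f t))\<^sup>2)"

end

theory Submission
 imports Defs
begin

text \<open>Write \<open>V u = \<Delta>u - \<nabla>(div u)\<close>. The pressure equation bounds \<open>\<parallel>\<nabla>p\<parallel>\<close> by \<open>\<nu>\<parallel>P (V u)\<parallel>\<close>, with \<open>P\<close> the
  projection to gradients, plus the convection and force terms. No inf-sup condition is needed because
  \<open>\<bar>\<langle>V u, \<nabla>\<phi>\<rangle>\<bar> \<le> (\<theta> \<parallel>\<Delta>u\<parallel> + C \<parallel>\<nabla>u\<parallel>) \<parallel>\<nabla>\<phi>\<parallel>\<close> with \<open>\<theta>\<^sup>2 = 3/4 < 1\<close> for all \<open>u\<close> in \<open>H\<^sup>2 \<inter> H\<^sub>0\<^sup>1\<close>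
  (Liu, Liu and Pego), so the implicit viscosity absorbs the explicit pressure.

  Since \<open>V u\<close> is orthogonal to gradients of test functions, \<open>\<nabla>\<phi>\<close> may be replaced by a harmonic field
  \<open>G\<close>. With a defining function \<open>\<rho>\<close> of the domain and \<open>\<xi> = s/(s + \<rho>)\<close>, only the tangential part
  \<open>\<tau>\<close> of \<open>\<xi>u\<close> contributes: \<open>u - \<tau>\<close> has normal boundary derivatives only, which the curl-free field
  \<open>G\<close> does not see, and \<open>div \<tau>\<close> vanishes on the boundary. A Pohozaev identity shows that near the
  boundary the tangential part of \<open>G\<close> carries about half of its energy, which yields \<open>\<theta>\<close>.

  Testing the velocity equation with the new velocity then gives a discrete Gronwall inequality in
  which \<open>\<parallel>u \<cdot> \<nabla>u\<parallel>\<^sup>2 \<le> C \<parallel>\<nabla>u\<parallel>\<^sup>3 \<parallel>\<Delta>u\<parallel>\<close> produces the superlinear term that limits the time.\<close>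

text \<open>The energy of the scheme contains only the norms of grad u and Delta u, so the
  commutator bound and the convection bound are both made in these two norms. Boundary values are
  read off from strips: a function counts as zero on the boundary when its L2 norm on the strip
  \<open>rr < s\<close> is O(s), and each boundary integral becomes the derivative of a cutoff
  \<open>cut (m * rr)\<close> that dies out as m grows. A bound o(sqrt s) improves to O(s) by a
  Hardy type inequality; this is how tangential derivatives of u are seen to vanish on the boundary.
  The value 3/4 is 1/2, from the balance of tangential and normal energy, plus an error K s that the
  choice s = 1/(4 K) turns into 1/4; any sum below 1 would serve. The C^3 boundary enters through
  the matrix \<open>coef\<close>, which contains the gradient of \<open>rr\<close> and is
  differentiated twice. In the energy estimate Young's inequality trades the convection bound for a
  small part of the squared norm of Delta u and the sixth power of the norm of grad u; this is the
  origin of the cube in the discrete Gronwall inequality.\<close>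

abbreviation univ_sum (binder "SU " 10) where "univ_sum f \<equiv> sum f UNIV"
abbreviation nn_lborel (binder "NI " 10) where "nn_lborel f \<equiv> integral\<^sup>N lborel f"
abbreviation lborel_int (binder "LB " 10) where "lborel_int f \<equiv> integral\<^sup>L lborel f"
abbreviation lebesgue_int (binder "LE " 10) where "lebesgue_int f \<equiv> integral\<^sup>L lebesgue f"
abbreviation seq_limit (infix "~~>" 60) where "X ~~> a \<equiv> X \<longlonglongrightarrow> a"
type_synonym 'n fn = "real^'n => real"
lemmas B_add = Bochner_Integration.integral_add and B_diff = Bochner_Integration.integral_diff and B_sum = Bochner_Integration.integral_sum
 and B_cong = Bochner_Integration.integral_cong and B_nonneg = Bochner_Integration.integral_nonneg
 and Bi_add = Bochner_Integration.integrable_add and Bi_diff = Bochner_Integration.integrable_diff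
 and Bi_sum = Bochner_Integration.integrable_sum and Bi_bound = Bochner_Integration.integrable_bound

subsection \<open>The space $L^2$\<close>

lemma L2D:
 assumes "f \<in> L2 S"
 shows "f \<in> borel_measurable (lebesgue_on S)" "integrable (lebesgue_on S) (%x. (norm (f x))^2)"
 using assms by (auto simp: L2_def)

lemma L2_integrable_inner:
 assumes "f \<in> L2 S" "g \<in> L2 S"
 shows "integrable (lebesgue_on S) (%x. f x \<bullet> g x)"
proof (rule Bi_bound)
 show "integrable (lebesgue_on S) (%x. (norm (f x))^2 + (norm (g x))^2)"
  using L2D[OF assms(1)] L2D[OF assms(2)] by auto
 show "(%x. f x \<bullet> g x) \<in> borel_measurable (lebesgue_on S)"
  using L2D[OF assms(1)] L2D[OF assms(2)] by measurable
 show "AE x in lebesgue_on S. norm (f x \<bullet> g x) <= norm ((norm (f x))^2 + (norm (g x))^2)"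
 proof (intro AE_I2)
  fix x
  have "\<bar>f x \<bullet> g x\<bar> <= norm (f x) * norm (g x)" by (rule Cauchy_Schwarz_ineq2)
  also have "... <= (norm (f x))^2 + (norm (g x))^2"
   using sum_squares_bound[of "norm (f x)" "norm (g x)"]
    mult_nonneg_nonneg[OF norm_ge_zero norm_ge_zero, of "f x" "g x"] by linarith
  finally show "norm (f x \<bullet> g x) <= norm ((norm (f x))^2 + (norm (g x))^2)" by simp
 qed
qed

lemma L2_integrable_mult:
 fixes f g :: "'a::euclidean_space => real"
 assumes "f \<in> L2 S" "g \<in> L2 S"
 shows "integrable (lebesgue_on S) (%x. f x * g x)"
 using L2_integrable_inner[OF assms] by simp

lemma L2_integrable_power2:
 fixes f :: "'a::euclidean_space => real"
 assumes "f \<in> L2 S"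
 shows "integrable (lebesgue_on S) (%x. (f x)^2)"
 using L2D(2)[OF assms] by simp

lemma L2_zero [simp]: "(%x. 0) \<in> L2 S"
 by (simp add: L2_def)

lemma L2_bound:
 fixes g :: "'a::euclidean_space => 'c::euclidean_space"
 assumes "g \<in> L2 S" "f \<in> borel_measurable (lebesgue_on S)"
  "AE x in lebesgue_on S. norm (f x) <= norm (g x)"
 shows "f \<in> L2 S"
proof -
 have m: "(%x. (norm (f x))^2) \<in> borel_measurable (lebesgue_on S)"
  using assms(2) by measurable
 have "integrable (lebesgue_on S) (%x. (norm (f x))^2)"
  by (rule Bi_bound[OF L2D(2)[OF assms(1)] m])
   (use assms(3) in eventually_elim, simp add: power_mono)
 with assms(2) show ?thesis by (simp add: L2_def)
qed

lemma L2_scaleR [intro]: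
 assumes "f \<in> L2 S" shows "(%x. c *\<^sub>R f x) \<in> L2 S"
 using L2D[OF assms] by (auto simp: L2_def power_mult_distrib)

lemma L2_cmult [intro]:
 fixes f :: "'a::euclidean_space => real"
 assumes "f \<in> L2 S" shows "(%x. c * f x) \<in> L2 S"
 using L2_scaleR[OF assms, of c] by simp

lemma L2_add [intro]:
 assumes "f \<in> L2 S" "g \<in> L2 S" shows "(%x. f x + g x) \<in> L2 S"
proof -
 have "integrable (lebesgue_on S) (%x. (norm (f x))^2 + 2 * (f x \<bullet> g x) + (norm (g x))^2)"
  using L2D[OF assms(1)] L2D[OF assms(2)] L2_integrable_inner[OF assms] by auto
 moreover have "(norm (f x + g x))^2 = (norm (f x))^2 + 2 * (f x \<bullet> g x) + (norm (g x))^2" for x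
  by (simp add: power2_norm_eq_inner algebra_simps inner_commute)
 ultimately show ?thesis
  using L2D(1)[OF assms(1)] L2D(1)[OF assms(2)] by (auto simp: L2_def)
qed

lemma L2_uminus [intro]:
 assumes "f \<in> L2 S" shows "(%x. - f x) \<in> L2 S"
 using L2_scaleR[OF assms, of "-1"] by simp

lemma L2_diff [intro]:
 assumes "f \<in> L2 S" "g \<in> L2 S" shows "(%x. f x - g x) \<in> L2 S"
 using L2_add[OF assms(1) L2_uminus[OF assms(2)]] by simp

lemma L2_sum [intro]:
 assumes "!!i. i \<in> I ==> f i \<in> L2 S" shows "(%x. \<Sum>i\<in>I. f i x) \<in> L2 S"
 using assms by (induction I rule: infinite_finite_induct) auto

lemma L2_cong_AE:
 assumes "f \<in> L2 S" "g \<in> borel_measurable (lebesgue_on S)" "AE x in lebesgue_on S. f x = g x"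
 shows "g \<in> L2 S"
 by (rule L2_bound[OF assms(1,2)]) (use assms(3) in eventually_elim, simp)

text \<open>Lebesgue measure is complete, so a change on a null set keeps measurability. The zero
  extension moves the question to the whole space.\<close>

lemma AE_measurable_lebesgue_on:
 fixes f g :: "'a::euclidean_space => 'b::euclidean_space"
 assumes S: "S \<in> sets lebesgue" and f: "f \<in> borel_measurable (lebesgue_on S)"
  and ae: "AE x in lebesgue_on S. f x = g x"
 shows "g \<in> borel_measurable (lebesgue_on S)"
proof -
 have m: "(%x. if x \<in> S then f x else 0) \<in> borel_measurable lebesgue"
  using f by (rule borel_measurable_if_I[OF _ S])
 have "AE x in lebesgue. x \<in> S --> f x = g x"
  using ae S by (simp add: AE_restrict_space_iff)
 then have "AE x in lebesgue. (if x \<in> S then f x else 0) = (if x \<in> S then g x else 0)"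
  by eventually_elim simp
 then have "(%x. if x \<in> S then g x else 0) \<in> borel_measurable lebesgue"
  by (rule borel_measurable_AE[OF m])
 then show ?thesis by (rule borel_measurable_if_D)
qed

lemma L2_cong_AE_iff:
 fixes f g :: "'a::euclidean_space => 'b::euclidean_space"
 assumes "S \<in> sets lebesgue" "AE x in lebesgue_on S. f x = g x" "f \<in> L2 S"
 shows "g \<in> L2 S"
 by (rule L2_cong_AE[OF assms(3) AE_measurable_lebesgue_on[OF assms(1) L2D(1)[OF assms(3)] assms(2)] assms(2)])

lemma L2_inner_commute: "L2_inner S f g = L2_inner S g f"
 by (simp add: L2_inner_def inner_commute)

lemma L2_inner_add_left:
 assumes "f \<in> L2 S" "g \<in> L2 S" "h \<in> L2 S"
 shows "L2_inner S (%x. f x + g x) h = L2_inner S f h + L2_inner S g h"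
 using L2_integrable_inner[OF assms(1,3)] L2_integrable_inner[OF assms(2,3)]
 by (simp add: L2_inner_def inner_add_left)

lemma L2_inner_diff_left:
 assumes "f \<in> L2 S" "g \<in> L2 S" "h \<in> L2 S"
 shows "L2_inner S (%x. f x - g x) h = L2_inner S f h - L2_inner S g h"
 using L2_integrable_inner[OF assms(1,3)] L2_integrable_inner[OF assms(2,3)]
 by (simp add: L2_inner_def inner_diff_left)

lemma L2_inner_scaleR_left: "L2_inner S (%x. c *\<^sub>R f x) h = c * L2_inner S f h"
 unfolding L2_inner_def inner_scaleR_left by (rule integral_mult_right_zero)

lemma L2_inner_scaleR_right: "L2_inner S h (%x. c *\<^sub>R f x) = c * L2_inner S h f"
 unfolding L2_inner_def inner_scaleR_right by (rule integral_mult_right_zero)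

lemma L2_inner_sum_left:
 assumes "!!i. i \<in> I ==> f i \<in> L2 S" "h \<in> L2 S"
 shows "L2_inner S (%x. \<Sum>i\<in>I. f i x) h = (\<Sum>i\<in>I. L2_inner S (f i) h)"
 unfolding L2_inner_def inner_sum_left
 by (rule B_sum) (use L2_integrable_inner assms in blast)

lemma L2_inner_self_nonneg: "0 <= L2_inner S f f"
 unfolding L2_inner_def by (rule integral_nonneg_AE) auto

lemma L2_norm_nonneg [simp]: "0 <= L2_norm S f"
 by (simp add: L2_norm_def L2_inner_self_nonneg)

lemma L2_norm_power2: "(L2_norm S f)^2 = (LINT x|lebesgue_on S. (norm (f x))^2)"
 unfolding L2_norm_def power2_norm_eq_inner
 using L2_inner_self_nonneg[of S f] by (metis L2_inner_def real_sqrt_pow2)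

lemma L2_norm_inner: "(L2_norm S f)^2 = L2_inner S f f"
 by (simp add: L2_norm_def L2_inner_self_nonneg)

lemma L2_norm_zero [simp]: "L2_norm S (%x. 0) = 0"
 by (simp add: L2_norm_def L2_inner_def)

lemma L2_norm_scaleR: "L2_norm S (%x. c *\<^sub>R f x) = \<bar>c\<bar> * L2_norm S f"
proof -
 have "L2_inner S (%x. c *\<^sub>R f x) (%x. c *\<^sub>R f x) = c^2 * L2_inner S f f"
  by (simp add: L2_inner_scaleR_left L2_inner_scaleR_right power2_eq_square)
 then show ?thesis by (simp add: L2_norm_def real_sqrt_mult)
qed

lemma L2_norm_uminus: "L2_norm S (%x. - f x) = L2_norm S f"
 by (simp add: L2_norm_def L2_inner_def)

lemma L2_norm_add_power2:
 assumes "f \<in> L2 S" "g \<in> L2 S"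
 shows "(L2_norm S (%x. f x + g x))^2 = (L2_norm S f)^2 + 2 * L2_inner S f g + (L2_norm S g)^2"
proof -
 have "(norm (f x + g x))^2 = (norm (f x))^2 + 2 * (f x \<bullet> g x) + (norm (g x))^2" for x
  by (simp add: power2_norm_eq_inner algebra_simps inner_commute)
 then show ?thesis
  using L2D(2)[OF assms(1)] L2D(2)[OF assms(2)] L2_integrable_inner[OF assms]
  by (simp add: L2_norm_power2 L2_inner_def)
qed

text \<open>The quadratic polynomial in \<open>t\<close> of \<open>*\<close> is nonnegative;
  evaluating it at its minimum gives the inequality.\<close>

lemma L2_Cauchy_Schwarz:
 assumes "f \<in> L2 S" "g \<in> L2 S"
 shows "\<bar>L2_inner S f g\<bar> <= L2_norm S f * L2_norm S g"
proof -
 have *: "0 <= (L2_norm S f)^2 + 2 * t * L2_inner S f g + t^2 * (L2_norm S g)^2" for t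
 proof -
  have "0 <= (L2_norm S (%x. f x + t *\<^sub>R g x))^2" by simp
  also have "... = (L2_norm S f)^2 + 2 * t * L2_inner S f g + t^2 * (L2_norm S g)^2"
   using L2_norm_add_power2[OF assms(1) L2_scaleR[OF assms(2), of t]]
   by (simp add: L2_norm_scaleR L2_inner_scaleR_right power_mult_distrib)
  finally show ?thesis .
 qed
 have "(L2_inner S f g)^2 <= (L2_norm S f)^2 * (L2_norm S g)^2"
 proof (cases "L2_norm S g = 0")
  case True
  have "L2_inner S f g = 0"
  proof (rule ccontr)
   assume n: "L2_inner S f g ~= 0"
   \<comment> \<open>If the leading coefficient vanishes, the polynomial is affine in
     \<open>t\<close>, and with a nonzero slope this \<open>t\<close> would make its value
     -1.\<close>
   have "(L2_norm S f)^2 + 2 * (-((L2_norm S f)^2 + 1) / (2 * L2_inner S f g)) * L2_inner S f g = -1"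
    using n by (simp add: field_simps)
   with *[of "-((L2_norm S f)^2 + 1) / (2 * L2_inner S f g)"] True show False by simp
  qed
  then show ?thesis by simp
 next
  case False
  then have p: "(L2_norm S g)^2 > 0" by simp
  have "0 <= (L2_norm S f)^2 - (L2_inner S f g)^2 / (L2_norm S g)^2"
   using *[of "- L2_inner S f g / (L2_norm S g)^2"] False
   by (simp add: field_simps power2_eq_square)
  then show ?thesis using p by (simp add: field_simps)
 qed
 then show ?thesis
  by (metis (no_types, lifting) L2_norm_nonneg abs_le_square_iff abs_of_nonneg mult_nonneg_nonneg
    power_mult_distrib)
qed

lemma L2_inner_le: 
 assumes "f \<in> L2 S" "g \<in> L2 S"
 shows "L2_inner S f g <= L2_norm S f * L2_norm S g"
 using L2_Cauchy_Schwarz[OF assms] by linarith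

lemma L2_norm_triangle:
 assumes "f \<in> L2 S" "g \<in> L2 S"
 shows "L2_norm S (%x. f x + g x) <= L2_norm S f + L2_norm S g"
proof (rule power2_le_imp_le)
 show "(L2_norm S (%x. f x + g x))^2 <= (L2_norm S f + L2_norm S g)^2"
  using L2_inner_le[OF assms] by (simp add: L2_norm_add_power2[OF assms] power2_sum)
qed simp

lemma L2_norm_triangle_diff:
 assumes "f \<in> L2 S" "g \<in> L2 S"
 shows "L2_norm S (%x. f x - g x) <= L2_norm S f + L2_norm S g"
 using L2_norm_triangle[OF assms(1) L2_uminus[OF assms(2)]] by (simp add: L2_norm_uminus)

lemma L2_norm_triangle_sum:
 assumes "!!i. i \<in> I ==> f i \<in> L2 S"
 shows "L2_norm S (%x. \<Sum>i\<in>I. f i x) <= (\<Sum>i\<in>I. L2_norm S (f i))"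
 using assms
proof (induction I rule: infinite_finite_induct)
 case (insert a I)
 have "L2_norm S (%x. f a x + (\<Sum>i\<in>I. f i x)) <= L2_norm S (f a) + L2_norm S (%x. \<Sum>i\<in>I. f i x)"
  by (rule L2_norm_triangle) (use insert in auto)
 with insert show ?case by simp
qed auto

lemma L2_norm_mono:
 fixes g :: "'a::euclidean_space => 'c::euclidean_space"
 assumes "g \<in> L2 S" "f \<in> borel_measurable (lebesgue_on S)"
  "AE x in lebesgue_on S. norm (f x) <= norm (g x)"
 shows "L2_norm S f <= L2_norm S g"
proof (rule power2_le_imp_le)
 have "f \<in> L2 S" by (rule L2_bound[OF assms])
 then show "(L2_norm S f)^2 <= (L2_norm S g)^2"
  unfolding L2_norm_power2 using L2D[OF assms(1)] L2D
  by (intro integral_mono_AE) (use assms(3) in "auto elim!: eventually_mono simp: power_mono")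
qed simp

lemma L2_norm_cong_AE:
 assumes "AE x in lebesgue_on S. f x = g x" "f \<in> borel_measurable (lebesgue_on S)"
  "g \<in> borel_measurable (lebesgue_on S)"
 shows "L2_norm S f = L2_norm S g"
 unfolding L2_norm_def L2_inner_def
 using assms by (intro arg_cong[where f=sqrt] integral_cong_AE) (auto elim!: eventually_mono)

lemma L2_mult_bounded:
 fixes c :: "'a::euclidean_space => real"
 assumes "f \<in> L2 S" "c \<in> borel_measurable (lebesgue_on S)" "AE x in lebesgue_on S. \<bar>c x\<bar> <= B"
 shows "(%x. c x *\<^sub>R f x) \<in> L2 S" "L2_norm S (%x. c x *\<^sub>R f x) <= \<bar>B\<bar> * L2_norm S f"
proof -
 have m: "(%x. c x *\<^sub>R f x) \<in> borel_measurable (lebesgue_on S)"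
  using L2D(1)[OF assms(1)] assms(2) by measurable
 have a: "AE x in lebesgue_on S. norm (c x *\<^sub>R f x) <= norm (B *\<^sub>R f x)"
  using assms(3) by eventually_elim (simp add: mult_right_mono)
 show "(%x. c x *\<^sub>R f x) \<in> L2 S"
  by (rule L2_bound[OF L2_scaleR[OF assms(1)] m a])
 show "L2_norm S (%x. c x *\<^sub>R f x) <= \<bar>B\<bar> * L2_norm S f"
  using L2_norm_mono[OF L2_scaleR[OF assms(1)] m a] by (simp add: L2_norm_scaleR)
qed

lemma L2_component_iff:
 fixes f :: "'a::euclidean_space => real^'n::finite"
 shows "f \<in> L2 S \<longleftrightarrow> (\<forall>i. (%x. f x $ i) \<in> L2 S)"
proof
 assume f: "f \<in> L2 S"
 show "\<forall>i. (%x. f x $ i) \<in> L2 S"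
 proof
  fix i
  have "(%x. f x \<bullet> axis i 1) \<in> borel_measurable (lebesgue_on S)"
   using L2D(1)[OF f] by measurable
  then have "(%x. f x $ i) \<in> borel_measurable (lebesgue_on S)"
   by (simp add: inner_axis)
  then show "(%x. f x $ i) \<in> L2 S"
   by (rule L2_bound[OF f]) (auto simp: component_le_norm_cart)
 qed
next
 assume a: "\<forall>i. (%x. f x $ i) \<in> L2 S"
 have "(%x. SU i. (f x $ i) *\<^sub>R axis i (1::real)) \<in> L2 S"
 proof (rule L2_sum)
  fix i
  have h: "(%x. f x $ i) \<in> L2 S" using a by auto
  have "(%x. (f x $ i) *\<^sub>R axis i (1::real) :: real^'n) \<in> borel_measurable (lebesgue_on S)"
   using L2D(1)[OF h] by measurable
  then show "(%x. (f x $ i) *\<^sub>R axis i (1::real) :: real^'n) \<in> L2 S"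
   by (rule L2_bound[OF h]) simp
 qed
 moreover have "(SU i. (f x $ i) *\<^sub>R axis i (1::real)) = f x" for x
  using basis_expansion[of "f x"] by (simp only: scalar_mult_eq_scaleR)
 ultimately show "f \<in> L2 S" by simp
qed

lemma L2_inner_component:
 fixes f g :: "'a::euclidean_space => real^'n::finite"
 assumes "f \<in> L2 S" "g \<in> L2 S"
 shows "L2_inner S f g = (SU i. LINT x|lebesgue_on S. f x $ i * g x $ i)"
proof -
 have "integrable (lebesgue_on S) (%x. f x $ i * g x $ i)" for i
  using assms L2_component_iff by (intro L2_integrable_mult) blast+
 then show ?thesis
  by (simp add: L2_inner_def inner_vec_def B_sum)
qed

lemma L2_norm_component:
 fixes f :: "'a::euclidean_space => real^'n::finite"
 assumes "f \<in> L2 S"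
 shows "(L2_norm S f)^2 = (SU i. (L2_norm S (%x. f x $ i))^2)"
 unfolding L2_norm_inner L2_inner_component[OF assms assms] by (rule sum.cong) (simp_all add: L2_inner_def)

lemma L2_norm_component_le:
 fixes f :: "'a::euclidean_space => real^'n::finite"
 assumes "f \<in> L2 S"
 shows "L2_norm S (%x. f x $ i) <= L2_norm S f"
proof (rule L2_norm_mono[OF assms])
 show "(%x. f x $ i) \<in> borel_measurable (lebesgue_on S)"
  using assms L2_component_iff L2D(1) by blast
qed (simp add: component_le_norm_cart)

lemma L2_tendsto_inner:
 assumes "!!k. F k \<in> L2 S" "f \<in> L2 S" "g \<in> L2 S"
  and "((%k. L2_norm S (%x. F k x - f x)) \<longlongrightarrow> 0) X"
 shows "((%k. L2_inner S (F k) g) \<longlongrightarrow> L2_inner S f g) X"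
proof -
 have "((%k. L2_inner S (F k) g - L2_inner S f g) \<longlongrightarrow> 0) X"
 proof (rule Lim_null_comparison)
  show "((%k. L2_norm S (%x. F k x - f x) * L2_norm S g) \<longlongrightarrow> 0) X"
   using tendsto_mult_right[OF assms(4)] by simp
  show "\<forall>\<^sub>F k in X. norm (L2_inner S (F k) g - L2_inner S f g)
    <= L2_norm S (%x. F k x - f x) * L2_norm S g"
   using L2_Cauchy_Schwarz[OF L2_diff[OF assms(1,2)] assms(3)] assms
   by (intro always_eventually) (simp add: L2_inner_diff_left)
 qed
 then show ?thesis by (simp add: LIM_zero_iff)
qed

lemma L2_tendsto_norm:
 assumes "!!k. F k \<in> L2 S" "f \<in> L2 S"
  and "((%k. L2_norm S (%x. F k x - f x)) \<longlongrightarrow> 0) X"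
 shows "((%k. L2_norm S (F k)) \<longlongrightarrow> L2_norm S f) X"
proof -
 have "((%k. L2_norm S (F k) - L2_norm S f) \<longlongrightarrow> 0) X"
 proof (rule Lim_null_comparison[OF _ assms(3)], intro always_eventually allI)
  fix k
  have "L2_norm S (F k) <= L2_norm S (%x. F k x - f x) + L2_norm S f"
   using L2_norm_triangle[OF L2_diff[OF assms(1)[of k] assms(2)] assms(2)] by simp
  moreover have "L2_norm S f <= L2_norm S (F k) + L2_norm S (%x. F k x - f x)"
   using L2_norm_triangle_diff[OF assms(1)[of k] L2_diff[OF assms(1)[of k] assms(2)]] by simp
  ultimately show "norm (L2_norm S (F k) - L2_norm S f) <= L2_norm S (%x. F k x - f x)" by simp
 qed
 then show ?thesis by (simp add: LIM_zero_iff)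
qed

subsection \<open>Functions of class $C^k$\<close>

lemma has_derivative_imp_pdiff:
 "(f has_derivative f') (at x) ==> pdiff i f x = f' (axis i 1)"
 by (simp add: frechet_derivative_at[symmetric])

lemma has_derivative_pdiff:
 assumes "f differentiable (at x)"
 shows "(f has_derivative (%h. SU i. pdiff i f x * h $ i)) (at x)"
proof -
 have d: "(f has_derivative frechet_derivative f (at x)) (at x)"
  using assms frechet_derivative_works by blast
 then have l: "linear (frechet_derivative f (at x))" by (rule has_derivative_linear)
 have "frechet_derivative f (at x) h = (SU i. pdiff i f x * h $ i)" for h
 proof -
  have "frechet_derivative f (at x) h
    = frechet_derivative f (at x) (SU i. (h $ i) *\<^sub>R axis i 1)"
   using basis_expansion[of h] by (simp only: scalar_mult_eq_scaleR)
  also have "... = (SU i. pdiff i f x * h $ i)"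
   by (simp add: linear_sum[OF l] linear_scale[OF l] mult.commute)
  finally show ?thesis .
 qed
 then have "frechet_derivative f (at x) = (%h. SU i. pdiff i f x * h $ i)" by (rule ext)
 with d show ?thesis by (simp only:)
qed

lemma Ck_imp_continuous: "Ck k f ==> continuous_on UNIV f"
proof (induction k)
 case (Suc k)
 then show ?case
  by (auto intro!: continuous_at_imp_continuous_on differentiable_imp_continuous_within)
qed simp

lemma Ck_Suc_imp: "Ck (Suc k) f ==> Ck k f"
proof (induction k arbitrary: f)
 case 0
 then show ?case using Ck_imp_continuous[OF 0] by simp
next
 case (Suc k)
 have "\<forall>i. Ck (Suc k) (pdiff i f)" "\<forall>x. f differentiable (at x)"
  using Suc.prems by simp_all
 then show ?case using Suc.IH by simp
qed

lemma Ck_mono: "k <= m ==> Ck m f ==> Ck k f"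
 by (induction m rule: dec_induct) (use Ck_Suc_imp in blast)+

lemma Ck_const [intro]: "Ck k (%x :: real^'n::finite. c)"
proof (induction k arbitrary: c)
 case (Suc k)
 have "pdiff i (%x. c) = (%x. 0)" for i :: "'n"
  by (rule ext, subst has_derivative_imp_pdiff[OF has_derivative_const]) simp
 with Suc[of 0] show ?case by simp
qed simp

lemma Ck_coord [intro]: "Ck k (%x :: real^'n::finite. x $ i)"
proof (cases k)
 case (Suc m)
 have d: "((%x. x $ i) has_derivative (%h. h $ i)) (at x)" for x :: "real^'n"
  by (intro bounded_linear_imp_has_derivative bounded_linear_vec_nth)
 have "pdiff j (%x. x $ i) = (%x. axis j 1 $ i)" for j :: "'n"
  by (rule ext) (rule has_derivative_imp_pdiff[OF d])
 with d Suc show ?thesis by (auto simp: differentiable_def intro!: Ck_const)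
qed (simp add: continuous_on_component)

lemma Ck_add [intro]: "Ck k f ==> Ck k g ==> Ck k (%x. f x + g x)"
proof (induction k arbitrary: f g)
 case (Suc k)
 have d: "f differentiable (at x)" "g differentiable (at x)" for x using Suc.prems by simp_all
 have "pdiff i (%x. f x + g x) = (%x. pdiff i f x + pdiff i g x)" for i
  by (rule ext, rule has_derivative_imp_pdiff)
   (intro has_derivative_add; rule frechet_derivative_works[THEN iffD1, OF d(1)]
    frechet_derivative_works[THEN iffD1, OF d(2)])
 moreover have "Ck k (%x. pdiff i f x + pdiff i g x)" for i
  by (rule Suc.IH) (use Suc.prems in simp_all)
 ultimately show ?case using d by simp
qed (auto intro: continuous_on_add)

lemma Ck_mult [intro]: "Ck k f ==> Ck k g ==> Ck k (%x. f x * g x)"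
proof (induction k arbitrary: f g)
 case (Suc k)
 have d: "f differentiable (at x)" "g differentiable (at x)" for x using Suc.prems by simp_all
 have "pdiff i (%x. f x * g x) = (%x. f x * pdiff i g x + pdiff i f x * g x)" for i
  by (rule ext, rule has_derivative_imp_pdiff)
   (intro has_derivative_mult; rule frechet_derivative_works[THEN iffD1, OF d(1)]
    frechet_derivative_works[THEN iffD1, OF d(2)])
 moreover have "Ck k (%x. f x * pdiff i g x + pdiff i f x * g x)" for i
  by (intro Ck_add Suc.IH) (use Suc.prems Ck_Suc_imp[of k] in simp_all)
 ultimately show ?case using d by simp
qed (auto intro: continuous_on_mult)

lemma Ck_cmult [intro]: "Ck k f ==> Ck k (%x. c * f x)"
 by (intro Ck_mult Ck_const)

lemma Ck_uminus [intro]: "Ck k f ==> Ck k (%x. - f x)"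
 using Ck_cmult[of k f "-1"] by simp

lemma Ck_diff [intro]: "Ck k f ==> Ck k g ==> Ck k (%x. f x - g x)"
 using Ck_add[OF _ Ck_uminus] by fastforce

lemma Ck_sum [intro]: "(!!i. i \<in> I ==> Ck k (f i)) ==> Ck k (%x. \<Sum>i\<in>I. f i x)"
 by (induction I rule: infinite_finite_induct) auto

text \<open>Smoothness is asked of the composite \<open>h' (f x)\<close> and not of
  \<open>h'\<close>, so that an induction over a family closed under differentiation, such as
  \<open>bump_fun\<close>, can supply it.\<close>

lemma Ck_chain:
 assumes h: "!!x. (h has_real_derivative h' (f x)) (at (f x))"
  and f: "Ck (Suc k) f" and "Ck k (%x. h' (f x))"
 shows "Ck (Suc k) (%x. h (f x))"
proof -
 have d: "(f has_derivative frechet_derivative f (at x)) (at x)" for x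
  using f frechet_derivative_works by auto
 have c: "((%x. h (f x)) has_derivative (%y. h' (f x) * frechet_derivative f (at x) y)) (at x)" for x
  using has_derivative_compose[OF d[of x] has_field_derivative_imp_has_derivative[OF h]] .
 have "pdiff i (%x. h (f x)) = (%x. h' (f x) * pdiff i f x)" for i
  by (rule ext) (rule has_derivative_imp_pdiff[OF c])
 moreover have "Ck k (%x. h' (f x) * pdiff i f x)" for i
  by (rule Ck_mult[OF assms(3)]) (use f in simp)
 ultimately show ?thesis using c by (auto simp: differentiable_def)
qed

text \<open>The functions $t^{-m} e^{-1/t}$, extended by $0$, are closed under differentiation.\<close>

definition bump_fun :: "nat => real => real" where
 "bump_fun m t = (if t > 0 then inverse t ^ m * exp (- inverse t) else 0)"

lemma bump_fun_tendsto: "(bump_fun m \<longlongrightarrow> 0) (at_right 0)"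
proof -
 have "((%s. s ^ m / exp s) \<longlongrightarrow> (0::real)) at_top"
  by (intro tendsto_power_div_exp_0)
 then have "((%t. inverse t ^ m / exp (inverse t)) \<longlongrightarrow> (0::real)) (at_right 0)"
  by (rule filterlim_compose[OF _ filterlim_inverse_at_top_right])
 moreover have "\<forall>\<^sub>F t in at_right (0::real). inverse t ^ m / exp (inverse t) = bump_fun m t"
  using eventually_at_right_less[of 0]
  by eventually_elim (simp add: bump_fun_def exp_minus divide_inverse)
 ultimately show ?thesis by (rule Lim_transform_eventually)
qed

lemma bump_fun_DERIV:
 "(bump_fun m has_real_derivative (- real m * bump_fun (m + 1) t + bump_fun (m + 2) t)) (at t)"
proof -
 consider "t > 0" | "t < 0" | "t = 0" by linarith
 then show ?thesis
 proof cases
  case 1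
  have i: "(inverse has_real_derivative - (inverse t)\<^sup>2) (at t)"
   using DERIV_inverse[of t] 1 by (simp add: power2_eq_square)
  note DERIV_mult[OF DERIV_power[OF i, of m] DERIV_fun_exp[OF DERIV_minus[OF i]]]
  moreover have "real m * (- (inverse t)\<^sup>2 * inverse t ^ (m - Suc 0)) * exp (- inverse t) +
    exp (- inverse t) * - (- (inverse t)\<^sup>2) * inverse t ^ m
    = - real m * bump_fun (m + 1) t + bump_fun (m + 2) t"
  proof (cases m)
   case 0
   then show ?thesis using 1 by (simp add: bump_fun_def power2_eq_square)
  next
   case (Suc k)
   then show ?thesis using 1 by (simp add: bump_fun_def power2_eq_square algebra_simps)
  qed
  ultimately have "((%t. inverse t ^ m * exp (- inverse t)) has_real_derivative
    (- real m * bump_fun (m + 1) t + bump_fun (m + 2) t)) (at t)" by (simp only:)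
  then show ?thesis
   by (rule has_field_derivative_transform_within_open[of _ _ _ "{0<..}"])
    (use 1 in "auto simp: bump_fun_def")
 next
  case 2
  have "((%t. 0) has_real_derivative (- real m * bump_fun (m + 1) t + bump_fun (m + 2) t)) (at t)"
   using 2 by (simp add: bump_fun_def)
  then show ?thesis
   by (rule has_field_derivative_transform_within_open[of _ _ _ "{..<0}"])
    (use 2 in "auto simp: bump_fun_def")
 next
  case 3
  have "((%h. (bump_fun m (0 + h) - bump_fun m 0) / h) \<longlongrightarrow> 0) (at 0)"
  proof (rule filterlim_split_at)
   have "0 = (bump_fun m (0 + h) - bump_fun m 0) / h" if "h < 0" for h
    using that by (simp add: bump_fun_def)
   then have "\<forall>\<^sub>F h in at_left (0::real). 0 = (bump_fun m (0 + h) - bump_fun m 0) / h"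
    by (simp add: eventually_at_filter)
   then show "((%h. (bump_fun m (0 + h) - bump_fun m 0) / h) \<longlongrightarrow> 0) (at_left 0)"
    by (rule Lim_transform_eventually[OF tendsto_const])
   \<comment> \<open>To the right of 0 the difference quotient of \<open>bump_fun m\<close> is
     \<open>bump_fun (m + 1)\<close>, whose limit is known.\<close>
   have "\<forall>\<^sub>F h in at_right (0::real). bump_fun (m + 1) h = (bump_fun m (0 + h) - bump_fun m 0) / h"
    using eventually_at_right_less[of 0]
    by eventually_elim (simp add: bump_fun_def divide_inverse)
   then show "((%h. (bump_fun m (0 + h) - bump_fun m 0) / h) \<longlongrightarrow> 0) (at_right 0)"
    by (rule Lim_transform_eventually[OF bump_fun_tendsto])
  qed
  then show ?thesis using 3 by (simp add: DERIV_def bump_fun_def)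
 qed
qed

lemma Ck_bump_fun: "Ck k f ==> Ck k (%x. bump_fun m (f x))"
proof (induction k arbitrary: m)
 case 0
 have "continuous_on UNIV (bump_fun m)"
  by (intro continuous_at_imp_continuous_on) (use bump_fun_DERIV DERIV_isCont in blast)
 with 0 show ?case using continuous_on_compose2[of UNIV "bump_fun m" UNIV f] by simp
next
 case (Suc k)
 have "Ck k (%x. - real m * bump_fun (m + 1) (f x) + bump_fun (m + 2) (f x))"
  using Suc.IH Ck_Suc_imp[OF Suc.prems] by (intro Ck_add Ck_cmult) blast+
 then show ?case by (rule Ck_chain[where h = "bump_fun m", OF bump_fun_DERIV Suc.prems])
qed

lemma bump_fun_nonneg: "bump_fun m t >= 0"
 by (simp add: bump_fun_def)

lemma bump_fun_pos_iff: "bump_fun m t > 0 \<longleftrightarrow> t > 0"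
 by (simp add: bump_fun_def)

lemma bump_fun_eq_0_iff: "bump_fun m t = 0 \<longleftrightarrow> t <= 0"
 by (simp add: bump_fun_def)

section \<open>Symmetry of second partial derivatives\<close>

lemma pdiff_comp_line:
 assumes "f differentiable (at (a + t *\<^sub>R axis i 1))"
 shows "((%t. f (a + t *\<^sub>R axis i 1)) has_real_derivative pdiff i f (a + t *\<^sub>R axis i 1)) (at t)"
proof -
 have d: "(f has_derivative frechet_derivative f (at (a + t *\<^sub>R axis i 1))) (at (a + t *\<^sub>R axis i 1))"
  using assms frechet_derivative_works by blast
 have "((%t. a + t *\<^sub>R axis i 1) has_derivative (%h. h *\<^sub>R axis i (1::real))) (at t)"
  by (auto intro!: derivative_eq_intros)
 from has_derivative_compose[OF this d]
 have "((%t. f (a + t *\<^sub>R axis i 1)) has_derivative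
  (%h. h * pdiff i f (a + t *\<^sub>R axis i 1))) (at t)"
  by (simp add: linear_scale[OF has_derivative_linear[OF d]])
 then show ?thesis
  unfolding has_field_derivative_def
  by (rule has_derivative_eq_rhs) (simp add: fun_eq_iff mult.commute)
qed

text \<open>The mean value theorem is applied along \<open>axis i\<close> to the difference of
  \<open>f\<close> on two parallel lines, and then along \<open>axis j\<close> to the resulting
  partial derivative.\<close>

lemma second_difference_mean_value:
 assumes f: "Ck 2 f" and h: "h > 0"
 obtains s t where "0 < s" "s < h" "0 < t" "t < h"
  "f (x + h *\<^sub>R axis i 1 + h *\<^sub>R axis j 1) - f (x + h *\<^sub>R axis i 1) - f (x + h *\<^sub>R axis j 1) + f x
  = h * h * pdiff j (pdiff i f) (x + s *\<^sub>R axis i 1 + t *\<^sub>R axis j 1)"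
proof -
 have d: "f differentiable (at y)" "pdiff i f differentiable (at y)" for y
  using f by (auto simp: numeral_2_eq_2)
 define ph where "ph s = f (x + h *\<^sub>R axis j 1 + s *\<^sub>R axis i 1) - f (x + s *\<^sub>R axis i 1)" for s
 have dph: "(ph has_real_derivative
   pdiff i f (x + h *\<^sub>R axis j 1 + s *\<^sub>R axis i 1) - pdiff i f (x + s *\<^sub>R axis i 1)) (at s)" for s
  unfolding ph_def by (intro DERIV_diff pdiff_comp_line d)
 then obtain s where s: "0 < s" "s < h"
  "ph h - ph 0 = (h - 0) * (pdiff i f (x + h *\<^sub>R axis j 1 + s *\<^sub>R axis i 1) - pdiff i f (x + s *\<^sub>R axis i 1))"
  using MVT2[OF h dph] by blast
 define ps where "ps t = pdiff i f (x + s *\<^sub>R axis i 1 + t *\<^sub>R axis j 1)" for t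
 have dps: "(ps has_real_derivative pdiff j (pdiff i f) (x + s *\<^sub>R axis i 1 + t *\<^sub>R axis j 1)) (at t)" for t
  unfolding ps_def by (intro pdiff_comp_line d)
 then obtain t where t: "0 < t" "t < h"
  "ps h - ps 0 = (h - 0) * pdiff j (pdiff i f) (x + s *\<^sub>R axis i 1 + t *\<^sub>R axis j 1)"
  using MVT2[OF h dps] by blast
 show ?thesis
  by (rule that[OF s(1,2) t(1,2)])
   (use s(3) t(3) in "simp add: ph_def ps_def algebra_simps")
qed

text \<open>The second difference quotient \<open>q\<close> is symmetric in \<open>i\<close> and
  \<open>j\<close>, while its mean value form can be taken in either order; by continuity both mixed
  derivatives are limits of the same quotient.\<close>

lemma pdiff_commute:
 assumes f: "Ck 2 f"
 shows "pdiff i (pdiff j f) x = pdiff j (pdiff i f) x"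
proof -
 define q where "q h = (f (x + h *\<^sub>R axis i 1 + h *\<^sub>R axis j 1) - f (x + h *\<^sub>R axis i 1)
   - f (x + h *\<^sub>R axis j 1) + f x) / (h * h)" for h
 have lim: "(q \<longlongrightarrow> pdiff b (pdiff a f) x) (at_right 0)" if ab: "a = i & b = j \<or> a = j & b = i" for a b
 proof (rule tendstoI)
  fix e :: real assume "e > 0"
  have "continuous_on UNIV (pdiff b (pdiff a f))" using f by (simp add: numeral_2_eq_2)
  then have "isCont (pdiff b (pdiff a f)) x" by (simp add: continuous_on_eq_continuous_at)
  then obtain r where r: "r > 0" "!!y. dist y x < r ==>
    dist (pdiff b (pdiff a f) y) (pdiff b (pdiff a f) x) < e"
   using \<open>e > 0\<close> unfolding continuous_at_eps_delta by (metis dist_commute dist_norm)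
  have "dist (q h) (pdiff b (pdiff a f) x) < e" if h: "0 < h" "h < r / 2" for h
  proof -
   obtain s t where st: "0 < s" "s < h" "0 < t" "t < h"
    "f (x + h *\<^sub>R axis a 1 + h *\<^sub>R axis b 1) - f (x + h *\<^sub>R axis a 1) - f (x + h *\<^sub>R axis b 1) + f x
    = h * h * pdiff b (pdiff a f) (x + s *\<^sub>R axis a 1 + t *\<^sub>R axis b 1)"
    using second_difference_mean_value[OF f h(1)] by blast
   have "f (x + h *\<^sub>R axis a 1 + h *\<^sub>R axis b 1) - f (x + h *\<^sub>R axis a 1) - f (x + h *\<^sub>R axis b 1) + f x
     = q h * (h * h)"
    using h ab by (auto simp: q_def add.assoc add.left_commute add.commute)
   then have q: "q h = pdiff b (pdiff a f) (x + s *\<^sub>R axis a 1 + t *\<^sub>R axis b 1)"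
    using st(5) h by simp
   have "dist (x + s *\<^sub>R axis a 1 + t *\<^sub>R axis b 1) x = norm (s *\<^sub>R axis a (1::real) + t *\<^sub>R axis b 1)"
    by (simp add: dist_norm add.assoc)
   also have "... <= norm (s *\<^sub>R axis a (1::real)) + norm (t *\<^sub>R axis b (1::real))"
    by (rule norm_triangle_ineq)
   also have "... < r" using st h by simp
   finally show ?thesis unfolding q by (rule r(2))
  qed
  then show "\<forall>\<^sub>F h in at_right 0. dist (q h) (pdiff b (pdiff a f) x) < e"
   using r(1) unfolding eventually_at_right_field by (intro exI[of _ "r/2"]) auto
 qed
 show ?thesis using tendsto_unique[OF _ lim[of j i] lim[of i j]] by simp
qed

subsection \<open>Continuously differentiable functions\<close>

text \<open>The partial derivatives are explicit data \<open>dc\<close>, so that product and chain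
  rules can compute them. Differentiability is at \<open>x\<close> in the whole space even when
  \<open>S\<close> is closed; on \<open>closure Om\<close> this expresses regularity up to the
  boundary.\<close>

definition C1_on ::
 "(real^'n::finite) set => 'n fn => ('n => 'n fn) => bool" where
 "C1_on S c dc \<longleftrightarrow>
  (\<forall>x\<in>S. (c has_derivative (%h. SU i. dc i x * h $ i)) (at x)) &
  (\<forall>i. continuous_on S (dc i))"

text \<open>C1 functions on the whole space with compact support in \<open>Om\<close>. Vanishing is
  asked of \<open>c\<close> alone; \<open>C1cD\<close> transfers it to \<open>dc\<close>.\<close>

definition C1c ::
 "(real^'n::finite) set => 'n fn => ('n => 'n fn) => bool" where
 "C1c Om c dc \<longleftrightarrow> C1_on UNIV c dc & (\<exists>K. compact K & K \<subseteq> Om & (\<forall>x. x \<notin> K --> c x = 0))"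

lemma C1_onD:
 assumes "C1_on S c dc"
 shows "x \<in> S ==> (c has_derivative (%h. SU i. dc i x * h $ i)) (at x)"
  "continuous_on S (dc i)"
 using assms by (auto simp: C1_on_def)

lemma C1_on_subset: "C1_on S c dc ==> T \<subseteq> S ==> C1_on T c dc"
 unfolding C1_on_def by (meson continuous_on_subset subsetD)

lemma C1_on_continuous: "C1_on S c dc ==> continuous_on S c"
 by (meson C1_onD(1) continuous_at_imp_continuous_on has_derivative_continuous)

lemma C1_on_pdiff:
 assumes "C1_on S c dc" "x \<in> S"
 shows "pdiff i c x = dc i x"
proof -
 have "pdiff i c x = (SU j. dc j x * axis i 1 $ j)"
  by (rule has_derivative_imp_pdiff[OF C1_onD(1)[OF assms]])
 also have "... = (SU j. if j = i then dc j x else 0)"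
  by (rule sum.cong) (auto simp: axis_def)
 finally show ?thesis by simp
qed

lemma C1_on_const: "C1_on S (%x. c) (%i x. 0)"
 by (simp add: C1_on_def)

lemma C1_on_add:
 assumes "C1_on S c dc" "C1_on S d dd"
 shows "C1_on S (%x. c x + d x) (%i x. dc i x + dd i x)"
proof -
 have "((%x. c x + d x) has_derivative (%h. SU i. (dc i x + dd i x) * h $ i)) (at x)"
  if "x \<in> S" for x
  using has_derivative_add[OF C1_onD(1)[OF assms(1) that] C1_onD(1)[OF assms(2) that]]
  by (simp add: distrib_right sum.distrib)
 then show ?thesis
  using assms by (simp add: C1_on_def continuous_on_add)
qed

lemma C1_on_mult:
 assumes "C1_on S c dc" "C1_on S d dd"
 shows "C1_on S (%x. c x * d x) (%i x. c x * dd i x + dc i x * d x)"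
proof -
 have "((%x. c x * d x) has_derivative (%h. SU i. (c x * dd i x + dc i x * d x) * h $ i)) (at x)"
  if "x \<in> S" for x
  using has_derivative_mult[OF C1_onD(1)[OF assms(1) that] C1_onD(1)[OF assms(2) that]]
  by (simp add: distrib_right distrib_left sum.distrib sum_distrib_left sum_distrib_right mult_ac)
 then show ?thesis
  using assms C1_on_continuous[OF assms(1)] C1_on_continuous[OF assms(2)]
  by (simp add: C1_on_def continuous_on_add continuous_on_mult)
qed

lemma C1_on_uminus:
 assumes "C1_on S c dc" shows "C1_on S (%x. - c x) (%i x. - dc i x)"
 using C1_on_mult[OF C1_on_const[of S "-1"] assms] by simp

lemma C1_on_diff:
 assumes "C1_on S c dc" "C1_on S d dd"
 shows "C1_on S (%x. c x - d x) (%i x. dc i x - dd i x)"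
 using C1_on_add[OF assms(1) C1_on_uminus[OF assms(2)]] by simp

lemma C1_on_sum:
 assumes "!!k. k \<in> I ==> C1_on S (c k) (dc k)"
 shows "C1_on S (%x. \<Sum>k\<in>I. c k x) (%i x. \<Sum>k\<in>I. dc k i x)"
 using assms
proof (induction I rule: infinite_finite_induct)
 case (insert k I)
 then have "C1_on S (%x. c k x + (\<Sum>k\<in>I. c k x)) (%i x. dc k i x + (\<Sum>k\<in>I. dc k i x))"
  by (intro C1_on_add) auto
 with insert show ?case by simp
qed (simp_all add: C1_on_const)

lemma C1_on_compose:
 assumes c: "C1_on S c dc"
  and h: "!!x. x \<in> S ==> (h has_real_derivative h' (c x)) (at (c x))" "continuous_on (c ` S) h'"
 shows "C1_on S (%x. h (c x)) (%i x. h' (c x) * dc i x)"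
proof -
 have "((%x. h (c x)) has_derivative (%y. SU i. h' (c x) * dc i x * y $ i)) (at x)"
  if "x \<in> S" for x
  using has_derivative_compose[OF C1_onD(1)[OF c that] has_field_derivative_imp_has_derivative[OF h(1)[OF that]]]
  by (simp add: sum_distrib_left mult.assoc)
 moreover have "continuous_on S (%x. h' (c x) * dc i x)" for i
  using continuous_on_compose[OF C1_on_continuous[OF c] h(2)] C1_onD(2)[OF c]
  by (intro continuous_on_mult) (simp_all add: comp_def)
 ultimately show ?thesis by (simp add: C1_on_def)
qed

lemma C1_on_inverse:
 assumes c: "C1_on S c dc" and nz: "!!x. x \<in> S ==> c x ~= 0"
 shows "C1_on S (%x. inverse (c x)) (%i x. - (inverse (c x) * inverse (c x)) * dc i x)"
proof (rule C1_on_compose[OF c, where h' = "%t. - (inverse t * inverse t)"])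
 show "(inverse has_real_derivative - (inverse (c x) * inverse (c x))) (at (c x))" if "x \<in> S" for x
  using DERIV_inverse[OF nz[OF that]] by (simp add: power2_eq_square)
 show "continuous_on (c ` S) (%t. - (inverse t * inverse t))"
  using nz by (intro continuous_intros) auto
qed

lemma Ck_imp_C1_on: "Ck (Suc k) f ==> C1_on UNIV f (%i. pdiff i f)"
 using Ck_imp_continuous by (auto simp: C1_on_def intro: has_derivative_pdiff)

lemma C1_on_imp_bounded:
 assumes "C1_on S c dc" "compact S"
 shows "\<exists>B>0. \<forall>x\<in>S. \<bar>c x\<bar> <= B & (\<forall>i. \<bar>dc i x\<bar> <= B)"
proof -
 have b: "\<exists>B. \<forall>x\<in>S. \<bar>f x\<bar> <= B" if "continuous_on S f" for f :: "real ^ 'a => real"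
  using compact_imp_bounded[OF compact_continuous_image[OF that assms(2)]]
  by (auto simp: bounded_iff)
 obtain B0 where B0: "\<forall>x\<in>S. \<bar>c x\<bar> <= B0" using b[OF C1_on_continuous[OF assms(1)]] by blast
 have "\<forall>i. \<exists>B. \<forall>x\<in>S. \<bar>dc i x\<bar> <= B" using b[OF C1_onD(2)[OF assms(1)]] by blast
 then obtain B1 where B1: "!!i x. x \<in> S ==> \<bar>dc i x\<bar> <= B1 i" by metis
 have "\<bar>dc i x\<bar> <= (SU j. \<bar>B1 j\<bar>)" if "x \<in> S" for i x
  using B1[OF that, of i] member_le_sum[of i UNIV "%j. \<bar>B1 j\<bar>"] by simp
 with B0 show ?thesis
  by (intro exI[of _ "1 + \<bar>B0\<bar> + (SU j. \<bar>B1 j\<bar>)"])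
   (fastforce simp: sum_nonneg add_pos_nonneg intro: order_trans)+
qed

lemma C1cD:
 assumes "C1c Om c dc"
 shows "\<exists>K. compact K & K \<subseteq> Om & (\<forall>x. x \<notin> K --> c x = 0 & (\<forall>i. dc i x = 0))"
proof -
 obtain K where K: "compact K" "K \<subseteq> Om" "!!x. x \<notin> K ==> c x = 0"
  and c: "C1_on UNIV c dc" using assms by (auto simp: C1c_def)
 have "dc i x = 0" if x: "x \<notin> K" for i x
 proof -
  have "open (- K)" using K(1) by (simp add: compact_imp_closed open_Compl)
  then have "(c has_derivative (%h. 0)) (at x)"
   using x K(3) by (intro has_derivative_transform_within_open[OF has_derivative_const[of 0]]) auto
  from has_derivative_imp_pdiff[OF this, of i] C1_on_pdiff[OF c, of x i] show ?thesis by simp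
 qed
 with K show ?thesis by blast
qed

lemma C1c_C1_on: "C1c Om c dc ==> C1_on UNIV c dc"
 by (simp add: C1c_def)

lemma C1c_mono: "C1c Om c dc ==> Om \<subseteq> Om' ==> C1c Om' c dc"
 unfolding C1c_def by blast

lemma C1c_mult:
 assumes "C1c Om c dc" "C1_on UNIV d dd"
 shows "C1c Om (%x. c x * d x) (%i x. c x * dd i x + dc i x * d x)"
proof -
 obtain K where "compact K" "K \<subseteq> Om" "!!x. x \<notin> K ==> c x = 0"
  using assms(1) unfolding C1c_def by metis
 moreover have "C1_on UNIV (%x. c x * d x) (%i x. c x * dd i x + dc i x * d x)"
  by (rule C1_on_mult[OF C1c_C1_on[OF assms(1)] assms(2)])
 ultimately show ?thesis unfolding C1c_def by (intro conjI exI[of _ K]) auto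
qed

text \<open>Here \<open>d\<close> is smooth in \<open>Om\<close> only and \<open>dd\<close> is
  arbitrary outside, hence the conditional derivative. Smoothness on the whole space holds because
  the product is zero near every point off the support \<open>K\<close> of \<open>c\<close>.\<close>

lemma C1c_mult_local:
 assumes c: "C1c Om c dc" and d: "C1_on Om d dd" and Om: "open Om"
 shows "C1c Om (%x. c x * d x) (%i x. if x \<in> Om then c x * dd i x + dc i x * d x else 0)"
proof -
 obtain K where K: "compact K" "K \<subseteq> Om" "!!x. x \<notin> K ==> c x = 0" "!!i x. x \<notin> K ==> dc i x = 0"
  using C1cD[OF c] by metis
 let ?e = "%i x. if x \<in> Om then c x * dd i x + dc i x * d x else 0"
 have oK: "open (- K)" using K(1) by (simp add: compact_imp_closed open_Compl)
 have "((%x. c x * d x) has_derivative (%h. SU i. ?e i x * h $ i)) (at x)" for x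
 proof (cases "x \<in> K")
  case True
  then have "x \<in> Om" using K by blast
  then show ?thesis
   using C1_onD(1)[OF C1_on_mult[OF C1_on_subset[OF C1c_C1_on[OF c]] d]] by simp
 next
  case False
  then have "?e i x = 0" for i using K by simp
  moreover have "((%x. c x * d x) has_derivative (%h. 0)) (at x)"
   using False K(3) oK by (intro has_derivative_transform_within_open[OF has_derivative_const[of 0]]) auto
  ultimately show ?thesis by simp
 qed
 moreover have "continuous_on UNIV (?e i)" for i
 proof (rule continuous_at_imp_continuous_on, intro ballI)
  fix x
  show "isCont (?e i) x"
  proof (cases "x \<in> K")
   case True
   then have "x \<in> Om" using K by blast
   have "continuous_on Om (%x. c x * dd i x + dc i x * d x)"
    by (rule C1_onD(2)[OF C1_on_mult[OF C1_on_subset[OF C1c_C1_on[OF c]] d]]) simp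
   then have "continuous_on Om (?e i)"
    by (rule continuous_on_eq) simp
   then show ?thesis using \<open>x \<in> Om\<close> continuous_on_eq_continuous_at[OF Om] by blast
  next
   case False
   have "?e i y = 0" if "y \<in> - K" for y using that K by simp
   then have "continuous_on (- K) (?e i)" using continuous_on_cong[of "-K" "-K" "?e i" "%_. 0"] by simp
   then show ?thesis using False oK by (simp add: continuous_on_eq_continuous_at)
  qed
 qed
 ultimately have "C1_on UNIV (%x. c x * d x) ?e" by (simp add: C1_on_def)
 with K show ?thesis by (auto simp: C1c_def)
qed

subsection \<open>Convolution\<close>

lemma lborel_distr_reflect:
 fixes t :: "'a::euclidean_space"
 shows "distr lborel borel (%x. t - x) = lborel"
 using lborel_affine[of "-1" t] by (simp add: density_1)

lemma integral_reflect_lborel: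
 fixes t :: "'a::euclidean_space" and f :: "'a => real"
 assumes [measurable]: "f \<in> borel_measurable borel"
 shows "(LB x. f (t - x)) = (LB x. f x)"
 by (subst (2) lborel_distr_reflect[of t, symmetric], subst integral_distr) simp_all

lemma nn_integral_translate:
 fixes t :: "'a::euclidean_space"
 assumes [measurable]: "f \<in> borel_measurable borel"
 shows "(NI x. f (x - t)) = (NI x. f x)"
 using lborel_distr_plus[of "-t"]
 by (subst (2) lborel_distr_plus[of "-t", symmetric], subst nn_integral_distr) simp_all

lemma integral_translate_lborel:
 fixes t :: "'a::euclidean_space" and f :: "'a => real"
 assumes [measurable]: "f \<in> borel_measurable borel"
 shows "(LB x. f (x + t)) = (LB x. f x)"
 by (subst (2) lborel_distr_plus[of t, symmetric], subst integral_distr) (simp_all add: add.commute)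

lemma continuous_imp_lebesgue_measurable:
 fixes f :: "'a::euclidean_space => real"
 shows "continuous_on UNIV f ==> f \<in> borel_measurable lebesgue"
 by (intro measurable_completion) (simp add: borel_measurable_continuous_onI)

lemma continuous_compact_support_integrable:
 fixes f :: "'a::euclidean_space => real"
 assumes "continuous_on UNIV f" "compact K" "!!x. x \<notin> K ==> f x = 0"
 shows "integrable lborel f" "integrable lebesgue f"
proof -
 have "integrable lborel (%x. indicator K x *\<^sub>R f x)"
  by (rule borel_integrable_compact[OF assms(2) continuous_on_subset[OF assms(1)]]) simp
 moreover have "(%x. indicator K x *\<^sub>R f x) = f"
  using assms(3) by (force simp: indicator_def fun_eq_iff)
 ultimately show 1: "integrable lborel f" by simp
 then show "integrable lebesgue f"
  by (subst integrable_completion) (use borel_measurable_integrable[OF 1] in simp_all)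
qed

lemma continuous_compact_support_bounded:
 fixes f :: "'a::euclidean_space => real"
 assumes "continuous_on UNIV f" "compact K" "!!x. x \<notin> K ==> f x = 0"
 shows "\<exists>B>0. \<forall>x. \<bar>f x\<bar> <= B"
proof -
 have "bounded (f ` K)"
  by (rule compact_imp_bounded[OF compact_continuous_image[OF continuous_on_subset[OF assms(1)] assms(2)]]) simp
 then obtain B where B: "B > 0" "\<forall>x\<in>K. \<bar>f x\<bar> <= B" by (auto simp: bounded_pos)
 have "\<bar>f x\<bar> <= B" for x
  using B assms(3)[of x] by (cases "x \<in> K") auto
 with B(1) show ?thesis by blast
qed

lemma uniformly_continuous_compact_support:
 fixes f :: "'a::euclidean_space => real"
 assumes "continuous_on UNIV f" "compact K" "!!x. x \<notin> K ==> f x = 0" "e > 0"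
 shows "\<exists>d>0. \<forall>x y. dist x y < d --> \<bar>f x - f y\<bar> < e"
proof -
 obtain R where R: "K \<subseteq> cball 0 R"
  using compact_imp_bounded[OF assms(2)] by (auto simp: bounded_iff subset_iff)
 have "uniformly_continuous_on (cball 0 (R + 1)) f"
  by (rule compact_uniformly_continuous[OF continuous_on_subset[OF assms(1)]]) auto
 then obtain d where d: "d > 0"
  "!!x y. x \<in> cball 0 (R + 1) ==> y \<in> cball 0 (R + 1) ==> dist y x < d ==> dist (f y) (f x) < e"
  using assms(4) unfolding uniformly_continuous_on_def by metis
 have key: "\<bar>f x - f y\<bar> < e" if xy: "dist x y < min d 1" for x y
 proof (cases "x \<in> cball 0 R \<or> y \<in> cball 0 R")
  case True
  have "norm x <= norm y + dist x y" "norm y <= norm x + dist x y"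
   using norm_triangle_ineq2[of x y] norm_triangle_ineq2[of y x] by (simp_all add: dist_norm norm_minus_commute)
  then have "x \<in> cball 0 (R + 1)" "y \<in> cball 0 (R + 1)" using True xy by auto
  then show ?thesis using d(2)[of y x] xy by (simp add: dist_real_def)
 next
  case False
  then have "f x = 0" "f y = 0" using R assms(3) by blast+
  then show ?thesis using assms(4) by simp
 qed
 show ?thesis by (rule exI[of _ "min d 1"]) (use d(1) key in auto)
qed

text \<open>Taken over \<open>lebesgue\<close> since \<open>f\<close> is only Lebesgue measurable;
  \<open>conv_borel\<close> passes to \<open>lborel\<close> where Tonelli's theorem is
  applied.\<close>

definition conv :: "('a::euclidean_space => real) => ('a => real) => 'a => real" where
 "conv f tt x = (LE y. f y * tt (x - y))"

lemma conv_integrable: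
 fixes f tt :: "'a::euclidean_space => real"
 assumes f: "integrable lebesgue f" and tt: "continuous_on UNIV tt" "!!x. \<bar>tt x\<bar> <= B"
 shows "integrable lebesgue (%y. f y * tt (x - y))"
proof (rule Bi_bound[where f = "%y. B * f y"])
 show "integrable lebesgue (%y. B * f y)" using f by simp
 have "continuous_on UNIV (%y. tt (x - y))"
  by (rule continuous_on_compose2[OF tt(1)]) (auto intro: continuous_intros)
 then show "(%y. f y * tt (x - y)) \<in> borel_measurable lebesgue"
  using f continuous_imp_lebesgue_measurable by (intro borel_measurable_times) auto
 show "AE y in lebesgue. norm (f y * tt (x - y)) <= norm (B * f y)"
 proof (rule AE_I2)
  fix y
  have "\<bar>tt (x - y)\<bar> <= \<bar>B\<bar>" using tt(2)[of "x - y"] by simp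
  then show "norm (f y * tt (x - y)) <= norm (B * f y)"
   using mult_right_mono[OF \<open>\<bar>tt (x - y)\<bar> <= \<bar>B\<bar>\<close> abs_ge_zero[of "f y"]]
   by (simp add: abs_mult mult.commute)
 qed
qed

text \<open>Meant for a small kernel \<open>tt\<close>: a difference of translates in
  \<open>conv_continuous\<close>, a first order Taylor remainder in
  \<open>conv_C1_on\<close>.\<close>

lemma conv_diff_bound:
 assumes f: "integrable lebesgue f" and tt: "continuous_on UNIV tt" "!!x. \<bar>tt x\<bar> <= e"
 shows "\<bar>conv f tt x\<bar> <= e * (LE y. \<bar>f y\<bar>)"
proof -
 have "\<bar>conv f tt x\<bar> <= (LE y. \<bar>f y * tt (x - y)\<bar>)"
  unfolding conv_def by (rule integral_abs_bound)
 also have "... <= (LE y. e * \<bar>f y\<bar>)"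
 proof (rule integral_mono)
  show "integrable lebesgue (%y. \<bar>f y * tt (x - y)\<bar>)"
   using conv_integrable[OF f tt] by (rule integrable_abs)
  show "integrable lebesgue (%y. e * \<bar>f y\<bar>)" using f by simp
  show "\<bar>f y * tt (x - y)\<bar> <= e * \<bar>f y\<bar>" for y
   using mult_right_mono[OF tt(2)[of "x - y"] abs_ge_zero[of "f y"]] by (simp add: abs_mult mult.commute)
 qed
 finally show ?thesis by simp
qed

lemma conv_continuous:
 assumes f: "integrable lebesgue f"
  and tt: "continuous_on UNIV tt" "compact K" "!!x. x \<notin> K ==> tt x = 0"
 shows "continuous_on UNIV (conv f tt)"
 unfolding continuous_on_iff
proof (intro ballI allI impI)
 fix x :: 'a and e :: real assume "e > 0"
 let ?I = "LE y. \<bar>f y\<bar>"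
 have I: "?I >= 0" by (rule B_nonneg) simp
 obtain B where B: "!!x. \<bar>tt x\<bar> <= B" using continuous_compact_support_bounded[OF tt] by blast
 have "e / (?I + 1) > 0" using \<open>e > 0\<close> I by (intro divide_pos_pos) linarith+
 from uniformly_continuous_compact_support[OF tt this] obtain d where
  d: "d > 0" "!!x y. dist x y < d ==> \<bar>tt x - tt y\<bar> < e / (?I + 1)" by metis
 have "dist (conv f tt x') (conv f tt x) < e" if "dist x' x < d" for x'
 proof -
  have "conv f tt x' - conv f tt x = conv f (%z. tt (z + (x' - x)) - tt z) x"
   unfolding conv_def
   by (subst B_diff[symmetric])
    (auto intro!: conv_integrable[OF f tt(1) B] simp: algebra_simps)
  moreover have "\<bar>conv f (%z. tt (z + (x' - x)) - tt z) x\<bar> <= (e / (?I + 1)) * ?I"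
  proof (rule conv_diff_bound[OF f])
   show "continuous_on UNIV (%z. tt (z + (x' - x)) - tt z)"
    by (intro continuous_intros tt(1) continuous_on_compose2[OF tt(1)]) auto
   show "\<bar>tt (z + (x' - x)) - tt z\<bar> <= e / (?I + 1)" for z
    using d(2)[of "z + (x' - x)" z] that by (simp add: dist_norm)
  qed
  moreover have "(e / (?I + 1)) * ?I < e"
   using \<open>e > 0\<close> I by (simp only: times_divide_eq_left pos_divide_less_eq distrib_left
     add_nonneg_pos zero_less_one mult_1_right less_add_same_cancel1)
  ultimately show ?thesis by (simp add: dist_real_def)
 qed
 with d(1) show "\<exists>d>0. \<forall>x'\<in>UNIV. dist x' x < d --> dist (conv f tt x') (conv f tt x) < e" by blast
qed

text \<open>The remainder is controlled by the oscillation of the finitely many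
  \<open>dtt i\<close>, which are uniformly continuous by compact support. Uniformity in
  \<open>z\<close> is what allows differentiation under the convolution integral and the difference
  quotient argument of \<open>integral_partial_derivative_zero\<close>.\<close>

lemma C1c_uniform_linearization:
 fixes dtt :: "'n::finite => _"
 assumes tt: "C1c UNIV tt dtt" and "e > 0"
 shows "\<exists>d>0. \<forall>z h. norm h < d --> \<bar>tt (z + h) - tt z - (SU i. dtt i z * h $ i)\<bar> <= e * norm h"
proof -
 define n where "n = real CARD('n)"
 have n: "n > 0" by (simp add: n_def)
 obtain K where K: "compact K" "!!x. x \<notin> K ==> tt x = 0" "!!i x. x \<notin> K ==> dtt i x = 0"
  using C1cD[OF tt] by metis
 have c: "continuous_on UNIV (dtt i)" for i using C1_onD(2)[OF C1c_C1_on[OF tt]] .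
 have "e / n > 0" using \<open>e > 0\<close> n by simp
 then have "\<forall>i. \<exists>d>0. \<forall>x y. dist x y < d --> \<bar>dtt i x - dtt i y\<bar> < e / n"
  using uniformly_continuous_compact_support[OF c K(1) K(3)] by blast
 then obtain D where D: "!!i. D i > 0" "!!i x y. dist x y < D i ==> \<bar>dtt i x - dtt i y\<bar> < e / n"
  by metis
 define d where "d = Min (range D)"
 have d: "d > 0" "!!i. d <= D i" using D(1) by (auto simp: d_def)
 have "\<bar>tt (z + h) - tt z - (SU i. dtt i z * h $ i)\<bar> <= e * norm h" if h: "norm h < d" for z h
 proof -
  let ?L = "%x h. SU i. dtt i x * h $ i"
  have "norm (tt (z + h) - tt z - ?L z (z + h - z)) <= norm (z + h - z) * e"
  proof (rule differentiable_bound_linearization[where S = "ball z d"])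
   show "z + t *\<^sub>R (z + h - z) \<in> ball z d" if "t \<in> {0..1}" for t
   proof -
    have "norm (t *\<^sub>R h) <= 1 * norm h" unfolding norm_scaleR using that by (intro mult_right_mono) auto
    then show ?thesis using h by (simp add: dist_norm)
   qed
   show "(tt has_derivative ?L x) (at x within ball z d)" for x
    using C1_onD(1)[OF C1c_C1_on[OF tt]] has_derivative_at_withinI by blast
   show "z \<in> ball z d" using d by simp
   fix x assume x: "x \<in> ball z d"
   show "onorm (?L x - ?L z) <= e"
   proof (rule onorm_le)
    fix h :: "real^'n"
    have "norm ((?L x - ?L z) h) = \<bar>SU i. (dtt i x - dtt i z) * h $ i\<bar>"
     by (simp add: left_diff_distrib sum_subtractf)
    also have "... <= (SU i. \<bar>(dtt i x - dtt i z) * h $ i\<bar>)" by (rule sum_abs)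
    also have "... <= (\<Sum>i\<in>(UNIV::'n set). e / n * norm h)"
    proof (rule sum_mono)
     fix i :: 'n
     have "dist x z < D i" using x d(2)[of i] by (simp add: dist_commute)
     then have "\<bar>dtt i x - dtt i z\<bar> <= e / n" using D(2) by (simp add: less_imp_le)
     then show "\<bar>(dtt i x - dtt i z) * h $ i\<bar> <= e / n * norm h"
      unfolding abs_mult using component_le_norm_cart[of h i] \<open>e / n > 0\<close>
      by (intro mult_mono) auto
    qed
    also have "... = e * norm h" by (simp add: n_def)
    finally show "norm ((?L x - ?L z) h) <= e * norm h" .
   qed
  qed
  then show ?thesis by (simp add: mult.commute)
 qed
 with d(1) show ?thesis by blast
qed

lemma conv_C1_on:
 assumes f: "integrable lebesgue f" and tt: "C1c UNIV tt dtt"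
 shows "C1_on UNIV (conv f tt) (%i. conv f (dtt i))"
proof -
 obtain K where K: "compact K" "!!x. x \<notin> K ==> tt x = 0" "!!i x. x \<notin> K ==> dtt i x = 0"
  using C1cD[OF tt] by metis
 have c: "continuous_on UNIV tt" "continuous_on UNIV (dtt i)" for i
  using C1_onD(2) C1_on_continuous C1c_C1_on[OF tt] by blast+
 obtain B where B: "!!x. \<bar>tt x\<bar> <= B"
  using continuous_compact_support_bounded[OF c(1) K(1,2)] by blast
 have "\<forall>i. \<exists>B>0. \<forall>x. \<bar>dtt i x\<bar> <= B"
  using continuous_compact_support_bounded[OF c(2) K(1) K(3)] by blast
 then obtain B' where B': "!!i x. \<bar>dtt i x\<bar> <= B' i" by metis
 note int = conv_integrable[OF f c(1) B] conv_integrable[OF f c(2) B']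
 let ?I = "LE y. \<bar>f y\<bar>"
 have I: "?I >= 0" by (rule B_nonneg) simp
 have "(conv f tt has_derivative (%h. SU i. conv f (dtt i) x * h $ i)) (at x)" for x
  unfolding has_derivative_at_alt
 proof (intro conjI allI impI)
  show "bounded_linear (%h. SU i. conv f (dtt i) x * h $ i)"
   by (intro bounded_linear_sum bounded_linear_mult_right bounded_linear_compose[OF bounded_linear_mult_right bounded_linear_vec_nth])
  fix e :: real assume "e > 0"
  then have "e / (?I + 1) > 0" using I by (intro divide_pos_pos) linarith+
  from C1c_uniform_linearization[OF tt this] obtain d where d: "d > 0"
   "!!z h. norm h < d ==> \<bar>tt (z + h) - tt z - (SU i. dtt i z * h $ i)\<bar> <= e / (?I + 1) * norm h"
   by metis
  have "norm (conv f tt y - conv f tt x - (SU i. conv f (dtt i) x * (y - x) $ i)) <= e * norm (y - x)"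
   if y: "norm (y - x) < d" for y
  proof -
   let ?r = "%z. tt (z + (y - x)) - tt z - (SU i. dtt i z * (y - x) $ i)"
   have "conv f ?r x = (LE w. f w * tt (y - w) - f w * tt (x - w)
     - (SU i. (f w * dtt i (x - w)) * (y - x) $ i))"
    unfolding conv_def
    by (rule B_cong)
     (simp_all add: right_diff_distrib sum_distrib_left mult.assoc algebra_simps)
   also have "... = conv f tt y - conv f tt x - (SU i. conv f (dtt i) x * (y - x) $ i)"
    using int by (simp add: conv_def)
   finally have eq: "conv f ?r x = conv f tt y - conv f tt x - (SU i. conv f (dtt i) x * (y - x) $ i)" .
   have "\<bar>conv f ?r x\<bar> <= (e / (?I + 1) * norm (y - x)) * ?I"
   proof (rule conv_diff_bound[OF f])
    show "continuous_on UNIV ?r"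
     by (intro continuous_intros c continuous_on_compose2[OF c(1)]) auto
   qed (use d(2) y in blast)
   also have "... <= e * norm (y - x)"
   proof -
    have "e / (?I + 1) * ?I <= e" using \<open>e > 0\<close> I
     by (simp only: times_divide_eq_left pos_divide_le_eq distrib_left
       add_nonneg_pos zero_less_one mult_1_right le_add_same_cancel1 less_imp_le)
    from mult_right_mono[OF this norm_ge_zero[of "y - x"]] show ?thesis by (simp add: mult_ac)
   qed
   finally show ?thesis unfolding eq by simp
  qed
  with d(1) show "\<exists>d>0. \<forall>y. norm (y - x) < d -->
    norm (conv f tt y - conv f tt x - (SU i. conv f (dtt i) x * (y - x) $ i)) <= e * norm (y - x)"
   by blast
 qed
 moreover have "continuous_on UNIV (conv f (dtt i))" for i
  by (rule conv_continuous[OF f c(2) K(1) K(3)])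
 ultimately show ?thesis by (simp add: C1_on_def)
qed

lemma C1c_pdiff:
 assumes "Ck (Suc 0) tt" "compact K" "!!x. x \<notin> K ==> tt x = 0"
 shows "C1c UNIV tt (%i. pdiff i tt)"
 unfolding C1c_def using assms Ck_imp_C1_on[OF assms(1)] by blast

lemma conv_Ck:
 fixes tt :: "'n::finite fn"
 assumes f: "integrable lebesgue f" and K: "compact K"
 shows "Ck k tt ==> (!!x. x \<notin> K ==> tt x = 0) ==> Ck k (conv f tt)"
proof (induction k arbitrary: tt)
 case 0
 then show ?case using conv_continuous[OF f _ K] by simp
next
 case (Suc k)
 have "Ck (Suc 0) tt" by (rule Ck_mono[OF _ Suc.prems(1)]) simp
 then have c: "C1c UNIV tt (%i. pdiff i tt)" by (rule C1c_pdiff[OF _ K Suc.prems(2)])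
 have z: "pdiff i tt x = 0" if "x \<notin> K" for i x
 proof -
  have "open (- K)" using K by (simp add: compact_imp_closed open_Compl)
  then have "(tt has_derivative (%h. 0)) (at x)"
   using that Suc.prems(2)
   by (intro has_derivative_transform_within_open[OF has_derivative_const[of 0]]) auto
  then show ?thesis by (rule has_derivative_imp_pdiff)
 qed
 note C = conv_C1_on[OF f c]
 have "pdiff i (conv f tt) = conv f (pdiff i tt)" for i
  by (rule ext) (simp add: C1_on_pdiff[OF C])
 moreover have "Ck k (conv f (pdiff i tt))" for i
  by (rule Suc.IH) (use Suc.prems(1) z in auto)
 moreover have "conv f tt differentiable (at x)" for x
  using C1_onD(1)[OF C] unfolding differentiable_def by blast
 ultimately show ?case by simp
qed

subsection \<open>Mollification\<close>

definition mollifier :: "real => 'n::finite fn => bool" where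
 "mollifier e tt \<longleftrightarrow> (\<forall>k. Ck k tt) & (\<forall>x. 0 <= tt x) & (\<forall>x. e <= norm x --> tt x = 0)
  & (LB x. tt x) = 1"

lemma mollifierD:
 assumes "mollifier e tt"
 shows "Ck k tt" "0 <= tt x" "x \<notin> cball 0 e ==> tt x = 0" "(LB x. tt x) = 1"
  "continuous_on UNIV tt" "integrable lborel tt" "tt \<in> borel_measurable borel"
proof -
 show 1: "continuous_on UNIV tt" using assms Ck_imp_continuous unfolding mollifier_def by blast
 show 0: "x \<notin> cball 0 e ==> tt x = 0" for x using assms by (auto simp: mollifier_def)
 show "integrable lborel tt" by (rule continuous_compact_support_integrable(1)[OF 1 compact_cball 0])
 show "tt \<in> borel_measurable borel" using 1 by (rule borel_measurable_continuous_onI)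
qed (use assms in "auto simp: mollifier_def")

lemma mollifier_exists:
 assumes "e > 0"
 shows "\<exists>tt :: real^'n::finite => real. mollifier e tt"
proof -
 define b :: "'n fn" where "b x = bump_fun 0 (e^2 - (SU i. x $ i * x $ i))" for x
 have b_eq: "b x = bump_fun 0 (e^2 - (norm x)^2)" for x
  by (simp add: b_def power2_norm_eq_inner inner_vec_def)
 have C: "Ck k b" for k unfolding b_def by (intro Ck_bump_fun Ck_diff Ck_const Ck_sum Ck_mult Ck_coord)
 have c: "continuous_on UNIV b" using C Ck_imp_continuous by blast
 have z: "b x = 0" if "e <= norm x" for x
  using that assms by (simp add: b_eq bump_fun_eq_0_iff power_mono)
 have p: "b x > 0" if "norm x < e" for x
  using that by (simp add: b_eq bump_fun_pos_iff power_strict_mono)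
 have z': "x \<notin> cball 0 e ==> b x = 0" for x using z by simp
 have int: "integrable lborel b" by (rule continuous_compact_support_integrable(1)[OF c compact_cball z'])
 have nn: "b x >= 0" for x by (simp add: b_eq bump_fun_nonneg)
 \<comment> \<open>A zero integral would make the nonnegative \<open>b\<close> vanish almost
   everywhere, but it is positive on a ball, which is not negligible.\<close>
 have "(LB x. b x) ~= 0"
 proof
  assume "(LB x. b x) = 0"
  then have "AE x in lborel. b x = 0"
   using integral_nonneg_eq_0_iff_AE[OF int] nn by simp
  then have "AE x in lebesgue. b x = 0" by (rule AE_completion)
  then have "AE x in lebesgue. x \<notin> ball (0 :: real^'n) e" by eventually_elim (use p in "metis less_irrefl mem_ball_0")
  then have "ball (0 :: real^'n) e \<in> null_sets lebesgue"
   by (subst AE_iff_null_sets) auto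
  then have "negligible (ball (0 :: real^'n) e)" by (simp add: negligible_iff_null_sets)
  then show False using open_not_negligible[of "ball (0 :: real^'n) e"] assms by simp
 qed
 moreover have "(LB x. b x) >= 0" using nn by (intro B_nonneg)
 ultimately have I: "(LB x. b x) > 0" by linarith
 define tt where "tt x = inverse (LB x. b x) * b x" for x
 have "mollifier e tt"
  unfolding mollifier_def
 proof (intro conjI allI impI)
  show "Ck k tt" for k unfolding tt_def by (intro Ck_cmult C)
  show "0 <= tt x" for x using I nn[of x] by (simp add: tt_def)
  show "tt x = 0" if "e <= norm x" for x using z[OF that] by (simp add: tt_def)
  show "(LB x. tt x) = 1" using I by (simp add: tt_def)
 qed
 then show ?thesis by blast
qed

lemma conv_borel:
 assumes "f' \<in> borel_measurable lborel" "AE x in lborel. f x = f' x" "f \<in> borel_measurable lebesgue"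
  and "tt \<in> borel_measurable borel"
 shows "conv f tt x = (LB y. f' y * tt (x - y))"
proof -
 have m: "(%y. tt (x - y)) \<in> borel_measurable borel" using assms(4) by measurable
 then have m': "(%y. tt (x - y)) \<in> borel_measurable lebesgue" by (intro measurable_completion) simp
 have f': "f' \<in> borel_measurable lebesgue" using assms(1) by (rule measurable_completion)
 have "conv f tt x = (LE y. f' y * tt (x - y))"
  unfolding conv_def
 proof (rule integral_cong_AE)
  show "AE y in lebesgue. f y * tt (x - y) = f' y * tt (x - y)"
   using AE_completion[OF assms(2)] by eventually_elim simp
 qed (use m' f' assms(3) in "auto intro!: borel_measurable_times")
 also have "... = (LB y. f' y * tt (x - y))"
  by (rule integral_completion) (use m assms(1) in "auto intro!: borel_measurable_times")
 finally show ?thesis .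
qed

text \<open>Jensen's inequality for the probability density \<open>tt (x - y)\<close> in
  \<open>y\<close>: the variance of \<open>f\<close> about its mean \<open>c\<close> is
  nonnegative.\<close>

lemma conv_power2_le:
 fixes f :: "'n::finite fn"
 assumes tt: "mollifier e tt" and [measurable]: "f \<in> borel_measurable lborel"
  and f: "integrable lborel f" and f2: "integrable lborel (%y. (f y)^2)"
 shows "(LB y. f y * tt (x - y))^2 <= (LB y. (f y)^2 * tt (x - y))"
  "integrable lborel (%y. (f y)^2 * tt (x - y))"
proof -
 note [measurable] = mollifierD(7)[OF tt]
 obtain B where B: "B > 0" "!!x. \<bar>tt x\<bar> <= B"
  using continuous_compact_support_bounded[OF mollifierD(5)[OF tt] compact_cball mollifierD(3)[OF tt]] by blast
 have bd: "integrable lborel (%y. g y * tt (x - y))" if [measurable]: "integrable lborel g" for g :: "'n fn"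
 proof (rule Bi_bound)
  show "integrable lborel (%y. B * g y)" using that by simp
  show "AE y in lborel. norm (g y * tt (x - y)) <= norm (B * g y)"
  proof (rule AE_I2)
   fix y show "norm (g y * tt (x - y)) <= norm (B * g y)"
    using mult_right_mono[OF B(2)[of "x - y"] abs_ge_zero[of "g y"]] B(1)
    by (simp add: abs_mult mult.commute)
  qed
 qed simp
 have i1: "(LB y. tt (x - y)) = 1"
  using integral_reflect_lborel[of tt x] mollifierD(4)[OF tt] by simp
 have int1: "integrable lborel (%y. tt (x - y))"
  using i1 not_integrable_integral_eq by fastforce
 show int2: "integrable lborel (%y. (f y)^2 * tt (x - y))" by (rule bd[OF f2])
 have int3: "integrable lborel (%y. f y * tt (x - y))" by (rule bd[OF f])
 define c where "c = (LB y. f y * tt (x - y))"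
 have "0 <= (LB y. (f y - c)^2 * tt (x - y))"
  using mollifierD(2)[OF tt] by (intro B_nonneg) simp
 also have "... = (LB y. (f y)^2 * tt (x - y) - 2 * c * (f y * tt (x - y)) + c^2 * tt (x - y))"
  by (rule B_cong) (simp_all add: power2_eq_square algebra_simps)
 also have "... = (LB y. (f y)^2 * tt (x - y)) - 2 * c * c + c^2"
  using int1 int2 int3 i1 by (simp add: c_def)
 finally show "(LB y. f y * tt (x - y))^2 <= (LB y. (f y)^2 * tt (x - y))"
  by (simp add: c_def power2_eq_square)
qed

text \<open>Jensen's inequality pointwise in \<open>x\<close>, then Tonelli's theorem and the unit
  mass of every translate of \<open>tt\<close>. The Borel representative \<open>f'\<close> makes the
  integrand measurable on the product space.\<close>

lemma conv_L2:
 fixes f :: "'n::finite fn"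
 assumes tt: "mollifier e tt" and f: "f \<in> L2 UNIV" "integrable lebesgue f"
 shows "conv f tt \<in> L2 UNIV" "L2_norm UNIV (conv f tt) <= L2_norm UNIV f"
proof -
 have fm: "f \<in> borel_measurable lebesgue" using f(2) by auto
 obtain f' where f'[measurable]: "f' \<in> borel_measurable lborel" and ae: "AE x in lborel. f x = f' x"
  using completion_ex_borel_measurable_real[OF fm] by blast
 note [measurable] = mollifierD(7)[OF tt]
 have ae': "AE x in lebesgue. f x = f' x" by (rule AE_completion[OF ae])
 have f'm: "f' \<in> borel_measurable lebesgue" using f' by (rule measurable_completion)
 have int: "integrable lebesgue f'" using integrable_cong_AE[OF fm f'm ae'] f(2) by simp
 then have int1: "integrable lborel f'" using f' by (simp add: integrable_completion)
 have "integrable lebesgue (%x. (f x)^2)" using L2_integrable_power2[OF f(1)] by (simp add: lebesgue_on_UNIV_eq)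
 moreover have m2: "(%x. (f' x)^2) \<in> borel_measurable lborel" by measurable
 moreover have ae2: "AE x in lebesgue. (f x)^2 = (f' x)^2" using ae' by eventually_elim simp
 ultimately have "integrable lebesgue (%x. (f' x)^2)"
  by (subst integrable_cong_AE[symmetric, OF _ _ ae2]) (use fm f'm in auto)
 then have int2: "integrable lborel (%x. (f' x)^2)" using integrable_completion[OF m2] by blast
 have I: "(L2_norm UNIV f)^2 = (LB x. (f' x)^2)"
 proof -
  have "(L2_norm UNIV f)^2 = (LE x. (f' x)^2)"
   unfolding L2_norm_power2 lebesgue_on_UNIV_eq using ae2 fm f'm by (auto intro!: integral_cong_AE)
  then show ?thesis using integral_completion[OF m2] by simp
 qed
 let ?c = "%x. LB y. f' y * tt (x - y)"
 have c: "conv f tt = ?c" by (rule ext, rule conv_borel[OF f' ae fm]) simp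
 have cont: "continuous_on UNIV (conv f tt)"
  by (rule conv_continuous[OF f(2) mollifierD(5)[OF tt] compact_cball mollifierD(3)[OF tt]])
 then have cm: "conv f tt \<in> borel_measurable borel" by (rule borel_measurable_continuous_onI)
 have shift: "(NI x. ennreal (tt (x - y))) = 1" for y
 proof -
  have "(NI x. ennreal (tt (x - y))) = (NI x. ennreal (tt x))"
   by (rule nn_integral_translate[of "%x. ennreal (tt x)"]) measurable
  also have "... = ennreal (LB x. tt x)"
   by (rule nn_integral_eq_integral) (use mollifierD(6)[OF tt] mollifierD(2)[OF tt] in auto)
  finally show ?thesis by (simp add: mollifierD(4)[OF tt])
 qed
 have "(NI x. ennreal ((conv f tt x)^2))
   <= (NI x. (NI y. ennreal ((f' y)^2 * tt (x - y))))"
 proof (rule nn_integral_mono)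
  fix x
  have "ennreal ((conv f tt x)^2) <= ennreal (LB y. (f' y)^2 * tt (x - y))"
   unfolding c using conv_power2_le(1)[OF tt f' int1 int2] by (rule ennreal_leI)
  also have "... = (NI y. ennreal ((f' y)^2 * tt (x - y)))"
   by (rule nn_integral_eq_integral[symmetric])
    (use conv_power2_le(2)[OF tt f' int1 int2] mollifierD(2)[OF tt] in auto)
  finally show "ennreal ((conv f tt x)^2) <= (NI y. ennreal ((f' y)^2 * tt (x - y)))" .
 qed
 also have "... = (NI y. (NI x. ennreal ((f' y)^2 * tt (x - y))))"
  by (rule lborel_pair.Fubini'[symmetric]) measurable
 also have "... = (NI y. ennreal ((f' y)^2))"
 proof (rule nn_integral_cong)
  fix y
  have "(NI x. ennreal ((f' y)^2 * tt (x - y))) = ennreal ((f' y)^2) * (NI x. ennreal (tt (x - y)))"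
   by (subst nn_integral_cmult[symmetric]) (auto simp: ennreal_mult' mollifierD(2)[OF tt])
  then show "(NI x. ennreal ((f' y)^2 * tt (x - y))) = ennreal ((f' y)^2)"
   by (simp add: shift)
 qed
 also have "... = ennreal (LB x. (f' x)^2)"
  by (rule nn_integral_eq_integral[OF int2]) simp
 finally have le: "(NI x. ennreal ((conv f tt x)^2)) <= ennreal (LB x. (f' x)^2)" .
 have m3: "(%x. (conv f tt x)^2) \<in> borel_measurable lborel" using cm by measurable
 have int3: "integrable lborel (%x. (conv f tt x)^2)"
  by (rule integrableI_bounded[OF m3]) (use le in "auto simp: less_top[symmetric] top_unique")
 then have "integrable lebesgue (%x. (conv f tt x)^2)" using integrable_completion[OF m3] by blast
 moreover have "conv f tt \<in> borel_measurable lebesgue" using cont by (rule continuous_imp_lebesgue_measurable)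
 ultimately show "conv f tt \<in> L2 UNIV" by (simp add: L2_def lebesgue_on_UNIV_eq)
 have "ennreal (LB x. (conv f tt x)^2) <= ennreal (LB x. (f' x)^2)"
  using le by (subst (asm) nn_integral_eq_integral[OF int3]) auto
 then have "(LB x. (conv f tt x)^2) <= (LB x. (f' x)^2)"
  by (subst (asm) ennreal_le_iff) (auto intro!: B_nonneg)
 then have "(L2_norm UNIV (conv f tt))^2 <= (L2_norm UNIV f)^2"
  unfolding I by (simp add: L2_norm_power2 integral_completion[OF m3] lebesgue_on_UNIV_eq)
 then show "L2_norm UNIV (conv f tt) <= L2_norm UNIV f" by (rule power2_le_imp_le) simp
qed

lemma conv_diff:
 fixes f g tt :: "'n::finite fn"
 assumes "mollifier e tt" "integrable lebesgue f" "integrable lebesgue g"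
 shows "conv (%y. f y - g y) tt x = conv f tt x - conv g tt x"
proof -
 obtain B where B: "!!x. \<bar>tt x\<bar> <= B"
  using continuous_compact_support_bounded[OF mollifierD(5)[OF assms(1)] compact_cball mollifierD(3)[OF assms(1)]]
  by blast
 note i = conv_integrable[OF _ mollifierD(5)[OF assms(1)] B]
 show ?thesis
  unfolding conv_def left_diff_distrib
  by (rule B_diff) (use i assms in blast)+
qed

lemma indicator_cball_L2: "(%x. c * indicator (cball a r) x) \<in> L2 UNIV" for c :: real and a :: "'a::euclidean_space"
proof (rule L2_cmult)
 have 1: "(norm (indicator (cball a r) x :: real))^2 = indicator (cball a r) x" for x
  by (simp add: indicator_def)
 have "integrable lebesgue (indicator (cball a r) :: 'a => real)"
  by (rule integrable_real_indicator) (use emeasure_lborel_cball_finite[of a r] in simp_all)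
 then show "(indicator (cball a r) :: 'a => real) \<in> L2 UNIV"
  unfolding L2_def mem_Collect_eq lebesgue_on_UNIV_eq 1 by auto
qed

lemma L2_uniform_bound:
 fixes F :: "'a::euclidean_space => real"
 assumes "!!x. \<bar>F x\<bar> <= w" "!!x. x \<notin> cball 0 r ==> F x = 0" "F \<in> borel_measurable lebesgue"
 shows "F \<in> L2 UNIV" "L2_norm UNIV F <= w * L2_norm UNIV (indicator (cball (0::'a) r) :: 'a => real)"
proof -
 have w: "w >= 0" using assms(1)[of 0] by linarith
 have m: "F \<in> borel_measurable (lebesgue_on UNIV)" using assms(3) by (simp add: lebesgue_on_UNIV_eq)
 have b: "AE x in lebesgue_on UNIV. norm (F x) <= norm (w * indicator (cball (0::'a) r) x)"
  using assms(1,2) w by (intro AE_I2) (force simp: indicator_def)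
 show "F \<in> L2 UNIV" by (rule L2_bound[OF indicator_cball_L2 m b])
 have "L2_norm UNIV F <= L2_norm UNIV (%x. w * indicator (cball (0::'a) r) x :: real)"
  by (rule L2_norm_mono[OF indicator_cball_L2 m b])
 then show "L2_norm UNIV F <= w * L2_norm UNIV (indicator (cball (0::'a) r) :: 'a => real)"
  using L2_norm_scaleR[of UNIV w "indicator (cball (0::'a) r) :: 'a => real"] w by simp
qed

lemma L2_bounded_support_integrable:
 fixes f :: "'a::euclidean_space => real"
 assumes "f \<in> L2 UNIV" "!!x. x \<notin> cball 0 r ==> f x = 0"
 shows "integrable lebesgue f"
proof -
 have "integrable (lebesgue_on UNIV) (%x. f x * (1 * indicator (cball 0 r) x))"
  by (rule L2_integrable_mult[OF assms(1) indicator_cball_L2])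
 moreover have "(%x. f x * (1 * indicator (cball 0 r) x)) = f"
 proof
  fix x show "f x * (1 * indicator (cball 0 r) x) = f x"
   using assms(2)[of x] by (cases "x \<in> cball 0 r") auto
 qed
 ultimately show ?thesis by (simp add: lebesgue_on_UNIV_eq)
qed

definition trunc :: "real => real => real" where "trunc m t = max (- m) (min m t)"

lemma L2_trunc:
 fixes f :: "'a::euclidean_space => real"
 assumes f: "f \<in> L2 S"
 shows "(%m. L2_norm S (%x. f x - trunc (real m) (f x))) ~~> 0"
proof -
 have m: "(%x. f x - trunc (real m) (f x)) \<in> borel_measurable (lebesgue_on S)" for m
  using L2D(1)[OF f] unfolding trunc_def by measurable
 have "(%m. (LINT x|lebesgue_on S. (f x - trunc (real m) (f x))^2)) ~~> (LINT x|lebesgue_on S. 0)"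
 proof (rule integral_dominated_convergence[where w = "%x. (f x)^2"])
  show "integrable (lebesgue_on S) (%x. (f x)^2)" by (rule L2_integrable_power2[OF f])
  show "AE x in lebesgue_on S. (%m. (f x - trunc (real m) (f x))^2) ~~> 0"
  proof (rule AE_I2, rule tendsto_eventually)
   fix x
   obtain m0 :: nat where "\<bar>f x\<bar> <= real m0" using real_arch_simple by blast
   then show "\<forall>\<^sub>F m in sequentially. (f x - trunc (real m) (f x))^2 = 0"
    unfolding eventually_sequentially trunc_def by (intro exI[of _ m0]) auto
  qed
  show "AE x in lebesgue_on S. norm ((f x - trunc (real m) (f x))^2) <= (f x)^2" for m
  proof (rule AE_I2)
   fix x
   have "\<bar>f x - trunc (real m) (f x)\<bar> <= \<bar>f x\<bar>" by (auto simp: trunc_def max_def min_def)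
   then show "norm ((f x - trunc (real m) (f x))^2) <= (f x)^2"
    by (simp add: abs_le_square_iff)
  qed
  show "(%x. (f x - trunc (real m) (f x))^2) \<in> borel_measurable (lebesgue_on S)" for m
   using m[of m] by measurable
 qed simp
 then have "(%m. (L2_norm S (%x. f x - trunc (real m) (f x)))^2) ~~> 0"
  by (simp add: L2_norm_power2)
 from tendsto_real_sqrt[OF this] show ?thesis by simp
qed

text \<open>Measurability provides continuous \<open>g n\<close> that converge to \<open>f\<close>
  almost everywhere. Truncation at height \<open>m\<close> and the factor \<open>cut\<close> give
  them a common bound of bounded support, so the convergence takes place in the L2 norm as
  well.\<close>

lemma L2_approx_continuous:
 fixes f :: "'a::euclidean_space => real"
 assumes f: "f \<in> L2 UNIV" and supp: "!!x. x \<notin> cball 0 R ==> f x = 0" and "e > 0"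
 shows "\<exists>g. continuous_on UNIV g & (\<forall>x. x \<notin> cball 0 (R + 1) --> g x = 0) &
  L2_norm UNIV (%x. f x - g x) < e"
proof -
 have fm: "f \<in> borel_measurable lebesgue" using L2D(1)[OF f] by (simp add: lebesgue_on_UNIV_eq)
 then have "f measurable_on UNIV" by (simp add: lebesgue_measurable_imp_measurable_on)
 then obtain N g where N: "negligible N" and g: "!!n. continuous_on UNIV (g n)"
  and lim: "!!x. x \<notin> N ==> (%n. g n x) ~~> f x"
  unfolding measurable_on_def by auto
 obtain m where "norm (L2_norm UNIV (%x. f x - trunc (real m) (f x)) - 0) < e / 2"
  using LIMSEQ_D[OF L2_trunc[OF f], of "e / 2"] \<open>e > 0\<close> by auto
 then have m: "L2_norm UNIV (%x. f x - trunc (real m) (f x)) < e / 2" by simp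
 define cut :: "'a => real" where "cut x = max 0 (min 1 (R + 1 - norm x))" for x
 define h where "h n x = cut x * trunc (real m) (g n x)" for n x
 have hc: "continuous_on UNIV (h n)" for n
  unfolding h_def cut_def trunc_def by (intro continuous_intros g)
 have hz: "h n x = 0" if "x \<notin> cball 0 (R + 1)" for n x
  using that by (simp add: h_def cut_def)
 have cl: "\<bar>trunc (real m) t\<bar> <= real m" for t by (auto simp: trunc_def)
 have "\<bar>cut x\<bar> <= 1" for x by (simp add: cut_def)
 then have hb: "\<bar>h n x\<bar> <= real m" for n x
  unfolding h_def abs_mult using mult_mono[of "\<bar>cut x\<bar>" 1, OF _ cl] by simp
 have fc: "(%x. trunc (real m) (f x)) \<in> L2 UNIV"
 proof (rule L2_bound[OF f])
  show "(%x. trunc (real m) (f x)) \<in> borel_measurable (lebesgue_on UNIV)"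
   using L2D(1)[OF f] unfolding trunc_def by measurable
 qed (auto simp: trunc_def)
 have hm: "h n \<in> borel_measurable lebesgue" for n by (rule continuous_imp_lebesgue_measurable[OF hc])
 have hL: "h n \<in> L2 UNIV" for n by (rule L2_uniform_bound(1)[OF hb hz hm])
 have "(%n. (LINT x|lebesgue_on UNIV. (trunc (real m) (f x) - h n x)^2)) ~~> (LINT x|lebesgue_on (UNIV :: 'a set). (0::real))"
 proof (rule integral_dominated_convergence[where w = "%x::'a. ((2 * real m) * indicator (cball 0 (R + 1)) x)^2"])
  show "integrable (lebesgue_on UNIV) (%x::'a. (2 * real m * indicator (cball 0 (R + 1)) x)^2)"
   by (rule L2_integrable_power2[OF indicator_cball_L2])
  have "AE x in lebesgue. x \<notin> N" using N by (simp add: negligible_iff_null_sets AE_not_in)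
  then show "AE x in lebesgue_on UNIV. (%n. (trunc (real m) (f x) - h n x)^2) ~~> 0"
   unfolding lebesgue_on_UNIV_eq
  proof eventually_elim
   case (elim x)
   have "(%n. h n x) ~~> cut x * trunc (real m) (f x)"
    unfolding h_def trunc_def by (intro tendsto_intros lim elim)
   moreover have "cut x * trunc (real m) (f x) = trunc (real m) (f x)"
    using supp[of x] by (cases "x \<in> cball 0 R") (auto simp: cut_def trunc_def)
   ultimately have "(%n. (trunc (real m) (f x) - h n x)^2) ~~> (trunc (real m) (f x) - trunc (real m) (f x))^2"
    by (intro tendsto_intros) simp
   then show ?case by simp
  qed
  show "AE x in lebesgue_on UNIV. norm ((trunc (real m) (f x) - h n x)^2)
    <= (2 * real m * indicator (cball 0 (R + 1)) x)^2" for n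
  proof (rule AE_I2)
   fix x
   have "\<bar>trunc (real m) (f x) - h n x\<bar> <= 2 * real m * indicator (cball 0 (R + 1)) x"
   proof (cases "x \<in> cball 0 (R + 1)")
    case True
    then show ?thesis using cl[of "f x"] hb[of n x] by simp
   next
    case False
    then have "f x = 0" using supp by simp
    then show ?thesis using False hz[OF False] by (simp add: trunc_def)
   qed
   then show "norm ((trunc (real m) (f x) - h n x)^2) <= (2 * real m * indicator (cball 0 (R + 1)) x)^2"
    using power_mono[of "\<bar>trunc (real m) (f x) - h n x\<bar>" _ 2] by simp
  qed
  show "(%x. (trunc (real m) (f x) - h n x)^2) \<in> borel_measurable (lebesgue_on UNIV)" for n
   using L2D(1)[OF L2_diff[OF fc hL[of n]]] by measurable
 qed simp
 then have "(%n. (L2_norm UNIV (%x. trunc (real m) (f x) - h n x))^2) ~~> 0"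
  by (simp add: L2_norm_power2)
 from tendsto_real_sqrt[OF this] have "(%n. L2_norm UNIV (%x. trunc (real m) (f x) - h n x)) ~~> 0" by simp
 from LIMSEQ_D[OF this, of "e / 2"] obtain n where
  n: "L2_norm UNIV (%x. trunc (real m) (f x) - h n x) < e / 2" using \<open>e > 0\<close> by auto
 have "L2_norm UNIV (%x. (f x - trunc (real m) (f x)) + (trunc (real m) (f x) - h n x)) < e"
  using L2_norm_triangle[OF L2_diff[OF f fc] L2_diff[OF fc hL[of n]]] m n by linarith
 then have "L2_norm UNIV (%x. f x - h n x) < e" by simp
 with hc[of n] hz show ?thesis by blast
qed

text \<open>The kernel has unit mass, so the difference is an average of \<open>g y - g x\<close>
  over the ball of radius \<open>e\<close> about \<open>x\<close>.\<close>

lemma conv_uniform: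
 fixes g tt :: "'n::finite fn"
 assumes tt: "mollifier e tt" and g: "integrable lebesgue g"
  and w: "!!x y. dist x y < e ==> \<bar>g x - g y\<bar> <= w"
 shows "\<bar>conv g tt x - g x\<bar> <= w"
proof -
 obtain B where B: "!!x. \<bar>tt x\<bar> <= B"
  using continuous_compact_support_bounded[OF mollifierD(5)[OF tt] compact_cball mollifierD(3)[OF tt]]
  by blast
 have ttm: "(%y. tt (x - y)) \<in> borel_measurable lborel" using mollifierD(7)[OF tt] by measurable
 have i1: "(LE y. tt (x - y)) = 1"
  using integral_reflect_lborel[OF mollifierD(7)[OF tt], of x] mollifierD(4)[OF tt]
  by (simp add: integral_completion[OF ttm])
 have int1: "integrable lebesgue (%y. tt (x - y))" using i1 not_integrable_integral_eq by fastforce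
 have int2: "integrable lebesgue (%y. g y * tt (x - y))"
  by (rule conv_integrable[OF g mollifierD(5)[OF tt] B])
 have eq: "conv g tt x - g x = (LE y. g y * tt (x - y) - g x * tt (x - y))"
  using int1 int2 i1 by (simp add: conv_def)
 have "\<bar>conv g tt x - g x\<bar> <= (LE y. \<bar>g y * tt (x - y) - g x * tt (x - y)\<bar>)"
  unfolding eq by (rule integral_abs_bound)
 also have "... <= (LE y. w * tt (x - y))"
 proof (rule integral_mono)
  show "integrable lebesgue (%y. \<bar>g y * tt (x - y) - g x * tt (x - y)\<bar>)"
   using int1 int2 by simp
  show "integrable lebesgue (%y. w * tt (x - y))" using int1 by simp
  fix y
  show "\<bar>g y * tt (x - y) - g x * tt (x - y)\<bar> <= w * tt (x - y)"
  proof (cases "dist x y < e")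
   case True
   then have "\<bar>g y - g x\<bar> <= w" using w[of x y] by (simp add: abs_minus_commute)
   from mult_right_mono[OF this mollifierD(2)[OF tt, of "x - y"]]
   show ?thesis by (simp add: abs_mult mollifierD(2)[OF tt] flip: left_diff_distrib)
  next
   case False
   then have "tt (x - y) = 0" using tt by (simp add: mollifier_def dist_norm)
   then show ?thesis by simp
  qed
 qed
 finally show ?thesis by (simp add: i1)
qed

lemma conv_support:
 fixes g tt :: "'n::finite fn"
 assumes tt: "mollifier e tt" and g: "!!y. dist x y < e ==> g y = 0"
 shows "conv g tt x = 0"
proof -
 have "g y * tt (x - y) = 0" for y
  using tt g[of y] by (cases "dist x y < e") (auto simp: mollifier_def dist_norm)
 then have "(%y. g y * tt (x - y)) = (%y. 0)" by (rule ext)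
 then show ?thesis by (simp add: conv_def)
qed

text \<open>Convolution does not increase the L2 norm, so it suffices to treat a continuous
  approximation \<open>g\<close> of bounded support, to which \<open>conv_uniform\<close> applies.
  \<open>V\<close> converts the uniform bound \<open>w\<close> into an L2 bound.\<close>

lemma conv_tendsto_L2:
 fixes f :: "'n::finite fn"
 assumes f: "f \<in> L2 UNIV" and supp: "!!x. x \<notin> cball 0 R ==> f x = 0"
  and tt: "!!k. mollifier (e k) (tt k)" and e: "e ~~> 0"
 shows "(%k::nat. L2_norm UNIV (%x. conv f (tt k) x - f x)) ~~> 0"
proof (rule LIMSEQ_I)
 fix d :: real assume "d > 0"
 obtain g where gc: "continuous_on UNIV g" and gz: "!!x. x \<notin> cball 0 (R + 1) ==> g x = 0"
  and fg: "L2_norm UNIV (%x. f x - g x) < d / 3"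
  using L2_approx_continuous[OF f supp, where e = "d / 3"] \<open>d > 0\<close> by (metis divide_pos_pos zero_less_numeral)
 have fi: "integrable lebesgue f" by (rule L2_bounded_support_integrable[OF f supp])
 have gi: "integrable lebesgue g" by (rule continuous_compact_support_integrable(2)[OF gc compact_cball gz])
 obtain B where "!!x. \<bar>g x\<bar> <= B" using continuous_compact_support_bounded[OF gc compact_cball gz] by blast
 from L2_uniform_bound(1)[OF this gz continuous_imp_lebesgue_measurable[OF gc]] have gL: "g \<in> L2 UNIV" .
 define V where "V = L2_norm UNIV (indicator (cball (0::real^'n) (R + 2)) :: real^'n => real)"
 have V: "V >= 0" by (simp add: V_def)
 define w where "w = d / (3 * (V + 1))"
 have w: "w > 0" "w * V < d / 3"
  using \<open>d > 0\<close> V by (auto simp: w_def field_simps)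
 obtain r where r: "r > 0" "!!x y. dist x y < r ==> \<bar>g x - g y\<bar> < w"
  using uniformly_continuous_compact_support[OF gc compact_cball gz w(1)] by metis
 obtain k0 where k0: "!!k. k >= k0 ==> \<bar>e k\<bar> < min r 1"
  using LIMSEQ_D[OF e, of "min r 1"] r(1) by auto
 have "norm (L2_norm UNIV (%x. conv f (tt k) x - f x) - 0) < d" if k: "k >= k0" for k
 proof -
  have ek: "e k < r" "e k < 1" using k0[OF k] by auto
  have cfL: "conv f (tt k) \<in> L2 UNIV" by (rule conv_L2(1)[OF tt f fi])
  have cgL: "conv g (tt k) \<in> L2 UNIV" by (rule conv_L2(1)[OF tt gL gi])
  have "L2_norm UNIV (conv (%x. f x - g x) (tt k)) <= L2_norm UNIV (%x. f x - g x)"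
   by (rule conv_L2(2)[OF tt L2_diff[OF f gL]]) (use fi gi in simp)
  moreover have "conv (%x. f x - g x) (tt k) = (%x. conv f (tt k) x - conv g (tt k) x)"
   by (rule ext) (rule conv_diff[OF tt fi gi])
  ultimately have 1: "L2_norm UNIV (%x. conv f (tt k) x - conv g (tt k) x) < d / 3"
   using fg by simp
  have 2: "L2_norm UNIV (%x. conv g (tt k) x - g x) <= w * V"
   unfolding V_def
  proof (rule L2_uniform_bound(2))
   show "\<bar>conv g (tt k) x - g x\<bar> <= w" for x
    by (rule conv_uniform[OF tt gi]) (use r(2) ek in "auto intro: less_imp_le")
   show "conv g (tt k) x - g x = 0" if x: "x \<notin> cball 0 (R + 2)" for x
   proof -
    have "g y = 0" if "dist x y < e k" for y
    proof (rule gz)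
     have "norm x <= norm y + dist x y" using norm_triangle_ineq2[of x y] by (simp add: dist_norm)
     then show "y \<notin> cball 0 (R + 1)" using x that ek by simp
    qed
    then have "conv g (tt k) x = 0" by (rule conv_support[OF tt])
    moreover have "g x = 0" using gz x by simp
    ultimately show ?thesis by simp
   qed
   show "(%x. conv g (tt k) x - g x) \<in> borel_measurable lebesgue"
    using L2D(1)[OF L2_diff[OF cgL gL]] by (simp add: lebesgue_on_UNIV_eq)
  qed
  have 3: "L2_norm UNIV (%x. g x - f x) < d / 3"
   using fg L2_norm_uminus[of UNIV "%x. f x - g x"] by simp
  have "L2_norm UNIV (%x. (conv f (tt k) x - conv g (tt k) x) + ((conv g (tt k) x - g x) + (g x - f x))) < d"
   using L2_norm_triangle[OF L2_diff[OF cfL cgL] L2_add[OF L2_diff[OF cgL gL] L2_diff[OF gL f]]]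
    L2_norm_triangle[OF L2_diff[OF cgL gL] L2_diff[OF gL f]] 1 2 3 w(2) by linarith
  then show ?thesis by simp
 qed
 then show "\<exists>k0. \<forall>k\<ge>k0. norm (L2_norm UNIV (%x. conv f (tt k) x - f x) - 0) < d" by blast
qed

subsection \<open>Test functions and weak derivatives\<close>

lemma test_functionI:
 assumes "!!k. Ck k ph" "compact K" "K \<subseteq> Om" "!!x. x \<notin> K ==> ph x = 0"
 shows "test_function Om ph"
proof -
 have "closure {x. ph x ~= 0} \<subseteq> K"
  by (rule closure_minimal) (use assms compact_imp_closed in auto)
 then have eq: "K \<inter> closure {x. ph x ~= 0} = closure {x. ph x ~= 0}" by blast
 have "compact (K \<inter> closure {x. ph x ~= 0})" by (rule compact_Int_closed[OF assms(2) closed_closure])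
 then have "compact (closure {x. ph x ~= 0})" by (simp only: eq)
 then show ?thesis unfolding test_function_def using eq assms(1,3) by blast
qed

lemma test_function_C1c:
 assumes "test_function Om ph"
 shows "C1c Om ph (%i. pdiff i ph)"
proof -
 have t: "\<forall>k. Ck k ph" "compact (closure {x. ph x ~= 0})" "closure {x. ph x ~= 0} \<subseteq> Om"
  using assms unfolding test_function_def by blast+
 have 1: "C1_on UNIV ph (%i. pdiff i ph)" by (rule Ck_imp_C1_on[OF t(1)[THEN spec, of "Suc 0"]])
 have 2: "\<forall>x. x \<notin> closure {x. ph x ~= 0} --> ph x = 0"
 proof (intro allI impI)
  fix x assume "x \<notin> closure {x. ph x ~= 0}"
  then have "x \<notin> {x. ph x ~= 0}" by (meson closure_subset subsetD)
  then show "ph x = 0" by simp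
 qed
 show ?thesis
  unfolding C1c_def by (intro conjI 1 exI[of _ "closure {x. ph x ~= 0}"] t 2)
qed

lemma test_function_pdiff:
 assumes "test_function Om ph"
 shows "test_function Om (pdiff i ph)"
proof -
 obtain K where K: "compact K" "K \<subseteq> Om" "!!x. x \<notin> K ==> pdiff i ph x = 0"
  using C1cD[OF test_function_C1c[OF assms]] by metis
 have "Ck (Suc k) ph" for k using assms unfolding test_function_def by blast
 then have "Ck k (pdiff i ph)" for k by simp
 then show ?thesis by (rule test_functionI[OF _ K])
qed

lemma C1_on_reflect:
 assumes "C1_on UNIV tt dtt"
 shows "C1_on UNIV (%y. tt (x - y)) (%i y. - dtt i (x - y))"
 unfolding C1_on_def
proof (intro conjI ballI allI)
 fix y
 have "((%y. x - y) has_derivative (%h. - h)) (at y)"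
  by (auto intro!: derivative_eq_intros)
 from has_derivative_compose[OF this C1_onD(1)[OF assms, of "x - y"]]
 show "((%y. tt (x - y)) has_derivative (%h. SU i. - dtt i (x - y) * h $ i)) (at y)"
  by (simp add: sum_negf)
next
 fix i show "continuous_on UNIV (%y. - dtt i (x - y))"
  by (intro continuous_intros continuous_on_compose2[OF C1_onD(2)[OF assms]]) auto
qed

text \<open>The integral of \<open>F (z + ?h) - F z\<close> is zero by translation invariance, and
  the difference quotient is uniformly close to \<open>dF i\<close> on a fixed ball of measure
  \<open>V\<close>. If the absolute value \<open>J\<close> of the integral were positive, an
  accuracy \<open>e\<close> with \<open>e * V < J\<close> would contradict this.\<close>

lemma integral_partial_derivative_zero:
 assumes F: "C1c UNIV F dF"
 shows "(LE x. dF i x) = 0"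
proof (rule ccontr)
 assume nz: "(LE x. dF i x) ~= 0"
 obtain K where K: "compact K" "!!x. x \<notin> K ==> F x = 0" "!!i x. x \<notin> K ==> dF i x = 0"
  using C1cD[OF F] by metis
 obtain R where R: "K \<subseteq> cball 0 R"
  using compact_imp_bounded[OF K(1)] by (auto simp: bounded_iff subset_iff)
 note c = C1_on_continuous[OF C1c_C1_on[OF F]] C1_onD(2)[OF C1c_C1_on[OF F]]
 have iF: "integrable lborel F" by (rule continuous_compact_support_integrable(1)[OF c(1) K(1,2)])
 have idF: "integrable lborel (dF i)" by (rule continuous_compact_support_integrable(1)[OF c(2) K(1,3)])
 have dFb: "dF i \<in> borel_measurable borel" "F \<in> borel_measurable borel"
  using c by (auto intro: borel_measurable_continuous_onI)
 define V where "V = (LB x. indicator (cball (0::real^'a) (R + 1)) x :: real)"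
 have iV: "integrable lborel (indicator (cball (0::real^'a) (R + 1)) :: _ => real)"
  by (rule integrable_real_indicator) (use emeasure_lborel_cball_finite[of "0::real^'a" "R+1"] in simp_all)
 have V: "V >= 0" unfolding V_def by (rule B_nonneg) simp
 define J where "J = \<bar>LB x. dF i x\<bar>"
 have "J > 0" using nz dFb by (simp add: J_def integral_completion)
 define e where "e = J / (V + 1) / 2"
 have e: "e > 0" "e * V < J"
  using \<open>J > 0\<close> V by (auto simp: e_def field_simps intro!: add_nonneg_pos)
 obtain d where d: "d > 0"
  "!!z h. norm h < d ==> \<bar>F (z + h) - F z - (SU i. dF i z * h $ i)\<bar> <= e * norm h"
  using C1c_uniform_linearization[OF F e(1)] by metis
 define t where "t = min (d / 2) 1"
 have t: "t > 0" "t < d" "t <= 1" using d(1) by (auto simp: t_def)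
 let ?h = "t *\<^sub>R axis i (1::real)"
 have hsum: "(SU j. dF j z * ?h $ j) = t * dF i z" for z
 proof -
  have "(SU j. dF j z * ?h $ j) = (SU j. if j = i then t * dF j z else 0)"
   by (rule sum.cong) (auto simp: axis_def)
  then show ?thesis by simp
 qed
 have iT: "integrable lborel (%z. F (z + ?h))"
 proof (rule continuous_compact_support_integrable(1))
  show "continuous_on UNIV (%z. F (z + ?h))"
   by (rule continuous_on_compose2[OF c(1)]) (auto intro: continuous_intros)
  show "compact ((%z. - ?h + z) ` K)" using K(1) by (rule compact_translation)
  show "F (z + ?h) = 0" if "z \<notin> (%z. - ?h + z) ` K" for z
   using that by (intro K(2)) (force simp: image_iff)
 qed
 have "(LB z. F (z + ?h) - F z - t * dF i z) = - t * (LB z. dF i z)"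
  using iT iF idF by (simp add: integral_translate_lborel[OF dFb(2)])
 then have "t * J = \<bar>LB z. F (z + ?h) - F z - t * dF i z\<bar>"
  using t by (simp add: J_def abs_mult)
 also have "... <= (LB z. \<bar>F (z + ?h) - F z - t * dF i z\<bar>)" by (rule integral_abs_bound)
 also have "... <= (LB z. (e * t) * indicator (cball (0::real^'a) (R + 1)) z)"
 proof (rule integral_mono)
  show "integrable lborel (%z. \<bar>F (z + ?h) - F z - t * dF i z\<bar>)" using iT iF idF by simp
  show "integrable lborel (%z::real^'a. (e * t) * indicator (cball 0 (R + 1)) z)" using iV by simp
  fix z :: "real ^ 'a"
  show "\<bar>F (z + ?h) - F z - t * dF i z\<bar> <= (e * t) * indicator (cball 0 (R + 1)) z"
  proof (cases "z \<in> cball 0 (R + 1)")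
   case True
   then show ?thesis using d(2)[of ?h z] t unfolding hsum by simp
  next
   case False
   have "norm z <= norm (z + ?h) + norm ?h" using norm_triangle_ineq4[of "z + ?h" ?h] by simp
   then have "z + ?h \<notin> K" "z \<notin> K" using False R t by (auto dest!: subsetD)
   then show ?thesis using False K by simp
  qed
 qed
 also have "... = e * t * V" by (simp add: V_def)
 finally have "t * J <= t * (e * V)" by (simp add: mult_ac)
 then have "J <= e * V" using t(1) by simp
 with e(2) show False by simp
qed

text \<open>Integration by parts on the whole space against the reflected kernel; it supplies the
  assumption \<open>fg\<close> of \<open>mollify_test_functions\<close> for classical
  derivatives.\<close>

lemma conv_partial_derivative:
 assumes ph: "C1c UNIV ph dph" and tt: "C1_on UNIV tt dtt"
 shows "conv ph (dtt i) x = conv (dph i) tt x"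
proof -
 have F: "C1c UNIV (%y. ph y * tt (x - y)) (%i y. ph y * - dtt i (x - y) + dph i y * tt (x - y))"
  by (rule C1c_mult[OF ph C1_on_reflect[OF tt]])
 obtain K where K: "compact K" "!!x. x \<notin> K ==> ph x = 0" "!!i x. x \<notin> K ==> dph i x = 0"
  using C1cD[OF ph] by metis
 note c = C1_on_continuous[OF C1c_C1_on[OF ph]] C1_onD(2)[OF C1c_C1_on[OF ph]]
 note r = C1_on_reflect[OF tt, of x]
 have i1: "integrable lebesgue (%y. ph y * - dtt i (x - y))"
  by (rule continuous_compact_support_integrable(2)[OF continuous_on_mult[OF c(1) C1_onD(2)[OF r]] K(1)])
   (simp add: K)
 have i2: "integrable lebesgue (%y. dph i y * tt (x - y))"
  by (rule continuous_compact_support_integrable(2)[OF continuous_on_mult[OF c(2) C1_on_continuous[OF r]] K(1)])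
   (simp add: K)
 have "0 = (LE y. ph y * - dtt i (x - y)) + (LE y. dph i y * tt (x - y))"
  using integral_partial_derivative_zero[OF F, of i] i1 i2 by simp
 then show ?thesis by (simp add: conv_def)
qed

lemma C1_on_mollifier:
 assumes "mollifier e tt" shows "C1c UNIV tt (%i. pdiff i tt)"
 by (rule C1c_pdiff[OF mollifierD(1)[OF assms] compact_cball mollifierD(3)[OF assms]])

lemma mollifier_sequence:
 assumes "d > 0"
 shows "\<exists>e tt. (\<forall>k::nat. mollifier (e k) (tt k :: 'n::finite fn) & 0 < e k & e k < d)
  & e ~~> 0"
proof -
 define e where "e k = d / real (k + 2)" for k
 have e: "0 < e k" "e k < d" for k using assms by (auto simp: e_def field_simps intro!: add_pos_nonneg)
 have "e ~~> 0" unfolding e_def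
  using LIMSEQ_ignore_initial_segment[OF lim_const_over_n[of d], of 2] by simp
 moreover have "\<forall>k. \<exists>tt :: real^'n => real. mollifier (e k) tt" using mollifier_exists e by blast
 ultimately show ?thesis using e by metis
qed

text \<open>The assumption \<open>fg\<close> says that \<open>g\<close> is the weak gradient of
  \<open>f\<close>, tested only with the translated kernels that mollification uses. Radii below
  \<open>d\<close> keep the supports inside \<open>Om\<close>.\<close>

lemma mollify_test_functions:
 fixes f :: "'n::finite fn"
 assumes f: "f \<in> L2 UNIV" and g: "!!i. g i \<in> L2 UNIV"
  and K: "compact K" "K \<subseteq> Om" "open Om" and z: "!!x. x \<notin> K ==> f x = 0" "!!i x. x \<notin> K ==> g i x = 0"
  and fg: "!!i x e tt. mollifier e tt ==> conv f (pdiff i tt) x = conv (g i) tt x"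
 shows "\<exists>ph. (\<forall>k. test_function Om (ph k)) &
  (%k. L2_norm UNIV (%x. ph k x - f x)) ~~> 0 &
  (\<forall>i. (%k. L2_norm UNIV (%x. pdiff i (ph k) x - g i x)) ~~> 0)"
proof -
 obtain d where d: "d > 0" "(\<Union>x\<in>K. cball x d) \<subseteq> Om"
  using compact_subset_open_imp_cball_epsilon_subset[OF K(1,3,2)] by metis
 obtain e tt where tt: "!!k. mollifier (e k) (tt k :: 'n fn)" "!!k. e k < d" and e: "e ~~> 0"
  using mollifier_sequence[OF d(1)] by metis
 obtain R where R: "K \<subseteq> cball 0 R"
  using compact_imp_bounded[OF K(1)] by (auto simp: bounded_iff subset_iff)
 have zf: "x \<notin> cball 0 R ==> f x = 0" and zg: "x \<notin> cball 0 R ==> g i x = 0" for x i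
  using z R by blast+
 have fi: "integrable lebesgue f" by (rule L2_bounded_support_integrable[OF f zf])
 define ph where "ph k = conv f (tt k)" for k
 have pd: "pdiff i (ph k) x = conv (g i) (tt k) x" for i k x
 proof -
  have "C1_on UNIV (conv f (tt k)) (%i. conv f (pdiff i (tt k)))"
   by (rule conv_C1_on[OF fi C1_on_mollifier[OF tt(1)]])
  then show ?thesis unfolding ph_def using C1_on_pdiff fg[OF tt(1)] by (metis UNIV_I)
 qed
 have "test_function Om (ph k)" for k
 proof (rule test_functionI)
  show "Ck m (ph k)" for m
   unfolding ph_def by (rule conv_Ck[OF fi compact_cball mollifierD(1)[OF tt(1)] mollifierD(3)[OF tt(1)]])
  show "compact {x + y |x y. x \<in> K & y \<in> cball 0 d}" by (rule compact_sums[OF K(1) compact_cball])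
  show "{x + y |x y. x \<in> K & y \<in> cball 0 d} \<subseteq> Om"
   using d(2) by (fastforce simp: dist_norm)
  fix x assume x: "x \<notin> {x + y |x y. x \<in> K & y \<in> cball 0 d}"
  show "ph k x = 0" unfolding ph_def
  proof (rule conv_support[OF tt(1)], rule z(1), rule notI)
   fix y assume y: "dist x y < e k" "y \<in> K"
   have "x = y + (x - y)" "x - y \<in> cball 0 d" using y tt(2)[of k] by (auto simp: dist_norm norm_minus_commute)
   with x y(2) show False by blast
  qed
 qed
 moreover have "(%k. L2_norm UNIV (%x. ph k x - f x)) ~~> 0"
  unfolding ph_def by (rule conv_tendsto_L2[OF f zf tt(1) e])
 moreover have "(%k. L2_norm UNIV (%x. pdiff i (ph k) x - g i x)) ~~> 0" for i
  unfolding pd by (rule conv_tendsto_L2[OF g zg tt(1) e])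
 ultimately show ?thesis by blast
qed

section \<open>Extension by zero and restriction\<close>

definition zext :: "'a set => ('a => real) => 'a => real" where
 "zext S f x = (if x \<in> S then f x else 0)"

lemma zext_measurable:
 fixes f :: "'a::euclidean_space => real"
 shows "S \<in> sets lebesgue ==> f \<in> borel_measurable (lebesgue_on S) \<longleftrightarrow> zext S f \<in> borel_measurable lebesgue"
 unfolding zext_def by (rule borel_measurable_if[symmetric])

lemma zext_integral:
 fixes f :: "'a::euclidean_space => real"
 assumes "S \<in> sets lebesgue"
 shows "(LINT x|lebesgue_on S. f x) = (LE x. zext S f x)"
proof -
 have "indicator S x *\<^sub>R f x = zext S f x" for x by (simp add: zext_def indicator_def)
 then show ?thesis using assms by (subst integral_restrict_space) auto
qed

lemma zext_integrable:
 fixes f :: "'a::euclidean_space => real"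
 assumes "S \<in> sets lebesgue"
 shows "integrable (lebesgue_on S) f \<longleftrightarrow> integrable lebesgue (zext S f)"
proof -
 have "(%x. indicator S x *\<^sub>R f x) = zext S f" by (rule ext) (simp add: zext_def indicator_def)
 then show ?thesis using assms by (subst integrable_restrict_space) auto
qed

lemma zext_L2:
 fixes f :: "'a::euclidean_space => real"
 assumes "S \<in> sets lebesgue"
 shows "zext S f \<in> L2 UNIV \<longleftrightarrow> f \<in> L2 S" "L2_norm UNIV (zext S f) = L2_norm S f"
proof -
 have eq: "(%x. (norm (zext S f x))^2) = zext S (%x. (norm (f x))^2)"
  by (rule ext) (simp add: zext_def)
 show "zext S f \<in> L2 UNIV \<longleftrightarrow> f \<in> L2 S"
  unfolding L2_def mem_Collect_eq eq lebesgue_on_UNIV_eq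
  using zext_integrable[OF assms] zext_measurable[OF assms] by blast
 have "(L2_norm UNIV (zext S f))^2 = (L2_norm S f)^2"
  unfolding L2_norm_power2 eq lebesgue_on_UNIV_eq zext_integral[OF assms] ..
 then show "L2_norm UNIV (zext S f) = L2_norm S f" by simp
qed

lemma L2_subset:
 fixes f :: "'a::euclidean_space => real"
 assumes "f \<in> L2 UNIV" "S \<in> sets lebesgue"
 shows "f \<in> L2 S" "L2_norm S f <= L2_norm UNIV f"
proof -
 have m: "zext S f \<in> borel_measurable (lebesgue_on UNIV)"
  using assms L2D(1)[OF assms(1)] zext_measurable[OF assms(2), of f]
  by (simp add: lebesgue_on_UNIV_eq measurable_restrict_space1)
 have b: "AE x in lebesgue_on UNIV. norm (zext S f x) <= norm (f x)"
  by (rule AE_I2) (simp add: zext_def)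
 show "f \<in> L2 S" using L2_bound[OF assms(1) m b] zext_L2(1)[OF assms(2)] by blast
 show "L2_norm S f <= L2_norm UNIV f"
  using L2_norm_mono[OF assms(1) m b] zext_L2(2)[OF assms(2)] by metis
qed

lemma continuous_compact_support_L2:
 fixes f :: "'a::euclidean_space => real"
 assumes "continuous_on UNIV f" "compact K" "!!x. x \<notin> K ==> f x = 0"
 shows "f \<in> L2 UNIV"
proof -
 obtain B where B: "!!x. \<bar>f x\<bar> <= B" using continuous_compact_support_bounded[OF assms] by blast
 obtain R where R: "K \<subseteq> cball 0 R"
  using compact_imp_bounded[OF assms(2)] by (auto simp: bounded_iff subset_iff)
 show ?thesis
  by (rule L2_uniform_bound(1)[OF B _ continuous_imp_lebesgue_measurable[OF assms(1)], of R]) (use assms(3) R in blast)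
qed

lemma C1c_L2:
 assumes "C1c Om ph dph"
 shows "ph \<in> L2 UNIV" "dph i \<in> L2 UNIV"
proof -
 obtain K where K: "compact K" "!!x. x \<notin> K ==> ph x = 0" "!!i x. x \<notin> K ==> dph i x = 0"
  using C1cD[OF assms] by metis
 note c = C1_on_continuous[OF C1c_C1_on[OF assms]] C1_onD(2)[OF C1c_C1_on[OF assms]]
 show "ph \<in> L2 UNIV" by (rule continuous_compact_support_L2[OF c(1) K(1,2)])
 show "dph i \<in> L2 UNIV" by (rule continuous_compact_support_L2[OF c(2) K(1,3)])
qed

lemma L2_tendsto_mult:
 fixes F :: "nat => 'a::euclidean_space => real"
 assumes "!!k. F k \<in> L2 UNIV" "f \<in> L2 UNIV" "g \<in> L2 S" "S \<in> sets lebesgue"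
  and "(%k. L2_norm UNIV (%x. F k x - f x)) ~~> 0"
 shows "(%k. LINT x|lebesgue_on S. g x * F k x) ~~> (LINT x|lebesgue_on S. g x * f x)"
proof -
 have "(%k. L2_norm S (%x. F k x - f x)) ~~> 0"
  by (rule tendsto_sandwich[OF _ _ tendsto_const assms(5)])
   (use L2_subset(2)[OF L2_diff[OF assms(1,2)] assms(4)] in "simp_all add: always_eventually")
 from L2_tendsto_inner[OF L2_subset(1)[OF assms(1,4)] L2_subset(1)[OF assms(2,4)] assms(3) this]
 show ?thesis by (simp add: L2_inner_def mult.commute)
qed

section \<open>Weak derivatives on a bounded open set\<close>

locale bounded_open =
 fixes Om :: "(real^'n::finite) set"
 assumes open_Omega: "open Om" and bounded_Omega: "bounded Om"
begin

abbreviation lint (binder "LI " 10) where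
 "lint f \<equiv> integral\<^sup>L (lebesgue_on Om) (f :: real^'n => real)"
abbreviation ae_Omega (binder "AEO " 10) where
 "ae_Omega P \<equiv> eventually P (ae_filter (lebesgue_on Om))"
abbreviation "MO \<equiv> lebesgue_on Om"
abbreviation L2O :: "(real^'n => 'b::euclidean_space) set" where "L2O \<equiv> L2 Om"
abbreviation nrm :: "(real^'n => 'b::euclidean_space) => real" where "nrm \<equiv> L2_norm Om"
abbreviation inr :: "(real^'n => 'b::euclidean_space) => _" where "inr \<equiv> L2_inner Om"

lemma sets_Omega [simp, measurable]: "Om \<in> sets lebesgue"
 using open_Omega by simp

lemma compact_closure_Omega: "compact (closure Om)"
 using bounded_Omega by (simp add: compact_closure)

lemma Omega_radius: "\<exists>R>0. Om \<subseteq> cball 0 R"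
 using bounded_Omega by (auto simp: bounded_pos subset_iff)

lemma L2_integrable:
 fixes f :: "'n fn"
 assumes "f \<in> L2O"
 shows "integrable MO f"
proof -
 obtain R where R: "Om \<subseteq> cball 0 R" using Omega_radius by blast
 have z: "zext Om f \<in> L2 UNIV" using assms zext_L2(1)[OF sets_Omega] by blast
 have "integrable lebesgue (zext Om f)"
  by (rule L2_bounded_support_integrable[OF z, of R]) (use R in "auto simp: zext_def")
 then show ?thesis using zext_integrable[OF sets_Omega] by blast
qed

lemma L2_bounded_continuous:
 fixes f :: "'n fn"
 assumes "continuous_on Om f" "!!x. x \<in> Om ==> \<bar>f x\<bar> <= B"
 shows "f \<in> borel_measurable MO" "f \<in> L2O"
proof -
 show m: "f \<in> borel_measurable MO"
  by (rule continuous_imp_measurable_on_sets_lebesgue[OF assms(1) sets_Omega])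
 obtain R where R: "Om \<subseteq> cball 0 R" using Omega_radius by blast
 have "AEO x. norm (f x) <= norm (B * indicator (cball 0 R) x)"
 proof (rule AE_I2)
  fix x assume "x \<in> space MO"
  then have x: "x \<in> Om" by simp
  then have "indicator (cball 0 R) x = (1::real)" using R by (auto simp: indicator_def)
  then show "norm (f x) <= norm (B * indicator (cball 0 R) x)" using assms(2)[OF x] by simp
 qed
 then show "f \<in> L2O"
  by (rule L2_bound[OF L2_subset(1)[OF indicator_cball_L2 sets_Omega] m])
qed

lemma C1_on_mult_L2:
 fixes f :: "'n fn"
 assumes c: "continuous_on (closure Om) c" and f: "f \<in> L2O"
 shows "(%x. c x * f x) \<in> L2O"
proof -
 obtain B where B: "!!x. x \<in> closure Om ==> \<bar>c x\<bar> <= B"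
  using compact_imp_bounded[OF compact_continuous_image[OF c compact_closure_Omega]]
  by (auto simp: bounded_iff)
 have m: "c \<in> borel_measurable MO"
  by (rule L2_bounded_continuous(1)[OF continuous_on_subset[OF c closure_subset]])
   (use B closure_subset in blast)
 have "AEO x. \<bar>c x\<bar> <= B" 
  by (rule AE_I2) (use B closure_subset in fastforce)
 from L2_mult_bounded(1)[OF f m this] show ?thesis by simp
qed

lemma locally_integrable_L2:
 assumes "f \<in> L2O" shows "locally_integrable Om f"
 unfolding locally_integrable_def
proof (intro allI impI)
 fix K assume K: "compact K & K \<subseteq> Om"
 have "set_integrable lebesgue Om f"
  using L2_integrable[OF assms] unfolding set_integrable_def
  by (subst (asm) integrable_restrict_space) auto
 then show "f absolutely_integrable_on K"
  by (rule set_integrable_subset) (use K in "simp_all add: compact_imp_closed lmeasurable_compact fmeasurableD")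
qed

text \<open>Test functions are smooth, but products with C1 coefficients are not; mollifying
  \<open>ph\<close> extends the defining identity to C1 functions of compact support.\<close>

lemma C1c_weak_derivative:
 assumes w: "has_weak_pderiv Om i f g" and f: "f \<in> L2O" and g: "g \<in> L2O"
  and ph: "C1c Om ph dph"
 shows "(LI x. f x * dph i x) = - (LI x. g x * ph x)"
proof -
 obtain K where K: "compact K" "K \<subseteq> Om" "!!x. x \<notin> K ==> ph x = 0" "!!i x. x \<notin> K ==> dph i x = 0"
  using C1cD[OF ph] by metis
 have "\<exists>ps. (\<forall>k::nat. test_function Om (ps k)) &
  (%k. L2_norm UNIV (%x. ps k x - ph x)) ~~> 0 &
  (\<forall>i. (%k. L2_norm UNIV (%x. pdiff i (ps k) x - dph i x)) ~~> 0)"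
  by (rule mollify_test_functions[OF C1c_L2[OF ph] K(1,2) open_Omega K(3,4)
    conv_partial_derivative[OF C1c_mono[OF ph subset_UNIV] C1c_C1_on[OF C1_on_mollifier]]])
 then obtain ps where ps0: "(\<forall>k::nat. test_function Om (ps k)) &
  (%k. L2_norm UNIV (%x. ps k x - ph x)) ~~> 0 &
  (\<forall>i. (%k. L2_norm UNIV (%x. pdiff i (ps k) x - dph i x)) ~~> 0)" by (rule exE)
 note ps = ps0[THEN conjunct1, rule_format] ps0[THEN conjunct2, THEN conjunct1]
  ps0[THEN conjunct2, THEN conjunct2, rule_format]
 have t: "test_function Om (ps k)" for k by (rule ps(1))
 note T = C1c_L2[OF test_function_C1c[OF t]]
 have "(%k. LI x. f x * pdiff i (ps k) x) ~~> (LI x. f x * dph i x)"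
  by (rule L2_tendsto_mult[OF T(2) C1c_L2(2)[OF ph] f sets_Omega ps(3)])
 moreover have "(LI x. f x * pdiff i (ps k) x) = - (LI x. g x * ps k x)" for k
  using w[unfolded has_weak_pderiv_def, THEN conjunct2, THEN conjunct2, rule_format, OF t] .
 moreover have "(%k. - (LI x. g x * ps k x)) ~~> - (LI x. g x * ph x)"
  by (intro tendsto_minus L2_tendsto_mult[OF T(1) C1c_L2(1)[OF ph] g sets_Omega ps(2)])
 ultimately show ?thesis by (simp only: LIMSEQ_unique)
qed

text \<open>H1 with the weak gradient as explicit data, so that rules such as the product rule can
  name it; \<open>h1_weak_pderiv\<close> returns to the chosen \<open>weak_pderiv\<close>.\<close>

definition h1 :: "'n fn => ('n => 'n fn) => bool" where
 "h1 f df \<longleftrightarrow> f \<in> L2O & (\<forall>i. df i \<in> L2O & has_weak_pderiv Om i f (df i))"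

lemma h1D:
 assumes "h1 f df" shows "f \<in> L2O" "df i \<in> L2O" "has_weak_pderiv Om i f (df i)"
 using assms by (auto simp: h1_def)

lemma h1_C1c:
 assumes "h1 f df" "C1c Om ph dph"
 shows "(LI x. f x * dph i x) = - (LI x. df i x * ph x)"
 by (rule C1c_weak_derivative[OF h1D(3,1,2)[OF assms(1)] assms(2)])

lemma h1I:
 assumes "f \<in> L2O" "!!i. df i \<in> L2O"
  and "!!i ph dph. C1c Om ph dph ==>
   (LI x. f x * dph i x) = - (LI x. df i x * ph x)"
 shows "h1 f df"
 unfolding h1_def has_weak_pderiv_def
 by (intro conjI allI impI assms locally_integrable_L2 test_function_C1c)

lemma C1c_L2_Omega:
 assumes "C1c Om ph dph" shows "ph \<in> L2O" "dph i \<in> L2O"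
 by (rule L2_subset(1)[OF C1c_L2(1)[OF assms] sets_Omega])
  (rule L2_subset(1)[OF C1c_L2(2)[OF assms] sets_Omega])

lemma h1_add:
 assumes "h1 f df" "h1 g dg"
 shows "h1 (%x. f x + g x) (%i x. df i x + dg i x)"
proof (rule h1I)
 fix i ph dph assume ph: "C1c Om ph dph"
 note i = L2_integrable_mult
 show "(LI x. (f x + g x) * dph i x) = - (LI x. (df i x + dg i x) * ph x)"
  using i[OF h1D(1)[OF assms(1)] C1c_L2_Omega(2)[OF ph, of i]] i[OF h1D(1)[OF assms(2)] C1c_L2_Omega(2)[OF ph, of i]]
   i[OF h1D(2)[OF assms(1), of i] C1c_L2_Omega(1)[OF ph]] i[OF h1D(2)[OF assms(2), of i] C1c_L2_Omega(1)[OF ph]]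
   h1_C1c[OF assms(1) ph, of i] h1_C1c[OF assms(2) ph, of i]
  by (simp add: distrib_right)
qed (use h1D[OF assms(1)] h1D[OF assms(2)] in "simp_all add: L2_add")

lemma h1_zero: "h1 (%x. 0) (%i x. 0)"
 by (rule h1I) simp_all

lemma h1_sum:
 assumes "!!k. k \<in> I ==> h1 (f k) (df k)"
 shows "h1 (%x. \<Sum>k\<in>I. f k x) (%i x. \<Sum>k\<in>I. df k i x)"
 using assms
proof (induction I rule: infinite_finite_induct)
 case (insert k I)
 have "h1 (%x. f k x + (\<Sum>k\<in>I. f k x)) (%i x. df k i x + (\<Sum>k\<in>I. df k i x))"
  by (rule h1_add) (use insert in auto)
 then show ?case using insert by simp
qed (simp_all add: h1_zero)

lemma h1_mult:
 assumes f: "h1 f df" and c: "C1_on (closure Om) c dc"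
 shows "h1 (%x. c x * f x) (%i x. c x * df i x + dc i x * f x)"
proof (rule h1I)
 note cc = C1_on_continuous[OF c] C1_onD(2)[OF c]
 show "(%x. c x * f x) \<in> L2O" by (rule C1_on_mult_L2[OF cc(1) h1D(1)[OF f]])
 show "(%x. c x * df i x + dc i x * f x) \<in> L2O" for i
  by (intro L2_add C1_on_mult_L2[OF cc(1) h1D(2)[OF f]] C1_on_mult_L2[OF cc(2) h1D(1)[OF f]])
 fix i ph dph assume ph: "C1c Om ph dph"
 have p: "C1c Om (%x. ph x * c x) (%i x. if x \<in> Om then ph x * dc i x + dph i x * c x else 0)"
  by (rule C1c_mult_local[OF ph C1_on_subset[OF c closure_subset] open_Omega])
 have i1: "integrable MO (%x. (c x * f x) * dph i x)"
  by (rule L2_integrable_mult[OF C1_on_mult_L2[OF cc(1) h1D(1)[OF f]] C1c_L2_Omega(2)[OF ph]])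
 have i2: "integrable MO (%x. (dc i x * f x) * ph x)"
  by (rule L2_integrable_mult[OF C1_on_mult_L2[OF cc(2) h1D(1)[OF f]] C1c_L2_Omega(1)[OF ph]])
 have i3: "integrable MO (%x. (c x * df i x) * ph x)"
  by (rule L2_integrable_mult[OF C1_on_mult_L2[OF cc(1) h1D(2)[OF f]] C1c_L2_Omega(1)[OF ph]])
 have "(LI x. (c x * f x) * dph i x) + (LI x. (dc i x * f x) * ph x)
  = (LI x. (c x * f x) * dph i x + (dc i x * f x) * ph x)"
  using i1 i2 by simp
 also have "... = (LI x. f x * (if x \<in> Om then ph x * dc i x + dph i x * c x else 0))"
  by (rule B_cong) (auto simp: algebra_simps)
 also have "... = - (LI x. df i x * (ph x * c x))" by (rule h1_C1c[OF f p])
 also have "... = - (LI x. (c x * df i x) * ph x)" by (simp add: mult_ac)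
 finally show "(LI x. (c x * f x) * dph i x) = - (LI x. (c x * df i x + dc i x * f x) * ph x)"
  using i2 i3 by (simp add: distrib_right)
qed

lemma h1_cmult: "h1 f df ==> h1 (%x. c * f x) (%i x. c * df i x)"
 using h1_mult[OF _ C1_on_const] by simp

lemma h1_diff:
 assumes "h1 f df" "h1 g dg"
 shows "h1 (%x. f x - g x) (%i x. df i x - dg i x)"
 using h1_add[OF assms(1) h1_cmult[OF assms(2), of "-1"]] by simp

lemma C1c_imp_h1:
 assumes "C1c Om ps dps" shows "h1 ps dps"
proof (rule h1I)
 fix i ph dph assume ph: "C1c Om ph dph"
 obtain K where K: "compact K" "K \<subseteq> Om" "!!x. x \<notin> K ==> ph x = 0" "!!i x. x \<notin> K ==> dph i x = 0"
  using C1cD[OF ph] by metis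
 have "C1c UNIV (%x. ph x * ps x) (%i x. ph x * dps i x + dph i x * ps x)"
  by (rule C1c_mult[OF C1c_mono[OF ph subset_UNIV] C1c_C1_on[OF assms]])
 from integral_partial_derivative_zero[OF this, of i]
 have "0 = (LE x. ph x * dps i x + dph i x * ps x)" by simp
 also have "... = (LE x. zext Om (%x. ph x * dps i x + dph i x * ps x) x)"
 proof (rule B_cong[OF refl])
  fix x show "ph x * dps i x + dph i x * ps x = zext Om (%x. ph x * dps i x + dph i x * ps x) x"
   using K(2) K(3,4)[of x] by (cases "x \<in> K") (auto simp: zext_def)
 qed
 also have "... = (LI x. ph x * dps i x + dph i x * ps x)"
  by (rule zext_integral[OF sets_Omega, symmetric])
 also have "... = (LI x. ph x * dps i x) + (LI x. dph i x * ps x)"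
  by (rule B_add)
   (rule L2_integrable_mult C1c_L2_Omega[OF ph] C1c_L2_Omega[OF assms])+
 finally show "(LI x. ps x * dph i x) = - (LI x. dps i x * ph x)"
  by (simp add: mult.commute)
qed (rule C1c_L2_Omega[OF assms])+

text \<open>After multiplication by a compactly supported \<open>c\<close>, the zero extension of
  the product is weakly differentiable on the whole space; \<open>conv_eq\<close> states this by
  testing \<open>f\<close> with \<open>c\<close> times a translated kernel. Mollification then
  yields test functions of \<open>Om\<close>.\<close>

lemma cutoff_approximation:
 assumes f: "h1 f df" and c: "C1c Om c dc"
 shows "\<exists>ph. (\<forall>k::nat. test_function Om (ph k)) &
  (%k. nrm (%x. ph k x - c x * f x)) ~~> 0 &
  (\<forall>i. (%k. nrm (%x. pdiff i (ph k) x - (c x * df i x + dc i x * f x))) ~~> 0)"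
proof -
 obtain K where K: "compact K" "K \<subseteq> Om" "!!x. x \<notin> K ==> c x = 0" "!!i x. x \<notin> K ==> dc i x = 0"
  using C1cD[OF c] by metis
 let ?f = "zext Om (%x. c x * f x)" and ?g = "%i. zext Om (%x. c x * df i x + dc i x * f x)"
 have h: "h1 (%x. c x * f x) (%i x. c x * df i x + dc i x * f x)"
  by (rule h1_mult[OF f C1_on_subset[OF C1c_C1_on[OF c] subset_UNIV]])
 have fL: "?f \<in> L2 UNIV" and gL: "?g i \<in> L2 UNIV" for i
  using h1D[OF h] zext_L2(1)[OF sets_Omega] by blast+
 have conv_eq: "conv ?f (pdiff i tt) x = conv (?g i) tt x" if tt: "mollifier e tt" for i x e tt
 proof -
  have tt': "C1_on UNIV tt (%i. pdiff i tt)" by (rule C1c_C1_on[OF C1_on_mollifier[OF tt]])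
  have p: "C1c Om (%y. c y * tt (x - y)) (%i y. c y * - pdiff i tt (x - y) + dc i y * tt (x - y))"
   by (rule C1c_mult[OF c C1_on_reflect[OF tt']])
  note r = C1_on_reflect[OF tt', of x]
  note cr = continuous_on_subset[OF C1_on_continuous[OF r] subset_UNIV]
   continuous_on_subset[OF C1_onD(2)[OF r] subset_UNIV]
  have ci: "integrable MO (%y. c y * f y * - pdiff i tt (x - y))"
   "integrable MO (%y. dc i y * f y * tt (x - y))"
   "integrable MO (%y. c y * df i y * tt (x - y))"
  proof -
   note cc = continuous_on_subset[OF C1_on_continuous[OF C1c_C1_on[OF c]] subset_UNIV]
    continuous_on_subset[OF C1_onD(2)[OF C1c_C1_on[OF c]] subset_UNIV]
   have "(%y. - pdiff i tt (x - y) * (c y * f y)) \<in> L2O"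
    by (rule C1_on_mult_L2[OF cr(2) C1_on_mult_L2[OF cc(1) h1D(1)[OF f]]])
   from L2_integrable[OF this] show "integrable MO (%y. c y * f y * - pdiff i tt (x - y))"
    by (simp add: mult.commute)
   have "(%y. tt (x - y) * (dc i y * f y)) \<in> L2O"
    by (rule C1_on_mult_L2[OF cr(1) C1_on_mult_L2[OF cc(2) h1D(1)[OF f]]])
   from L2_integrable[OF this] show "integrable MO (%y. dc i y * f y * tt (x - y))"
    by (simp add: mult.commute)
   have "(%y. tt (x - y) * (c y * df i y)) \<in> L2O"
    by (rule C1_on_mult_L2[OF cr(1) C1_on_mult_L2[OF cc(1) h1D(2)[OF f]]])
   from L2_integrable[OF this] show "integrable MO (%y. c y * df i y * tt (x - y))"
    by (simp add: mult.commute)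
  qed
  have "conv ?f (pdiff i tt) x = (LI y. c y * f y * pdiff i tt (x - y))"
   unfolding conv_def zext_integral[OF sets_Omega]
   by (rule B_cong) (simp_all add: zext_def)
  also have "... = (LI y. dc i y * f y * tt (x - y))
    - (LI y. f y * (c y * - pdiff i tt (x - y) + dc i y * tt (x - y)))"
  proof -
   have "(LI y. f y * (c y * - pdiff i tt (x - y) + dc i y * tt (x - y)))
    = (LI y. c y * f y * - pdiff i tt (x - y) + dc i y * f y * tt (x - y))"
    by (rule B_cong) (simp_all add: algebra_simps)
   also have "... = (LI y. c y * f y * - pdiff i tt (x - y)) + (LI y. dc i y * f y * tt (x - y))"
    using ci(1,2) by (rule B_add)
   finally show ?thesis by simp
  qed
  also have "... = (LI y. dc i y * f y * tt (x - y)) + (LI y. df i y * (c y * tt (x - y)))"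
   using h1_C1c[OF f p, of i] by simp
  also have "... = (LI y. (c y * df i y + dc i y * f y) * tt (x - y))"
   using ci(2,3) by (simp add: algebra_simps)
  also have "... = conv (?g i) tt x"
   unfolding conv_def zext_integral[OF sets_Omega]
   by (rule B_cong) (simp_all add: zext_def)
  finally show ?thesis .
 qed
 have z: "?f x = 0" "?g i x = 0" if "x \<notin> K" for i x
  using K(3,4)[OF that] by (simp_all add: zext_def)
 have "\<exists>ph. (\<forall>k::nat. test_function Om (ph k)) &
  (%k. L2_norm UNIV (%x. ph k x - ?f x)) ~~> 0 &
  (\<forall>i. (%k. L2_norm UNIV (%x. pdiff i (ph k) x - ?g i x)) ~~> 0)"
  by (rule mollify_test_functions[OF fL gL K(1,2) open_Omega z conv_eq])
 then obtain ph where ph0: "(\<forall>k::nat. test_function Om (ph k)) &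
  (%k. L2_norm UNIV (%x. ph k x - ?f x)) ~~> 0 &
  (\<forall>i. (%k. L2_norm UNIV (%x. pdiff i (ph k) x - ?g i x)) ~~> 0)" by (rule exE)
 note ph = ph0[THEN conjunct1, rule_format] ph0[THEN conjunct2, THEN conjunct1]
  ph0[THEN conjunct2, THEN conjunct2, rule_format]
 have t: "test_function Om (ph k)" for k by (rule ph(1))
 note T = C1c_L2[OF test_function_C1c[OF t]]
 have restrict: "nrm (%x. u x - v x) <= L2_norm UNIV (%x. u x - zext Om v x)"
  if "u \<in> L2 UNIV" "zext Om v \<in> L2 UNIV" for u v
 proof -
  have "nrm (%x. u x - v x) = nrm (%x. u x - zext Om v x)"
   unfolding L2_norm_def L2_inner_def
   by (intro arg_cong[where f = sqrt] B_cong) (auto simp: zext_def)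
  then show ?thesis using L2_subset(2)[OF L2_diff[OF that] sets_Omega] by simp
 qed
 have "(%k. nrm (%x. ph k x - c x * f x)) ~~> 0"
  by (rule tendsto_sandwich[OF _ _ tendsto_const ph(2)]) (use restrict[OF T(1) fL] in "simp_all add: always_eventually")
 moreover have "(%k. nrm (%x. pdiff i (ph k) x - (c x * df i x + dc i x * f x))) ~~> 0" for i
  by (rule tendsto_sandwich[OF _ _ tendsto_const ph(3)[of i]]) (use restrict[OF T(2) gL] in "simp_all add: always_eventually")
 ultimately show ?thesis using t by (intro exI[of _ ph] conjI allI)
qed

end

lemma L2_AE_subsequence:
 fixes F :: "nat => 'a::euclidean_space => real"
 assumes F: "!!k. F k \<in> L2 S" and f: "f \<in> L2 S"
  and lim: "(%k. L2_norm S (%x. F k x - f x)) ~~> 0"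
 shows "\<exists>r::nat => nat. strict_mono r & (AE x in lebesgue_on S. (%k. F (r k) x) ~~> f x)"
proof -
 have int: "integrable (lebesgue_on S) (%x. (F k x - f x)^2)" for k
  by (rule L2_integrable_power2[OF L2_diff[OF F f]])
 have "(%k. (L2_norm S (%x. F k x - f x))^2) ~~> 0^2"
  by (rule tendsto_power[OF lim])
 then have "(%k. LINT x|lebesgue_on S. norm ((F k x - f x)^2)) ~~> 0"
  by (simp add: L2_norm_power2)
 from tendsto_L1_AE_subseq[OF int this] obtain r :: "nat => nat"
  where r: "strict_mono r" "AE x in lebesgue_on S. (%k. (F (r k) x - f x)^2) ~~> 0" by blast
 have "AE x in lebesgue_on S. (%k. F (r k) x) ~~> f x"
  using r(2)
 proof eventually_elim
  case (elim x)
  from tendsto_real_sqrt[OF elim] have "(%k. \<bar>F (r k) x - f x\<bar>) ~~> 0" by simp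
  then show ?case by (simp add: tendsto_rabs_zero_iff LIM_zero_iff)
 qed
 with r(1) show ?thesis by blast
qed

section \<open>Uniqueness of weak derivatives and integration by parts\<close>

context bounded_open
begin

lemma locally_integrable_mult:
 assumes g: "locally_integrable Om g" and ph: "continuous_on UNIV ph" "compact K" "K \<subseteq> Om"
  "!!x. x \<notin> K ==> ph x = 0"
 shows "integrable MO (%x. g x * ph x)"
proof -
 obtain B where B: "!!x. \<bar>ph x\<bar> <= B" using continuous_compact_support_bounded[OF ph(1,2,4)] by blast
 have "set_integrable lebesgue K g"
  using g ph(2,3) unfolding locally_integrable_def by blast
 then have i: "integrable lebesgue (%x. indicator K x * g x)" by (simp add: set_integrable_def)
 have "integrable lebesgue (zext Om (%x. g x * ph x))"
 proof (rule Bi_bound)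
  show "integrable lebesgue (%x. B * (indicator K x * g x))" using i by simp
  have "zext Om (%x. g x * ph x) = (%x. (indicator K x * g x) * ph x)"
   using ph(3,4) by (force simp: zext_def fun_eq_iff indicator_def)
  then show "zext Om (%x. g x * ph x) \<in> borel_measurable lebesgue"
   using borel_measurable_times[OF borel_measurable_integrable[OF i] continuous_imp_lebesgue_measurable[OF ph(1)]]
   by simp
  show "AE x in lebesgue. norm (zext Om (%x. g x * ph x) x) <= norm (B * (indicator K x * g x))"
  proof (rule AE_I2)
   fix x
   have "\<bar>ph x\<bar> <= \<bar>B\<bar>" using B[of x] by linarith
   from mult_right_mono[OF this abs_ge_zero[of "g x"]]
   show "norm (zext Om (%x. g x * ph x) x) <= norm (B * (indicator K x * g x))"
    using ph(4)[of x] by (cases "x \<in> K") (auto simp: zext_def abs_mult mult.commute)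
  qed
 qed
 then show ?thesis using zext_integrable[OF sets_Omega] by blast
qed

text \<open>The ideal test function is the sign \<open>s\<close> of \<open>h\<close> on a compact
  \<open>K\<close>. Its mollifications are test functions bounded by 1, live in a compact
  neighbourhood \<open>L\<close> of \<open>K\<close>, and converge almost everywhere along a
  subsequence, so dominated convergence yields the integral of |h| over \<open>K\<close>. Countably
  many boxes exhaust \<open>Om\<close>.\<close>

lemma locally_integrable_test_zero:
 assumes h: "locally_integrable Om h"
  and z: "!!ph. test_function Om ph ==> (LI x. h x * ph x) = 0"
 shows "AEO x. h x = 0"
proof -
 have K0: "AE x in lebesgue. x \<in> K --> h x = 0" if K: "compact K" "K \<subseteq> Om" for K
 proof -
  obtain d where d: "d > 0" "(\<Union>x\<in>K. cball x d) \<subseteq> Om"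
   using compact_subset_open_imp_cball_epsilon_subset[OF K(1) open_Omega K(2)] by metis
  obtain e tt where tt: "!!k. mollifier (e k) (tt k :: 'n fn)" "!!k. e k < d" and e: "e ~~> 0"
   using mollifier_sequence[OF d(1)] by metis
  obtain R where R: "K \<subseteq> cball 0 R"
   using compact_imp_bounded[OF K(1)] by (auto simp: bounded_iff subset_iff)
  define L where "L = {x + y |x y. x \<in> K & y \<in> cball (0::real^'n) d}"
  have L1: "compact L" unfolding L_def by (rule compact_sums[OF K(1) compact_cball])
  have L2: "L \<subseteq> Om" unfolding L_def using d(2) by (fastforce simp: dist_norm)
  note L = L1 L2
  have KL: "K \<subseteq> L"
  proof
   fix x assume "x \<in> K"
   moreover have "x = x + 0" "(0::real^'n) \<in> cball 0 d" using d(1) by simp_all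
   ultimately show "x \<in> L" unfolding L_def by blast
  qed
  have hL: "integrable lebesgue (%x. indicator L x * h x)" and hK: "integrable lebesgue (%x. indicator K x * h x)"
   using h[unfolded locally_integrable_def set_integrable_def] L K by simp_all
  define s where "s x = sgn (indicator K x * h x)" for x
  have sm: "s \<in> borel_measurable lebesgue"
   unfolding s_def using borel_measurable_integrable[OF hK] by measurable
  have sz: "x \<notin> K ==> s x = 0" for x by (simp add: s_def)
  have sz': "x \<notin> cball 0 R ==> s x = 0" for x using sz R by blast
  have sb: "\<bar>s x\<bar> <= 1" for x by (simp add: s_def sgn_if)
  have sL: "s \<in> L2 UNIV" by (rule L2_uniform_bound(1)[OF sb sz' sm])
  have si: "integrable lebesgue s" by (rule L2_bounded_support_integrable[OF sL sz'])
  have cz: "conv s (tt k) x = 0" if "x \<notin> L" for k x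
  proof (rule conv_support[OF tt(1)], rule sz, rule notI)
   fix y assume y: "dist x y < e k" "y \<in> K"
   have "x = y + (x - y)" "x - y \<in> cball 0 d" using y tt(2)[of k] by (auto simp: dist_norm norm_minus_commute)
   then have "x \<in> L" unfolding L_def using y(2) by blast
   with that show False by simp
  qed
  have t: "test_function Om (conv s (tt k))" for k
   by (rule test_functionI[OF conv_Ck[OF si compact_cball mollifierD(1)[OF tt(1)] mollifierD(3)[OF tt(1)]] L cz])
  have cb: "\<bar>conv s (tt k) x\<bar> <= 1" for k x
  proof -
   have "ttm": "(%y. tt k (x - y)) \<in> borel_measurable lborel" using mollifierD(7)[OF tt(1)] by measurable
   have i1: "(LE y. tt k (x - y)) = 1"
    using integral_reflect_lborel[OF mollifierD(7)[OF tt(1)], of k x] mollifierD(4)[OF tt(1)]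
    by (simp add: integral_completion[OF \<open>(%y. tt k (x - y)) \<in> borel_measurable lborel\<close>])
   have int1: "integrable lebesgue (%y. tt k (x - y))" using i1 not_integrable_integral_eq by fastforce
   have "\<bar>conv s (tt k) x\<bar> <= (LE y. \<bar>s y * tt k (x - y)\<bar>)"
    unfolding conv_def by (rule integral_abs_bound)
   also have "... <= (LE y. tt k (x - y))"
   proof (rule integral_mono[OF _ int1])
    obtain B where B: "!!x. \<bar>tt k x\<bar> <= B"
     using continuous_compact_support_bounded[OF mollifierD(5)[OF tt(1)] compact_cball mollifierD(3)[OF tt(1)[of k]]] by blast
    show "integrable lebesgue (%y. \<bar>s y * tt k (x - y)\<bar>)"
     by (rule integrable_abs[OF conv_integrable[OF si mollifierD(5)[OF tt(1)] B]])
    show "\<bar>s y * tt k (x - y)\<bar> <= tt k (x - y)" for y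
     using mult_right_mono[OF sb mollifierD(2)[OF tt(1)], of y k "x - y"]
     by (simp add: abs_mult mollifierD(2)[OF tt(1)])
   qed
   finally show ?thesis by (simp add: i1)
  qed
  have lim: "(%k. L2_norm UNIV (%x. conv s (tt k) x - s x)) ~~> 0"
   by (rule conv_tendsto_L2[OF sL sz' tt(1) e])
  have cL: "conv s (tt k) \<in> L2 UNIV" for k by (rule conv_L2(1)[OF tt(1) sL si])
  obtain r :: "nat => nat" where r: "AE x in lebesgue. (%k. conv s (tt (r k)) x) ~~> s x"
   using L2_AE_subsequence[OF cL sL lim] unfolding lebesgue_on_UNIV_eq by blast
  have cm: "conv s (tt k) \<in> borel_measurable lebesgue" for k
   using L2D(1)[OF cL] by (simp add: lebesgue_on_UNIV_eq)
  have "(%k. LE x. (indicator L x * h x) * conv s (tt (r k)) x) ~~>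
    (LE x. (indicator L x * h x) * s x)"
  proof (rule integral_dominated_convergence[where w = "%x. \<bar>indicator L x * h x\<bar>"])
   show "integrable lebesgue (%x. \<bar>indicator L x * h x\<bar>)" using hL by simp
   show "AE x in lebesgue. (%k. indicator L x * h x * conv s (tt (r k)) x) ~~> indicator L x * h x * s x"
    using r by eventually_elim (intro tendsto_mult_left)
   show "AE x in lebesgue. norm (indicator L x * h x * conv s (tt (r k)) x) <= \<bar>indicator L x * h x\<bar>" for k
   proof (rule AE_I2)
    fix x
    show "norm (indicator L x * h x * conv s (tt (r k)) x) <= \<bar>indicator L x * h x\<bar>"
     using mult_left_mono[OF cb[of "r k" x] abs_ge_zero[of "indicator L x * h x"]] by (simp add: abs_mult)
   qed
  qed (use borel_measurable_integrable[OF hL] sm cm in "auto intro!: borel_measurable_times")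
  moreover have "(LE x. (indicator L x * h x) * conv s (tt k) x) = 0" for k
  proof -
   have "(LE x. (indicator L x * h x) * conv s (tt k) x)
     = (LE x. zext Om (%x. h x * conv s (tt k) x) x)"
   proof (rule B_cong[OF refl])
    fix x show "(indicator L x * h x) * conv s (tt k) x = zext Om (%x. h x * conv s (tt k) x) x"
     using L(2) cz[of x k] by (cases "x \<in> L") (simp_all add: zext_def subset_iff)
   qed
   also have "... = 0" unfolding zext_integral[OF sets_Omega, symmetric] by (rule z[OF t])
   finally show ?thesis .
  qed
  ultimately have "(LE x. (indicator L x * h x) * s x) = 0"
   using LIMSEQ_unique[OF _ tendsto_const[of 0]] by simp
  moreover have eq: "(indicator L x * h x) * s x = \<bar>indicator K x * h x\<bar>" for x
   using KL by (auto simp: s_def indicator_def abs_sgn)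
  ultimately have "(LE x. \<bar>indicator K x * h x\<bar>) = 0" by simp
  then have "AE x in lebesgue. \<bar>indicator K x * h x\<bar> = 0"
   using integral_nonneg_eq_0_iff_AE[OF integrable_abs[OF hK]] by simp
  then show ?thesis by eventually_elim (auto simp: indicator_def)
 qed
 obtain D :: "(real^'n) set set" where D: "countable D" "D \<subseteq> Pow Om" "!!X. X \<in> D ==> \<exists>a b. X = cbox a b" "\<Union>D = Om"
  using open_countable_Union_open_cbox[OF open_Omega] by metis
 have "AE x in lebesgue. \<forall>X\<in>D. x \<in> X --> h x = 0"
  unfolding AE_ball_countable[OF D(1)]
 proof
  fix X assume "X \<in> D"
  then obtain a b where "X = cbox a b" using D(3) by metis
  then have "compact X" by simp
  have "X \<subseteq> Om" using D(2) \<open>X \<in> D\<close> by blast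
  then show "AE x in lebesgue. x \<in> X --> h x = 0" by (rule K0[OF \<open>compact X\<close>])
 qed
 then have "AE x in lebesgue. x \<in> Om --> h x = 0"
  by eventually_elim (use D(4) in blast)
 then show ?thesis by (simp add: AE_restrict_space_iff)
qed

lemma weak_pderiv_unique:
 assumes "has_weak_pderiv Om i f g" "has_weak_pderiv Om i f g'"
 shows "AEO x. g x = g' x"
proof -
 have l: "locally_integrable Om g" "locally_integrable Om g'"
  using assms unfolding has_weak_pderiv_def by blast+
 have "locally_integrable Om (%x. g x - g' x)"
  using l unfolding locally_integrable_def by (blast intro: set_integral_diff)
 moreover have "(LI x. (g x - g' x) * ph x) = 0" if t: "test_function Om ph" for ph
 proof -
  obtain K where K: "compact K" "K \<subseteq> Om" "!!x. x \<notin> K ==> ph x = 0"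
   using C1cD[OF test_function_C1c[OF t]] by metis
  note c = C1_on_continuous[OF C1c_C1_on[OF test_function_C1c[OF t]]]
  have "(LI x. g x * ph x) = (LI x. g' x * ph x)"
   using assms[unfolded has_weak_pderiv_def, THEN conjunct2, THEN conjunct2, rule_format, OF t] by simp
  then show ?thesis
   using locally_integrable_mult[OF l(1) c K] locally_integrable_mult[OF l(2) c K]
   by (simp add: left_diff_distrib)
 qed
 ultimately have "AEO x. g x - g' x = 0" by (rule locally_integrable_test_zero)
 then show ?thesis by eventually_elim simp
qed

lemma h1_cong_AE:
 assumes f: "h1 f df" and ae: "AEO x. f x = f' x" "!!i. AEO x. df i x = df' i x"
 shows "h1 f' df'"
proof (rule h1I)
 show f': "f' \<in> L2O" by (rule L2_cong_AE_iff[OF sets_Omega ae(1) h1D(1)[OF f]])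
 show df': "df' i \<in> L2O" for i by (rule L2_cong_AE_iff[OF sets_Omega ae(2) h1D(2)[OF f]])
 fix i ph dph assume ph: "C1c Om ph dph"
 have "(LI x. f' x * dph i x) = (LI x. f x * dph i x)"
  by (rule integral_cong_AE)
   (use ae(1) L2D(1)[OF f'] L2D(1)[OF h1D(1)[OF f]] L2D(1)[OF C1c_L2_Omega(2)[OF ph]] in
    \<open>auto intro!: borel_measurable_times elim!: eventually_mono\<close>)
 moreover have "(LI x. df' i x * ph x) = (LI x. df i x * ph x)"
  by (rule integral_cong_AE)
   (use ae(2)[of i] L2D(1)[OF df'] L2D(1)[OF h1D(2)[OF f]] L2D(1)[OF C1c_L2_Omega(1)[OF ph]] in
    \<open>auto intro!: borel_measurable_times elim!: eventually_mono\<close>)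
 ultimately show "(LI x. f' x * dph i x) = - (LI x. df' i x * ph x)"
  using h1_C1c[OF f ph] by simp
qed

text \<open>The choice in \<open>weak_pderiv\<close> picks some weak derivative, and weak
  derivatives are unique up to null sets.\<close>

lemma h1_weak_pderiv_AE:
 assumes "h1 f df"
 shows "AEO x. df i x = weak_pderiv Om i f x"
proof -
 have "has_weak_pderiv Om i f (weak_pderiv Om i f)"
  unfolding weak_pderiv_def
  by (rule someI[where P = "has_weak_pderiv Om i f", OF h1D(3)[OF assms]])
 then show ?thesis by (rule weak_pderiv_unique[OF h1D(3)[OF assms]])
qed

lemma h1_weak_pderiv:
 assumes "h1 f df" shows "h1 f (%i. weak_pderiv Om i f)"
 by (rule h1_cong_AE[OF assms _ h1_weak_pderiv_AE[OF assms]]) simp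

lemma sobolev_1_h1:
 assumes "f \<in> sobolev Om (Suc 0)" shows "h1 f (%i. weak_pderiv Om i f)"
proof -
 have "f \<in> L2O" "\<forall>i. \<exists>g. g \<in> L2O & has_weak_pderiv Om i f g" using assms by auto
 then obtain df where "!!i. df i \<in> L2O & has_weak_pderiv Om i f (df i)" by metis
 then have "h1 f df" using \<open>f \<in> L2O\<close> by (simp add: h1_def)
 then show ?thesis by (rule h1_weak_pderiv)
qed

lemma sobolev_2_h1:
 assumes "f \<in> sobolev Om 2"
 shows "h1 f (%i. weak_pderiv Om i f)"
  "h1 (weak_pderiv Om i f) (%j. weak_pderiv Om j (weak_pderiv Om i f))"
proof -
 have s: "f \<in> L2O" "\<forall>i. \<exists>g. g \<in> sobolev Om (Suc 0) & has_weak_pderiv Om i f g"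
  using assms by (auto simp: numeral_2_eq_2)
 have "sobolev Om (Suc 0) \<subseteq> L2O" by auto
 then have "f \<in> sobolev Om (Suc 0)" using s by auto
 then show 1: "h1 f (%i. weak_pderiv Om i f)" by (rule sobolev_1_h1)
 obtain g where g: "g \<in> sobolev Om (Suc 0)" "has_weak_pderiv Om i f g" using s(2) by blast
 note h = sobolev_1_h1[OF g(1)]
 have "AEO x. g x = weak_pderiv Om i f x"
  by (rule weak_pderiv_unique[OF g(2) h1D(3)[OF 1]])
 then have "h1 (weak_pderiv Om i f) (%j. weak_pderiv Om j g)"
  by (rule h1_cong_AE[OF h]) simp
 then show "h1 (weak_pderiv Om i f) (%j. weak_pderiv Om j (weak_pderiv Om i f))"
  by (rule h1_weak_pderiv)
qed

text \<open>Both derivatives act on a test function alike, since the second derivatives of the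
  smooth \<open>ph\<close> commute.\<close>

lemma h1_second_symmetric:
 assumes f: "h1 f df" and ddf: "!!i. h1 (df i) (ddf i)"
 shows "AEO x. ddf i j x = ddf j i x"
proof (rule weak_pderiv_unique[OF h1D(3)[OF ddf]])
 show "has_weak_pderiv Om j (df i) (ddf j i)"
  unfolding has_weak_pderiv_def
 proof (intro conjI allI impI locally_integrable_L2 h1D(1)[OF ddf] h1D(2)[OF ddf])
  fix ph assume t: "test_function Om ph"
  note ti = test_function_C1c[OF test_function_pdiff[OF t]]
  have "Ck 2 ph" using t unfolding test_function_def by blast
  then have comm: "pdiff i (pdiff j ph) x = pdiff j (pdiff i ph) x" for x by (rule pdiff_commute)
  have "(LI x. df i x * pdiff j ph x) = - (LI x. f x * pdiff i (pdiff j ph) x)"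
   using h1_C1c[OF f ti[of j], of i] by simp
  also have "... = - (LI x. f x * pdiff j (pdiff i ph) x)" by (simp only: comm)
  also have "... = (LI x. df j x * pdiff i ph x)"
   using h1_C1c[OF f ti[of i], of j] by simp
  also have "... = - (LI x. ddf j i x * ph x)"
   by (rule h1_C1c[OF ddf test_function_C1c[OF t]])
  finally show "(LI x. df i x * pdiff j ph x) = - (LI x. ddf j i x * ph x)" .
 qed
qed

lemma L2_Omega_tendsto_mult:
 fixes F :: "nat => 'n fn"
 assumes "!!k. F k \<in> L2O" "f \<in> L2O" "g \<in> L2O"
  and "(%k. nrm (%x. F k x - f x)) ~~> 0"
 shows "(%k. LI x. g x * F k x) ~~> (LI x. g x * f x)"
 using L2_tendsto_inner[OF assms] by (simp add: L2_inner_def mult.commute)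

text \<open>Integration by parts for two merely weakly differentiable functions: the compact support
  of \<open>c\<close> removes the boundary term, and \<open>c * f\<close> is a limit of test
  functions. The strip estimates use it with \<open>c\<close> built from
  \<open>cut (m * rr)\<close>.\<close>

lemma h1_product:
 assumes f: "h1 f df" and g: "h1 g dg" and c: "C1c Om c dc"
 shows "(LI x. dg i x * (c x * f x)) = - (LI x. g x * (c x * df i x + dc i x * f x))"
proof -
 obtain ph where ph0: "(\<forall>k::nat. test_function Om (ph k)) &
  (%k. nrm (%x. ph k x - c x * f x)) ~~> 0 &
  (\<forall>i. (%k. nrm (%x. pdiff i (ph k) x - (c x * df i x + dc i x * f x))) ~~> 0)"
  using cutoff_approximation[OF f c] by (rule exE)
 note ph = ph0[THEN conjunct1, rule_format] ph0[THEN conjunct2, THEN conjunct1]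
  ph0[THEN conjunct2, THEN conjunct2, rule_format]
 note T = C1c_L2_Omega[OF test_function_C1c[OF ph(1)]]
 note h = h1_mult[OF f C1_on_subset[OF C1c_C1_on[OF c] subset_UNIV]]
 have 1: "(%k. LI x. dg i x * ph k x) ~~> (LI x. dg i x * (c x * f x))"
  by (rule L2_Omega_tendsto_mult[OF T(1) h1D(1)[OF h] h1D(2)[OF g] ph(2)])
 have 2: "(%k. LI x. g x * pdiff i (ph k) x) ~~> (LI x. g x * (c x * df i x + dc i x * f x))"
  by (rule L2_Omega_tendsto_mult[OF T(2) h1D(2)[OF h] h1D(1)[OF g] ph(3)])
 have eq: "(LI x. dg i x * ph k x) = - (LI x. g x * pdiff i (ph k) x)" for k
  using h1_C1c[OF g test_function_C1c[OF ph(1)[of k]], of i] by simp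
 show ?thesis
  by (rule LIMSEQ_unique[OF 1]) (unfold eq, rule tendsto_minus[OF 2])
qed

end

subsection \<open>Sobolev inequalities\<close>

text \<open>The index type is known only through its elements, so the iterated integral is stated
  with named axes. Their order is free, and the inequalities below use it in several orders.\<close>

lemma nn_integral_lborel_coordinates_2:
 fixes F :: "real^'n::finite => ennreal"
 assumes [measurable]: "F \<in> borel_measurable borel" and U: "(UNIV :: 'n set) = {i, j}" "i ~= j"
 shows "(NI x. F x) = (NI a. NI b. F (a *\<^sub>R axis i 1 + b *\<^sub>R axis j 1))"
proof -
 interpret product_sigma_finite "%_ :: real^'n. lborel :: real measure" ..
 have B: "(Basis :: (real^'n) set) = {axis i 1, axis j 1}"
  unfolding Basis_vec_def using U(1) by (auto simp: Basis_real_def)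
 have ne: "axis i (1::real) ~= axis j 1" using U(2) by (simp add: axis_eq_axis)
 let ?s = "%f. \<Sum>b\<in>Basis. f b *\<^sub>R b"
 have "(NI x. F x) = (\<integral>\<^sup>+f. F (?s f) \<partial>(\<Pi>\<^sub>M b\<in>(Basis :: (real^'n) set). lborel))"
 proof -
  have L: "(lborel :: (real^'n) measure) = distr (\<Pi>\<^sub>M b\<in>Basis. lborel) borel ?s" by (rule lborel_eq)
  have m: "?s \<in> measurable (\<Pi>\<^sub>M b\<in>Basis. lborel) (borel :: (real^'n) measure)" by measurable
  show ?thesis by (subst L) (rule nn_integral_distr[OF m], simp)
 qed
 also have "... = (\<integral>\<^sup>+f. (NI b. F (?s (f(axis j 1 := b)))) \<partial>(\<Pi>\<^sub>M b\<in>{axis i 1 :: real^'n}. lborel))"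
  unfolding B insert_commute[of "axis i 1"]
  by (rule product_nn_integral_insert) (use ne in "auto")
 also have "... = (\<integral>\<^sup>+f. (NI b. F (f (axis i 1) *\<^sub>R axis i 1 + b *\<^sub>R axis j 1)) \<partial>(\<Pi>\<^sub>M b\<in>{axis i 1 :: real^'n}. lborel))"
  unfolding B using ne by (intro nn_integral_cong) simp
 also have "... = (NI a. NI b. F (a *\<^sub>R axis i 1 + b *\<^sub>R axis j 1))"
  by (rule product_nn_integral_singleton) simp
 finally show ?thesis .
qed

lemma nn_integral_lborel_coordinates_3:
 fixes F :: "real^'n::finite => ennreal"
 assumes [measurable]: "F \<in> borel_measurable borel"
  and U: "(UNIV :: 'n set) = {i, j, k}" "i ~= j" "i ~= k" "j ~= k"
 shows "(NI x. F x) =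
  (NI a. NI b. NI c. F (a *\<^sub>R axis i 1 + b *\<^sub>R axis j 1 + c *\<^sub>R axis k 1))"
proof -
 interpret product_sigma_finite "%_ :: real^'n. lborel :: real measure" ..
 have B: "(Basis :: (real^'n) set) = {axis i 1, axis j 1, axis k 1}"
  unfolding Basis_vec_def using U(1) by (auto simp: Basis_real_def)
 have ne: "axis i (1::real) ~= axis j 1" "axis i (1::real) ~= axis k 1" "axis j (1::real) ~= axis k 1"
  using U(2-4) by (simp_all add: axis_eq_axis)
 let ?s = "%f. \<Sum>b\<in>(Basis :: (real^'n) set). f b *\<^sub>R b"
 have s: "?s f = f (axis i 1) *\<^sub>R axis i 1 + f (axis j 1) *\<^sub>R axis j 1 + f (axis k 1) *\<^sub>R axis k 1" for f
  unfolding B using ne by (simp add: add.assoc)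
 have "(NI x. F x) = (\<integral>\<^sup>+f. F (?s f) \<partial>(\<Pi>\<^sub>M b\<in>(Basis :: (real^'n) set). lborel))"
 proof -
  have L: "(lborel :: (real^'n) measure) = distr (\<Pi>\<^sub>M b\<in>Basis. lborel) borel ?s" by (rule lborel_eq)
  have m: "?s \<in> measurable (\<Pi>\<^sub>M b\<in>Basis. lborel) (borel :: (real^'n) measure)" by measurable
  show ?thesis by (subst L) (rule nn_integral_distr[OF m], simp)
 qed
 also have "... = (\<integral>\<^sup>+f. F (?s f) \<partial>(\<Pi>\<^sub>M b\<in>{axis k 1, axis j 1, axis i 1 :: real^'n}. lborel))"
  by (simp only: B insert_commute)
 also have "... = (\<integral>\<^sup>+f. (NI c. F (?s (f(axis k 1 := c)))) \<partial>(\<Pi>\<^sub>M b\<in>{axis j 1, axis i 1 :: real^'n}. lborel))"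
  by (rule product_nn_integral_insert) (use ne in "auto simp: s")
 also have "... = (\<integral>\<^sup>+f. (NI b. (NI c. F (?s (f(axis j 1 := b, axis k 1 := c))))) \<partial>(\<Pi>\<^sub>M b\<in>{axis i 1 :: real^'n}. lborel))"
  by (rule product_nn_integral_insert) (use ne in "auto simp: s")
 also have "... = (\<integral>\<^sup>+f. (NI b. (NI c. F (f (axis i 1) *\<^sub>R axis i 1 + b *\<^sub>R axis j 1 + c *\<^sub>R axis k 1))) \<partial>(\<Pi>\<^sub>M b\<in>{axis i 1 :: real^'n}. lborel))"
  unfolding s using ne by (intro nn_integral_cong) simp
 also have "... = (NI a. NI b. NI c. F (a *\<^sub>R axis i 1 + b *\<^sub>R axis j 1 + c *\<^sub>R axis k 1))"
  by (rule product_nn_integral_singleton) measurable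
 finally show ?thesis .
qed

text \<open>The Cauchy-Schwarz inequality, once in \<open>c\<close> for fixed \<open>a\<close> and
  \<open>b\<close>, and once in the pair \<open>(a, b)\<close>; the double integral of
  \<open>A b * B a\<close> then factorizes.\<close>

lemma Loomis_Whitney_3:
 fixes h1 h2 h3 :: "real => real => ennreal"
 assumes [measurable]: "case_prod h1 \<in> borel_measurable (lborel \<Otimes>\<^sub>M lborel)"
  "case_prod h2 \<in> borel_measurable (lborel \<Otimes>\<^sub>M lborel)"
  "case_prod h3 \<in> borel_measurable (lborel \<Otimes>\<^sub>M lborel)"
 shows "(NI a. NI b. NI c. h1 b c * h2 a c * h3 a b)^2
  <= (NI b. NI c. (h1 b c)^2) * (NI a. NI c. (h2 a c)^2)
   * (NI a. NI b. (h3 a b)^2)"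
proof -
 define I where "I a b = (NI c. h1 b c * h2 a c)" for a b
 define A where "A b = (NI c. (h1 b c)^2)" for b
 define B where "B a = (NI c. (h2 a c)^2)" for a
 have [measurable]: "case_prod I \<in> borel_measurable (lborel \<Otimes>\<^sub>M lborel)"
  "A \<in> borel_measurable lborel" "B \<in> borel_measurable lborel"
  unfolding I_def A_def B_def by measurable
 have I2: "(I a b)^2 <= A b * B a" for a b
  unfolding I_def A_def B_def by (rule Cauchy_Schwarz_nn_integral) measurable
 have "(NI a. NI b. NI c. h1 b c * h2 a c * h3 a b)
   = (NI a. NI b. h3 a b * I a b)"
  unfolding I_def by (subst nn_integral_cmult[symmetric]) (simp_all add: mult.commute)
 also have "... = (\<integral>\<^sup>+p. (case_prod h3 p * case_prod I p) \<partial>(lborel \<Otimes>\<^sub>M lborel))"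
  by (subst lborel.nn_integral_fst[symmetric]) simp_all
 finally have "(NI a. NI b. NI c. h1 b c * h2 a c * h3 a b)^2
   <= (\<integral>\<^sup>+p. (case_prod h3 p)^2 \<partial>(lborel \<Otimes>\<^sub>M lborel)) * (\<integral>\<^sup>+p. (case_prod I p)^2 \<partial>(lborel \<Otimes>\<^sub>M lborel))"
  by (simp only:) (rule Cauchy_Schwarz_nn_integral, measurable)
 also have "... = (NI a. NI b. (h3 a b)^2) * (NI a. NI b. (I a b)^2)"
  by (subst (1 2) lborel.nn_integral_fst[symmetric]) simp_all
 also have "... <= (NI a. NI b. (h3 a b)^2) * (NI a. NI b. A b * B a)"
  by (intro mult_left_mono nn_integral_mono I2) simp
 also have "(NI a. NI b. A b * B a) = (NI b. A b) * (NI a. B a)"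
  by (simp add: nn_integral_multc nn_integral_cmult)
 finally show ?thesis unfolding A_def B_def by (simp add: mult_ac)
qed

lemma line_integral_bound:
 assumes ps: "C1c UNIV ps dps"
 shows "integrable lborel (%s. \<bar>dps i (x + s *\<^sub>R axis i 1)\<bar>)"
  "\<bar>ps (x + t *\<^sub>R axis i 1)\<bar> <= (LB s. \<bar>dps i (x + s *\<^sub>R axis i 1)\<bar>)"
proof -
 obtain K where K: "compact K" "!!x. x \<notin> K ==> ps x = 0" "!!i x. x \<notin> K ==> dps i x = 0"
  using C1cD[OF ps] by metis
 obtain R where R: "R > 0" "K \<subseteq> cball 0 R"
  using compact_imp_bounded[OF K(1)] by (auto simp: bounded_pos subset_iff)
 let ?l = "%s. x + s *\<^sub>R axis i 1" and ?M = "R + norm x + 1"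
 have out: "?l s \<notin> K" if "s \<notin> cball 0 (R + norm x)" for s
 proof -
  have "norm (s *\<^sub>R axis i (1::real)) <= norm (?l s) + norm x"
   using norm_triangle_ineq4[of "?l s" x] by simp
  then have "norm (?l s) > R" using that by simp
  then show ?thesis using R(2) by auto
 qed
 have lc: "continuous_on UNIV ?l" by (intro continuous_intros)
 have dc: "continuous_on UNIV (%s. dps i (?l s))"
  by (rule continuous_on_compose2[OF C1_onD(2)[OF C1c_C1_on[OF ps]] lc]) simp
 show int: "integrable lborel (%s. \<bar>dps i (?l s)\<bar>)"
  by (rule continuous_compact_support_integrable(1)[OF continuous_on_rabs[OF dc] compact_cball[of 0 "R + norm x"]])
   (use K(3) out in simp)
 \<comment> \<open>A parameter at most \<open>t\<close> whose point lies outside the support, so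
   that the fundamental theorem of calculus has no contribution from the lower end.\<close>
 define L where "L = - (max (R + norm x + 1) (1 - t))"
 have L: "L <= t" "L \<notin> cball 0 (R + norm x)" using R(1) by (auto simp: L_def dist_real_def)
 have "(LB s. indicator {L..t} s *\<^sub>R dps i (?l s)) = ps (?l t) - ps (?l L)"
 proof (rule integral_FTC_atLeastAtMost[OF L(1)])
  fix s
  have "ps differentiable (at (?l s))" using C1_onD(1)[OF C1c_C1_on[OF ps]] unfolding differentiable_def by blast
  from pdiff_comp_line[OF this] have "((%s. ps (?l s)) has_real_derivative dps i (?l s)) (at s)"
   using C1_on_pdiff[OF C1c_C1_on[OF ps]] by simp
  then show "((%s. ps (?l s)) has_vector_derivative dps i (?l s)) (at s within {L..t})"
   using has_field_derivative_at_within has_real_derivative_iff_has_vector_derivative by blast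
 qed (rule continuous_on_subset[OF dc], simp)
 then have "ps (?l t) = (LB s. indicator {L..t} s *\<^sub>R dps i (?l s))" using K(2)[OF out[OF L(2)]] by simp
 also have "\<bar>...\<bar> <= (LB s. \<bar>indicator {L..t} s *\<^sub>R dps i (?l s)\<bar>)" by (rule integral_abs_bound)
 also have "... <= (LB s. \<bar>dps i (?l s)\<bar>)"
 proof (rule integral_mono[OF _ int])
  have "integrable lborel (%s. dps i (?l s))"
   by (rule continuous_compact_support_integrable(1)[OF dc compact_cball[of 0 "R + norm x"]]) (use K(3) out in simp)
  then have "integrable lborel (%s. indicator {L..t} s *\<^sub>R dps i (?l s))"
   by (rule integrable_mult_indicator[rotated]) simp
  then show "integrable lborel (%s. \<bar>indicator {L..t} s *\<^sub>R dps i (?l s)\<bar>)" by (rule integrable_abs)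
 qed (simp add: indicator_def)
 finally show "\<bar>ps (?l t)\<bar> <= (LB s. \<bar>dps i (?l s)\<bar>)" by simp
qed

lemma C1c_power:
 assumes "C1c Om ph dph"
 shows "C1c Om (%x. ph x ^ Suc m) (%i x. real (Suc m) * ph x ^ m * dph i x)"
proof (induction m)
 case 0
 then show ?case using assms by simp
next
 case (Suc m)
 have "C1c Om (%x. ph x * ph x ^ Suc m) (%i x. ph x * (real (Suc m) * ph x ^ m * dph i x) + dph i x * ph x ^ Suc m)"
  by (rule C1c_mult[OF assms C1c_C1_on[OF Suc]])
 moreover have "ph x * (real (Suc m) * ph x ^ m * dph i x) + dph i x * ph x ^ Suc m
   = real (Suc (Suc m)) * ph x ^ Suc m * dph i x" for i x
  by (simp add: algebra_simps)
 ultimately show ?case by simp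
qed

text \<open>Each of three line integrals bounds \<open>ph ^ 4\<close>; the product of their square
  roots bounds \<open>ph ^ 6\<close>, and \<open>Loomis_Whitney_3\<close> applies. The fourth power
  is chosen because its derivative contains \<open>ph ^ 3\<close>, whose squared L2 norm is again
  the left side.\<close>

lemma Gagliardo_Nirenberg_3:
 fixes ph :: "'n::finite fn"
 assumes ph: "C1c UNIV ph dph" and U: "(UNIV :: 'n set) = {i, j, k}" "i ~= j" "i ~= k" "j ~= k"
 shows "(NI x. ennreal (ph x ^ 6))^2 \<le>
  (NI x. ennreal \<bar>4 * ph x ^ 3 * dph i x\<bar>) * (NI x. ennreal \<bar>4 * ph x ^ 3 * dph j x\<bar>)
  * (NI x. ennreal \<bar>4 * ph x ^ 3 * dph k x\<bar>)"
proof -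
 define dps where "dps i x = 4 * ph x ^ 3 * dph i x" for i x
 have ps: "C1c UNIV (%x. ph x ^ 4) dps"
  using C1c_power[OF ph, of 3] by (simp add: dps_def[abs_def])
 let ?p = "%a b c. a *\<^sub>R axis i 1 + b *\<^sub>R axis j 1 + c *\<^sub>R axis k (1::real)"
 have dm[measurable]: "dps l \<in> borel_measurable borel" for l
  using C1_onD(2)[OF C1c_C1_on[OF ps]] by (rule borel_measurable_continuous_onI)
 have pm[measurable]: "ph \<in> borel_measurable borel"
  using C1_on_continuous[OF C1c_C1_on[OF ph]] by (rule borel_measurable_continuous_onI)
 define f1 where "f1 b c = (LB a. \<bar>dps i (?p a b c)\<bar>)" for b c
 define f2 where "f2 a c = (LB b. \<bar>dps j (?p a b c)\<bar>)" for a c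
 define f3 where "f3 a b = (LB c. \<bar>dps k (?p a b c)\<bar>)" for a b
 have fm[measurable]: "case_prod f1 \<in> borel_measurable (lborel \<Otimes>\<^sub>M lborel)"
  "case_prod f2 \<in> borel_measurable (lborel \<Otimes>\<^sub>M lborel)"
  "case_prod f3 \<in> borel_measurable (lborel \<Otimes>\<^sub>M lborel)"
  unfolding f1_def f2_def f3_def by measurable
 have nn: "f1 b c >= 0" "f2 a c >= 0" "f3 a b >= 0" for a b c
  unfolding f1_def f2_def f3_def by (rule B_nonneg, simp)+
 note l1 = line_integral_bound[OF ps, where i = i and x = "b *\<^sub>R axis j 1 + c *\<^sub>R axis k 1" for b c]
 note l2 = line_integral_bound[OF ps, where i = j and x = "a *\<^sub>R axis i 1 + c *\<^sub>R axis k 1" for a c]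
 note l3 = line_integral_bound[OF ps, where i = k and x = "a *\<^sub>R axis i 1 + b *\<^sub>R axis j 1" for a b]
 have b1: "ph (?p a b c) ^ 4 <= f1 b c" and b2: "ph (?p a b c) ^ 4 <= f2 a c" and b3: "ph (?p a b c) ^ 4 <= f3 a b" for a b c
  using l1(2)[of b c a] l2(2)[of a c b] l3(2)[of a b c] by (simp_all add: f1_def f2_def f3_def add_ac)
 have e1: "ennreal (f1 b c) = (NI a. ennreal \<bar>dps i (?p a b c)\<bar>)" for b c
  unfolding f1_def by (rule nn_integral_eq_integral[symmetric]) (use l1(1)[of b c] in "simp_all add: add_ac")
 have e2: "ennreal (f2 a c) = (NI b. ennreal \<bar>dps j (?p a b c)\<bar>)" for a c
  unfolding f2_def by (rule nn_integral_eq_integral[symmetric]) (use l2(1)[of a c] in "simp_all add: add_ac")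
 have e3: "ennreal (f3 a b) = (NI c. ennreal \<bar>dps k (?p a b c)\<bar>)" for a b
  unfolding f3_def by (rule nn_integral_eq_integral[symmetric]) (use l3(1)[of a b] in "simp_all add: add_ac")
 have pw: "ph (?p a b c) ^ 6 <= sqrt (f1 b c) * sqrt (f2 a c) * sqrt (f3 a b)" for a b c
 proof -
  let ?q = "ph (?p a b c)"
  have r: "?q^2 <= sqrt y" if "?q ^ 4 <= y" for y
  proof (rule real_le_rsqrt)
   show "(?q^2)^2 <= y" using that by (simp flip: power_mult)
  qed
  have "?q ^ 6 = ?q^2 * ?q^2 * ?q^2" by (simp flip: power_add)
  also have "... <= sqrt (f1 b c) * sqrt (f2 a c) * sqrt (f3 a b)"
   by (intro mult_mono r b1 b2 b3 mult_nonneg_nonneg) (simp_all add: nn)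
  finally show ?thesis .
 qed
 let ?h1 = "%b c. ennreal (sqrt (f1 b c))" and ?h2 = "%a c. ennreal (sqrt (f2 a c))" and ?h3 = "%a b. ennreal (sqrt (f3 a b))"
 have sq: "(ennreal (sqrt y))^2 = ennreal y" if "y >= 0" for y
  using that by (simp add: ennreal_power)
 have "(NI x. ennreal (ph x ^ 6)) = (NI a. NI b. NI c. ennreal (ph (?p a b c) ^ 6))"
  by (rule nn_integral_lborel_coordinates_3[OF _ U]) measurable
 also have "... <= (NI a. NI b. NI c. ?h1 b c * ?h2 a c * ?h3 a b)"
 proof (intro nn_integral_mono)
  fix a b c
  have "ennreal (ph (?p a b c) ^ 6) <= ennreal (sqrt (f1 b c) * sqrt (f2 a c) * sqrt (f3 a b))"
   by (rule ennreal_leI[OF pw])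
  then show "ennreal (ph (?p a b c) ^ 6) <= ?h1 b c * ?h2 a c * ?h3 a b"
   by (simp add: ennreal_mult nn)
 qed
 finally have "(NI x. ennreal (ph x ^ 6))^2 \<le>
   (NI a. NI b. NI c. ?h1 b c * ?h2 a c * ?h3 a b)^2"
  by (rule power_mono) simp
 also have "... <= (NI b. NI c. (?h1 b c)^2) * (NI a. NI c. (?h2 a c)^2)
   * (NI a. NI b. (?h3 a b)^2)"
  by (rule Loomis_Whitney_3) measurable
 also have "(NI b. NI c. (?h1 b c)^2) = (NI x. ennreal \<bar>dps i x\<bar>)"
  by (subst nn_integral_lborel_coordinates_3[of _ j k i]) (use U in "auto simp: sq nn e1 add_ac")
 also have "(NI a. NI c. (?h2 a c)^2) = (NI x. ennreal \<bar>dps j x\<bar>)"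
  by (subst nn_integral_lborel_coordinates_3[of _ i k j]) (use U in "auto simp: sq nn e2 add_ac")
 also have "(NI a. NI b. (?h3 a b)^2) = (NI x. ennreal \<bar>dps k x\<bar>)"
  by (subst nn_integral_lborel_coordinates_3[of _ i j k]) (use U in "auto simp: sq nn e3 add_ac")
 finally show ?thesis by (simp add: dps_def)
qed

text \<open>In the plane two line integrals of the derivatives of \<open>ph ^ 3\<close> suffice;
  each depends on one variable only, so the integral of their product factorizes.\<close>

lemma Gagliardo_Nirenberg_2:
 fixes ph :: "'n::finite fn"
 assumes ph: "C1c UNIV ph dph" and U: "(UNIV :: 'n set) = {i, j}" "i ~= j"
 shows "(NI x. ennreal (ph x ^ 6)) \<le>
  (NI x. ennreal \<bar>3 * ph x ^ 2 * dph i x\<bar>) * (NI x. ennreal \<bar>3 * ph x ^ 2 * dph j x\<bar>)"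
proof -
 define dps where "dps i x = 3 * ph x ^ 2 * dph i x" for i x
 have ps: "C1c UNIV (%x. ph x ^ 3) dps"
  using C1c_power[OF ph, of 2] by (simp add: dps_def[abs_def])
 let ?p = "%a b. a *\<^sub>R axis i 1 + b *\<^sub>R axis j (1::real)"
 have dm[measurable]: "dps l \<in> borel_measurable borel" for l
  using C1_onD(2)[OF C1c_C1_on[OF ps]] by (rule borel_measurable_continuous_onI)
 have pm[measurable]: "ph \<in> borel_measurable borel"
  using C1_on_continuous[OF C1c_C1_on[OF ph]] by (rule borel_measurable_continuous_onI)
 define f1 where "f1 b = (LB a. \<bar>dps i (?p a b)\<bar>)" for b
 define f2 where "f2 a = (LB b. \<bar>dps j (?p a b)\<bar>)" for a
 have fm[measurable]: "f1 \<in> borel_measurable lborel" "f2 \<in> borel_measurable lborel"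
  unfolding f1_def f2_def by measurable
 have nn: "f1 b >= 0" "f2 a >= 0" for a b
  unfolding f1_def f2_def by (rule B_nonneg, simp)+
 note l1 = line_integral_bound[OF ps, where i = i and x = "b *\<^sub>R axis j 1" for b]
 note l2 = line_integral_bound[OF ps, where i = j and x = "a *\<^sub>R axis i 1" for a]
 have b1: "\<bar>ph (?p a b) ^ 3\<bar> <= f1 b" and b2: "\<bar>ph (?p a b) ^ 3\<bar> <= f2 a" for a b
  using l1(2)[of b a] l2(2)[of a b] by (simp_all add: f1_def f2_def add_ac)
 have e1: "ennreal (f1 b) = (NI a. ennreal \<bar>dps i (?p a b)\<bar>)" for b
  unfolding f1_def by (rule nn_integral_eq_integral[symmetric]) (use l1(1)[of b] in "simp_all add: add_ac")
 have e2: "ennreal (f2 a) = (NI b. ennreal \<bar>dps j (?p a b)\<bar>)" for a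
  unfolding f2_def by (rule nn_integral_eq_integral[symmetric]) (use l2(1)[of a] in "simp_all add: add_ac")
 have "(NI x. ennreal (ph x ^ 6)) = (NI a. NI b. ennreal (ph (?p a b) ^ 6))"
  by (rule nn_integral_lborel_coordinates_2[OF _ U]) measurable
 also have "... <= (NI a. NI b. ennreal (f1 b) * ennreal (f2 a))"
 proof (intro nn_integral_mono)
  fix a b
  have "ph (?p a b) ^ 6 = \<bar>ph (?p a b) ^ 3\<bar> * \<bar>ph (?p a b) ^ 3\<bar>" by (simp flip: power_add)
  also have "... <= f1 b * f2 a" by (intro mult_mono b1 b2 nn) simp
  finally have "ennreal (ph (?p a b) ^ 6) <= ennreal (f1 b * f2 a)" by (rule ennreal_leI)
  then show "ennreal (ph (?p a b) ^ 6) <= ennreal (f1 b) * ennreal (f2 a)" by (simp add: ennreal_mult nn)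
 qed
 also have "... = (NI b. ennreal (f1 b)) * (NI a. ennreal (f2 a))"
  by (simp add: nn_integral_multc nn_integral_cmult)
 also have "(NI b. ennreal (f1 b)) = (NI x. ennreal \<bar>dps i x\<bar>)"
  by (subst nn_integral_lborel_coordinates_2[of _ j i]) (use U in "auto simp: e1 add_ac")
 also have "(NI a. ennreal (f2 a)) = (NI x. ennreal \<bar>dps j x\<bar>)"
  by (subst nn_integral_lborel_coordinates_2[of _ i j]) (use U in "auto simp: e2 add_ac")
 finally show ?thesis by (simp add: dps_def)
qed

lemma Fatou_integrable:
 fixes F :: "nat => 'a => real"
 assumes F: "!!k. integrable M (F k)" "!!k x. 0 <= F k x" and lim: "AE x in M. (%k. F k x) ~~> f x"
  and f: "f \<in> borel_measurable M" and C: "!!k. (LINT x|M. F k x) <= C k" "C ~~> c"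
 shows "integrable M f" "(LINT x|M. f x) <= c"
proof -
 have f0: "AE x in M. 0 <= f x"
  using lim by eventually_elim (rule LIMSEQ_le_const, auto simp: F(2))
 have "C k >= 0" for k using C(1)[of k] B_nonneg[of M "F k"] F(2) by (meson order_trans)
 then have c0: "c >= 0" using C(2) by (intro LIMSEQ_le_const[OF C(2)]) auto
 have "(\<integral>\<^sup>+x. ennreal (f x) \<partial>M) = (\<integral>\<^sup>+x. liminf (%k. ennreal (F k x)) \<partial>M)"
 proof (rule nn_integral_cong_AE)
  show "AE x in M. ennreal (f x) = liminf (%k. ennreal (F k x))"
   using lim
  proof eventually_elim
   case (elim x)
   have "(%k. ennreal (F k x)) ~~> ennreal (f x)" by (intro tendsto_ennrealI elim)
   then show ?case by (simp add: lim_imp_Liminf)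
  qed
 qed
 also have "... <= liminf (%k. \<integral>\<^sup>+x. ennreal (F k x) \<partial>M)"
  by (rule nn_integral_liminf) (use F(1) in auto)
 also have "... <= liminf (%k. ennreal (C k))"
 proof (rule Liminf_mono, rule always_eventually, rule allI)
  fix k
  have "(\<integral>\<^sup>+x. ennreal (F k x) \<partial>M) = ennreal (LINT x|M. F k x)"
   by (rule nn_integral_eq_integral) (use F in auto)
  then show "(\<integral>\<^sup>+x. ennreal (F k x) \<partial>M) <= ennreal (C k)" using C(1) by (simp add: ennreal_leI)
 qed
 also have "... = ennreal c"
  by (rule lim_imp_Liminf) (auto intro: tendsto_ennrealI C(2))
 finally have le: "(\<integral>\<^sup>+x. ennreal (f x) \<partial>M) <= ennreal c" .
 show i: "integrable M f"
  by (rule integrableI_nonneg[OF f f0]) (rule le_less_trans[OF le], simp)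
 have "ennreal (LINT x|M. f x) <= ennreal c"
  using le nn_integral_eq_integral[OF i f0] by simp
 then show "(LINT x|M. f x) <= c" using c0 by simp
qed

lemma L2_norm_cmult: "L2_norm S (%x. c * f x) = \<bar>c\<bar> * L2_norm S f" for f :: "'a::euclidean_space => real"
 using L2_norm_scaleR[of S c f] by simp

lemma zero_outside_L2_norm:
 fixes f :: "'a::euclidean_space => real"
 assumes "S \<in> sets lebesgue" "!!x. x \<notin> S ==> f x = 0"
 shows "L2_norm UNIV f = L2_norm S f"
proof -
 have "zext S f = f" using assms(2) by (auto simp: zext_def fun_eq_iff)
 then show ?thesis using zext_L2(2)[OF assms(1), of f] by simp
qed

lemma C1_on_coord: "C1_on S (%x. x $ i) (%j x. if j = i then 1 else 0)"
proof -
 have "((%x. x $ i) has_derivative (%h. SU j. (if j = i then 1 else 0) * h $ j)) (at x)" for x :: "real ^ 'a"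
 proof -
  have "((%x. x $ i) has_derivative (%h. h $ i)) (at x)"
   by (intro bounded_linear_imp_has_derivative bounded_linear_vec_nth)
  then show ?thesis by (simp add: if_distrib[of "%y. y * _"] cong: if_cong)
 qed
 then show ?thesis by (simp add: C1_on_def)
qed

section \<open>Poincare and Sobolev inequalities for functions vanishing on the boundary\<close>

context bounded_open
begin

definition gnorm :: "('n => 'n fn) => real" where
 "gnorm df = sqrt (SU i. (nrm (df i))^2)"

lemma gnorm_nonneg: "gnorm df >= 0" by (simp add: gnorm_def sum_nonneg)

lemma L2_norm_le_gnorm: "nrm (df i) <= gnorm df"
 unfolding gnorm_def
 by (rule real_le_rsqrt) (rule member_le_sum[of i UNIV "%i. (nrm (df i))^2"], simp_all)

lemma C1c_norm_UNIV:
 assumes "C1c Om ph dph"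
 shows "L2_norm UNIV ph = nrm ph" "L2_norm UNIV (dph i) = nrm (dph i)"
proof -
 obtain K where K: "K \<subseteq> Om" "!!x. x \<notin> K ==> ph x = 0" "!!i x. x \<notin> K ==> dph i x = 0"
  using C1cD[OF assms] by metis
 show "L2_norm UNIV ph = nrm ph" "L2_norm UNIV (dph i) = nrm (dph i)"
  by (rule zero_outside_L2_norm[OF sets_Omega], use K in blast)+
qed

text \<open>A radius of a ball about the origin that contains \<open>Om\<close>, fixed by choice so
  that constants expressed by it depend on \<open>Om\<close> only.\<close>

definition diam :: real where "diam = (SOME R. R > 0 & Om \<subseteq> cball 0 R)"

lemma diam: "diam > 0" "Om \<subseteq> cball 0 diam"
 using someI_ex[OF Omega_radius] by (simp_all add: diam_def)

text \<open>The integral of the \<open>i\<close>-th derivative of \<open>ph x ^ 2 * x $ i\<close>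
  vanishes, and on the support the coordinate is bounded by \<open>diam\<close>.\<close>

lemma Poincare_C1c:
 assumes ph: "C1c Om ph dph"
 shows "nrm ph <= 2 * diam * nrm (dph i)"
proof -
 obtain K where K: "compact K" "K \<subseteq> Om" "!!x. x \<notin> K ==> ph x = 0" "!!i x. x \<notin> K ==> dph i x = 0"
  using C1cD[OF ph] by metis
 have F: "C1c UNIV (%x. ph x ^ 2 * x $ i) (%j x. ph x ^ 2 * (if j = i then 1 else 0) + (2 * ph x * dph j x) * x $ i)"
  using C1c_mult[OF C1c_power[OF C1c_mono[OF ph subset_UNIV], of 1] C1_on_coord, of i]
  by (simp add: numeral_2_eq_2)
 have xL: "(%x. x $ i * ph x) \<in> L2 UNIV"
 proof (rule continuous_compact_support_L2[OF _ K(1)])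
  show "continuous_on UNIV (%x. x $ i * ph x)"
   by (intro continuous_on_mult C1_on_continuous[OF C1c_C1_on[OF ph]] C1_on_continuous[OF C1_on_coord])
 qed (simp add: K)
 note L = C1c_L2[OF ph]
 have i1: "integrable lebesgue (%x. ph x ^ 2)" using L2_integrable_power2[OF L(1)] by (simp add: lebesgue_on_UNIV_eq)
 have i2: "integrable lebesgue (%x. (x $ i * ph x) * dph i x)"
  using L2_integrable_mult[OF xL L(2)[of i]] by (simp add: lebesgue_on_UNIV_eq)
 have "0 = (LE x. ph x ^ 2 + 2 * ((x $ i * ph x) * dph i x))"
  using integral_partial_derivative_zero[OF F, of i] by (simp add: mult_ac)
 also have "... = (LE x. ph x ^ 2) + 2 * (LE x. (x $ i * ph x) * dph i x)"
  using i1 i2 by simp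
 also have "... = (L2_norm UNIV ph)^2 + 2 * L2_inner UNIV (%x. x $ i * ph x) (dph i)"
  by (simp add: L2_norm_power2 L2_inner_def lebesgue_on_UNIV_eq)
 finally have "(L2_norm UNIV ph)^2 <= 2 * (L2_norm UNIV (%x. x $ i * ph x) * L2_norm UNIV (dph i))"
  using L2_Cauchy_Schwarz[OF xL L(2)[of i]] by linarith
 also have "... <= 2 * ((diam * L2_norm UNIV ph) * L2_norm UNIV (dph i))"
 proof -
  have "L2_norm UNIV (%x. x $ i * ph x) <= L2_norm UNIV (%x. diam *\<^sub>R ph x)"
  proof (rule L2_norm_mono[OF L2_scaleR[OF L(1)] L2D(1)[OF xL]], rule AE_I2)
   fix x
   show "norm (x $ i * ph x) <= norm (diam *\<^sub>R ph x)"
   proof (cases "x \<in> K")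
    case True
    then have "norm x <= diam" using K(2) diam(2) by auto
    then have "\<bar>x $ i\<bar> <= diam" using component_le_norm_cart[of x i] by linarith
    then show ?thesis using diam(1) by (simp add: abs_mult mult_right_mono)
   qed (simp add: K)
  qed
  then show ?thesis using diam(1) by (intro mult_left_mono mult_right_mono) (simp_all add: L2_norm_cmult)
 qed
 finally have "nrm ph * nrm ph <= nrm ph * (2 * diam * nrm (dph i))"
  unfolding C1c_norm_UNIV[OF ph] by (simp add: power2_eq_square mult_ac)
 then show ?thesis
  using diam(1) by (cases "nrm ph = 0") (auto simp: less_le)
qed

end

locale sobolev_domain = bounded_open Om for Om :: "(real^'n::finite) set" +
 assumes card_23: "CARD('n) = 2 \<or> CARD('n) = 3"
begin

text \<open>In three dimensions the fourth power of the unknown norm \<open>N\<close> is bounded by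
  64 times its third power and three derivative norms, and dividing leaves 64. In two dimensions the
  norm of \<open>ph ^ 2\<close> is interpolated between those of \<open>ph ^ 3\<close> and
  \<open>ph\<close>, and Poincare's inequality leads to 18 \<open>diam\<close>. The constant adds
  both.\<close>

lemma Sobolev_C1c:
 assumes ph: "C1c Om ph dph"
 shows "nrm (%x. ph x ^ 3) <= (64 + 18 * diam) * gnorm dph ^ 3"
proof -
 obtain K where K: "compact K" "K \<subseteq> Om" "!!x. x \<notin> K ==> ph x = 0" "!!i x. x \<notin> K ==> dph i x = 0"
  using C1cD[OF ph] by metis
 note phU = C1c_mono[OF ph subset_UNIV]
 note c = C1_on_continuous[OF C1c_C1_on[OF ph]] C1_onD(2)[OF C1c_C1_on[OF ph]]
 have cs: "f \<in> L2 UNIV" "integrable lborel f" if "continuous_on UNIV f" "!!x. ph x = 0 ==> f x = 0" for f :: "'n fn"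
  using continuous_compact_support_L2[OF that(1) K(1)] continuous_compact_support_integrable(1)[OF that(1) K(1)]
   that(2) K(3) by blast+
 have p3: "(%x. ph x ^ 3) \<in> L2 UNIV" and p2: "(%x. ph x ^ 2) \<in> L2 UNIV"
  by (rule cs, intro continuous_intros c, simp)+
 define N where "N = L2_norm UNIV (%x. ph x ^ 3)"
 define I where "I = (LB x. ph x ^ 6)"
 have N0: "N >= 0" by (simp add: N_def)
 have bm: "ph \<in> borel_measurable borel" "dph i \<in> borel_measurable borel" for i
  using c by (auto intro: borel_measurable_continuous_onI)
 have NI: "N^2 = I"
 proof -
  have m: "(%x. (ph x ^ 3)^2) \<in> borel_measurable lborel" using bm by measurable
  have "N^2 = (LE x. (ph x ^ 3)^2)" by (simp add: N_def L2_norm_power2 lebesgue_on_UNIV_eq)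
  also have "... = (LB x. (ph x ^ 3)^2)" by (rule integral_completion[OF m])
  finally show ?thesis by (simp add: I_def flip: power_mult)
 qed
 have I6: "(NI x. ennreal (ph x ^ 6)) = ennreal (N^2)"
  unfolding NI I_def by (rule nn_integral_eq_integral, rule cs(2)) (auto intro!: continuous_intros c)
 have hold: "(NI x. ennreal \<bar>a * ph x ^ m * dph i x\<bar>) <= ennreal (a * (L2_norm UNIV (%x. ph x ^ m) * nrm (dph i)))"
  if a: "a >= 0" and m: "m > 0" for a i m
 proof -
  have pm: "(%x. \<bar>ph x ^ m\<bar>) \<in> L2 UNIV" by (rule cs) (use m in "auto intro!: continuous_intros c")
  have dm: "(%x. \<bar>dph i x\<bar>) \<in> L2 UNIV"
   by (rule continuous_compact_support_L2[OF _ K(1)]) (auto intro!: continuous_intros c simp: K)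
  have int: "integrable lborel (%x. \<bar>a * ph x ^ m * dph i x\<bar>)"
   by (rule cs(2)) (use m in "auto intro!: continuous_intros c")
  have "(LB x. \<bar>a * ph x ^ m * dph i x\<bar>) = (LE x. \<bar>a * ph x ^ m * dph i x\<bar>)"
   by (rule integral_completion[symmetric]) (use borel_measurable_integrable[OF int] in simp)
  also have "... = a * L2_inner UNIV (%x. \<bar>ph x ^ m\<bar>) (%x. \<bar>dph i x\<bar>)"
   unfolding L2_inner_def lebesgue_on_UNIV_eq using a
   by (subst integral_mult_right_zero[symmetric]) (simp add: abs_mult mult_ac)
  also have "... <= a * (L2_norm UNIV (%x. \<bar>ph x ^ m\<bar>) * L2_norm UNIV (%x. \<bar>dph i x\<bar>))"
   by (intro mult_left_mono[OF L2_inner_le[OF pm dm] a])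
  also have "... = a * (L2_norm UNIV (%x. ph x ^ m) * nrm (dph i))"
   unfolding C1c_norm_UNIV(2)[OF ph, symmetric] by (simp add: L2_norm_def L2_inner_def)
  finally have "(LB x. \<bar>a * ph x ^ m * dph i x\<bar>) <= a * (L2_norm UNIV (%x. ph x ^ m) * nrm (dph i))" .
  moreover have "(NI x. ennreal \<bar>a * ph x ^ m * dph i x\<bar>) = ennreal (LB x. \<bar>a * ph x ^ m * dph i x\<bar>)"
   by (rule nn_integral_eq_integral[OF int]) simp
  ultimately show ?thesis by (simp add: ennreal_leI)
 qed
 let ?d = "%i. nrm (dph i)" and ?G = "gnorm dph"
 have d: "0 <= ?d i" "?d i <= ?G" for i using L2_norm_le_gnorm by simp_all
 have G0: "?G >= 0" by (rule gnorm_nonneg)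
 have "N <= (64 + 18 * diam) * ?G ^ 3"
  using card_23
 proof
  assume "CARD('n) = 2"
  then obtain i j :: 'n where U: "UNIV = {i, j}" "i ~= j" unfolding card_2_iff by blast
  let ?P = "L2_norm UNIV (%x. ph x ^ 2)"
  have "ennreal (N^2) <= ennreal (3 * (?P * ?d i)) * ennreal (3 * (?P * ?d j))"
   unfolding I6[symmetric]
   by (rule order_trans[OF Gagliardo_Nirenberg_2[OF phU U]]) (intro mult_mono hold, auto)
  then have "ennreal (N^2) <= ennreal (3 * (?P * ?d i) * (3 * (?P * ?d j)))"
   by (subst ennreal_mult) (simp_all add: d)
  then have "N^2 <= 9 * (?P^2 * (?d i * ?d j))"
   by (subst (asm) ennreal_le_iff) (simp_all add: d power2_eq_square mult_ac)
  also have "... <= 9 * ((N * (2 * diam * ?G)) * (?G * ?G))"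
  proof -
   have "?P^2 = L2_inner UNIV (%x. ph x ^ 3) ph"
    by (subst L2_norm_power2) (simp add: L2_inner_def power2_eq_square power3_eq_cube mult_ac)
   also have "... <= N * L2_norm UNIV ph" unfolding N_def by (rule L2_inner_le[OF p3 C1c_L2(1)[OF ph]])
   also have "... <= N * (2 * diam * ?G)"
    using Poincare_C1c[OF ph, of i] d(2)[of i] diam(1) N0 C1c_norm_UNIV(1)[OF ph]
    by (intro mult_left_mono) (auto intro: order_trans mult_left_mono)
   finally show ?thesis using d G0 N0 diam(1) by (intro mult_left_mono mult_mono) auto
  qed
  finally have "N * N <= N * (18 * diam * ?G ^ 3)" by (simp add: power2_eq_square power3_eq_cube mult_ac)
  then have "N <= 18 * diam * ?G ^ 3" using N0 G0 diam(1) by (cases "N = 0") (auto simp: less_le)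
  also have "... <= (64 + 18 * diam) * ?G ^ 3" using G0 by (intro mult_right_mono) auto
  finally show ?thesis .
 next
  assume "CARD('n) = 3"
  then obtain i j k :: 'n where U: "UNIV = {i, j, k}" "i ~= j" "i ~= k" "j ~= k"
   unfolding card_3_iff by blast
  have "(ennreal (N^2))^2 <= ennreal (4 * (N * ?d i)) * ennreal (4 * (N * ?d j)) * ennreal (4 * (N * ?d k))"
   unfolding I6[symmetric]
   by (rule order_trans[OF Gagliardo_Nirenberg_3[OF phU U]]) (intro mult_mono hold[of 4 3, folded N_def], auto)
  then have "ennreal ((N^2)^2) <= ennreal (4 * (N * ?d i) * (4 * (N * ?d j)) * (4 * (N * ?d k)))"
  proof -
   have m3: "ennreal a * ennreal b * ennreal c = ennreal (a * b * c)" if "a >= 0" "b >= 0" "c >= 0" for a b c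
    using that by (simp add: ennreal_mult)
   assume "(ennreal (N^2))^2 <= ennreal (4 * (N * ?d i)) * ennreal (4 * (N * ?d j)) * ennreal (4 * (N * ?d k))"
   also have "... = ennreal (4 * (N * ?d i) * (4 * (N * ?d j)) * (4 * (N * ?d k)))"
    by (rule m3) (simp_all add: d N0)
   finally show ?thesis by (simp add: ennreal_power)
  qed
  then have "(N^2)^2 <= 4 * (N * ?d i) * (4 * (N * ?d j)) * (4 * (N * ?d k))"
   by (subst (asm) ennreal_le_iff) (simp_all add: d N0)
  then have "N ^ 3 * N <= N ^ 3 * (64 * (?d i * ?d j * ?d k))"
   by (simp add: power2_eq_square power3_eq_cube mult_ac)
  then have "N <= 64 * (?d i * ?d j * ?d k)"
   using N0 d by (cases "N = 0") (auto simp: less_le)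
  also have "... <= 64 * (?G * ?G * ?G)" using d G0 by (intro mult_left_mono mult_mono) auto
  also have "... <= (64 + 18 * diam) * ?G ^ 3"
   using G0 diam(1) by (simp add: power3_eq_cube distrib_right)
  finally show ?thesis .
 qed
 moreover have "N = nrm (%x. ph x ^ 3)"
  unfolding N_def by (rule zero_outside_L2_norm[OF sets_Omega]) (use K in auto)
 ultimately show ?thesis by simp
qed

end

text \<open>One factor converges boundedly almost everywhere, the other in L2. In
  \<open>truncated_identity\<close> the first are nonlinear functions of the approximations and the
  second their derivatives.\<close>

lemma L2_tendsto_mult_AE:
 fixes F :: "nat => 'a::euclidean_space => real"
 assumes c: "!!k. c k \<in> borel_measurable (lebesgue_on S)" "!!k x. \<bar>c k x\<bar> <= B"
  "AE x in lebesgue_on S. (%k. c k x) ~~> c' x" "c' \<in> borel_measurable (lebesgue_on S)"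
  and F: "!!k. F k \<in> L2 S" "f \<in> L2 S" "(%k. L2_norm S (%x. F k x - f x)) ~~> 0"
  and g: "g \<in> L2 S"
 shows "(%k. LINT x|lebesgue_on S. g x * (c k x * F k x)) ~~> (LINT x|lebesgue_on S. g x * (c' x * f x))"
proof -
 have B0: "B >= 0" using c(2)[of undefined undefined] by linarith
 have cg: "(%x. c k x * g x) \<in> L2 S" for k using L2_mult_bounded(1)[OF g c(1) AE_I2[OF c(2)]] by simp
 have cgn: "L2_norm S (%x. c k x * g x) <= B * L2_norm S g" for k
  using L2_mult_bounded(2)[OF g c(1) AE_I2[OF c(2)]] B0 by simp
 have i1: "integrable (lebesgue_on S) (%x. (c k x * g x) * (F k x - f x))" for k
  by (rule L2_integrable_mult[OF cg L2_diff[OF F(1,2)]])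
 have i2: "integrable (lebesgue_on S) (%x. (c k x * g x) * f x)" for k
  by (rule L2_integrable_mult[OF cg F(2)])
 have 1: "(%k. LINT x|lebesgue_on S. (c k x * g x) * (F k x - f x)) ~~> 0"
 proof (rule Lim_null_comparison)
  show "(%k. (B * L2_norm S g) * L2_norm S (%x. F k x - f x)) ~~> 0"
   using tendsto_mult_left[OF F(3)] by simp
  show "\<forall>\<^sub>F k in sequentially. norm (LINT x|lebesgue_on S. (c k x * g x) * (F k x - f x))
    <= (B * L2_norm S g) * L2_norm S (%x. F k x - f x)"
  proof (intro always_eventually allI)
   fix k
   have "\<bar>LINT x|lebesgue_on S. (c k x * g x) * (F k x - f x)\<bar> <= L2_norm S (%x. c k x * g x) * L2_norm S (%x. F k x - f x)"
    using L2_Cauchy_Schwarz[OF cg[of k] L2_diff[OF F(1)[of k] F(2)]] by (simp add: L2_inner_def)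
   also have "... <= (B * L2_norm S g) * L2_norm S (%x. F k x - f x)"
    by (rule mult_right_mono[OF cgn]) simp
   finally show "norm (LINT x|lebesgue_on S. (c k x * g x) * (F k x - f x)) <= (B * L2_norm S g) * L2_norm S (%x. F k x - f x)"
    by simp
  qed
 qed
 have 2: "(%k. LINT x|lebesgue_on S. (c k x * g x) * f x) ~~> (LINT x|lebesgue_on S. (c' x * g x) * f x)"
 proof (rule integral_dominated_convergence[where w = "%x. B * \<bar>g x * f x\<bar>"])
  show "integrable (lebesgue_on S) (%x. B * \<bar>g x * f x\<bar>)" using L2_integrable_mult[OF g F(2)] by simp
  show "AE x in lebesgue_on S. (%k. c k x * g x * f x) ~~> c' x * g x * f x"
   using c(3) by eventually_elim (intro tendsto_mult_right)
  show "AE x in lebesgue_on S. norm (c k x * g x * f x) <= B * \<bar>g x * f x\<bar>" for k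
  proof (rule AE_I2)
   fix x show "norm (c k x * g x * f x) <= B * \<bar>g x * f x\<bar>"
    using mult_right_mono[OF c(2)[of k x] abs_ge_zero[of "g x * f x"]] by (simp add: abs_mult mult.assoc)
  qed
 qed (use c(4) i2 L2D(1)[OF g] L2D(1)[OF F(2)] in "auto intro!: borel_measurable_times")
 have "(LINT x|lebesgue_on S. g x * (c k x * F k x))
   = (LINT x|lebesgue_on S. (c k x * g x) * (F k x - f x)) + (LINT x|lebesgue_on S. (c k x * g x) * f x)" for k
  by (subst B_add[OF i1 i2, symmetric]) (simp add: algebra_simps)
 then show ?thesis using tendsto_add[OF 1 2] by (simp add: mult_ac)
qed

context bounded_open
begin

definition h10 :: "'n fn => ('n => 'n fn) => bool" where
 "h10 f df \<longleftrightarrow> h1 f df & (\<exists>ph. (\<forall>k::nat. test_function Om (ph k)) &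
  (%k. nrm (%x. ph k x - f x)) ~~> 0 &
  (\<forall>i. (%k. nrm (%x. pdiff i (ph k) x - df i x)) ~~> 0))"

lemma h10_h1: "h10 f df ==> h1 f df"
 by (simp add: h10_def)

text \<open>An approximating sequence that also converges almost everywhere, as Fatou's lemma and
  nonlinear coefficients require.\<close>

definition h10_seq where
 "h10_seq f df ph dph \<longleftrightarrow> (\<forall>k::nat. C1c Om (ph k) (dph k)) &
  (%k. nrm (%x. ph k x - f x)) ~~> 0 &
  (\<forall>i. (%k. nrm (%x. dph k i x - df i x)) ~~> 0) &
  (AEO x. (%k. ph k x) ~~> f x)"

lemma h10_seqD:
 assumes "h10_seq f df ph dph"
 shows "C1c Om (ph k) (dph k)" "(%k. nrm (%x. ph k x - f x)) ~~> 0"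
  "(%k. nrm (%x. dph k i x - df i x)) ~~> 0"
  "AEO x. (%k. ph k x) ~~> f x"
 using assms by (simp_all add: h10_seq_def)

lemma h10_sequence:
 assumes "h10 f df"
 shows "\<exists>ph dph. h10_seq f df ph dph"
proof -
 obtain ph where ph0: "(\<forall>k::nat. test_function Om (ph k)) &
  (%k. nrm (%x. ph k x - f x)) ~~> 0 &
  (\<forall>i. (%k. nrm (%x. pdiff i (ph k) x - df i x)) ~~> 0)"
  using assms[unfolded h10_def, THEN conjunct2] by (rule exE)
 note ph = ph0[THEN conjunct1, rule_format] ph0[THEN conjunct2, THEN conjunct1]
  ph0[THEN conjunct2, THEN conjunct2, rule_format]
 have "\<exists>r::nat => nat. strict_mono r & (AEO x. (%k. ph (r k) x) ~~> f x)"
  by (rule L2_AE_subsequence[OF C1c_L2_Omega(1)[OF test_function_C1c[OF ph(1)]] h1D(1)[OF h10_h1[OF assms]] ph(2)])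
 then obtain r :: "nat => nat" where r: "strict_mono r & (AEO x. (%k. ph (r k) x) ~~> f x)"
  by (rule exE)
 have "h10_seq f df (%k. ph (r k)) (%k i. pdiff i (ph (r k)))"
  unfolding h10_seq_def
 proof (intro conjI allI)
  show "C1c Om (ph (r k)) (%i. pdiff i (ph (r k)))" for k by (rule test_function_C1c[OF ph(1)])
  show "(%k. nrm (%x. ph (r k) x - f x)) ~~> 0"
   using LIMSEQ_subseq_LIMSEQ[OF ph(2) r[THEN conjunct1]] by (simp only: comp_def)
  show "(%k. nrm (%x. pdiff i (ph (r k)) x - df i x)) ~~> 0" for i
   using LIMSEQ_subseq_LIMSEQ[OF ph(3)[of i] r[THEN conjunct1]] by (simp only: comp_def)
 qed (rule r[THEN conjunct2])
 then show ?thesis by (intro exI)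
qed

lemma gnorm_tendsto:
 assumes "!!k i. dph k i \<in> L2O" "!!i. df i \<in> L2O"
  "!!i. (%k. nrm (%x. dph k i x - df i x)) ~~> 0"
 shows "(%k. gnorm (dph k)) ~~> gnorm df"
 unfolding gnorm_def using L2_tendsto_norm[OF assms(1,2,3)] by (intro tendsto_intros)

lemma Poincare:
 assumes "h10 f df" shows "nrm f <= 2 * diam * nrm (df i)"
proof -
 obtain ph dph where ph0: "h10_seq f df ph dph"
  using h10_sequence[OF assms] by (elim exE)
 note ph = h10_seqD[OF ph0]
 note L = C1c_L2_Omega[OF ph(1)] and F = h1D[OF h10_h1[OF assms]]
 show ?thesis
  by (rule LIMSEQ_le[OF L2_tendsto_norm[OF L(1) F(1) ph(2)] tendsto_mult_left[OF L2_tendsto_norm[OF L(2) F(2) ph(3)]]])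
   (intro exI[of _ 0] allI impI Poincare_C1c[OF ph(1)])
qed

text \<open>The \<open>H1_norm\<close> in \<open>H1_0\<close> is formed with the chosen gradient of
  the difference; up to null sets this is the difference of the gradients.\<close>

lemma H1_0_h10:
 assumes "f \<in> H1_0 Om" shows "h10 f (%i. weak_pderiv Om i f)"
proof -
 have s: "f \<in> sobolev Om (Suc 0)" using assms by (simp add: H1_0_def)
 note f = sobolev_1_h1[OF s]
 have "\<exists>ph. (\<forall>k::nat. test_function Om (ph k)) & (%k. H1_norm Om (%x. f x - ph k x)) ~~> 0"
  using assms unfolding H1_0_def mem_Collect_eq by (rule conjunct2)
 then obtain ph where ph0: "(\<forall>k::nat. test_function Om (ph k)) & (%k. H1_norm Om (%x. f x - ph k x)) ~~> 0"
  by (rule exE)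
 note ph = ph0[THEN conjunct1, rule_format] ph0[THEN conjunct2]
 note t = C1c_imp_h1[OF test_function_C1c[OF ph(1)]]
 have d: "h1 (%x. f x - ph k x) (%i x. weak_pderiv Om i f x - pdiff i (ph k) x)" for k
  by (rule h1_diff[OF f t])
 have b1: "nrm (%x. ph k x - f x) <= H1_norm Om (%x. f x - ph k x)" for k
 proof -
  have "nrm (%x. ph k x - f x) = nrm (%x. f x - ph k x)"
   using L2_norm_uminus[of Om "%x. f x - ph k x"] by simp
  then show ?thesis unfolding H1_norm_def by (intro real_le_rsqrt) simp
 qed
 have b2: "nrm (%x. pdiff i (ph k) x - weak_pderiv Om i f x) <= H1_norm Om (%x. f x - ph k x)" for k i
 proof -
  let ?g = "%x. f x - ph k x"
  note w = h1_weak_pderiv[OF d[of k]]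
  have gL: "grad Om ?g \<in> L2O"
   unfolding L2_component_iff grad_def using h1D(2)[OF w] by simp
  have "nrm (%x. pdiff i (ph k) x - weak_pderiv Om i f x) = nrm (%x. weak_pderiv Om i f x - pdiff i (ph k) x)"
   using L2_norm_uminus[of Om "%x. weak_pderiv Om i f x - pdiff i (ph k) x"] by simp
  also have "... = nrm (weak_pderiv Om i ?g)"
   by (rule L2_norm_cong_AE[OF h1_weak_pderiv_AE[OF d] L2D(1)[OF h1D(2)[OF d]] L2D(1)[OF h1D(2)[OF w]]])
  also have "... = nrm (%x. grad Om ?g x $ i)" by (simp add: grad_def)
  also have "... <= nrm (grad Om ?g)" by (rule L2_norm_component_le[OF gL])
  also have "... <= H1_norm Om ?g" unfolding H1_norm_def by (intro real_le_rsqrt) simp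
  finally show ?thesis .
 qed
 show ?thesis
  unfolding h10_def
 proof (intro conjI f exI[of _ ph] allI ph(1))
  show "(%k. nrm (%x. ph k x - f x)) ~~> 0"
   by (rule tendsto_sandwich[OF _ _ tendsto_const ph(2)]) (simp_all add: b1)
  show "(%k. nrm (%x. pdiff i (ph k) x - weak_pderiv Om i f x)) ~~> 0" for i
   by (rule tendsto_sandwich[OF _ _ tendsto_const ph(2)]) (simp_all add: b2)
 qed
qed

end

context sobolev_domain
begin

text \<open>Fatou's lemma along an approximating sequence that converges almost everywhere, the
  gradient norms converging as well.\<close>

lemma Sobolev_h10:
 assumes "h10 f df"
 shows "(%x. f x ^ 3) \<in> L2O" "nrm (%x. f x ^ 3) <= (64 + 18 * diam) * gnorm df ^ 3"
proof -
 obtain ph dph where ph0: "h10_seq f df ph dph"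
  using h10_sequence[OF assms] by (elim exE)
 note ph = h10_seqD[OF ph0]
 note L = C1c_L2_Omega[OF ph(1)] and F = h1D[OF h10_h1[OF assms]]
 let ?C = "64 + 18 * diam"
 have p: "C1c Om (%x. ph k x ^ 3) (%i x. 3 * ph k x ^ 2 * dph k i x)" for k
  using C1c_power[OF ph(1)[of k], of 2] by simp
 have fm: "f \<in> borel_measurable MO" by (rule L2D(1)[OF F(1)])
 note Fa = Fatou_integrable[where F = "%k x. (ph k x ^ 3)^2" and f = "%x. (f x ^ 3)^2" and M = "MO"
   and C = "%k. (?C * gnorm (dph k) ^ 3)^2" and c = "(?C * gnorm df ^ 3)^2"]
 have 1: "integrable MO (%x. (ph k x ^ 3)^2)" for k
  by (rule L2_integrable_power2[OF C1c_L2_Omega(1)[OF p]])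
 have 2: "AEO x. (%k. (ph k x ^ 3)^2) ~~> (f x ^ 3)^2"
  using ph(4) by eventually_elim (intro tendsto_intros)
 have 3: "(LI x. (ph k x ^ 3)^2) <= (?C * gnorm (dph k) ^ 3)^2" for k
 proof -
  have "(nrm (%x. ph k x ^ 3))^2 <= (?C * gnorm (dph k) ^ 3)^2"
   by (rule power_mono[OF Sobolev_C1c[OF ph(1)]]) simp
  then show ?thesis by (simp add: L2_norm_power2)
 qed
 have 4: "(%k. (?C * gnorm (dph k) ^ 3)^2) ~~> (?C * gnorm df ^ 3)^2"
  by (intro tendsto_intros gnorm_tendsto[OF L(2) F(2) ph(3)])
 have 5: "(%x. (f x ^ 3)^2) \<in> borel_measurable MO" using fm by measurable
 have i: "integrable MO (%x. (f x ^ 3)^2)" "(LI x. (f x ^ 3)^2) <= (?C * gnorm df ^ 3)^2"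
  by (rule Fa[OF 1 _ 2 5 3 4], simp)+
 then show "(%x. f x ^ 3) \<in> L2O" using fm by (auto simp: L2_def)
 have "(nrm (%x. f x ^ 3))^2 <= (?C * gnorm df ^ 3)^2" using i(2) by (simp add: L2_norm_power2)
 then show "nrm (%x. f x ^ 3) <= ?C * gnorm df ^ 3"
  by (rule power2_le_imp_le) (use diam(1) gnorm_nonneg in simp)
qed

end

section \<open>Weighted gradient estimates for the convection term\<close>

definition Ktr :: "real => real => real" where "Ktr d a = arctan (d * a) / d"
definition Ktr' :: "real => real => real" where "Ktr' d a = inverse (1 + (d * a)^2)"
text \<open>\<open>Ktr d a * Htr d b\<close> is a bounded substitute for \<open>a * b^2\<close> and
  tends to it as \<open>d\<close> tends to 0. Both factors have bounded derivatives, and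
  \<open>Ktr d a\<close> keeps the sign of \<open>Htr' d a\<close>.\<close>

definition Htr :: "real => real => real" where "Htr d b = b^2 * inverse (1 + (d * b)^2)"
definition Htr' :: "real => real => real" where "Htr' d b = 2 * b * (inverse (1 + (d * b)^2))^2"

lemma one_plus_square_pos: "(1::real) + x^2 > 0" "(1::real) + x^2 ~= 0"
 by (simp_all add: add_pos_nonneg add_nonneg_eq_0_iff)

lemma Ktr_DERIV: "d > 0 ==> (Ktr d has_real_derivative Ktr' d a) (at a)"
proof -
 assume d: "d > 0"
 have "((%a. inverse d * arctan (d * a)) has_real_derivative inverse d * (inverse (1 + (d * a)^2) * (d * 1))) (at a)"
  by (intro DERIV_cmult DERIV_chain2[where f = arctan] DERIV_arctan DERIV_ident)
 moreover have "inverse d * (inverse (1 + (d * a)^2) * (d * 1)) = Ktr' d a"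
  using d by (simp add: Ktr'_def)
 ultimately show ?thesis
  unfolding Ktr_def[abs_def] by (simp only: divide_inverse mult.commute[of _ "inverse d"])
qed

lemma Htr_DERIV: "(Htr d has_real_derivative Htr' d b) (at b)"
proof -
 have n: "1 + (d * b)^2 ~= 0" by (rule one_plus_square_pos)
 have "((%b. b^2 / (1 + (d * b)^2)) has_real_derivative
   (2 * b * (1 + (d * b)^2) - b^2 * (2 * (d * b) * d)) / ((1 + (d * b)^2) * (1 + (d * b)^2))) (at b)"
  by (rule derivative_eq_intros refl n | simp add: power2_eq_square)+
 moreover have "(2 * b * (1 + (d * b)^2) - b^2 * (2 * (d * b) * d)) / ((1 + (d * b)^2) * (1 + (d * b)^2)) = Htr' d b"
 proof -
  have e: "2 * b * (1 + (d * b)^2) - b^2 * (2 * (d * b) * d) = 2 * b"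
   by (simp add: power2_eq_square algebra_simps)
  show ?thesis unfolding e Htr'_def by (simp add: divide_inverse power2_eq_square[of "inverse _"])
 qed
 ultimately show ?thesis unfolding Htr_def[abs_def] by (simp only: divide_inverse)
qed

lemma Ktr'_continuous: "continuous_on A (Ktr' d)" and Htr'_continuous: "continuous_on A (Htr' d)"
 unfolding Ktr'_def[abs_def] Htr'_def[abs_def]
 by (intro continuous_intros; simp add: add_nonneg_eq_0_iff)+

lemma arctan_le_self: "\<bar>arctan x\<bar> <= \<bar>x\<bar>"
proof -
 have "arctan x <= x" if "x >= 0" for x :: real
 proof -
  have "x - arctan x >= 0 - arctan 0"
  proof (rule DERIV_nonneg_imp_nondecreasing[OF that, of "%x. x - arctan x"])
   fix y :: real
   have "((%x. x - arctan x) has_real_derivative 1 - inverse (1 + y^2)) (at y)"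
    by (auto intro!: derivative_eq_intros)
   moreover have "inverse (1 + y^2) <= 1" by (rule inverse_le_1_iff[THEN iffD2]) simp
   ultimately show "\<exists>z. ((%x. x - arctan x) has_real_derivative z) (at y) & 0 <= z"
    by (intro exI[of _ "1 - inverse (1 + y^2)"]) auto
  qed
  then show ?thesis by simp
 qed
 from this[of x] this[of "- x"] show ?thesis
  by (cases "x >= 0") (auto simp: arctan_minus abs_if not_le)
qed

lemma tr_bounds:
 assumes d: "d > 0"
 shows "\<bar>Ktr d a\<bar> <= \<bar>a\<bar>" "\<bar>Ktr d a\<bar> <= 2 / d" "0 <= Ktr' d a" "Ktr' d a <= 1" "0 <= Htr d b" "Htr d b <= b^2"
  "Htr d b <= 1 / d^2" "\<bar>Htr' d b\<bar> <= 2 * \<bar>b\<bar>" "\<bar>Htr' d b\<bar> <= 2 / d" "0 <= Ktr d a * Htr' d a"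
proof -
 show "\<bar>Ktr d a\<bar> <= \<bar>a\<bar>" using arctan_le_self[of "d * a"] d by (simp add: Ktr_def abs_mult field_simps)
 have "\<bar>arctan (d * a)\<bar> <= 2" using arctan_bounded[of "d * a"] pi_half_less_two by linarith
 then show "\<bar>Ktr d a\<bar> <= 2 / d" using d by (simp add: Ktr_def divide_right_mono)
 have i: "0 < inverse (1 + x^2)" "inverse (1 + x^2) <= (1::real)" for x
  using one_plus_square_pos[of x] by (simp_all add: inverse_le_1_iff)
 show "0 <= Ktr' d a" "Ktr' d a <= 1" using i[of "d * a"] by (simp_all add: Ktr'_def)
 show "0 <= Htr d b" "Htr d b <= b^2"
  using i[of "d * b"] mult_left_mono[of "inverse (1 + (d * b)^2)" 1 "b^2"] by (simp_all add: Htr_def)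
 show "Htr d b <= 1 / d^2"
 proof -
  have "d^2 * b^2 <= 1 + (d * b)^2" by (simp add: power_mult_distrib)
  then show ?thesis using d one_plus_square_pos[of "d * b"]
   by (simp add: Htr_def divide_inverse[symmetric] field_simps)
 qed
 have sq: "(inverse (1 + (d * b)^2))^2 <= inverse (1 + (d * b)^2)"
  using i[of "d * b"] by (simp add: power2_eq_square mult_left_le)
 then have sq1: "(inverse (1 + (d * b)^2))^2 <= 1" using i(2)[of "d * b"] by linarith
 show "\<bar>Htr' d b\<bar> <= 2 * \<bar>b\<bar>"
  using mult_left_mono[OF sq1, of "2 * \<bar>b\<bar>"] by (simp add: Htr'_def abs_mult)
 show "\<bar>Htr' d b\<bar> <= 2 / d"
 proof -
  have "\<bar>Htr' d b\<bar> <= 2 * \<bar>b\<bar> * inverse (1 + (d * b)^2)"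
   using mult_left_mono[OF sq, of "2 * \<bar>b\<bar>"] by (simp add: Htr'_def abs_mult)
  also have "... <= 2 / d"
  proof -
   have "d * \<bar>b\<bar> * 2 <= 1 + (d * b)^2"
    using sum_squares_bound[of 1 "d * \<bar>b\<bar>"] by (simp add: power_mult_distrib)
   then have "d * \<bar>b\<bar> <= 1 + (d * b)^2" using mult_nonneg_nonneg[of d "\<bar>b\<bar>"] d by linarith
   then show ?thesis using d one_plus_square_pos[of "d * b"]
    by (simp add: divide_inverse[symmetric] field_simps)
  qed
  finally show ?thesis .
 qed
 show "0 <= Ktr d a * Htr' d a"
 proof (cases "a >= 0")
  case True
  then have "0 <= Ktr d a" using d by (simp add: Ktr_def)
  then show ?thesis using True by (simp add: Htr'_def)
 next
  case False
  then have "Ktr d a <= 0" "Htr' d a <= 0"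
   using d by (auto simp: Ktr_def Htr'_def divide_le_0_iff mult_le_0_iff)
  then show ?thesis by (rule mult_nonpos_nonpos)
 qed
qed

lemma C1c_compose:
 assumes ph: "C1c Om ph dph" and h: "!!y. (h has_real_derivative h' y) (at y)" "!!A. continuous_on A h'" "h 0 = 0"
 shows "C1c Om (%x. h (ph x)) (%i x. h' (ph x) * dph i x)"
proof -
 obtain K where K: "compact K" "K \<subseteq> Om" "!!x. x \<notin> K ==> ph x = 0"
  using C1cD[OF ph] by metis
 have "C1_on UNIV (%x. h (ph x)) (%i x. h' (ph x) * dph i x)"
  by (rule C1_on_compose[OF C1c_C1_on[OF ph] h(1,2)])
 then show ?thesis unfolding C1c_def using K h(3) by (intro conjI exI[of _ K]) simp_all
qed

context bounded_open
begin

lemma const_L2: "(%x. c) \<in> L2O" for c :: real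
 by (rule L2_bounded_continuous(2)[of _ "\<bar>c\<bar>"]) auto

text \<open>The weak form of the \<open>l\<close>-th second derivative, tested with
  \<open>Ktr d a * Htr d b\<close>. As \<open>a\<close> and \<open>b\<close> are only limits of test
  functions, the same expression is formed with the approximations, where it has compact
  support.\<close>

lemma truncated_identity:
 assumes a: "h10 a da" and b: "h10 b db" and dda: "h1 (da l) (dda l)" and d: "d > 0"
 shows "(LI x. da l x * ((Ktr d (a x) * Htr' d (b x)) * db l x))
  + (LI x. da l x * ((Ktr' d (a x) * Htr d (b x)) * da l x))
  = - (LI x. dda l l x * (Ktr d (a x) * Htr d (b x)))"
proof -
 obtain ph dph where ph0: "h10_seq a da ph dph" using h10_sequence[OF a] by (elim exE)
 note ph = h10_seqD[OF ph0]
 obtain ps dps where ps0: "h10_seq b db ps dps" using h10_sequence[OF b] by (elim exE)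
 note ps = h10_seqD[OF ps0]
 note A = h1D[OF h10_h1[OF a]] and B = h1D[OF h10_h1[OF b]]
 have am: "a \<in> borel_measurable MO" "b \<in> borel_measurable MO"
  by (rule L2D(1)[OF A(1)], rule L2D(1)[OF B(1)])
 have km: "Ktr d \<in> borel_measurable borel" "Ktr' d \<in> borel_measurable borel"
  "Htr d \<in> borel_measurable borel" "Htr' d \<in> borel_measurable borel"
  unfolding Ktr_def[abs_def] Ktr'_def[abs_def] Htr_def[abs_def] Htr'_def[abs_def] by measurable
 have kc: "isCont (Ktr d) y" "isCont (Ktr' d) y" "isCont (Htr d) y" "isCont (Htr' d) y" for y
  using Ktr'_continuous[of UNIV d] Htr'_continuous[of UNIV d]
  by (simp_all add: continuous_on_eq_continuous_at DERIV_isCont[OF Ktr_DERIV[OF d]] DERIV_isCont[OF Htr_DERIV])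
 have C: "C1c Om (%x. Ktr d (ph k x) * Htr d (ps k x))
   (%i x. Ktr d (ph k x) * (Htr' d (ps k x) * dps k i x) + (Ktr' d (ph k x) * dph k i x) * Htr d (ps k x))" for k
  by (rule C1c_mult[OF C1c_compose[OF ph(1) Ktr_DERIV[OF d] Ktr'_continuous]
     C1c_C1_on[OF C1c_compose[OF ps(1) Htr_DERIV Htr'_continuous]]]) (simp_all add: Ktr_def Htr_def)
 have phm: "ph k \<in> borel_measurable MO" and psm: "ps k \<in> borel_measurable MO" for k
  by (rule L2D(1)[OF C1c_L2_Omega(1)[OF ph(1)]], rule L2D(1)[OF C1c_L2_Omega(1)[OF ps(1)]])
 note bd = tr_bounds[OF d]
 let ?M = "2 / d * (2 / d) + 1 * (1 / d^2) + 2 / d * (1 / d^2)"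
 have nnM: "0 <= 2 / d * (2 / d)" "0 <= 1 * (1 / d^2)" "0 <= 2 / d * (1 / d^2)" using d by simp_all
 have b1: "\<bar>Ktr d y * Htr' d z\<bar> <= ?M" for y z
 proof -
  have "\<bar>Ktr d y * Htr' d z\<bar> <= 2 / d * (2 / d)"
   unfolding abs_mult by (intro mult_mono bd) (use d in auto)
  then show ?thesis using nnM by linarith
 qed
 have b2: "\<bar>Ktr' d y * Htr d z\<bar> <= ?M" for y z
 proof -
  have "\<bar>Ktr' d y * Htr d z\<bar> <= 1 * (1 / d^2)"
   unfolding abs_mult using bd(3)[of y] bd(5)[of z] by (intro mult_mono) (use bd in auto)
  then show ?thesis using nnM by linarith
 qed
 have b3: "\<bar>Ktr d y * Htr d z\<bar> <= ?M" for y z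
 proof -
  have "\<bar>Ktr d y * Htr d z\<bar> <= 2 / d * (1 / d^2)"
   unfolding abs_mult using bd(5)[of z] d by (intro mult_mono bd) (use bd in auto)
  then show ?thesis using nnM by linarith
 qed
 have meas: "(%x. f (u x) * g (v x)) \<in> borel_measurable MO"
  if "f \<in> borel_measurable borel" "g \<in> borel_measurable borel"
   "u \<in> borel_measurable MO" "v \<in> borel_measurable MO" for f g :: "real => real" and u v
  using measurable_compose[OF that(3) that(1)] measurable_compose[OF that(4) that(2)]
  by (rule borel_measurable_times)
 have ae: "AEO x. (%k. f (ph k x) * g (ps k x)) ~~> f (a x) * g (b x)"
  if "!!y. isCont f y" "!!y. isCont g y" for f g :: "real => real"
  using ph(4) ps(4)
  by eventually_elim (intro tendsto_mult isCont_tendsto_compose[OF that(1)] isCont_tendsto_compose[OF that(2)])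
 have L1: "(%k. LI x. da l x * ((Ktr d (ph k x) * Htr' d (ps k x)) * dps k l x)) ~~>
   (LI x. da l x * ((Ktr d (a x) * Htr' d (b x)) * db l x))"
  by (rule L2_tendsto_mult_AE[OF meas[OF km(1,4) phm psm] b1 ae[OF kc(1,4)] meas[OF km(1,4) am]
     C1c_L2_Omega(2)[OF ps(1)] B(2) ps(3) A(2)])
 have L2': "(%k. LI x. da l x * ((Ktr' d (ph k x) * Htr d (ps k x)) * dph k l x)) ~~>
   (LI x. da l x * ((Ktr' d (a x) * Htr d (b x)) * da l x))"
  by (rule L2_tendsto_mult_AE[OF meas[OF km(2,3) phm psm] b2 ae[OF kc(2,3)] meas[OF km(2,3) am]
     C1c_L2_Omega(2)[OF ph(1)] A(2) ph(3) A(2)])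
 have L3: "(%k. LI x. dda l l x * ((Ktr d (ph k x) * Htr d (ps k x)) * 1)) ~~>
   (LI x. dda l l x * ((Ktr d (a x) * Htr d (b x)) * 1))"
  by (rule L2_tendsto_mult_AE[OF meas[OF km(1,3) phm psm] b3 ae[OF kc(1,3)] meas[OF km(1,3) am]
     const_L2 const_L2 _ h1D(2)[OF dda]]) simp
 have ft: "(%x. f (ph k x) * g (ps k x) * w x) \<in> L2O"
  if "f \<in> borel_measurable borel" "g \<in> borel_measurable borel" "!!y z. \<bar>f y * g z\<bar> <= ?M" "w \<in> L2O" for f g w k
  using L2_mult_bounded(1)[OF that(4) meas[OF that(1,2) phm psm] AE_I2[OF that(3)]] by simp
 have eq: "(LI x. da l x * ((Ktr d (ph k x) * Htr' d (ps k x)) * dps k l x))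
   + (LI x. da l x * ((Ktr' d (ph k x) * Htr d (ps k x)) * dph k l x))
   = - (LI x. dda l l x * ((Ktr d (ph k x) * Htr d (ps k x)) * 1))" for k
 proof -
  have "(LI x. da l x * ((Ktr d (ph k x) * Htr' d (ps k x)) * dps k l x))
    + (LI x. da l x * ((Ktr' d (ph k x) * Htr d (ps k x)) * dph k l x))
   = (LI x. da l x * ((Ktr d (ph k x) * Htr' d (ps k x)) * dps k l x)
     + da l x * ((Ktr' d (ph k x) * Htr d (ps k x)) * dph k l x))"
   by (rule B_add[symmetric])
    (rule L2_integrable_mult[OF A(2) ft[OF km(1,4) b1 C1c_L2_Omega(2)[OF ps(1)]]],
    rule L2_integrable_mult[OF A(2) ft[OF km(2,3) b2 C1c_L2_Omega(2)[OF ph(1)]]])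
  also have "... = (LI x. da l x * (Ktr d (ph k x) * (Htr' d (ps k x) * dps k l x) + (Ktr' d (ph k x) * dph k l x) * Htr d (ps k x)))"
   by (rule B_cong[OF refl]) (simp add: algebra_simps)
  also have "... = - (LI x. dda l l x * (Ktr d (ph k x) * Htr d (ps k x)))"
   by (rule h1_C1c[OF dda C])
  finally show ?thesis by simp
 qed
 show ?thesis
  using LIMSEQ_unique[OF tendsto_add[OF L1 L2'], unfolded eq, OF tendsto_minus[OF L3]] by simp
qed

text \<open>Summing \<open>truncated_identity\<close> over \<open>l\<close> isolates a nonnegative
  gradient term that tends to the sum of \<open>(b * da l)^2\<close> as \<open>d\<close> tends to 0.
  Fatou's lemma asks for bounds on the other two terms that are uniform in \<open>d\<close>:
  \<open>C1\<close> for the Laplacian, \<open>C2\<close> for the mixed term.\<close>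

lemma weighted_gradient_bound:
 assumes a: "h10 a da" and b: "h10 b db" and dda: "!!l. h1 (da l) (dda l)"
  and C: "!!d. d > 0 ==>
   \<bar>SU l. LI x. dda l l x * (Ktr d (a x) * Htr d (b x))\<bar> <= C1"
   "!!d. d > 0 ==>
   - (SU l. LI x. da l x * ((Ktr d (a x) * Htr' d (b x)) * db l x)) <= C2"
 shows "(%x. b x * da l x) \<in> L2O" "(SU l. (nrm (%x. b x * da l x))^2) <= C1 + C2"
proof -
 note A = h1D[OF h10_h1[OF a]] and B = h1D[OF h10_h1[OF b]]
 have am[measurable]: "a \<in> borel_measurable MO" "b \<in> borel_measurable MO"
  by (rule L2D(1)[OF A(1)], rule L2D(1)[OF B(1)])
 have dam[measurable]: "da l \<in> borel_measurable MO" for l by (rule L2D(1)[OF A(2)])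
 define d where "d m = inverse (real (Suc m))" for m
 have d0: "d m > 0" for m by (simp add: d_def)
 have dlim: "d ~~> 0" unfolding d_def by (rule LIMSEQ_inverse_real_of_nat)
 define F where "F m x = (SU l. da l x * ((Ktr' (d m) (a x) * Htr (d m) (b x)) * da l x))" for m x
 have Fi: "integrable MO (%x. da l x * ((Ktr' (d m) (a x) * Htr (d m) (b x)) * da l x))" for m l
 proof (rule Bi_bound)
  show "integrable MO (%x. (1 / (d m)^2) * (da l x)^2)"
   using L2_integrable_power2[OF A(2)] by simp
  show "(%x. da l x * ((Ktr' (d m) (a x) * Htr (d m) (b x)) * da l x)) \<in> borel_measurable MO"
   unfolding Ktr'_def Htr_def by measurable
  show "AEO x. norm (da l x * ((Ktr' (d m) (a x) * Htr (d m) (b x)) * da l x))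
    <= norm ((1 / (d m)^2) * (da l x)^2)"
  proof (rule AE_I2)
   fix x
   note bd = tr_bounds[OF d0[of m]]
   have "\<bar>Ktr' (d m) (a x) * Htr (d m) (b x)\<bar> <= 1 * (1 / (d m)^2)"
    unfolding abs_mult using bd(3)[of "a x"] bd(5)[of "b x"] by (intro mult_mono) (use bd in auto)
   from mult_right_mono[OF this, of "(da l x)^2"]
   show "norm (da l x * ((Ktr' (d m) (a x) * Htr (d m) (b x)) * da l x)) <= norm ((1 / (d m)^2) * (da l x)^2)"
    by (simp add: abs_mult power2_eq_square mult_ac)
  qed
 qed
 have 1: "integrable MO (F m)" for m
  unfolding F_def by (rule Bi_sum) (rule Fi)
 have 2: "0 <= F m x" for m x
 proof -
  have "0 <= Ktr' (d m) (a x) * Htr (d m) (b x)"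
   using tr_bounds[OF d0[of m]] by (intro mult_nonneg_nonneg)
  from mult_nonneg_nonneg[OF this zero_le_square]
  show ?thesis unfolding F_def by (intro sum_nonneg) (simp add: mult_ac)
 qed
 have 3: "(%m. F m x) ~~> (SU l. (b x * da l x)^2)" for x
 proof -
  have k: "(%m. inverse (1 + (d m * y)^2)) ~~> inverse (1 + (0 * y)^2)" for y
   by (intro tendsto_intros dlim) simp
  have "(%m. F m x) ~~> (SU l. da l x * ((inverse (1 + (0 * a x)^2) * ((b x)^2 * inverse (1 + (0 * b x)^2))) * da l x))"
   unfolding F_def Ktr'_def Htr_def by (intro tendsto_intros k)
  then show ?thesis by (simp add: power_mult_distrib power2_eq_square mult_ac)
 qed
 have 4: "(LI x. F m x) <= C1 + C2" for m
 proof -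
  have "(LI x. F m x) = (SU l. LI x. da l x * ((Ktr' (d m) (a x) * Htr (d m) (b x)) * da l x))"
   unfolding F_def by (rule B_sum) (rule Fi)
  also have "... = (SU l. - (LI x. dda l l x * (Ktr (d m) (a x) * Htr (d m) (b x)))
    - (LI x. da l x * ((Ktr (d m) (a x) * Htr' (d m) (b x)) * db l x)))"
  proof (rule sum.cong[OF refl])
   fix l
   show "(LI x. da l x * ((Ktr' (d m) (a x) * Htr (d m) (b x)) * da l x))
    = - (LI x. dda l l x * (Ktr (d m) (a x) * Htr (d m) (b x)))
    - (LI x. da l x * ((Ktr (d m) (a x) * Htr' (d m) (b x)) * db l x))"
    using truncated_identity[where da = da and db = db and dda = dda and l = l, OF a b dda d0, of m] by linarith
  qed
  also have "... <= C1 + C2"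
   using C(1)[OF d0[of m]] C(2)[OF d0[of m]] by (simp add: sum_subtractf sum_negf)
  finally show ?thesis .
 qed
 have 5: "(%x. SU l. (b x * da l x)^2) \<in> borel_measurable MO" by measurable
 note Fa = Fatou_integrable[where F = F and f = "%x. SU l. (b x * da l x)^2" and M = "MO"
   and C = "%_. C1 + C2" and c = "C1 + C2", OF 1 2 AE_I2[OF 3] 5 4 tendsto_const]
 have int: "integrable MO (%x. (b x * da l x)^2)" for l
 proof (rule Bi_bound[OF Fa(1)])
  show "(%x. (b x * da l x)^2) \<in> borel_measurable MO" by measurable
  show "AEO x. norm ((b x * da l x)^2) <= norm (SU l. (b x * da l x)^2)"
  proof (rule AE_I2)
   fix x
   have "(b x * da l x)^2 <= (SU l. (b x * da l x)^2)"
    by (rule member_le_sum[of l UNIV "%l. (b x * da l x)^2"]) simp_all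
   then show "norm ((b x * da l x)^2) <= norm (SU l. (b x * da l x)^2)"
    by (simp add: sum_nonneg)
  qed
 qed
 show L: "(%x. b x * da l x) \<in> L2O" for l
  using int[of l] unfolding L2_def by simp
 have "(SU l. (nrm (%x. b x * da l x))^2) = (LI x. (SU l. (b x * da l x)^2))"
  by (subst B_sum[OF int]) (simp add: L2_norm_power2)
 with Fa(2) show "(SU l. (nrm (%x. b x * da l x))^2) <= C1 + C2" by simp
qed

end

context sobolev_domain
begin

text \<open>The weight is at most |a| b^2, hence at most |a|^3 + |b|^3, which the Sobolev inequality
  places in L2.\<close>

lemma laplacian_weight_bound:
 assumes a: "h10 a da" and b: "h10 b db" and dda: "!!l. h1 (da l) (dda l)" and d: "d > 0"
 shows "\<bar>SU l. LI x. dda l l x * (Ktr d (a x) * Htr d (b x))\<bar>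
  <= nrm (%x. SU l. dda l l x) * (nrm (%x. a x ^ 3) + nrm (%x. b x ^ 3))"
proof -
 note A = h1D[OF h10_h1[OF a]] and B = h1D[OF h10_h1[OF b]]
 have am[measurable]: "a \<in> borel_measurable MO" "b \<in> borel_measurable MO"
  by (rule L2D(1)[OF A(1)], rule L2D(1)[OF B(1)])
 have a3: "(%x. \<bar>a x\<bar> ^ 3) \<in> L2O" and b3: "(%x. \<bar>b x\<bar> ^ 3) \<in> L2O"
  by (rule L2_bound[OF Sobolev_h10(1)[OF a]], measurable, simp add: power_abs,
    rule L2_bound[OF Sobolev_h10(1)[OF b]], measurable, simp add: power_abs)
 have n3: "nrm (%x. \<bar>f x\<bar> ^ 3) = nrm (%x. f x ^ 3)" for f :: "'n fn"
  by (simp add: L2_norm_def L2_inner_def power_abs)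
 let ?w = "%x. Ktr d (a x) * Htr d (b x)"
 have wm: "?w \<in> borel_measurable MO" unfolding Ktr_def Htr_def by measurable
 have wb: "norm (?w x) <= norm (\<bar>a x\<bar> ^ 3 + \<bar>b x\<bar> ^ 3)" for x
 proof -
  have "norm (?w x) <= \<bar>a x\<bar> * (b x)^2"
   unfolding real_norm_def abs_mult using tr_bounds[OF d] by (intro mult_mono) auto
  also have "... <= \<bar>a x\<bar> ^ 3 + \<bar>b x\<bar> ^ 3"
  proof (cases "\<bar>a x\<bar> <= \<bar>b x\<bar>")
   case True
   have "\<bar>a x\<bar> * (b x)^2 <= \<bar>b x\<bar> * \<bar>b x\<bar>^2" using True by (simp add: mult_right_mono)
   also have "... = \<bar>b x\<bar> ^ 3" by (simp only: power3_eq_cube power2_eq_square mult.assoc)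
   finally show ?thesis using zero_le_power[of "\<bar>a x\<bar>" 3] by linarith
  next
   case False
   then have "\<bar>b x\<bar>^2 <= \<bar>a x\<bar>^2" by (intro power_mono) auto
   then have "\<bar>a x\<bar> * (b x)^2 <= \<bar>a x\<bar> * \<bar>a x\<bar>^2" by (simp add: mult_left_mono)
   also have "... = \<bar>a x\<bar> ^ 3" by (simp only: power3_eq_cube power2_eq_square mult.assoc)
   finally show ?thesis using zero_le_power[of "\<bar>b x\<bar>" 3] by linarith
  qed
  finally show ?thesis by simp
 qed
 have wL: "?w \<in> L2O" by (rule L2_bound[OF L2_add[OF a3 b3] wm AE_I2[OF wb]])
 have wn: "nrm ?w <= nrm (%x. a x ^ 3) + nrm (%x. b x ^ 3)"
  using L2_norm_mono[OF L2_add[OF a3 b3] wm AE_I2[OF wb]] L2_norm_triangle[OF a3 b3] unfolding n3 by linarith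
 have LL: "(%x. SU l. dda l l x) \<in> L2O" by (rule L2_sum) (rule h1D(2)[OF dda])
 have "(SU l. LI x. dda l l x * ?w x) = inr (%x. SU l. dda l l x) ?w"
  using L2_inner_sum_left[where f = "%l. dda l l" and S = Om and h = ?w and I = UNIV] h1D(2)[OF dda] wL
  by (simp add: L2_inner_def)
 then show ?thesis
  using order_trans[OF L2_Cauchy_Schwarz[OF LL wL] mult_left_mono[OF wn L2_norm_nonneg]] by simp
qed

text \<open>For \<open>b = a\<close> the mixed term has a favourable sign by the last bound of
  \<open>tr_bounds\<close>, so \<open>C2\<close> can be taken as 0.\<close>

lemma weighted_gradient_self:
 assumes a: "h10 a da" and dda: "!!l. h1 (da l) (dda l)"
 shows "(%x. a x * da l x) \<in> L2O"
  "(SU l. (nrm (%x. a x * da l x))^2)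
   <= 2 * (nrm (%x. SU l. dda l l x) * nrm (%x. a x ^ 3))"
proof -
 have c2: "- (SU l. LI x. da l x * ((Ktr d (a x) * Htr' d (a x)) * da l x)) <= 0" if d: "d > 0" for d
 proof -
  have "0 <= (LI x. da l x * ((Ktr d (a x) * Htr' d (a x)) * da l x))" for l
  proof (rule B_nonneg)
   fix x
   show "0 <= da l x * ((Ktr d (a x) * Htr' d (a x)) * da l x)"
    using mult_nonneg_nonneg[OF tr_bounds(10)[OF d] zero_le_square, of "a x" "da l x"] by (simp add: mult_ac)
  qed
  then show ?thesis by (simp add: sum_nonneg)
 qed
 note W = weighted_gradient_bound[OF a a dda laplacian_weight_bound[OF a a dda] c2]
 show "(%x. a x * da l x) \<in> L2O" by (rule W(1))
 show "(SU l. (nrm (%x. a x * da l x))^2)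
   <= 2 * (nrm (%x. SU l. dda l l x) * nrm (%x. a x ^ 3))"
  using W(2) by simp
qed

text \<open>The mixed term is at most twice the product of \<open>a * da l\<close> and
  \<open>b * db l\<close>, so \<open>weighted_gradient_self\<close> for \<open>a\<close> and for
  \<open>b\<close> bounds it by \<open>4 * (Lm * X)\<close>; the Laplacian term adds
  \<open>2 * (Lm * X)\<close>. Applied to two components of a velocity this estimates the convection
  term.\<close>

lemma weighted_gradient_mixed:
 assumes a: "h10 a da" and b: "h10 b db" and dda: "!!l. h1 (da l) (dda l)" and ddb: "!!l. h1 (db l) (ddb l)"
  and La: "nrm (%x. SU l. dda l l x) <= Lm" and Lb: "nrm (%x. SU l. ddb l l x) <= Lm"
  and Xa: "nrm (%x. a x ^ 3) <= X" and Xb: "nrm (%x. b x ^ 3) <= X"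
 shows "(%x. b x * da l x) \<in> L2O" "(SU l. (nrm (%x. b x * da l x))^2) <= 6 * (Lm * X)"
proof -
 note SA = weighted_gradient_self[OF a dda] and SB = weighted_gradient_self[OF b ddb]
 have Lm: "0 <= Lm" using La L2_norm_nonneg order_trans by blast
 have X: "0 <= X" using Xa L2_norm_nonneg order_trans by blast
 have sa: "(SU l. (nrm (%x. a x * da l x))^2) <= 2 * (Lm * X)"
  by (rule order_trans[OF SA(2)]) (intro mult_left_mono mult_mono La Xa Lm, simp_all)
 have sb: "(SU l. (nrm (%x. b x * db l x))^2) <= 2 * (Lm * X)"
  by (rule order_trans[OF SB(2)]) (intro mult_left_mono mult_mono Lb Xb Lm, simp_all)
 have c1: "\<bar>SU l. LI x. dda l l x * (Ktr d (a x) * Htr d (b x))\<bar> <= 2 * (Lm * X)" if d: "d > 0" for d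
 proof -
  have "nrm (%x. SU l. dda l l x) * (nrm (%x. a x ^ 3) + nrm (%x. b x ^ 3)) <= Lm * (X + X)"
   by (intro mult_mono La add_mono Xa Xb Lm) simp
  then show ?thesis using laplacian_weight_bound[OF a b dda d] by simp
 qed
 have c2: "- (SU l. LI x. da l x * ((Ktr d (a x) * Htr' d (b x)) * db l x)) <= 4 * (Lm * X)" if d: "d > 0" for d
 proof -
  have t: "\<bar>LI x. da l x * ((Ktr d (a x) * Htr' d (b x)) * db l x)\<bar>
    <= (nrm (%x. a x * da l x))^2 + (nrm (%x. b x * db l x))^2" for l
  proof -
   have i1: "integrable MO (%x. (a x * da l x)^2 + (b x * db l x)^2)"
    using L2_integrable_power2[OF SA(1)] L2_integrable_power2[OF SB(1)] by (rule Bi_add)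
   have pw: "\<bar>da l x * ((Ktr d (a x) * Htr' d (b x)) * db l x)\<bar> <= (a x * da l x)^2 + (b x * db l x)^2" for x
   proof -
    have "\<bar>Ktr d (a x) * Htr' d (b x)\<bar> <= \<bar>a x\<bar> * (2 * \<bar>b x\<bar>)"
     unfolding abs_mult using tr_bounds[OF d] by (intro mult_mono) auto
    from mult_right_mono[OF this, of "\<bar>da l x\<bar> * \<bar>db l x\<bar>"]
    have "\<bar>da l x * ((Ktr d (a x) * Htr' d (b x)) * db l x)\<bar> <= 2 * \<bar>a x * da l x\<bar> * \<bar>b x * db l x\<bar>"
     by (simp add: abs_mult mult_ac)
    also have "... <= (a x * da l x)^2 + (b x * db l x)^2"
     using sum_squares_bound[of "\<bar>a x * da l x\<bar>" "\<bar>b x * db l x\<bar>"] by simp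
    finally show ?thesis .
   qed
   have "\<bar>LI x. da l x * ((Ktr d (a x) * Htr' d (b x)) * db l x)\<bar>
     <= (LI x. (a x * da l x)^2 + (b x * db l x)^2)"
   proof (rule order_trans[OF integral_abs_bound], rule integral_mono_AE'[OF i1])
    show "AEO x. \<bar>da l x * ((Ktr d (a x) * Htr' d (b x)) * db l x)\<bar> <= (a x * da l x)^2 + (b x * db l x)^2"
     by (rule AE_I2[OF pw])
   qed simp
   also have "... = (nrm (%x. a x * da l x))^2 + (nrm (%x. b x * db l x))^2"
    using L2_integrable_power2[OF SA(1)] L2_integrable_power2[OF SB(1)] by (simp add: L2_norm_power2)
   finally show ?thesis .
  qed
  have "- (SU l. LI x. da l x * ((Ktr d (a x) * Htr' d (b x)) * db l x))
    <= (SU l. (nrm (%x. a x * da l x))^2 + (nrm (%x. b x * db l x))^2)"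
   unfolding sum_negf[symmetric] by (rule sum_mono) (use t in "simp add: abs_le_iff")
  also have "... <= 4 * (Lm * X)" using sa sb by (simp add: sum.distrib)
  finally show ?thesis .
 qed
 note W = weighted_gradient_bound[OF a b dda c1 c2]
 show "(%x. b x * da l x) \<in> L2O" by (rule W(1))
 show "(SU l. (nrm (%x. b x * da l x))^2) <= 6 * (Lm * X)" using W(2) by simp
qed

end

subsection \<open>A defining function of the domain\<close>

lemma Ck_compose_linear:
 fixes f :: "'n::finite fn"
 assumes L: "bounded_linear L"
 shows "Ck k f ==> Ck k (%x. f (L x :: real^'n))"
proof (induction k arbitrary: f)
 case 0
 then show ?case
  using continuous_on_compose2[of UNIV f UNIV L] linear_continuous_on[OF L] by simp
next
 case (Suc k)
 have d: "((%x. f (L x)) has_derivative (%h. SU j. pdiff j f (L x) * L h $ j)) (at x)" for x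
  using Suc.prems has_derivative_compose[OF bounded_linear_imp_has_derivative[OF L] has_derivative_pdiff]
  by simp
 have "pdiff i (%x. f (L x)) = (%x. SU j. pdiff j f (L x) * L (axis i 1) $ j)" for i
  by (rule ext) (rule has_derivative_imp_pdiff[OF d])
 moreover have "Ck k (%x. SU j. pdiff j f (L x) * L (axis i 1) $ j)" for i
  by (intro Ck_sum Ck_mult Ck_const Suc.IH) (use Suc.prems in simp)
 ultimately show ?case using d by (auto simp: differentiable_def)
qed

text \<open>The last clause says that from every boundary point in the ball \<open>h\<close> grows
  with unit speed along a common direction \<open>e\<close>. It is vacuous when the ball misses the
  boundary, and after gluing it forces a nonzero gradient.\<close>

definition local_defining where
 "local_defining Om x r h \<longleftrightarrow> r > 0 & Ck 3 h & (\<forall>y\<in>ball x r. h y > 0 \<longleftrightarrow> y \<in> Om) &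
  (\<exists>e. \<forall>y\<in>ball x r \<inter> frontier Om. \<forall>t. h (y + t *\<^sub>R e) = t)"

lemma local_defining_exists:
 fixes Om :: "(real^'n::finite) set"
 assumes op: "open Om" and bd: "Ck_boundary 3 Om" and x: "x \<in> closure Om"
 shows "\<exists>r h. local_defining Om x r h"
proof (cases "x \<in> Om")
 case True
 then obtain r where r: "r > 0" "ball x r \<subseteq> Om" using op open_contains_ball by blast
 have "ball x r \<inter> frontier Om = {}" using r(2) op by (auto simp: frontier_def interior_open)
 then have "local_defining Om x r (%y. 1)"
  unfolding local_defining_def using r by (auto simp: Ck_const subset_iff)
 then show ?thesis by (intro exI)
next
 case False
 then have "x \<in> frontier Om" using x op by (simp add: frontier_def interior_open)
 then have "\<exists>r>0. \<exists>e \<gamma>. norm e = 1 & Ck 3 \<gamma> &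
    Om \<inter> ball x r = {y \<in> ball x r. y \<bullet> e > \<gamma> (y - (y \<bullet> e) *\<^sub>R e)}"
  by (rule bd[unfolded Ck_boundary_def, THEN bspec])
 then obtain r e \<gamma> where r: "r > 0" and e: "norm e = 1" and \<gamma>: "Ck 3 \<gamma>"
  and eq: "Om \<inter> ball x r = {y \<in> ball x r. y \<bullet> e > \<gamma> (y - (y \<bullet> e) *\<^sub>R e)}"
  by (elim exE conjE)
 define L where "L y = y - (y \<bullet> e) *\<^sub>R e" for y :: "real^'n"
 have L: "bounded_linear L"
  unfolding L_def[abs_def]
  by (rule bounded_linear_sub[OF bounded_linear_ident bounded_linear_compose[OF bounded_linear_scaleR_left bounded_linear_inner_left]])
 define h where "h y = y \<bullet> e - \<gamma> (L y)" for y
 have ee: "e \<bullet> e = 1" using e by (simp add: norm_eq_1)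
 have Ch: "Ck 3 h"
 proof -
  have "Ck 3 (%y. SU i. y $ i * e $ i)" by (intro Ck_sum Ck_mult Ck_coord Ck_const)
  then have "Ck 3 (%y. y \<bullet> e)" by (simp add: inner_vec_def)
  then show ?thesis unfolding h_def by (intro Ck_diff Ck_compose_linear[OF L \<gamma>])
 qed
 have pos: "h y > 0 \<longleftrightarrow> y \<in> Om" if "y \<in> ball x r" for y
 proof -
  have "y \<in> Om \<inter> ball x r \<longleftrightarrow> y \<in> {y \<in> ball x r. y \<bullet> e > \<gamma> (y - (y \<bullet> e) *\<^sub>R e)}"
   by (rule arg_cong[OF eq])
  then show ?thesis using that by (simp add: h_def L_def)
 qed
 have shift: "h (y + t *\<^sub>R e) = h y + t" for y t
 proof -
  have "L (y + t *\<^sub>R e) = L y" by (simp add: L_def inner_add_left ee algebra_simps)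
  then show ?thesis by (simp add: h_def inner_add_left ee)
 qed
 \<comment> \<open>A positive value would put the boundary point into the open set
   \<open>Om\<close>; a negative one would persist at nearby points, some of which belong to
   \<open>Om\<close>.\<close>
 have zero: "h y = 0" if y: "y \<in> ball x r" "y \<in> frontier Om" for y
 proof -
  have "y \<notin> Om" using y(2) op by (simp add: frontier_def interior_open)
  then have "h y <= 0" using pos[OF y(1)] by linarith
  moreover have "h y >= 0"
  proof (rule ccontr)
   assume "\<not> h y >= 0"
   then have "y \<in> {z. h z < 0} \<inter> ball x r" using y(1) by simp
   moreover have "open ({z. h z < 0} \<inter> ball x r)"
    by (intro open_Int open_ball open_Collect_less Ck_imp_continuous[OF Ch] continuous_on_const)
   moreover have "y \<in> closure Om" using y(2) by (simp add: frontier_def)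
   ultimately have "({z. h z < 0} \<inter> ball x r) \<inter> Om ~= {}"
    using open_Int_closure_eq_empty[of "{z. h z < 0} \<inter> ball x r" Om] by blast
   then obtain z where "h z < 0" "z \<in> ball x r" "z \<in> Om" by blast
   then show False using pos[of z] by simp
  qed
  ultimately show ?thesis by simp
 qed
 have "\<forall>y\<in>ball x r \<inter> frontier Om. \<forall>t. h (y + t *\<^sub>R e) = t"
  using zero by (simp add: shift)
 then have "local_defining Om x r h"
  unfolding local_defining_def using pos r Ch by blast
 then show ?thesis by (intro exI)
qed

text \<open>The local functions are added with bump weights. Each has the sign prescribed by
  \<open>Om\<close> wherever its weight is positive, so the sum keeps this sign without any
  normalization. At a boundary point some weight is positive and its \<open>h\<close> grows linearly
  along \<open>e\<close>; the difference quotients of \<open>rr\<close> then stay above a positive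
  number.\<close>

lemma defining_function_exists:
 fixes Om :: "(real^'n::finite) set"
 assumes op: "open Om" and bdd: "bounded Om" and bd: "Ck_boundary 3 Om"
 shows "\<exists>rr. Ck 3 rr & (\<forall>x. rr x > 0 \<longleftrightarrow> x \<in> Om) & (\<forall>x\<in>frontier Om. \<exists>i. pdiff i rr x ~= 0)"
proof -
 have "\<forall>x\<in>closure Om. \<exists>r h. local_defining Om x r h" using local_defining_exists[OF op bd] by blast
 then obtain r h where rh: "!!x. x \<in> closure Om ==> local_defining Om x (r x) (h x)" by metis
 have "compact (closure Om)" using bdd by simp
 moreover have "closure Om \<subseteq> (\<Union>x\<in>closure Om. ball x (r x))"
  using rh unfolding local_defining_def by fastforce
 ultimately obtain A where A: "A \<subseteq> closure Om" "finite A" "closure Om \<subseteq> (\<Union>x\<in>A. ball x (r x))"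
  using compactE_image[of "closure Om" "closure Om" "%x. ball x (r x)"] by (metis open_ball)
 have rA: "r x > 0" "Ck 3 (h x)" "!!y. y \<in> ball x (r x) ==> h x y > 0 \<longleftrightarrow> y \<in> Om"
  "\<exists>e. \<forall>y\<in>ball x (r x) \<inter> frontier Om. \<forall>t. h x (y + t *\<^sub>R e) = t" if "x \<in> A" for x
  using rh[of x] A(1) that unfolding local_defining_def by blast+
 define b where "b x y = bump_fun 0 ((r x)^2 - (SU i. (y $ i - x $ i) * (y $ i - x $ i)))" for x y :: "real^'n"
 have b_eq: "b x y = bump_fun 0 ((r x)^2 - (dist x y)^2)" for x y
  by (simp add: b_def dist_norm norm_minus_commute[of x] power2_norm_eq_inner inner_vec_def)
 have bC: "Ck k (b x)" for k x
  unfolding b_def[abs_def] by (intro Ck_bump_fun Ck_diff Ck_const Ck_sum Ck_mult Ck_coord)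
 have bpos: "b x y > 0" if "x \<in> A" "y \<in> ball x (r x)" for x y
  using that rA(1)[OF that(1)] by (simp add: b_eq bump_fun_pos_iff power_strict_mono)
 have bzero: "b x y = 0" if "x \<in> A" "y \<notin> ball x (r x)" for x y
  using that rA(1)[OF that(1)] by (simp add: b_eq bump_fun_eq_0_iff power_mono)
 have bnn: "b x y >= 0" for x y by (simp add: b_eq bump_fun_nonneg)
 define rr where "rr y = (\<Sum>x\<in>A. b x y * h x y)" for y
 have C: "Ck 3 rr" unfolding rr_def by (intro Ck_sum Ck_mult bC rA(2))
 have term_nn: "b x y * h x y >= 0" if "x \<in> A" "y \<in> Om" for x y
  using rA(3)[OF that(1), of y] bzero[OF that(1), of y] bnn[of x y] that(2)
  by (cases "y \<in> ball x (r x)") (auto intro!: mult_nonneg_nonneg)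
 have term_np: "b x y * h x y <= 0" if "x \<in> A" "y \<notin> Om" for x y
 proof (cases "y \<in> ball x (r x)")
  case True
  then have "h x y <= 0" using rA(3)[OF that(1) True] that(2) by linarith
  then show ?thesis using bnn[of x y] by (rule mult_nonneg_nonpos[rotated])
 qed (simp add: bzero[OF that(1)])
 have pos: "rr y > 0 \<longleftrightarrow> y \<in> Om" for y
 proof
  assume y: "y \<in> Om"
  then have "y \<in> closure Om" using closure_subset by blast
  then obtain x where x: "x \<in> A" "y \<in> ball x (r x)" using A(3) by blast
  have "0 < b x y * h x y" using bpos[OF x] rA(3)[OF x] y by simp
  also have "... <= rr y" unfolding rr_def
   by (rule member_le_sum[of x A "%x. b x y * h x y"]) (use x A(2) term_nn y in auto)
  finally show "rr y > 0" .
 next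
  assume "rr y > 0"
  show "y \<in> Om"
  proof (rule ccontr)
   assume "y \<notin> Om"
   then have "rr y <= 0" unfolding rr_def by (intro sum_nonpos term_np)
   with \<open>rr y > 0\<close> show False by simp
  qed
 qed
 have "\<exists>i. pdiff i rr y ~= 0" if y: "y \<in> frontier Om" for y
 proof (rule ccontr)
  assume "\<nexists>i. pdiff i rr y ~= 0"
  then have z: "pdiff i rr y = 0" for i by blast
  have "y \<in> closure Om" "y \<notin> Om" using y op by (simp_all add: frontier_def interior_open)
  then obtain x where x: "x \<in> A" "y \<in> ball x (r x)" using A(3) by blast
  obtain e where e: "!!t. h x (y + t *\<^sub>R e) = t" using rA(4)[OF x(1)] x(2) y by blast
  have "((%t. y + t *\<^sub>R e) \<longlongrightarrow> y + 0 *\<^sub>R e) (at_right 0)" by (intro tendsto_intros)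
  then have cl: "((%t. y + t *\<^sub>R e) \<longlongrightarrow> y) (at_right 0)" by simp
  then have ball: "\<forall>\<^sub>F t in at_right 0. y + t *\<^sub>R e \<in> ball x (r x)"
   using x(2) by (rule topological_tendstoD[OF _ open_ball])
  have "rr differentiable (at y)" using C by (simp add: numeral_3_eq_3)
  from has_derivative_pdiff[OF this] have D: "(rr has_derivative (%h. 0)) (at y)" by (simp add: z)
  have "((%t. y + t *\<^sub>R e) has_derivative (%h. h *\<^sub>R e)) (at 0)" by (auto intro!: derivative_eq_intros)
  from has_derivative_compose[OF this, of rr "%h. 0"] D have "((%t. rr (y + t *\<^sub>R e)) has_derivative (%h. 0)) (at 0)"
   by simp
  then have "((%t. rr (y + t *\<^sub>R e)) has_real_derivative 0) (at 0)"
   by (rule has_derivative_imp_has_field_derivative) simp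
  then have "((%t. (rr (y + t *\<^sub>R e) - rr y) / t) \<longlongrightarrow> 0) (at 0)" by (simp add: DERIV_def)
  then have l0: "((%t. (rr (y + t *\<^sub>R e) - rr y) / t) \<longlongrightarrow> 0) (at_right 0)"
   by (rule filterlim_mono) (simp_all add: at_within_le_at)
  have "isCont (b x) y" using Ck_imp_continuous[OF bC[of 0 x]] by (simp add: continuous_on_eq_continuous_at)
  then have lb: "((%t. b x (y + t *\<^sub>R e)) \<longlongrightarrow> b x y) (at_right 0)" by (rule isCont_tendsto_compose[OF _ cl])
  have "rr y <= 0" using pos[of y] \<open>y \<notin> Om\<close> by linarith
  \<comment> \<open>For small positive \<open>t\<close> the point lies in \<open>Om\<close>, where
    all summands are nonnegative, and the summand of \<open>x\<close> is its weight times
    \<open>t\<close>.\<close>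
  have "\<forall>\<^sub>F t in at_right 0. b x (y + t *\<^sub>R e) <= (rr (y + t *\<^sub>R e) - rr y) / t"
   using ball eventually_at_right_less[of 0]
  proof eventually_elim
   case (elim t)
   have "y + t *\<^sub>R e \<in> Om" using rA(3)[OF x(1) elim(1)] elim(2) by (simp add: e)
   have "b x (y + t *\<^sub>R e) * t = b x (y + t *\<^sub>R e) * h x (y + t *\<^sub>R e)" by (simp add: e)
   also have "... <= rr (y + t *\<^sub>R e)" unfolding rr_def
    by (rule member_le_sum[of x A "%x. b x (y + t *\<^sub>R e) * h x (y + t *\<^sub>R e)"])
     (use x A(2) term_nn \<open>y + t *\<^sub>R e \<in> Om\<close> in auto)
   also have "... <= rr (y + t *\<^sub>R e) - rr y" using \<open>rr y <= 0\<close> by simp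
   finally show ?case using elim(2) by (simp add: pos_le_divide_eq)
  qed
  from tendsto_le[OF _ l0 lb this] have "b x y <= 0" by simp
  then show False using bpos[OF x] by simp
 qed
 with C pos show ?thesis by blast
qed

subsection \<open>Boundary strips\<close>

text \<open>The square of the positive part is a simple C1 truncation, and C1 is the regularity that
  \<open>C1c\<close> and \<open>C1_on\<close> ask of cutoffs and strip weights.\<close>

definition pos2 :: "real => real" where "pos2 r = (max 0 r)^2"

lemma pos2_DERIV: "(pos2 has_real_derivative 2 * max 0 r) (at r)"
proof (cases "r = 0")
 case True
 have "((%h. pos2 h / h) \<longlongrightarrow> 0) (at 0)"
 proof (rule Lim_null_comparison)
  show "\<forall>\<^sub>F h in at 0. norm (pos2 h / h) <= \<bar>h\<bar>"
   by (rule always_eventually) (auto simp: pos2_def power2_eq_square max_def)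
  show "((%h::real. \<bar>h\<bar>) \<longlongrightarrow> 0) (at 0)" by (rule tendsto_rabs_zero[OF tendsto_ident_at])
 qed
 then show ?thesis using True by (simp add: DERIV_def pos2_def)
next
 case False
 then consider "r > 0" | "r < 0" by linarith
 then show ?thesis
 proof cases
  case 1
  have "((%r. r^2) has_real_derivative 2 * max 0 r) (at r)"
   using 1 by (auto intro!: derivative_eq_intros)
  then show ?thesis
   by (rule has_field_derivative_transform_within_open[where S = "{0<..}"]) (use 1 in "auto simp: pos2_def")
 next
  case 2
  have "((%r. 0) has_real_derivative 2 * max 0 r) (at r)" using 2 by simp
  then show ?thesis
   by (rule has_field_derivative_transform_within_open[where S = "{..<0}"]) (use 2 in "auto simp: pos2_def")
 qed
qed

text \<open>A C1 step from 0 for \<open>r <= 1\<close> to 1 for \<open>r >= 2\<close>. Thus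
  \<open>cut (m * rr x)\<close> has compact support in \<open>Om\<close> and differs from 1 inside
  \<open>Om\<close> only on the strip \<open>rr x < 2 / m\<close>.\<close>

definition cut :: "real => real" where "cut r = 1 - pos2 (1 - pos2 (r - 1))"
definition cut' :: "real => real" where "cut' r = 4 * max 0 (1 - pos2 (r - 1)) * max 0 (r - 1)"

lemma cut_DERIV: "(cut has_real_derivative cut' r) (at r)"
proof -
 have 1: "((%r. 1 - pos2 (r - 1)) has_real_derivative - (2 * max 0 (r - 1))) (at r)"
  using DERIV_diff[OF DERIV_const[of 1] DERIV_chain2[OF pos2_DERIV DERIV_diff[OF DERIV_ident DERIV_const[of 1]]]] by simp
 show ?thesis
  using DERIV_diff[OF DERIV_const[of 1] DERIV_chain2[OF pos2_DERIV 1]] 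
  unfolding cut_def[abs_def] cut'_def by (simp add: mult.assoc)
qed

lemma cut'_continuous: "continuous_on A cut'"
 unfolding cut'_def[abs_def] pos2_def by (intro continuous_intros)

lemma cut_bounds:
 "0 <= cut r" "cut r <= 1" "r <= 1 ==> cut r = 0" "r >= 2 ==> cut r = 1"
 "\<bar>cut' r\<bar> <= 4" "r >= 2 ==> cut' r = 0" "0 <= cut' r"
proof -
 let ?p = "pos2 (r - 1)"
 have p: "0 <= ?p" by (simp add: pos2_def)
 have "max 0 (1 - ?p) <= 1" "0 <= max 0 (1 - ?p)" using p by auto
 then have "(max 0 (1 - ?p))^2 <= 1" by (simp add: power_le_one)
 then show "0 <= cut r" "cut r <= 1" by (simp_all add: cut_def pos2_def[of "1 - _"])
 show "r <= 1 ==> cut r = 0" by (simp add: cut_def pos2_def)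
 have big: "?p >= 1" if "r >= 2"
  using that by (simp add: pos2_def)
 show "r >= 2 ==> cut r = 1" using big by (simp add: cut_def pos2_def[of "1 - _"])
 show z: "r >= 2 ==> cut' r = 0" using big by (simp add: cut'_def)
 show nn: "0 <= cut' r" by (simp add: cut'_def)
 show "\<bar>cut' r\<bar> <= 4"
 proof (cases "r >= 2")
  case False
  have "max 0 (1 - ?p) * max 0 (r - 1) <= 1 * 1" by (rule mult_mono) (use p False in auto)
  then show ?thesis using nn by (simp add: cut'_def)
 qed (simp add: z)
qed

section \<open>Calculus near the boundary with a C3 defining function\<close>

locale strip_domain = sobolev_domain Om for Om :: "(real^'n::finite) set" +
 fixes rr :: "'n fn"
 assumes rho_Ck: "Ck 3 rr" and rho_pos: "rr x > 0 \<longleftrightarrow> x \<in> Om"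
  and rho_grad: "x \<in> frontier Om ==> \<exists>i. pdiff i rr x ~= 0"
begin

definition N where "N i = pdiff i rr"
definition H where "H i j = pdiff j (N i)"
text \<open>The squared gradient of \<open>rr\<close> may vanish inside \<open>Om\<close>. Adding
  \<open>rr\<close> makes \<open>q\<close> positive on the closure and leaves the boundary values
  unchanged; wherever the two are exchanged, the error carries the factor \<open>rr\<close> and
  vanishes on the boundary.\<close>

definition q where "q x = (SU i. N i x * N i x) + rr x"

lemma N_Ck: "Ck 2 (N i)"
 using rho_Ck by (simp add: N_def numeral_3_eq_3 numeral_2_eq_2)

lemma H_Ck: "Ck 1 (H i j)"
 using N_Ck[of i] by (simp add: H_def numeral_2_eq_2)

lemma rho_C1: "C1_on UNIV rr N"
 using Ck_imp_C1_on[of 2 rr] rho_Ck by (simp add: N_def[abs_def])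

lemma N_C1: "C1_on UNIV (N i) (H i)"
 using Ck_imp_C1_on[of 1 "N i"] N_Ck[of i] by (simp add: H_def[abs_def] numeral_2_eq_2)

lemma H_C1: "C1_on UNIV (H i j) (%l. pdiff l (H i j))"
 using Ck_imp_C1_on[of 0 "H i j"] H_Ck[of i j] by simp

lemma H_symmetric: "H i j x = H j i x"
 unfolding H_def N_def by (rule pdiff_commute[OF Ck_mono[OF _ rho_Ck]]) simp

lemma q_C1: "C1_on UNIV q (%l x. (SU i. N i x * H i l x + H i l x * N i x) + N l x)"
 unfolding q_def[abs_def] by (intro C1_on_add C1_on_sum C1_on_mult N_C1 rho_C1)

lemmas rho_cont = C1_on_continuous[OF rho_C1] and N_cont = C1_on_continuous[OF N_C1]
 and H_cont = C1_on_continuous[OF H_C1] and q_cont = C1_on_continuous[OF q_C1]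

lemma rho_closure: "x \<in> closure Om ==> 0 <= rr x"
proof -
 assume x: "x \<in> closure Om"
 have "Om \<subseteq> {x. 0 <= rr x}" using rho_pos by (auto intro: less_imp_le)
 moreover have "closed {x. 0 <= rr x}" by (intro closed_Collect_le continuous_on_const rho_cont)
 ultimately show ?thesis using x closure_minimal by blast
qed

lemma N_square_le_q: "x \<in> Om ==> (SU i. N i x * N i x) <= q x"
 using rho_pos[of x] by (simp add: q_def)

lemma q_pos: assumes "x \<in> closure Om" shows "q x > 0"
proof (cases "x \<in> Om")
 case True
 have "(SU i. N i x * N i x) >= 0" by (simp add: sum_nonneg)
 then show ?thesis using rho_pos[of x] True by (simp add: q_def)
next
 case False
 then have "x \<in> frontier Om" using assms open_Omega by (simp add: frontier_def interior_open)
 from rho_grad[OF this] obtain i where "N i x ~= 0" by (auto simp: N_def)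
 then have "0 < N i x * N i x" by (metis not_real_square_gt_zero)
 also have "... <= (SU i. N i x * N i x)" by (rule member_le_sum) auto
 finally show ?thesis using rho_closure[OF assms] by (simp add: q_def)
qed

lemma continuous_bounded: "continuous_on UNIV f ==> \<exists>B>0. \<forall>x\<in>closure Om. \<bar>f x\<bar> <= (B::real)"
proof -
 assume "continuous_on UNIV f"
 then have "bounded (f ` closure Om)"
  by (intro compact_imp_bounded compact_continuous_image compact_closure_Omega) (rule continuous_on_subset, auto)
 then obtain B where "B > 0" "\<forall>y\<in>f ` closure Om. norm y <= B" unfolding bounded_pos by blast
 then show ?thesis by (intro exI[of _ B]) auto
qed

lemma q_lower: "\<exists>c>0. \<forall>x\<in>closure Om. c <= q x"
proof (cases "closure Om = {}")
 case True then show ?thesis by (intro exI[of _ 1]) simp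
next
 case False
 obtain x where "x \<in> closure Om" "\<forall>y\<in>closure Om. q x <= q y"
  using continuous_attains_inf[OF compact_closure_Omega False continuous_on_subset[OF q_cont subset_UNIV]] by blast
 then show ?thesis using q_pos by blast
qed

lemma rho_bounds:
 "\<exists>c b. 0 < c & 0 < b & (\<forall>x\<in>closure Om. c <= q x & (SU i. N i x * N i x) <= b & \<bar>SU i. H i i x\<bar> <= b
  & (\<forall>i. \<bar>N i x\<bar> <= b))"
proof -
 obtain c where c: "c > 0" "\<forall>x\<in>closure Om. c <= q x" using q_lower by blast
 define F where "F x = (SU i. N i x * N i x) + \<bar>SU i. H i i x\<bar> + (SU i. \<bar>N i x\<bar>)" for x
 have "continuous_on UNIV F"
  unfolding F_def[abs_def] by (intro continuous_on_add continuous_on_sum continuous_on_mult continuous_on_rabs N_cont H_cont)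
 then obtain b where b: "b > 0" "\<forall>x\<in>closure Om. \<bar>F x\<bar> <= b" using continuous_bounded by blast
 have "c <= q x & (SU i. N i x * N i x) <= b & \<bar>SU i. H i i x\<bar> <= b & (\<forall>i. \<bar>N i x\<bar> <= b)"
  if x: "x \<in> closure Om" for x
 proof -
  have 1: "0 <= (SU i. N i x * N i x)" "0 <= (SU i. \<bar>N i x\<bar>)" by (simp_all add: sum_nonneg)
  have 2: "\<bar>N i x\<bar> <= (SU i. \<bar>N i x\<bar>)" for i by (rule member_le_sum) auto
  have 3: "F x <= b" using b(2) x by (meson abs_le_D1)
  have 4: "c <= q x" using c(2) x by (rule bspec)
  have "\<bar>N i x\<bar> <= b" for i using 1 2[of i] 3 unfolding F_def by linarith
  moreover have "(SU i. N i x * N i x) <= b" "\<bar>SU i. H i i x\<bar> <= b"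
   using 1 3 unfolding F_def by linarith+
  ultimately show ?thesis using 4 by (intro conjI allI)
 qed
 then show ?thesis using b(1) c(1) by (intro exI[of _ c] exI[of _ b]) simp
qed

lemma measurable_Omega: "continuous_on UNIV f ==> f \<in> borel_measurable MO" for f :: "_ => real"
 by (rule continuous_imp_measurable_on_sets_lebesgue[OF continuous_on_subset[OF _ subset_UNIV] sets_Omega])

lemma rho_measurable [measurable]: "rr \<in> borel_measurable MO"
 by (rule measurable_Omega[OF rho_cont])

lemma cut_rho_C1: "C1_on UNIV (%x. cut (m * rr x)) (%i x. m * cut' (m * rr x) * N i x)"
proof -
 have "((%y. cut (m * y)) has_real_derivative m * cut' (m * y)) (at y)" for y
  using DERIV_chain2[OF cut_DERIV DERIV_cmult[OF DERIV_ident], of m y] by (simp add: mult.commute)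
 moreover have "continuous_on A (%y. m * cut' (m * y))" for A
  by (intro continuous_intros continuous_on_compose2[OF cut'_continuous[of UNIV]]) auto
 ultimately show ?thesis by (rule C1_on_compose[OF rho_C1])
qed

lemma cut_C1c:
 assumes m: "m > 0" shows "C1c Om (%x. cut (m * rr x)) (%i x. m * cut' (m * rr x) * N i x)"
 unfolding C1c_def
proof (intro conjI exI[of _ "closure Om \<inter> {x. 1 / m <= rr x}"] allI impI)
 show "compact (closure Om \<inter> {x. 1 / m <= rr x})"
  by (intro compact_Int_closed compact_closure_Omega closed_Collect_le continuous_on_const rho_cont)
 show "closure Om \<inter> {x. 1 / m <= rr x} \<subseteq> Om"
 proof
  fix x assume "x \<in> closure Om \<inter> {x. 1 / m <= rr x}"
  then have "1 / m <= rr x" by simp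
  then have "0 < rr x" using m by (meson less_le_trans zero_less_divide_1_iff)
  then show "x \<in> Om" using rho_pos by blast
 qed
 fix x assume x: "x \<notin> closure Om \<inter> {x. 1 / m <= rr x}"
 have "rr x < 1 / m"
 proof (cases "x \<in> Om")
  case True
  then show ?thesis using x closure_subset[of Om] by auto
 next
  case False
  then have "rr x <= 0" using rho_pos[of x] by linarith
  then show ?thesis using m by (meson le_less_trans zero_less_divide_1_iff)
 qed
 then have "m * rr x <= 1" using m by (simp add: pos_less_divide_eq mult.commute)
 then show "cut (m * rr x) = 0" by (rule cut_bounds(3))
qed (rule cut_rho_C1)

definition loc :: "real => 'n fn => 'n fn" where
 "loc s f x = (if rr x < s then f x else 0)"

lemma loc_L2: assumes "f \<in> L2O"
 shows "loc s f \<in> L2O" "nrm (loc s f) <= nrm f"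
proof -
 have m: "loc s f \<in> borel_measurable MO"
  unfolding loc_def[abs_def] using L2D(1)[OF assms] by measurable
 have ae: "AEO x. norm (loc s f x) <= norm (f x)" by (rule AE_I2) (simp add: loc_def)
 show "loc s f \<in> L2O" "nrm (loc s f) <= nrm f"
  by (rule L2_bound[OF assms m ae], rule L2_norm_mono[OF assms m ae])
qed

lemma loc_mono:
 assumes "f \<in> L2O" "g \<in> L2O" "s <= t" "!!x. x \<in> Om ==> rr x < s ==> \<bar>f x\<bar> <= \<bar>g x\<bar>"
 shows "nrm (loc s f) <= nrm (loc t g)"
 by (rule L2_norm_mono[OF loc_L2(1)[OF assms(2)] L2D(1)[OF loc_L2(1)[OF assms(1)]]])
  (rule AE_I2, use assms(3,4) in "auto simp: loc_def")

lemma loc_tendsto: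
 assumes "f \<in> L2O" shows "(%m. nrm (loc (k / real (Suc m)) f)) ~~> 0"
proof -
 have "(%m. LI x. (norm (loc (k / real (Suc m)) f x))^2) ~~> (LI x. 0)"
 proof (rule integral_dominated_convergence)
  show "integrable MO (%x. (norm (f x))^2)" by (rule L2D(2)[OF assms])
  show "(%x. (norm (loc (k / real (Suc m)) f x))^2) \<in> borel_measurable MO" for m
   using L2D(1)[OF loc_L2(1)[OF assms]] by measurable
  show "AEO x. norm ((norm (loc (k / real (Suc m)) f x))^2) <= (norm (f x))^2" for m
   by (rule AE_I2) (simp add: loc_def)
  show "AEO x. (%m. (norm (loc (k / real (Suc m)) f x))^2) ~~> 0"
  proof (rule AE_I2)
   fix x assume "x \<in> space MO"
   then have "rr x > 0" using rho_pos[of x] by simp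
   have "(%m. k * inverse (real (Suc m))) ~~> k * 0" by (intro tendsto_mult_left LIMSEQ_inverse_real_of_nat)
   then have "(%m. k / real (Suc m)) ~~> 0" by (simp add: divide_inverse)
   then have "\<forall>\<^sub>F m in sequentially. k / real (Suc m) < rr x" using \<open>rr x > 0\<close> by (rule order_tendstoD(2))
   then have "\<forall>\<^sub>F m in sequentially. (norm (loc (k / real (Suc m)) f x))^2 = 0"
    by eventually_elim (simp add: loc_def)
   then show "(%m. (norm (loc (k / real (Suc m)) f x))^2) ~~> 0" by (rule tendsto_eventually)
  qed
 qed simp
 then have "(%m. sqrt ((nrm (loc (k / real (Suc m)) f))^2)) ~~> sqrt 0"
  unfolding L2_norm_power2 by (intro tendsto_real_sqrt) simp
 then show ?thesis by simp
qed

lemma cut_tendsto: "x \<in> Om ==> (%m. cut (real (Suc m) * rr x)) ~~> 1"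
proof (rule tendsto_eventually)
 assume "x \<in> Om"
 then have "rr x > 0" using rho_pos by blast
 have "filterlim (%m. real (Suc m) * rr x) at_top sequentially"
  by (intro filterlim_at_top_mult_tendsto_pos[OF tendsto_const \<open>rr x > 0\<close>] filterlim_compose[OF filterlim_real_sequentially filterlim_Suc])
 then have "\<forall>\<^sub>F m in sequentially. 2 <= real (Suc m) * rr x" by (simp add: filterlim_at_top)
 then show "\<forall>\<^sub>F m in sequentially. cut (real (Suc m) * rr x) = 1"
  by eventually_elim (rule cut_bounds(4))
qed

lemma cut_measurable: "(%x. cut (m * rr x)) \<in> borel_measurable MO"
 by (rule measurable_Omega[OF C1_on_continuous[OF cut_rho_C1]])

lemma cut_integral_tendsto:
 assumes "integrable MO F"
 shows "(%m. LI x. cut (real (Suc m) * rr x) * F x) ~~> (LI x. (F x :: real))"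
  "integrable MO (%x. cut (k * rr x) * F x)"
proof -
 have [measurable]: "F \<in> borel_measurable MO" by (rule borel_measurable_integrable[OF assms])
 note cut_measurable[measurable]
 have b: "\<bar>cut r * F x\<bar> <= \<bar>F x\<bar>" for r x
  using mult_right_mono[OF cut_bounds(2)[of r] abs_ge_zero[of "F x"]] cut_bounds(1)[of r] by (simp add: abs_mult)
 show "integrable MO (%x. cut (k * rr x) * F x)"
  by (rule Bi_bound[OF assms]) (use b in auto)
 show "(%m. LI x. cut (real (Suc m) * rr x) * F x) ~~> (LI x. F x)"
 proof (rule integral_dominated_convergence[where w = "%x. \<bar>F x\<bar>"])
  show "AEO x. (%m. cut (real (Suc m) * rr x) * F x) ~~> F x"
   by (rule AE_I2) (use tendsto_mult[OF cut_tendsto tendsto_const] in force)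
 qed (use assms b in auto)
qed

end

text \<open>In the application \<open>t\<close> is \<open>s - rr\<close> cut off at 0,
  \<open>v\<close> the derivative of \<open>f\<close> along the gradient of \<open>rr\<close>,
  \<open>n\<close> the squared gradient and \<open>L\<close> the Laplacian of \<open>rr\<close>. The
  term with \<open>n\<close> is at most \<open>- c * t * f^2\<close>; Young's inequality for the
  term with \<open>v\<close> and the smallness of \<open>s * b\<close> for the term with
  \<open>L\<close> each give back a quarter of it.\<close>

lemma strip_pointwise:
 fixes t :: real
 assumes t: "0 <= t" "t <= s" and c: "c > 0" and sb: "s * b <= c / 4" and n: "t > 0 ==> c / 2 <= n"
  and v: "v^2 <= b * D" and L: "\<bar>L\<bar> <= b"
 shows "2 * t^2 * f * v + t^2 * L * f^2 - 2 * t * n * f^2 <= - (c / 2) * t * f^2 + 4 * b / c * s ^ 3 * D"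
proof -
 have bD: "0 <= b * D" using v zero_le_power2 by (rule order_trans[rotated])
 have b0: "0 <= b" using L by linarith
 have "0 <= (c * f - 4 * t * v)^2 / (4 * c)" using c by simp
 also have "... = c / 4 * f^2 - 2 * t * f * v + 4 / c * t^2 * v^2" using c
  by (simp add: field_simps power2_eq_square)
 finally have "2 * t * f * v <= c / 4 * f^2 + 4 / c * t^2 * v^2" by simp
 from mult_left_mono[OF this t(1)]
 have 1: "2 * t^2 * f * v <= c / 4 * t * f^2 + 4 / c * t ^ 3 * v^2"
  by (simp add: power2_eq_square power3_eq_cube algebra_simps)
 have "t ^ 3 * v^2 <= s ^ 3 * (b * D)" by (rule mult_mono) (use t v in "auto intro: power_mono")
 then have 2: "4 / c * t ^ 3 * v^2 <= 4 * b / c * s ^ 3 * D" using c by (simp add: field_simps)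
 have "t * L <= s * b" using mult_mono[of t s "\<bar>L\<bar>" b] t L mult_left_mono[of L "\<bar>L\<bar>" t] by linarith
 then have "t * f^2 * (t * L) <= t * f^2 * (c / 4)" using sb t by (intro mult_left_mono) auto
 then have 3: "t^2 * L * f^2 <= c / 4 * t * f^2" by (simp add: power2_eq_square algebra_simps)
 have 4: "c * t * f^2 <= 2 * t * n * f^2"
 proof (cases "t > 0")
  case True
  from mult_right_mono[OF n[OF this], of "2 * t * f^2"] True show ?thesis by (simp add: algebra_simps)
 qed (use t in simp)
 show ?thesis using 1 2 3 4 by linarith
qed

context strip_domain
begin

lemma gnorm_power2: "(gnorm df)^2 = (SU i. (nrm (df i))^2)"
 by (simp add: gnorm_def sum_nonneg)

lemma L2_norm_power2_real: "(L2_norm S f)^2 = (LINT x|lebesgue_on S. (f x)^2)" for f :: "'n fn"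
 by (simp add: L2_norm_power2)

text \<open>A Hardy type inequality from the divergence of \<open>k * t^2 * f^2 * N\<close> with
  \<open>t = max 0 (s - rr)\<close> and \<open>k = cut (m * rr)\<close>, whose integral is zero. The
  derivative of \<open>t^2\<close> produces the weight on the left; the derivative of
  \<open>k\<close> produces the last term on the right, which measures \<open>f\<close> next to the
  boundary.\<close>

lemma strip_cut_estimate:
 assumes f: "h1 f df" and s: "0 < s" "s <= c / 2" "s * b <= c / 4" and c: "c > 0" and m: "m > 0"
  and bd: "!!x. x \<in> Om ==> c <= q x & (SU i. N i x * N i x) <= b & \<bar>SU i. H i i x\<bar> <= b"
 shows "integrable MO (%x. max 0 (s - rr x) * (f x)^2)"
  "c / 2 * (LI x. cut (m * rr x) * (max 0 (s - rr x) * (f x)^2))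
  <= 4 * b / c * s ^ 3 * (gnorm df)^2 + 4 * m * b * s^2 * (nrm (loc (2 / m) f))^2"
proof -
 define k where "k x = cut (m * rr x)" for x
 define t where "t x = max 0 (s - rr x)" for x
 have hC: "C1_on UNIV (%x. pos2 (s - rr x)) (%i x. 2 * max 0 (s - rr x) * (0 - N i x))"
  by (rule C1_on_compose[OF C1_on_diff[OF C1_on_const rho_C1] pos2_DERIV]) (intro continuous_intros)
 note C = C1c_mult[OF cut_C1c[OF m] C1_on_mult[OF hC N_C1]]
 define w where "w l x = k x * (pos2 (s - rr x) * N l x)" for l x
 define dw where "dw l x = k x * (pos2 (s - rr x) * H l l x + 2 * max 0 (s - rr x) * (0 - N l x) * N l x)
  + m * cut' (m * rr x) * N l x * (pos2 (s - rr x) * N l x)" for l x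
 have ids: "(LI x. df l x * (w l x * f x)) = - (LI x. f x * (w l x * df l x + dw l x * f x))" for l
  using h1_product[OF f f C[of l], of l] unfolding w_def dw_def k_def .
 have wL: "(%x. w l x * f x) \<in> L2O" "(%x. w l x * df l x + dw l x * f x) \<in> L2O" for l
  using h1D(1)[OF h1_mult[OF f C1_on_subset[OF C1c_C1_on[OF C[of l]] subset_UNIV]]]
   h1D(2)[OF h1_mult[OF f C1_on_subset[OF C1c_C1_on[OF C[of l]] subset_UNIV]], of l]
  unfolding w_def dw_def k_def by simp_all
 note i1 = L2_integrable_mult[OF h1D(2)[OF f] wL(1)] and i2 = L2_integrable_mult[OF h1D(1)[OF f] wL(2)]
 define E where "E x = (SU l. df l x * (w l x * f x) + f x * (w l x * df l x + dw l x * f x))" for x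
 have Ei: "integrable MO E" unfolding E_def[abs_def]
  by (intro Bi_sum Bi_add i1 i2)
 have E0: "(LI x. E x) = 0"
  unfolding E_def by (simp add: B_sum B_add i1 i2 ids)
 note f2 = L2_integrable_power2[OF h1D(1)[OF f]]
 have [measurable]: "f \<in> borel_measurable MO" by (rule L2D(1)[OF h1D(1)[OF f]])
 show ti: "integrable MO (%x. max 0 (s - rr x) * (f x)^2)"
 proof (rule Bi_bound[OF integrable_mult_right[OF f2, of s]])
  show "AEO x. norm (max 0 (s - rr x) * (f x)^2) <= norm (s * (f x)^2)"
  proof (rule AE_I2)
   fix x assume "x \<in> space MO"
   then have "max 0 (s - rr x) <= s" using rho_pos[of x] s(1) by simp
   then have "max 0 (s - rr x) * (f x)^2 <= s * (f x)^2" by (rule mult_right_mono) simp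
   then show "norm (max 0 (s - rr x) * (f x)^2) <= norm (s * (f x)^2)" using s(1) by (simp add: abs_mult)
  qed
 qed measurable
 define D where "D x = (SU l. (df l x)^2)" for x
 have Di: "integrable MO D" unfolding D_def[abs_def]
  by (intro Bi_sum L2_integrable_power2 h1D(2)[OF f])
 have DG: "(LI x. D x) = (gnorm df)^2"
  unfolding D_def gnorm_power2 L2_norm_power2_real
  by (intro B_sum L2_integrable_power2 h1D(2)[OF f])
 note li = L2_integrable_power2[OF loc_L2(1)[OF h1D(1)[OF f], of "2 / m"]]
 have ki: "integrable MO (%x. k x * (max 0 (s - rr x) * (f x)^2))"
  unfolding k_def by (rule cut_integral_tendsto(2)[OF ti])
 have "(LI x. c / 2 * (k x * (max 0 (s - rr x) * (f x)^2)) + E x)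
  <= (LI x. 4 * b / c * s ^ 3 * D x + 4 * m * b * s^2 * (loc (2 / m) f x)^2)"
 proof (rule integral_mono)
  fix x assume "x \<in> space MO"
  then have x: "x \<in> Om" by simp
  define n where "n = (SU i. N i x * N i x)"
  define v where "v = (SU l. N l x * df l x)"
  define L where "L = (SU i. H i i x)"
  have rp: "rr x > 0" using x rho_pos by blast
  have b: "n <= b" "\<bar>L\<bar> <= b" "c <= n + rr x" and n0: "0 <= n"
   using bd[OF x] by (simp_all add: n_def L_def q_def sum_nonneg)
  have tx: "0 <= t x" "t x <= s" using rp s(1) by (simp_all add: t_def)
  have E: "E x = k x * (2 * (t x)^2 * f x * v + (t x)^2 * L * (f x)^2 - 2 * t x * n * (f x)^2)
   + m * cut' (m * rr x) * n * (t x)^2 * (f x)^2"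
  proof -
   have "E x = (SU l. k x * (2 * (t x)^2 * f x) * (N l x * df l x) + k x * (t x)^2 * (f x)^2 * H l l x
    + (m * cut' (m * rr x) * (t x)^2 * (f x)^2 - k x * 2 * t x * (f x)^2) * (N l x * N l x))"
    unfolding E_def w_def dw_def t_def pos2_def
    by (rule sum.cong[OF refl]) (simp add: algebra_simps power2_eq_square)
   also have "... = k x * (2 * (t x)^2 * f x) * v + k x * (t x)^2 * (f x)^2 * L
    + (m * cut' (m * rr x) * (t x)^2 * (f x)^2 - k x * 2 * t x * (f x)^2) * n"
    by (simp add: sum.distrib sum_distrib_left v_def L_def n_def)
   finally show ?thesis by (simp add: algebra_simps)
  qed
  have "v^2 <= (SU l. (N l x)^2) * D x" unfolding v_def D_def by (rule Cauchy_Schwarz_ineq_sum)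
  also have "... <= b * D x" by (rule mult_right_mono) (use b(1) in "simp_all add: n_def D_def power2_eq_square sum_nonneg")
  finally have v: "v^2 <= b * D x" .
  have nt: "c / 2 <= n" if "t x > 0" using that b(3) s(2) by (auto simp: t_def max_def split: if_splits)
  note sp = strip_pointwise[OF tx c s(3) nt v b(2), of "f x"]
  have kx: "0 <= k x" "k x <= 1" unfolding k_def by (rule cut_bounds)+
  have pos: "0 <= 4 * b / c * s ^ 3 * D x" using b(1) n0 c s(1) by (simp add: D_def sum_nonneg)
  have "k x * (2 * (t x)^2 * f x * v + (t x)^2 * L * (f x)^2 - 2 * t x * n * (f x)^2)
    <= k x * (- (c / 2) * t x * (f x)^2) + k x * (4 * b / c * s ^ 3 * D x)"
   unfolding distrib_left[symmetric] by (rule mult_left_mono[OF sp kx(1)])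
  also have "k x * (4 * b / c * s ^ 3 * D x) <= 4 * b / c * s ^ 3 * D x"
   using mult_right_mono[OF kx(2) pos] by simp
  finally have A: "k x * (2 * (t x)^2 * f x * v + (t x)^2 * L * (f x)^2 - 2 * t x * n * (f x)^2)
    <= k x * (- (c / 2) * t x * (f x)^2) + 4 * b / c * s ^ 3 * D x" by simp
  have B: "m * cut' (m * rr x) * n * (t x)^2 * (f x)^2 <= 4 * m * b * s^2 * (loc (2 / m) f x)^2"
  proof (cases "rr x < 2 / m")
   case True
   have "cut' (m * rr x) * n * (t x)^2 <= 4 * b * s^2"
    by (intro mult_mono) (use cut_bounds(5,7)[of "m * rr x"] b(1) n0 tx in "auto intro: power_mono")
   from mult_left_mono[OF this, of "m * (f x)^2"] m True show ?thesis by (simp add: loc_def algebra_simps)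
  next
   case False
   then have "2 <= m * rr x" using m by (simp add: field_simps)
   then show ?thesis using False by (simp add: cut_bounds(6) loc_def)
  qed
  show "c / 2 * (k x * (max 0 (s - rr x) * (f x)^2)) + E x
   <= 4 * b / c * s ^ 3 * D x + 4 * m * b * s^2 * (loc (2 / m) f x)^2"
   using A B unfolding E t_def[symmetric] by (simp add: algebra_simps)
 qed (intro Bi_add integrable_mult_right ki Ei Di li)+
 then show "c / 2 * (LI x. cut (m * rr x) * (max 0 (s - rr x) * (f x)^2))
  <= 4 * b / c * s ^ 3 * (gnorm df)^2 + 4 * m * b * s^2 * (nrm (loc (2 / m) f))^2"
  unfolding B_add[OF integrable_mult_right[OF ki] Ei]
   B_add[OF integrable_mult_right[OF Di] integrable_mult_right[OF li]]
   integral_mult_right_zero E0 DG L2_norm_power2_real[symmetric]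
  unfolding k_def by simp
qed

text \<open>The limit condition expresses zero boundary values: the mean square of \<open>f\<close>
  over the strip of width \<open>2 / m\<close> tends to zero. It removes the cutoff term of
  \<open>strip_cut_estimate\<close> as \<open>m\<close> grows.\<close>

lemma strip_estimate:
 "\<exists>K s0. 0 < K & 0 < s0 & (\<forall>f df s. h1 f df --> 0 < s --> s <= s0 -->
  ((%m. real (Suc m) * (nrm (loc (2 / real (Suc m)) f))^2) ~~> 0) -->
  nrm (loc (s / 2) f) <= K * s * gnorm df)"
proof -
 obtain c b where cb: "0 < c" "0 < b" and bd: "\<forall>x\<in>closure Om. c <= q x & (SU i. N i x * N i x) <= b & \<bar>SU i. H i i x\<bar> <= b
  & (\<forall>i. \<bar>N i x\<bar> <= b)" using rho_bounds by (elim exE conjE)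
 have bd': "c <= q x & (SU i. N i x * N i x) <= b & \<bar>SU i. H i i x\<bar> <= b" if "x \<in> Om" for x
  using bspec[OF bd subsetD[OF closure_subset that]] by (elim conjE) (intro conjI)
 \<comment> \<open>\<open>s <= c / 2\<close> keeps the squared gradient of \<open>rr\<close> above
   \<open>c / 2\<close> in the strip, and \<open>s * b <= c / 4\<close> absorbs the Laplacian of
   \<open>rr\<close>. The value of \<open>K\<close> results from comparing
   \<open>c / 2 * (s / 2)\<close> with \<open>4 * b / c * s ^ 3\<close>.\<close>
 define s0 where "s0 = min (c / 2) (c / (4 * b))"
 define K where "K = sqrt (16 * b / c^2)"
 have "nrm (loc (s / 2) f) <= K * s * gnorm df" if f: "h1 f df" and s: "0 < s" "s <= s0"
  and lim: "(%m. real (Suc m) * (nrm (loc (2 / real (Suc m)) f))^2) ~~> 0" for f df s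
 proof -
  have s2: "s <= c / 2" "s * b <= c / 4" using s(2) cb by (simp_all add: s0_def field_simps)
  note est = strip_cut_estimate[OF f s(1) s2 cb(1) _ bd']
  have ti: "integrable MO (%x. max 0 (s - rr x) * (f x)^2)" by (rule est(1)[OF zero_less_one])
  have "c / 2 * (LI x. max 0 (s - rr x) * (f x)^2) <= 4 * b / c * s ^ 3 * (gnorm df)^2 + 4 * b * s^2 * 0"
  proof (rule tendsto_le[OF sequentially_bot])
   show "(%m. c / 2 * (LI x. cut (real (Suc m) * rr x) * (max 0 (s - rr x) * (f x)^2)))
    ~~> c / 2 * (LI x. max 0 (s - rr x) * (f x)^2)"
    by (intro tendsto_mult_left cut_integral_tendsto(1)[OF ti])
   show "(%m. 4 * b / c * s ^ 3 * (gnorm df)^2 + 4 * b * s^2 * (real (Suc m) * (nrm (loc (2 / real (Suc m)) f))^2))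
    ~~> 4 * b / c * s ^ 3 * (gnorm df)^2 + 4 * b * s^2 * 0"
    by (intro tendsto_add tendsto_const tendsto_mult_left lim)
   show "\<forall>\<^sub>F m in sequentially. c / 2 * (LI x. cut (real (Suc m) * rr x) * (max 0 (s - rr x) * (f x)^2))
    <= 4 * b / c * s ^ 3 * (gnorm df)^2 + 4 * b * s^2 * (real (Suc m) * (nrm (loc (2 / real (Suc m)) f))^2)"
   proof (rule always_eventually, rule allI)
    fix m
    show "c / 2 * (LI x. cut (real (Suc m) * rr x) * (max 0 (s - rr x) * (f x)^2))
    <= 4 * b / c * s ^ 3 * (gnorm df)^2 + 4 * b * s^2 * (real (Suc m) * (nrm (loc (2 / real (Suc m)) f))^2)"
     using est(2)[of "real (Suc m)"] by (simp only: mult_ac of_nat_0_less_iff zero_less_Suc simp_thms)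
   qed
  qed
  note lim_le = this
  have "s / 2 * (nrm (loc (s / 2) f))^2 <= (LI x. max 0 (s - rr x) * (f x)^2)"
  proof -
   have "(LI x. s / 2 * (loc (s / 2) f x)^2) <= (LI x. max 0 (s - rr x) * (f x)^2)"
   proof (rule integral_mono)
    show "integrable MO (%x. s / 2 * (loc (s / 2) f x)^2)"
     by (intro integrable_mult_right L2_integrable_power2 loc_L2(1) h1D(1)[OF f])
    show "s / 2 * (loc (s / 2) f x)^2 <= max 0 (s - rr x) * (f x)^2" for x
     using s(1) by (cases "rr x < s / 2") (auto simp: loc_def simp del: times_divide_eq_left intro!: mult_right_mono)
   qed (rule ti)
   then show ?thesis by (simp add: L2_norm_power2_real)
  qed
  from mult_left_mono[OF this, of "c / 2"] cb(1)
  have "c / 2 * (s / 2 * (nrm (loc (s / 2) f))^2) <= c / 2 * (LI x. max 0 (s - rr x) * (f x)^2)"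
   by simp
  also note lim_le
  finally have "c / 2 * (s / 2 * (nrm (loc (s / 2) f))^2) <= 4 * b / c * s ^ 3 * (gnorm df)^2"
   by simp
  then have "(nrm (loc (s / 2) f))^2 <= 16 * b / c^2 * s^2 * (gnorm df)^2"
   using cb(1) s(1) by (simp add: field_simps power2_eq_square power3_eq_cube)
  also have "... = (K * s * gnorm df)^2" using cb by (simp add: K_def power_mult_distrib)
  finally show ?thesis
   by (rule power2_le_imp_le) (use cb s(1) gnorm_nonneg in "simp add: K_def")
 qed
 moreover have "0 < K" "0 < s0" using cb by (simp_all add: K_def s0_def)
 ultimately show ?thesis by (intro exI[of _ K] exI[of _ s0]) simp
qed

end

section \<open>Functions that vanish on the boundary\<close>

context strip_domain
begin

text \<open>Vanishing on the boundary, in the quantitative form in which it is used: the \<open>L\<^sup>2\<close> norm on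
 the boundary strip of width \<open>s\<close> is \<open>O(s)\<close>.\<close>

definition van :: "'n fn => bool" where
 "van f \<longleftrightarrow> f \<in> L2O & (\<exists>C. \<forall>s>0. nrm (loc s f) <= C * s)"

lemma van_add: assumes "van f" "van g" shows "van (%x. f x + g x)"
proof -
 obtain C D where CD: "!!s. s > 0 ==> nrm (loc s f) <= C * s" "!!s. s > 0 ==> nrm (loc s g) <= D * s"
  and L: "f \<in> L2O" "g \<in> L2O" using assms unfolding van_def by blast
 have "nrm (loc s (%x. f x + g x)) <= (C + D) * s" if "s > 0" for s
 proof -
  have "loc s (%x. f x + g x) = (%x. loc s f x + loc s g x)" by (auto simp: loc_def)
  then have "nrm (loc s (%x. f x + g x)) <= nrm (loc s f) + nrm (loc s g)"
   by (simp add: L2_norm_triangle loc_L2(1) L)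
  then show ?thesis using CD(1)[OF that] CD(2)[OF that] by (simp add: distrib_right)
 qed
 then show ?thesis unfolding van_def using L2_add[OF L] by blast
qed

lemma van_bound:
 assumes "van f" "g \<in> L2O" "!!x. x \<in> Om ==> \<bar>g x\<bar> <= B * \<bar>f x\<bar>" shows "van g"
proof -
 obtain C where C: "!!s. s > 0 ==> nrm (loc s f) <= C * s" and L: "f \<in> L2O"
  using assms(1) unfolding van_def by blast
 have "nrm (loc s g) <= \<bar>B\<bar> * C * s" if "s > 0" for s
 proof -
  have "nrm (loc s g) <= nrm (loc s (%x. B * f x))"
  proof (rule loc_mono[OF assms(2) L2_cmult[OF L] order_refl])
   fix x assume "x \<in> Om" "rr x < s"
   have "\<bar>g x\<bar> <= B * \<bar>f x\<bar>" by (rule assms(3)[OF \<open>x \<in> Om\<close>])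
   also have "... <= \<bar>B\<bar> * \<bar>f x\<bar>" by (rule mult_right_mono) simp_all
   finally show "\<bar>g x\<bar> <= \<bar>B * f x\<bar>" by (simp add: abs_mult)
  qed
  also have "loc s (%x. B * f x) = (%x. B * loc s f x)" by (auto simp: loc_def)
  also have "nrm ... <= \<bar>B\<bar> * (C * s)"
   unfolding L2_norm_cmult by (intro mult_left_mono C that abs_ge_zero)
  finally show ?thesis by simp
 qed
 then show ?thesis unfolding van_def using assms(2) by blast
qed

lemma van_mult:
 assumes "van f" "continuous_on (closure Om) c" shows "van (%x. c x * f x)"
proof -
 have "bounded (c ` closure Om)"
  by (intro compact_imp_bounded compact_continuous_image compact_closure_Omega assms(2))
 then obtain B where B: "!!x. x \<in> closure Om ==> \<bar>c x\<bar> <= B" by (auto simp: bounded_iff)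
 have "\<bar>c x * f x\<bar> <= B * \<bar>f x\<bar>" if "x \<in> Om" for x
  unfolding abs_mult by (rule mult_right_mono[OF B[OF subsetD[OF closure_subset that]] abs_ge_zero])
 moreover have "f \<in> L2O" using assms(1) by (simp add: van_def)
 ultimately show ?thesis by (intro van_bound[OF assms(1) C1_on_mult_L2[OF assms(2)]])
qed

lemma van_rho: assumes f: "f \<in> L2O" shows "van (%x. rr x * f x)"
proof -
 have L: "(%x. rr x * f x) \<in> L2O"
  by (rule C1_on_mult_L2[OF continuous_on_subset[OF rho_cont subset_UNIV] f])
 have "nrm (loc s (%x. rr x * f x)) <= nrm f * s" if s: "s > 0" for s
 proof -
  have "nrm (loc s (%x. rr x * f x)) <= nrm (loc s (%x. s * f x))"
  proof (rule loc_mono[OF L L2_cmult[OF f] order_refl])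
   fix x assume "x \<in> Om" "rr x < s"
   then have "\<bar>rr x\<bar> <= \<bar>s\<bar>" using rho_pos[of x] by simp
   then show "\<bar>rr x * f x\<bar> <= \<bar>s * f x\<bar>" unfolding abs_mult by (rule mult_right_mono) simp
  qed
  also have "... <= nrm (%x. s * f x)" by (rule loc_L2(2)[OF L2_cmult[OF f]])
  also have "... = nrm f * s" using s by (simp add: L2_norm_cmult)
  finally show ?thesis .
 qed
 then show ?thesis unfolding van_def using L by blast
qed

lemma van_zero: "van (%x. 0)"
 using van_rho[of "%x. 0"] by simp

lemma van_sum: "(!!k. k \<in> I ==> van (f k)) ==> van (%x. \<Sum>k\<in>I. f k x)"
 by (induction I rule: infinite_finite_induct) (simp_all add: van_zero van_add)

lemma van_diff: assumes "van f" "van g" shows "van (%x. f x - g x)"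
 using van_add[OF assms(1) van_mult[OF assms(2) continuous_on_const[of _ "- 1"]]] by simp

text \<open>Only thin strips matter: for larger \<open>s\<close> the full norm of \<open>f\<close>
  over \<open>s0\<close> gives the constant.\<close>

lemma van_near_boundary:
 assumes f: "f \<in> L2O" and s0: "0 < s0" and A: "!!s. 0 < s ==> s <= s0 ==> nrm (loc (s / 2) f) <= A * s"
 shows "van f"
proof -
 have "nrm (loc s f) <= (2 * \<bar>A\<bar> + 2 * nrm f / s0) * s" if s: "s > 0" for s
 proof (cases "2 * s <= s0")
  case True
  have "nrm (loc s f) <= A * (2 * s)" using A[of "2 * s"] s True by simp
  also have "... <= \<bar>A\<bar> * (2 * s)" using s by (intro mult_right_mono) auto
  also have "... <= 2 * \<bar>A\<bar> * s + 2 * nrm f / s0 * s" using s s0 by simp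
  finally show ?thesis by (simp add: distrib_right)
 next
  case False
  have "nrm (loc s f) <= nrm f * 1" using loc_L2(2)[OF f] by simp
  also have "... <= nrm f * (2 * s / s0)" using False s0 by (intro mult_left_mono) (auto simp: field_simps)
  also have "... <= 2 * \<bar>A\<bar> * s + 2 * nrm f / s0 * s" using s by (simp add: field_simps)
  finally show ?thesis by (simp add: distrib_right)
 qed
 then show ?thesis unfolding van_def using f by blast
qed

text \<open>A self-improvement: decay faster than the square root of the width, along the strips
  \<open>2 / m\<close>, already implies linear decay.\<close>

lemma van_h1:
 assumes "h1 f df" "(%m. real (Suc m) * (nrm (loc (2 / real (Suc m)) f))^2) ~~> 0"
 shows "van f"
proof -
 obtain K s0 where K: "0 < K & 0 < s0 & (\<forall>f df s. h1 f df --> 0 < s --> s <= s0 -->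
  ((%m. real (Suc m) * (nrm (loc (2 / real (Suc m)) f))^2) ~~> 0) -->
  nrm (loc (s / 2) f) <= K * s * gnorm df)" using strip_estimate by (elim exE)
 note K' = K[THEN conjunct2, THEN conjunct2, rule_format]
 show ?thesis
  by (rule van_near_boundary[OF h1D(1)[OF assms(1)], of s0 "K * gnorm df"])
   (use K in simp, use K'[OF assms(1) _ _ assms(2)] in "simp add: mult_ac")
qed

text \<open>A compactly supported function is zero on thin strips, so \<open>strip_estimate\<close>
  applies to the approximating sequence with constants that do not depend on it, and the bound
  passes to the limit.\<close>

lemma van_h10: assumes "h10 f df" shows "van f"
proof -
 obtain K s0 where K: "0 < K & 0 < s0 & (\<forall>f df s. h1 f df --> 0 < s --> s <= s0 -->
  ((%m. real (Suc m) * (nrm (loc (2 / real (Suc m)) f))^2) ~~> 0) -->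
  nrm (loc (s / 2) f) <= K * s * gnorm df)" using strip_estimate by (elim exE)
 note K' = K[THEN conjunct2, THEN conjunct2, rule_format]
 have c: "nrm (loc (s / 2) ph) <= K * s * gnorm dph" if ph: "C1c Om ph dph" and s: "0 < s" "s <= s0" for ph dph s
 proof (rule K'[OF C1c_imp_h1[OF ph] s])
  obtain Ks where Ks: "compact Ks & Ks \<subseteq> Om & (\<forall>x. x \<notin> Ks --> ph x = 0 & (\<forall>i. dph i x = 0))"
   using C1cD[OF ph] by (elim exE)
  obtain de where de: "de > 0" "!!x. x \<in> Ks ==> de <= rr x"
  proof (cases "Ks = {}")
   case False
   then obtain x where "x \<in> Ks" "\<forall>y\<in>Ks. rr x <= rr y"
    using continuous_attains_inf[of Ks rr] Ks continuous_on_subset[OF rho_cont subset_UNIV] by blast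
   moreover have "rr x > 0" using \<open>x \<in> Ks\<close> Ks rho_pos by blast
   ultimately show ?thesis using that by blast
  qed (use that[of 1] in simp)
  have "(%m. 2 * inverse (real (Suc m))) ~~> 2 * 0" by (intro tendsto_mult_left LIMSEQ_inverse_real_of_nat)
  then have "(%m. 2 / real (Suc m)) ~~> 0" by (simp add: divide_inverse)
  then have ev: "\<forall>\<^sub>F m in sequentially. 2 / real (Suc m) < de" using de(1) by (rule order_tendstoD(2))
  show "(%m. real (Suc m) * (nrm (loc (2 / real (Suc m)) ph))^2) ~~> 0"
  proof (rule tendsto_eventually, rule eventually_mono[OF ev])
   fix m assume m: "2 / real (Suc m) < de"
   have "loc (2 / real (Suc m)) ph x = 0" for x
   proof (cases "x \<in> Ks")
    case True then show ?thesis using de(2)[OF True] m by (simp add: loc_def)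
   next
    case False then show ?thesis using Ks by (simp add: loc_def)
   qed
   then have "loc (2 / real (Suc m)) ph = (%x. 0)" by (rule ext)
   then show "real (Suc m) * (nrm (loc (2 / real (Suc m)) ph))^2 = 0" by simp
  qed
 qed
 obtain ph dph where seq: "h10_seq f df ph dph" using h10_sequence[OF assms] by (elim exE)
 note S = h10_seqD[OF seq]
 note T = C1c_L2_Omega[OF S(1)] and fL = h1D[OF h10_h1[OF assms]]
 show ?thesis
 proof (rule van_near_boundary[OF fL(1), of s0 "K * gnorm df"])
  fix s assume s: "0 < s" "s <= s0"
  have le: "nrm (loc (s / 2) f) <= K * s * gnorm (dph k) + nrm (%x. ph k x - f x)" for k
  proof -
   have "loc (s / 2) f = (%x. loc (s / 2) (ph k) x - loc (s / 2) (%x. ph k x - f x) x)" by (auto simp: loc_def)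
   then have "nrm (loc (s / 2) f) <= nrm (loc (s / 2) (ph k)) + nrm (loc (s / 2) (%x. ph k x - f x))"
    by (simp add: L2_norm_triangle_diff loc_L2(1) T(1) fL(1) L2_diff)
   also have "nrm (loc (s / 2) (%x. ph k x - f x)) <= nrm (%x. ph k x - f x)"
    by (intro loc_L2(2) L2_diff T(1) fL(1))
   finally show ?thesis using c[OF S(1)[of k] s] by linarith
  qed
  have "(%k. K * s * gnorm (dph k) + nrm (%x. ph k x - f x)) ~~> K * s * gnorm df + 0"
   by (intro tendsto_add tendsto_mult_left gnorm_tendsto S(2,3) T(2) fL(2))
  from LIMSEQ_le_const[OF this] le have "nrm (loc (s / 2) f) <= K * s * gnorm df + 0" by blast
  then show "nrm (loc (s / 2) f) <= K * gnorm df * s" by (simp add: mult_ac)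
 qed (use K in simp)
qed

text \<open>\<open>N i * dg j - N j * dg i\<close> differentiates along the level sets of
  \<open>rr\<close>. Moving this derivative off \<open>g\<close> costs nothing on cutoffs that
  depend on \<open>rr\<close> alone, so the squared norm of \<open>f\<close> on the strip of width
  \<open>s\<close> is at most the product of the norms of \<open>g\<close> and \<open>W\<close> on
  the strip of width \<open>2 * s\<close>. The first factor is O(s), the second tends to zero, and
  together they give the hypothesis of \<open>van_h1\<close>.\<close>

lemma van_tangential:
 assumes g: "h1 g dg" and dg: "!!i. h1 (dg i) (ddg i)" and v: "van g"
 shows "van (%x. N i x * dg j x - N j x * dg i x)"
proof -
 define f where "f x = N i x * dg j x - N j x * dg i x" for x
 define df where "df l x = (N i x * ddg j l x + H i l x * dg j x) - (N j x * ddg i l x + H j l x * dg i x)" for l x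
 have f: "h1 f df" unfolding f_def[abs_def] df_def[abs_def]
  by (intro h1_diff h1_mult dg C1_on_subset[OF N_C1 subset_UNIV])
 obtain C where C: "!!s. s > 0 ==> nrm (loc s g) <= C * s" using v unfolding van_def by blast
 define W where "W x = N i x * df j x - N j x * df i x" for x
 have WL: "W \<in> L2O" unfolding W_def[abs_def]
  by (intro L2_diff C1_on_mult_L2 h1D(2)[OF f] continuous_on_subset[OF N_cont subset_UNIV])
 have key: "(nrm (loc s f))^2 <= nrm (loc (2 * s) g) * nrm (loc (2 * s) W)" if s: "s > 0" for s
 proof -
  define e where "e x = 1 - cut (1 / s * rr x)" for x
  have e: "0 <= e x" "e x <= 1" "rr x < s ==> e x = 1" "\<not> rr x < 2 * s ==> e x = 0" for x
   unfolding e_def using cut_bounds(1,2)[of "1 / s * rr x"] cut_bounds(3,4)[of "1 / s * rr x"] s by (simp_all add: field_simps)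
  have ec: "continuous_on UNIV e" unfolding e_def[abs_def]
   by (intro continuous_intros C1_on_continuous[OF cut_rho_C1])
  have eL: "(%x. e x * f x) \<in> L2O"
   by (rule C1_on_mult_L2[OF continuous_on_subset[OF ec subset_UNIV] h1D(1)[OF f]])
  have i: "integrable MO (%x. (e x * f x) * f x)"
   by (rule L2_integrable_mult[OF eL h1D(1)[OF f]])
  have step: "(LI x. cut (m * rr x) * ((e x * f x) * f x)) <= nrm (loc (2 * s) g) * nrm (loc (2 * s) W)"
   if m: "m > 0" for m
  proof -
   define k where "k x = cut (m * rr x)" for x
   note C = C1c_mult[OF cut_C1c[OF m] C1_on_mult[OF C1_on_diff[OF C1_on_const[of _ 1] cut_rho_C1[of "1 / s"]] N_C1]]
   define dw where "dw a b x = k x * (e x * H a b x + (0 - 1 / s * cut' (1 / s * rr x) * N b x) * N a x)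
    + m * cut' (m * rr x) * N b x * (e x * N a x)" for a b x
   have ids: "(LI x. dg b x * (k x * (e x * N a x) * f x))
    = - (LI x. g x * (k x * (e x * N a x) * df b x + dw a b x * f x))" for a b
    using h1_product[OF f g C[of a], of b] unfolding dw_def k_def e_def .
   have wL: "(%x. k x * (e x * N a x) * f x) \<in> L2O" "(%x. k x * (e x * N a x) * df b x + dw a b x * f x) \<in> L2O" for a b
    using h1D(1)[OF h1_mult[OF f C1_on_subset[OF C1c_C1_on[OF C[of a]] subset_UNIV]]]
     h1D(2)[OF h1_mult[OF f C1_on_subset[OF C1c_C1_on[OF C[of a]] subset_UNIV]], of b]
    unfolding dw_def k_def e_def by simp_all
   note i1 = L2_integrable_mult[OF h1D(2)[OF g] wL(1)] and i2 = L2_integrable_mult[OF h1D(1)[OF g] wL(2)]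
   have "(LI x. k x * ((e x * f x) * f x))
    = (LI x. dg j x * (k x * (e x * N i x) * f x) - dg i x * (k x * (e x * N j x) * f x))"
    by (rule B_cong[OF refl]) (simp add: f_def algebra_simps)
   also have "... = - (LI x. g x * (k x * (e x * N i x) * df j x + dw i j x * f x)
     - g x * (k x * (e x * N j x) * df i x + dw j i x * f x))"
    by (simp add: B_diff[OF i1 i1] B_diff[OF i2 i2] ids)
   \<comment> \<open>The terms with derivatives of the cutoffs are symmetric in \<open>N i\<close>
     and \<open>N j\<close> and cancel; those with the Hessian of \<open>rr\<close> cancel by its
     symmetry.\<close>
   also have "... = - (LI x. k x * e x * (g x * W x))"
    by (rule arg_cong[where f = uminus], rule B_cong[OF refl])
     (simp add: W_def dw_def H_symmetric[of j i] algebra_simps)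
   also have "... = (LI x. - (k x * e x * (g x * W x)))" by simp
   also have "... <= (LI x. \<bar>loc (2 * s) g x\<bar> * \<bar>loc (2 * s) W x\<bar>)"
   proof (rule integral_mono)
    have "integrable MO (%x. cut (m * rr x) * ((e x * g x) * W x))"
     by (rule cut_integral_tendsto(2)[OF L2_integrable_mult[OF C1_on_mult_L2[OF continuous_on_subset[OF ec subset_UNIV] h1D(1)[OF g]] WL]])
    then show "integrable MO (%x. - (k x * e x * (g x * W x)))"
     by (simp add: k_def mult_ac)
    have "integrable MO (%x. \<bar>loc (2 * s) g x * loc (2 * s) W x\<bar>)"
     by (intro integrable_abs L2_integrable_mult loc_L2(1) h1D(1)[OF g] WL)
    then show "integrable MO (%x. \<bar>loc (2 * s) g x\<bar> * \<bar>loc (2 * s) W x\<bar>)" by (simp add: abs_mult)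
    fix x
    show "- (k x * e x * (g x * W x)) <= \<bar>loc (2 * s) g x\<bar> * \<bar>loc (2 * s) W x\<bar>"
    proof (cases "rr x < 2 * s")
     case True
     have "\<bar>k x * e x\<bar> <= 1" using e(1,2)[of x] cut_bounds(1,2)[of "m * rr x"]
      by (simp add: k_def abs_mult mult_le_one)
     from mult_right_mono[OF this abs_ge_zero[of "g x * W x"]]
     have "\<bar>k x * e x * (g x * W x)\<bar> <= \<bar>g x\<bar> * \<bar>W x\<bar>" by (simp only: abs_mult mult_1)
     then show ?thesis using True by (simp add: loc_def)
    qed (simp add: e(4) loc_def)
   qed
   also have "... = inr (%x. \<bar>loc (2 * s) g x\<bar>) (%x. \<bar>loc (2 * s) W x\<bar>)" by (simp add: L2_inner_def)
   also have "... <= nrm (%x. \<bar>loc (2 * s) g x\<bar>) * nrm (%x. \<bar>loc (2 * s) W x\<bar>)"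
   proof (rule L2_inner_le)
    have ab: "(%x. \<bar>h x\<bar>) \<in> L2O" if "h \<in> L2O" for h :: "'n fn"
     by (rule L2_bound[OF that borel_measurable_abs[OF L2D(1)[OF that]]]) simp
    show "(%x. \<bar>loc (2 * s) g x\<bar>) \<in> L2O" "(%x. \<bar>loc (2 * s) W x\<bar>) \<in> L2O"
     by (intro ab loc_L2(1) h1D(1)[OF g] WL)+
   qed
   also have "... = nrm (loc (2 * s) g) * nrm (loc (2 * s) W)"
    by (simp add: L2_norm_def L2_inner_def abs_mult[symmetric])
   finally show ?thesis by (simp add: k_def)
  qed
  have "(nrm (loc s f))^2 <= (LI x. (e x * f x) * f x)"
   unfolding L2_norm_power2_real
  proof (rule integral_mono[OF L2_integrable_power2[OF loc_L2(1)[OF h1D(1)[OF f]]] i])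
   show "(loc s f x)^2 <= (e x * f x) * f x" for x
    using e(1,3)[of x] by (simp add: loc_def power2_eq_square mult.assoc)
  qed
  also have "... <= nrm (loc (2 * s) g) * nrm (loc (2 * s) W)"
   by (rule LIMSEQ_le_const2[OF cut_integral_tendsto(1)[OF i]]) (use step[of "real (Suc _)"] in auto)
  finally show ?thesis .
 qed
 have "(%m. real (Suc m) * (nrm (loc (2 / real (Suc m)) f))^2) ~~> 0"
 proof (rule tendsto_sandwich[OF always_eventually always_eventually tendsto_const])
  have "(%m. 4 * C * nrm (loc (4 / real (Suc m)) W)) ~~> 4 * C * 0" by (intro tendsto_mult_left loc_tendsto WL)
  then show "(%m. 4 * C * nrm (loc (4 / real (Suc m)) W)) ~~> 0" by simp
  show "\<forall>m. real (Suc m) * (nrm (loc (2 / real (Suc m)) f))^2 <= 4 * C * nrm (loc (4 / real (Suc m)) W)"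
  proof
   fix m
   have 0: "2 * (2 / real (Suc m)) = 4 / real (Suc m)" by simp
   have "(nrm (loc (2 / real (Suc m)) f))^2 <= nrm (loc (4 / real (Suc m)) g) * nrm (loc (4 / real (Suc m)) W)"
    using key[of "2 / real (Suc m)"] unfolding 0 by simp
   also have "... <= C * (4 / real (Suc m)) * nrm (loc (4 / real (Suc m)) W)"
    by (intro mult_right_mono C) auto
   finally have "real (Suc m) * (nrm (loc (2 / real (Suc m)) f))^2
    <= real (Suc m) * (C * (4 / real (Suc m)) * nrm (loc (4 / real (Suc m)) W))" by (rule mult_left_mono) simp
   also have "... = 4 * C * nrm (loc (4 / real (Suc m)) W)" by (simp add: field_simps)
   finally show "real (Suc m) * (nrm (loc (2 / real (Suc m)) f))^2 <= 4 * C * nrm (loc (4 / real (Suc m)) W)" .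
  qed
 qed simp
 from van_h1[OF f this] show ?thesis by (simp add: f_def[abs_def])
qed

end

subsection \<open>Replacing a gradient by a harmonic field\<close>

definition gr :: "'n::finite fn => real^'n => real^'n" where
 "gr ph x = (\<chi> i. pdiff i ph x)"

lemma gr_nth [simp]: "gr ph x $ i = pdiff i ph x"
 by (simp add: gr_def)

lemma test_function_linear:
 assumes "test_function Om ph" "test_function Om ps"
 shows "test_function Om (%x. a * ph x + b * ps x)"
  and "gr (%x. a * ph x + b * ps x) x = a *\<^sub>R gr ph x + b *\<^sub>R gr ps x"
proof -
 let ?K = "closure {x. ph x ~= 0} \<union> closure {x. ps x ~= 0}"
 note t1 = assms(1)[unfolded test_function_def] and t2 = assms(2)[unfolded test_function_def]
 show "test_function Om (%x. a * ph x + b * ps x)"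
 proof (rule test_functionI[where K = ?K])
  show "Ck k (%x. a * ph x + b * ps x)" for k
   by (rule Ck_add[OF Ck_cmult[OF t1[THEN conjunct1, rule_format]] Ck_cmult[OF t2[THEN conjunct1, rule_format]]])
  show "compact ?K" "?K \<subseteq> Om"
   by (rule compact_Un, rule t1[THEN conjunct2, THEN conjunct1], rule t2[THEN conjunct2, THEN conjunct1])
    (rule Un_least, rule t1[THEN conjunct2, THEN conjunct2], rule t2[THEN conjunct2, THEN conjunct2])
  fix x assume "x \<notin> ?K"
  then have "x \<notin> {x. ph x ~= 0}" "x \<notin> {x. ps x ~= 0}" using subsetD[OF closure_subset, of x] by (simp_all only: Un_iff) (rule notI, simp only: simp_thms)+
  then have "ph x = 0" "ps x = 0" by simp_all
  then show "a * ph x + b * ps x = 0" by simp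
 qed
 have c: "C1_on UNIV ph (%i. pdiff i ph)" "C1_on UNIV ps (%i. pdiff i ps)"
  by (rule C1c_C1_on[OF test_function_C1c[OF assms(1)]], rule C1c_C1_on[OF test_function_C1c[OF assms(2)]])
 have "C1_on UNIV (%x. a * ph x + b * ps x) (%i x. (a * pdiff i ph x + 0 * ph x) + (b * pdiff i ps x + 0 * ps x))"
  by (intro C1_on_add C1_on_mult c C1_on_const)
 note p = C1_on_pdiff[OF this UNIV_I]
 show "gr (%x. a * ph x + b * ps x) x = a *\<^sub>R gr ph x + b *\<^sub>R gr ps x"
  unfolding vec_eq_iff vector_add_component vector_scaleR_component gr_nth p by simp
qed

lemma L2_nth:
 fixes f :: "'a::euclidean_space => real^'n::finite"
 shows "f \<in> L2 S ==> (%x. f x $ i) \<in> L2 S"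
 by (simp add: L2_component_iff)

lemma L2_norm_diff_power2:
 fixes f g :: "'a::euclidean_space => 'b::euclidean_space"
 assumes "f \<in> L2 S" "g \<in> L2 S"
 shows "(L2_norm S (%x. f x - t *\<^sub>R g x))^2 = (L2_norm S f)^2 - 2 * t * L2_inner S f g + t^2 * (L2_norm S g)^2"
 using L2_norm_add_power2[OF assms(1) L2_scaleR[OF assms(2), of "- t"], unfolded L2_inner_scaleR_right L2_norm_scaleR]
 by (simp add: power_mult_distrib)

lemma L2_parallelogram:
 fixes f g :: "'a::euclidean_space => 'b::euclidean_space"
 assumes "f \<in> L2 S" "g \<in> L2 S"
 shows "(L2_norm S (%x. f x - g x))^2 = 2 * (L2_norm S f)^2 + 2 * (L2_norm S g)^2
  - 4 * (L2_norm S (%x. (1 / 2) *\<^sub>R (f x + g x)))^2"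
 unfolding L2_norm_scaleR using L2_norm_diff_power2[OF assms, of 1] L2_norm_add_power2[OF assms]
 by (simp add: power_mult_distrib power_divide field_simps)

text \<open>Polarization reduces the claim to convergence of norms.\<close>

lemma L2_tendsto_inner_both:
 fixes F H :: "nat => 'a::euclidean_space => 'b::euclidean_space"
 assumes F: "!!k. F k \<in> L2 S" "f \<in> L2 S" "(%k. L2_norm S (%x. F k x - f x)) ~~> 0"
  and H: "!!k. H k \<in> L2 S" "h \<in> L2 S" "(%k. L2_norm S (%x. H k x - h x)) ~~> 0"
 shows "(%k. L2_inner S (F k) (H k)) ~~> L2_inner S f h"
proof -
 have "(%k. L2_norm S (%x. (F k x + H k x) - (f x + h x))) ~~> 0"
 proof (rule tendsto_sandwich[OF always_eventually always_eventually tendsto_const])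
  show "(%k. L2_norm S (%x. F k x - f x) + L2_norm S (%x. H k x - h x)) ~~> 0"
   using tendsto_add[OF F(3) H(3)] by simp
  have "L2_norm S (%x. (F k x - f x) + (H k x - h x)) <= L2_norm S (%x. F k x - f x) + L2_norm S (%x. H k x - h x)" for k
   by (intro L2_norm_triangle L2_diff F H)
  then show "\<forall>k. L2_norm S (%x. (F k x + H k x) - (f x + h x)) <= L2_norm S (%x. F k x - f x) + L2_norm S (%x. H k x - h x)"
   by (simp add: algebra_simps)
 qed simp
 from L2_tendsto_norm[OF L2_add[OF F(1) H(1)] L2_add[OF F(2) H(2)] this]
 have s: "(%k. L2_norm S (%x. F k x + H k x)) ~~> L2_norm S (%x. f x + h x)" .
 have "(%k. ((L2_norm S (%x. F k x + H k x))^2 - (L2_norm S (F k))^2 - (L2_norm S (H k))^2) / 2)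
  ~~> ((L2_norm S (%x. f x + h x))^2 - (L2_norm S f)^2 - (L2_norm S h)^2) / 2"
  by (intro tendsto_divide tendsto_diff tendsto_power tendsto_const s L2_tendsto_norm[OF F] L2_tendsto_norm[OF H]) simp
 then show ?thesis by (simp add: L2_norm_add_power2 F H)
qed

context bounded_open
begin

text \<open>On a bounded set an L2 Cauchy sequence is Cauchy in L1 and has a subsequence that
  converges almost everywhere; Fatou's lemma identifies its limit as the L2 limit of the whole
  sequence.\<close>

lemma L2_complete:
 fixes F :: "nat => 'n fn"
 assumes F: "!!k. F k \<in> L2O"
  and C: "!!e. e > 0 ==> \<exists>K. \<forall>m\<ge>K. \<forall>n\<ge>K. nrm (%x. F m x - F n x) < e"
 shows "\<exists>f\<in>L2O. (%k. nrm (%x. F k x - f x)) ~~> 0"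
proof -
 define V where "V = nrm (%x. 1 :: real) + 1"
 have V: "V > 0" by (simp add: V_def add_nonneg_pos)
 note one = const_L2[of 1]
 have L1: "(LI x. norm (F m x - F n x)) <= nrm (%x. F m x - F n x) * V" for m n
 proof -
  have ab: "(%x. \<bar>F m x - F n x\<bar>) \<in> L2O"
   by (rule L2_bound[OF L2_diff[OF F[of m] F[of n]] borel_measurable_abs[OF L2D(1)[OF L2_diff[OF F[of m] F[of n]]]]]) simp
  have "(LI x. norm (F m x - F n x)) = inr (%x. \<bar>F m x - F n x\<bar>) (%x. 1)"
   by (simp add: L2_inner_def)
  also have "... <= nrm (%x. \<bar>F m x - F n x\<bar>) * nrm (%x. 1 :: real)" by (rule L2_inner_le[OF ab one])
  also have "nrm (%x. \<bar>F m x - F n x\<bar>) = nrm (%x. F m x - F n x)"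
   by (simp add: L2_norm_def L2_inner_def abs_mult[symmetric])
  also have "... * nrm (%x. 1 :: real) <= nrm (%x. F m x - F n x) * V"
   by (intro mult_left_mono) (simp_all add: V_def)
  finally show ?thesis .
 qed
 have CL1: "\<exists>K. \<forall>m\<ge>K. \<forall>n\<ge>K. (LI x. norm (F m x - F n x)) < e" if "e > 0" for e
 proof -
  obtain K where K: "!!m n. m >= K ==> n >= K ==> nrm (%x. F m x - F n x) < e / V"
   using C[of "e / V"] V \<open>e > 0\<close> by auto
  have "(LI x. norm (F m x - F n x)) < e" if "m >= K" "n >= K" for m n
   using order_le_less_trans[OF L1[of m n], of e] K[OF that] V by (simp add: pos_less_divide_eq)
  then show ?thesis by blast
 qed
 obtain r :: "nat => nat" where r: "strict_mono r" "AEO x. Cauchy (%i. F (r i) x)"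
  by (rule cauchy_L1_AE_cauchy_subseq[OF L2_integrable[OF F] CL1])
 define f where "f x = lim (%i. F (r i) x)" for x
 have fm [measurable]: "f \<in> borel_measurable MO"
  unfolding f_def[abs_def] by (rule borel_measurable_lim_metric) (rule L2D(1)[OF F])
 have fl: "AEO x. (%i. F (r i) x) ~~> f x"
  using r(2) unfolding f_def by eventually_elim (simp add: Cauchy_convergent convergent_LIMSEQ_iff[symmetric])
 have key: "(%x. f x - F k x) \<in> L2O & nrm (%x. f x - F k x) <= e"
  if e: "e > 0" and K: "!!m n. m >= K ==> n >= K ==> nrm (%x. F m x - F n x) < e" and k: "k >= K" for e K k
 proof -
  have int: "integrable MO (%x. (F (r (i + K)) x - F k x)^2)" for i
   by (rule L2_integrable_power2[OF L2_diff[OF F F]])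
  have lim: "AEO x. (%i. (F (r (i + K)) x - F k x)^2) ~~> (f x - F k x)^2"
   using fl
  proof eventually_elim
   case (elim x)
   then have "(%i. F (r (i + K)) x) ~~> f x" by (rule LIMSEQ_ignore_initial_segment)
   then show ?case by (intro tendsto_intros)
  qed
  have bd: "(LI x. (F (r (i + K)) x - F k x)^2) <= e^2" for i
  proof -
   have "i + K <= r (i + K)" by (rule seq_suble[OF r(1)])
   then have "nrm (%x. F (r (i + K)) x - F k x) < e" using K k by simp
   then have "(nrm (%x. F (r (i + K)) x - F k x))^2 <= e^2" by (intro power_mono) auto
   then show ?thesis by (simp add: L2_norm_power2)
  qed
  have m: "(%x. f x - F k x) \<in> borel_measurable MO" using L2D(1)[OF F[of k]] by measurable
  have m2: "(%x. (f x - F k x)^2) \<in> borel_measurable MO" using m by measurable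
  note fat = Fatou_integrable[OF int zero_le_power2 lim m2 bd tendsto_const]
  have "(nrm (%x. f x - F k x))^2 <= e^2" using fat(2) by (simp add: L2_norm_power2)
  then have "nrm (%x. f x - F k x) <= e" by (rule power2_le_imp_le) (use e in simp)
  moreover have "(%x. f x - F k x) \<in> L2O" unfolding L2_def using fat(1) m by simp
  ultimately show ?thesis by blast
 qed
 have fL: "f \<in> L2O"
 proof -
  obtain K where K: "\<forall>m\<ge>K. \<forall>n\<ge>K. nrm (%x. F m x - F n x) < 1" using C[of 1] by auto
  have "(%x. f x - F K x) \<in> L2O" using key[of 1 K K] K by simp
  from L2_add[OF this F[of K]] show ?thesis by simp
 qed
 have "(%k. nrm (%x. F k x - f x)) ~~> 0"
 proof (rule LIMSEQ_I)
  fix d :: real assume d: "d > 0"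
  then obtain K where K: "\<forall>m\<ge>K. \<forall>n\<ge>K. nrm (%x. F m x - F n x) < d / 2" using C[of "d / 2"] by auto
  have "norm (nrm (%x. F k x - f x) - 0) < d" if "k >= K" for k
   using key[of "d / 2" K k] K that d L2_norm_uminus[of Om "%x. f x - F k x"] by simp
  then show "\<exists>K. \<forall>k\<ge>K. norm (nrm (%x. F k x - f x) - 0) < d" by blast
 qed
 with fL show ?thesis by blast
qed

lemma L2_complete_vec:
 fixes F :: "nat => real^'n => real ^ 'm"
 assumes F: "!!k. F k \<in> L2O"
  and C: "!!e. e > 0 ==> \<exists>K. \<forall>m\<ge>K. \<forall>n\<ge>K. nrm (%x. F m x - F n x) < e"
 shows "\<exists>f\<in>L2O. (%k. nrm (%x. F k x - f x)) ~~> 0"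
proof -
 have Fi: "(%x. F k x $ i) \<in> L2O" for k i by (rule L2_nth[OF F])
 have "\<exists>f\<in>L2O. (%k. nrm (%x. F k x $ i - f x)) ~~> 0" for i
 proof (rule L2_complete[OF Fi])
  fix e :: real assume "e > 0"
  then obtain K where K: "\<forall>m\<ge>K. \<forall>n\<ge>K. nrm (%x. F m x - F n x) < e" using C by blast
  have "nrm (%x. F m x $ i - F n x $ i) <= nrm (%x. F m x - F n x)" for m n
   using L2_norm_component_le[OF L2_diff[OF F F], of m n i] by simp
  then have "\<forall>m\<ge>K. \<forall>n\<ge>K. nrm (%x. F m x $ i - F n x $ i) < e"
   using K by (intro allI impI) (rule order_le_less_trans, assumption, simp)
  then show "\<exists>K. \<forall>m\<ge>K. \<forall>n\<ge>K. nrm (%x. F m x $ i - F n x $ i) < e" by (rule exI)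
 qed
 then have "\<forall>i. \<exists>f. f \<in> L2O & (%k. nrm (%x. F k x $ i - f x)) ~~> 0" by (simp add: Bex_def)
 from choice[OF this] obtain f where f0: "\<forall>i. f i \<in> L2O & (%k. nrm (%x. F k x $ i - f i x)) ~~> 0"
  by (rule exE)
 note f = f0[rule_format, THEN conjunct1] f0[rule_format, THEN conjunct2]
 define g :: "real^'n => real ^ 'm" where "g x = (\<chi> i. f i x)" for x
 have gL: "g \<in> L2O" using f(1) by (simp add: L2_component_iff g_def)
 have "(%k. sqrt (SU i. (nrm (%x. F k x $ i - f i x))^2)) ~~> sqrt (\<Sum>i\<in>(UNIV :: 'm set). 0^2)"
  by (intro tendsto_real_sqrt tendsto_sum tendsto_power f(2))
 moreover have "sqrt (SU i. (nrm (%x. F k x $ i - f i x))^2) = nrm (%x. F k x - g x)" for k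
  using L2_norm_component[OF L2_diff[OF F[of k] gL]] by (simp add: g_def real_sqrt_unique)
 ultimately show ?thesis using gL by auto
qed

text \<open>Curl and divergence of \<open>G\<close> vanish in the sense of distributions;
  \<open>G\<close> itself is only square integrable, with no condition at the boundary.\<close>

definition hfield :: "(real^'n => real^'n) => bool" where
 "hfield G \<longleftrightarrow> G \<in> L2O & (\<forall>ph. test_function Om ph -->
  (\<forall>i j. (LI x. G x $ i * pdiff j ph x) = (LI x. G x $ j * pdiff i ph x))
  & inr G (gr ph) = 0)"

lemma hfieldD:
 assumes "hfield G"
 shows "G \<in> L2O" "(%x. G x $ i) \<in> L2O"
  "test_function Om ph ==> (LI x. G x $ i * pdiff j ph x) = (LI x. G x $ j * pdiff i ph x)"
  "test_function Om ph ==> inr G (gr ph) = 0"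
proof -
 note h = assms[unfolded hfield_def]
 show L: "G \<in> L2O" by (rule h[THEN conjunct1])
 show "(%x. G x $ i) \<in> L2O" by (rule L2_nth[OF L])
 note t = h[THEN conjunct2, THEN spec, THEN mp]
 show "(LI x. G x $ i * pdiff j ph x) = (LI x. G x $ j * pdiff i ph x)" if "test_function Om ph"
  by (rule t[OF that, THEN conjunct1, THEN spec, THEN spec])
 show "inr G (gr ph) = 0" if "test_function Om ph"
  by (rule t[OF that, THEN conjunct2])
qed

lemma gr_L2: "test_function Om ph ==> gr ph \<in> L2O"
 using C1c_L2_Omega(2)[OF test_function_C1c] by (simp add: L2_component_iff)

lemma h1_curl_free:
 assumes "h1 f df" "test_function Om ph"
 shows "(LI x. df i x * pdiff j ph x) = (LI x. df j x * pdiff i ph x)"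
proof -
 have "Ck 2 ph" using assms(2) by (simp add: test_function_def)
 then have eq: "pdiff i (pdiff j ph) x = pdiff j (pdiff i ph) x" for x by (rule pdiff_commute)
 have e: "(LI x. f x * pdiff a (pdiff b ph) x) = - (LI x. df a x * pdiff b ph x)" for a b
  by (rule h1_C1c[OF assms(1) test_function_C1c[OF test_function_pdiff[OF assms(2)]]])
 show ?thesis using e[of i j, unfolded eq] e[of j i, unfolded eq] by linarith
qed

text \<open>\<open>G\<close> is \<open>\<nabla>ph\<close> minus its projection to the closure of the gradients of test functions.\<close>

lemma harmonic_part:
 assumes ph: "h1 ph dph"
 shows "\<exists>G. hfield G & nrm G <= gnorm dph &
  (\<forall>F. F \<in> L2O --> (\<forall>th. test_function Om th --> inr F (gr th) = 0) -->
   inr F (%x. \<chi> i. dph i x) = inr F G)"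
proof -
 define v :: "real^'n => real^'n" where "v x = (\<chi> i. dph i x)" for x
 have vL: "v \<in> L2O" using h1D(2)[OF ph] by (simp add: L2_component_iff v_def)
 have vn: "nrm v = gnorm dph"
  unfolding gnorm_def using L2_norm_component[OF vL] by (simp add: v_def real_sqrt_unique)
 define W where "W th x = v x - gr th x" for th x
 have WL: "W th \<in> L2O" if "test_function Om th" for th
  unfolding W_def[abs_def] by (intro L2_diff vL gr_L2 that)
 define A where "A = (%th. (nrm (W th))^2) ` {th. test_function Om th}"
 have z: "test_function Om (%x. 0)" by (rule test_functionI[OF Ck_const, of "{}"]) auto
 have "gr (%x. 0) = (%x. 0 :: real^'n)"
  using test_function_linear(2)[OF z z, of 0 0] by auto
 then have Wz: "W (%x. 0) = v" by (intro ext) (simp add: W_def)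
 have bdd: "bdd_below A" unfolding A_def by (rule bdd_belowI[of _ 0]) auto
 define d where "d = Inf A"
 have dle: "d <= (nrm (W th))^2" if "test_function Om th" for th
  unfolding d_def by (rule cInf_lower[OF _ bdd]) (use that in "simp add: A_def")
 have "\<exists>th. test_function Om th & (nrm (W th))^2 < d + inverse (real (Suc k))" for k
 proof -
  have "\<exists>a\<in>A. a < d + inverse (real (Suc k))"
   unfolding d_def by (rule cInf_lessD) (use z in "auto simp: A_def")
  then show ?thesis by (auto simp: A_def)
 qed
 then obtain th where th: "!!k. test_function Om (th k)" "!!k. (nrm (W (th k)))^2 < d + inverse (real (Suc k))"
  by metis
 define V where "V k = W (th k)" for k
 have VL: "V k \<in> L2O" for k unfolding V_def by (rule WL[OF th(1)])
 \<comment> \<open>The midpoint of two competitors is again a competitor, so its squared norm is at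
   least \<open>d\<close>; the parallelogram law then makes the minimizing sequence Cauchy.\<close>
 have Vc: "(nrm (%x. V m x - V n x))^2 < 2 * inverse (real (Suc m)) + 2 * inverse (real (Suc n))" for m n
 proof -
  have "(%x. (1 / 2) *\<^sub>R (V m x + V n x)) = W (%x. 1 / 2 * th m x + 1 / 2 * th n x)"
   using test_function_linear(2)[OF th(1)[of m] th(1)[of n], of "1 / 2" "1 / 2"]
   by (auto simp: V_def W_def vec_eq_iff field_simps)
  then have "d <= (nrm (%x. (1 / 2) *\<^sub>R (V m x + V n x)))^2"
   using dle[OF test_function_linear(1)[OF th(1)[of m] th(1)[of n], of "1 / 2" "1 / 2"]] by simp
  then show ?thesis using L2_parallelogram[OF VL[of m] VL[of n]] th(2)[of m] th(2)[of n] by (simp add: V_def)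
 qed
 have "\<exists>G\<in>L2O. (%k. nrm (%x. V k x - G x)) ~~> 0"
 proof (rule L2_complete_vec[OF VL])
  fix e :: real assume e: "e > 0"
  obtain K where K: "inverse (real (Suc K)) < e^2 / 4"
   using reals_Archimedean[of "e^2 / 4"] e by auto
  have "nrm (%x. V m x - V n x) < e" if "m >= K" "n >= K" for m n
  proof (rule power2_less_imp_less)
   have "inverse (real (Suc m)) <= inverse (real (Suc K))" "inverse (real (Suc n)) <= inverse (real (Suc K))"
    using that by (auto intro!: le_imp_inverse_le)
   then show "(nrm (%x. V m x - V n x))^2 < e^2" using Vc[of m n] K by linarith
  qed (use e in simp)
  then show "\<exists>K. \<forall>m\<ge>K. \<forall>n\<ge>K. nrm (%x. V m x - V n x) < e" by blast
 qed
 then obtain G where G: "G \<in> L2O" "(%k. nrm (%x. V k x - G x)) ~~> 0" by blast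
 have Vn: "(%k. (nrm (V k))^2) ~~> (nrm G)^2"
  by (intro tendsto_power L2_tendsto_norm[OF VL G])
 have "(%k. d + inverse (real (Suc k))) ~~> d + 0" by (intro tendsto_add tendsto_const LIMSEQ_inverse_real_of_nat)
 from LIMSEQ_le[OF Vn this] have Gd: "(nrm G)^2 <= d"
  using th(2) less_imp_le unfolding V_def by auto
 have div0: "inr G (gr ps) = 0" if ps: "test_function Om ps" for ps
 proof -
  \<comment> \<open>First variation: adding a multiple of \<open>gr ps\<close> cannot lower the norm
    of the minimizer, so this quadratic in \<open>t\<close> is nonnegative.\<close>
  have ge: "0 <= - 2 * t * inr G (gr ps) + t^2 * (nrm (gr ps))^2" for t
  proof -
   have "d <= (nrm (V k))^2 - 2 * t * inr (V k) (gr ps) + t^2 * (nrm (gr ps))^2" for k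
   proof -
    have "(%x. V k x - t *\<^sub>R gr ps x) = W (%x. 1 * th k x + t * ps x)"
     using test_function_linear(2)[OF th(1)[of k] ps, of 1 t] by (auto simp: V_def W_def)
    then show ?thesis
     using dle[OF test_function_linear(1)[OF th(1)[of k] ps, of 1 t]] L2_norm_diff_power2[OF VL[of k] gr_L2[OF ps], of t] by simp
   qed
   moreover have "(%k. (nrm (V k))^2 - 2 * t * inr (V k) (gr ps) + t^2 * (nrm (gr ps))^2)
    ~~> (nrm G)^2 - 2 * t * inr G (gr ps) + t^2 * (nrm (gr ps))^2"
    by (intro tendsto_add tendsto_diff tendsto_const tendsto_mult_left Vn L2_tendsto_inner[OF VL G(1) gr_L2[OF ps] G(2)])
   ultimately have "d <= (nrm G)^2 - 2 * t * inr G (gr ps) + t^2 * (nrm (gr ps))^2"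
    by (intro LIMSEQ_le_const) auto
   then show ?thesis using Gd by linarith
  qed
  define p n where "p = inr G (gr ps)" and "n = (nrm (gr ps))^2"
  have n0: "n >= 0" by (simp add: n_def)
  \<comment> \<open>The denominator \<open>n + 1\<close> in place of \<open>n\<close> avoids a
    separate case for a vanishing gradient.\<close>
  have "p^2 <= 0"
  proof -
   have "0 <= - 2 * (p / (n + 1)) * p + (p / (n + 1))^2 * n" using ge[of "p / (n + 1)"] unfolding p_def n_def .
   also have "... = - (p^2 * (n + 2)) / (n + 1)^2"
   proof -
    have "n + 1 ~= 0" using n0 by linarith
    then show ?thesis by (simp add: divide_simps power2_eq_square) (simp add: algebra_simps)
   qed
   finally have "p^2 * (n + 2) / (n + 1)^2 <= 0" by simp
   moreover have "0 < (n + 1)^2" using n0 by (intro zero_less_power) simp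
   ultimately have "p^2 * (n + 2) <= 0" by (simp add: divide_le_0_iff)
   then show ?thesis using n0 by (simp add: mult_le_0_iff)
  qed
  then show ?thesis by (simp add: p_def)
 qed
 have GLi: "(%x. G x $ i) \<in> L2O" and VLi: "(%x. V k x $ i) \<in> L2O" for i k
  by (rule L2_nth[OF G(1)], rule L2_nth[OF VL])
 have Vi: "(%k. nrm (%x. V k x $ i - G x $ i)) ~~> 0" for i
  by (rule tendsto_sandwich[OF always_eventually always_eventually tendsto_const G(2)])
   (use L2_norm_component_le[OF L2_diff[OF VL G(1)], of _ i] in simp_all)
 have curl: "(LI x. G x $ i * pdiff j ps x) = (LI x. G x $ j * pdiff i ps x)"
  if ps: "test_function Om ps" for ps i j
 proof -
  note T = C1c_L2_Omega(2)[OF test_function_C1c[OF ps]]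
  have l: "(%k. LI x. pdiff b ps x * V k x $ a) ~~> (LI x. pdiff b ps x * G x $ a)" for a b
   by (rule L2_Omega_tendsto_mult[OF VLi GLi T Vi])
  have "(LI x. pdiff b ps x * V k x $ a) = (LI x. pdiff a ps x * V k x $ b)" for a b k
  proof -
   note hd = h1_diff[OF ph C1c_imp_h1[OF test_function_C1c[OF th(1)[of k]]]]
   have "(LI x. (dph a x - pdiff a (th k) x) * pdiff b ps x) = (LI x. (dph b x - pdiff b (th k) x) * pdiff a ps x)"
    by (rule h1_curl_free[OF hd ps])
   then show ?thesis by (simp add: V_def W_def v_def mult.commute)
  qed
  then have "(LI x. pdiff j ps x * G x $ i) = (LI x. pdiff i ps x * G x $ j)"
   using LIMSEQ_unique[OF l[of j i]] l[of i j] by simp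
  then show ?thesis by (simp add: mult.commute)
 qed
 have "hfield G" unfolding hfield_def by (intro conjI allI impI G(1) curl div0)
 moreover have "nrm G <= gnorm dph"
  by (rule power2_le_imp_le[OF order_trans[OF Gd] gnorm_nonneg]) (use dle[OF z] vn in "simp add: Wz")
 \<comment> \<open>The approximants \<open>V k\<close> differ from \<open>v\<close> by gradients of
   test functions, to which \<open>F\<close> is orthogonal.\<close>
 moreover have "inr F v = inr F G"
  if F: "F \<in> L2O" and o: "!!th. test_function Om th ==> inr F (gr th) = 0" for F
 proof -
  have "inr (V k) F = inr F v" for k
   unfolding V_def W_def[abs_def] L2_inner_diff_left[OF vL gr_L2[OF th(1)] F]
   by (simp add: L2_inner_commute[of _ _ F] o[OF th(1)])
  then have "(%k. inr F v) ~~> inr G F" using L2_tendsto_inner[OF VL G(1) F G(2)] by simp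
  then show ?thesis using LIMSEQ_unique[OF _ tendsto_const] by (metis L2_inner_commute)
 qed
 ultimately show ?thesis by (intro exI[of _ G] conjI allI impI) (auto simp: v_def[abs_def])
qed

end

section \<open>Identities for harmonic fields\<close>

context bounded_open
begin

lemma h1_one: "h1 (%x. 1) (%i x. 0)"
proof (rule h1I)
 fix i ph dph assume "C1c Om ph dph"
 obtain K where K: "compact K & K \<subseteq> Om & (\<forall>x. x \<notin> K --> ph x = 0 & (\<forall>i. dph i x = 0))"
  using C1cD[OF \<open>C1c Om ph dph\<close>] by (rule exE)
 have "zext Om (dph i) = dph i"
 proof (rule ext)
  show "zext Om (dph i) x = dph i x" for x
   using K by (cases "x \<in> K") (auto simp: zext_def)
 qed
 then show "(LI x. 1 * dph i x) = - (LI x. 0 * ph x)"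
  using integral_partial_derivative_zero[OF C1c_mono[OF \<open>C1c Om ph dph\<close> subset_UNIV], of i]
  by (simp add: zext_integral)
qed (simp_all add: const_L2)

text \<open>The cutoff \<open>c\<close> turns the Sobolev function \<open>f\<close> into a limit of
  test functions. It is removed later, in \<open>hfield_h1_limit\<close>, when \<open>f\<close>
  vanishes on the boundary.\<close>

lemma hfield_h1:
 assumes G: "hfield G" and f: "h1 f df" and c: "C1c Om c dc"
 shows "(LI x. G x $ i * (c x * df j x + dc j x * f x)) = (LI x. G x $ j * (c x * df i x + dc i x * f x))"
  "(SU i. LI x. G x $ i * (c x * df i x + dc i x * f x)) = 0"
proof -
 obtain ph where ph0: "(\<forall>k::nat. test_function Om (ph k)) &
  (%k. nrm (%x. ph k x - c x * f x)) ~~> 0 &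
  (\<forall>i. (%k. nrm (%x. pdiff i (ph k) x - (c x * df i x + dc i x * f x))) ~~> 0)"
  using cutoff_approximation[OF f c] by (rule exE)
 note ph = ph0[THEN conjunct1, rule_format] ph0[THEN conjunct2, THEN conjunct2, rule_format]
 note T = C1c_L2_Omega(2)[OF test_function_C1c[OF ph(1)]]
 note h = h1D(2)[OF h1_mult[OF f C1_on_subset[OF C1c_C1_on[OF c] subset_UNIV]]]
 have l: "(%k. LI x. G x $ i * pdiff j (ph k) x) ~~> (LI x. G x $ i * (c x * df j x + dc j x * f x))" for i j
  by (rule L2_Omega_tendsto_mult[OF T h hfieldD(2)[OF G] ph(2)])
 show "(LI x. G x $ i * (c x * df j x + dc j x * f x)) = (LI x. G x $ j * (c x * df i x + dc i x * f x))"
  by (rule LIMSEQ_unique[OF l]) (unfold hfieldD(3)[OF G ph(1), where i = i and j = j], rule l)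
 have "(SU i. LI x. G x $ i * pdiff i (ph k) x) = 0" for k
  using hfieldD(4)[OF G ph(1)[of k]] L2_inner_component[OF hfieldD(1)[OF G] gr_L2[OF ph(1)[of k]]] by simp
 moreover have "(%k. SU i. LI x. G x $ i * pdiff i (ph k) x)
  ~~> (SU i. LI x. G x $ i * (c x * df i x + dc i x * f x))"
  by (intro tendsto_sum l)
 ultimately show "(SU i. LI x. G x $ i * (c x * df i x + dc i x * f x)) = 0"
  using LIMSEQ_unique[OF _ tendsto_const] by simp
qed

lemma hfield_C1c:
 assumes G: "hfield G" and ph: "C1c Om ph dph"
 shows "(LI x. G x $ i * dph j x) = (LI x. G x $ j * dph i x)"
  "(SU i. LI x. G x $ i * dph i x) = 0"
 using hfield_h1[OF G h1_one ph] by simp_all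

text \<open>The translated kernel is an admissible test function as long as its support
  \<open>cball x e\<close> lies in \<open>Om\<close>; at such points the mollified field is free of
  curl and divergence in the classical sense.\<close>

lemma mollified_field:
 assumes G: "hfield G" and tt: "mollifier e tt" and x: "cball x e \<subseteq> Om"
 shows "conv (zext Om (%x. G x $ i)) (pdiff j tt) x = conv (zext Om (%x. G x $ j)) (pdiff i tt) x"
  "(SU i. conv (zext Om (%x. G x $ i)) (pdiff i tt) x) = 0"
proof -
 have c: "C1c Om (%y. tt (x - y)) (%i y. - pdiff i tt (x - y))"
  unfolding C1c_def
 proof (intro conjI exI[of _ "cball x e"] allI impI)
  show "C1_on UNIV (%y. tt (x - y)) (%i y. - pdiff i tt (x - y))"
   by (rule C1_on_reflect[OF C1c_C1_on[OF C1_on_mollifier[OF tt]]])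
  show "tt (x - y) = 0" if "y \<notin> cball x e" for y
   by (rule mollifierD(3)[OF tt]) (use that in "simp add: dist_norm norm_minus_commute")
 qed (use x in simp_all)
 have e: "conv (zext Om (%x. G x $ i)) (pdiff j tt) x = - (LI y. G y $ i * - pdiff j tt (x - y))" for i j
 proof -
  have "zext Om (%y. G y $ i * pdiff j tt (x - y)) = (%y. zext Om (%x. G x $ i) y * pdiff j tt (x - y))"
   by (auto simp: zext_def)
  then show ?thesis unfolding conv_def by (simp add: zext_integral)
 qed
 show "conv (zext Om (%x. G x $ i)) (pdiff j tt) x = conv (zext Om (%x. G x $ j)) (pdiff i tt) x"
  unfolding e hfield_C1c(1)[OF G c, where i = i and j = j] ..
 show "(SU i. conv (zext Om (%x. G x $ i)) (pdiff i tt) x) = 0"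
  unfolding e sum_negf hfield_C1c(2)[OF G c] by simp
qed

lemma L2_tendsto_cmult:
 fixes c :: "'n fn"
 assumes c: "continuous_on UNIV c" and F: "!!k. F k \<in> L2O" "f \<in> L2O" "(%k. nrm (%x. F k x - f x)) ~~> 0"
 shows "(%x. c x * F k x) \<in> L2O" "(%x. c x * f x) \<in> L2O"
  "(%k. nrm (%x. c x * F k x - c x * f x)) ~~> 0"
proof -
 note cc = continuous_on_subset[OF c subset_UNIV]
 show "(%x. c x * F k x) \<in> L2O" "(%x. c x * f x) \<in> L2O" by (intro C1_on_mult_L2 cc F)+
 have "bounded (c ` closure Om)" by (intro compact_imp_bounded compact_continuous_image compact_closure_Omega cc)
 then obtain B where B: "!!x. x \<in> closure Om ==> \<bar>c x\<bar> <= B" by (auto simp: bounded_iff)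
 have m: "c \<in> borel_measurable MO"
  by (rule continuous_imp_measurable_on_sets_lebesgue[OF cc sets_Omega])
 have ae: "AEO x. \<bar>c x\<bar> <= B" by (rule AE_I2, rule B, rule subsetD[OF closure_subset]) simp
 have le: "nrm (%x. c x * F k x - c x * f x) <= \<bar>B\<bar> * nrm (%x. F k x - f x)" for k
  using L2_mult_bounded(2)[OF L2_diff[OF F(1)[of k] F(2)] m ae] by (simp add: algebra_simps)
 show "(%k. nrm (%x. c x * F k x - c x * f x)) ~~> 0"
  by (rule tendsto_sandwich[OF always_eventually always_eventually tendsto_const tendsto_mult_right_zero[OF F(3), of "\<bar>B\<bar>"]])
   (use le in simp_all)
qed

text \<open>For a smooth field \<open>F\<close> free of curl and divergence, the divergence of
  \<open>2 * (a . F) * F - |F|^2 * a\<close> contains no derivative of \<open>F\<close> and equals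
  the integrand. Its integral vanishes because \<open>a\<close> has compact support. The
  mollifications of \<open>G\<close> serve as \<open>F\<close>, and the quadratic terms pass to the
  limit; \<open>P\<close> and \<open>Q\<close> are the two parts of the vector field.\<close>

lemma Pohozaev_identity:
 assumes G: "hfield G" and a: "!!i. C1c Om (a i) (da i)"
 shows "(LI x. (SU i j. 2 * (da j i x * (G x $ i * G x $ j)))
  - (SU j i. da j j x * (G x $ i * G x $ i))) = 0"
proof -
 have "\<forall>i. \<exists>K. compact K & K \<subseteq> Om & (\<forall>x. x \<notin> K --> a i x = 0 & (\<forall>l. da i l x = 0))"
  using C1cD[OF a] by (rule allI)
 from choice[OF this] obtain Ks where Ks: "\<forall>i. compact (Ks i) & Ks i \<subseteq> Om & (\<forall>x. x \<notin> Ks i --> a i x = 0 & (\<forall>l. da i l x = 0))"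
  by (rule exE)
 define K where "K = (\<Union>i. Ks i)"
 have K: "compact K" "K \<subseteq> Om"
  unfolding K_def by (rule compact_UN[OF finite], rule Ks[rule_format, THEN conjunct1])
   (rule UN_least, rule Ks[rule_format, THEN conjunct2, THEN conjunct1])
 have z: "a i x = 0" "da i l x = 0" if "x \<notin> K" for i l x
 proof -
  have "x \<notin> Ks i" using that by (simp add: K_def)
  then show "a i x = 0" "da i l x = 0" using Ks[rule_format, of i] by simp_all
 qed
 have "\<exists>d>0. (\<Union>x\<in>K. cball x d) \<subseteq> Om"
  using compact_subset_open_imp_cball_epsilon_subset[OF K(1) open_Omega K(2)] by metis
 then obtain d where d0: "d > 0 & (\<Union>x\<in>K. cball x d) \<subseteq> Om" by (rule exE)
 have d: "d > 0" "!!x. x \<in> K ==> cball x d \<subseteq> Om"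
  using d0 by (simp, meson UN_subset_iff)
 obtain e tt where ett: "(\<forall>k::nat. mollifier (e k) (tt k :: 'n fn) & 0 < e k & e k < d) & e ~~> 0"
  using mollifier_sequence[OF d(1)] by (elim exE)
 note tt = ett[THEN conjunct1, rule_format, THEN conjunct1] and ed = ett[THEN conjunct1, rule_format, THEN conjunct2, THEN conjunct2]
  and e = ett[THEN conjunct2]
 define g where "g i = zext Om (%x. G x $ i)" for i
 have gL: "g i \<in> L2 UNIV" for i unfolding g_def by (rule zext_L2(1)[OF sets_Omega, THEN iffD2, OF hfieldD(2)[OF G]])
 have gz: "x \<notin> cball 0 diam ==> g i x = 0" for i x using subsetD[OF diam(2), of x] by (cases "x \<in> Om") (simp_all add: g_def zext_def)
 have gi: "integrable lebesgue (g i)" for i by (rule L2_bounded_support_integrable[OF gL gz])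
 define F where "F k i = conv (g i) (tt k)" for k i
 define dF where "dF k i l = conv (g i) (pdiff l (tt k))" for k i l
 have FC: "C1_on UNIV (F k i) (dF k i)" for k i
  unfolding F_def dF_def by (rule conv_C1_on[OF gi C1_on_mollifier[OF tt]])
 have FU: "F k i \<in> L2 UNIV" for k i unfolding F_def by (rule conv_L2(1)[OF tt gL gi])
 have FL: "F k i \<in> L2O" for k i by (rule L2_subset(1)[OF FU sets_Omega])
 have GL: "(%x. G x $ i) \<in> L2O" for i by (rule hfieldD(2)[OF G])
 have Fl: "(%k. nrm (%x. F k i x - G x $ i)) ~~> 0" for i
 proof (rule tendsto_sandwich[OF always_eventually always_eventually tendsto_const])
  show "(%k. L2_norm UNIV (%x. F k i x - g i x)) ~~> 0"
   unfolding F_def by (rule conv_tendsto_L2[OF gL gz tt e])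
  have "nrm (%x. F k i x - g i x) = nrm (%x. F k i x - G x $ i)" for k
   by (rule L2_norm_cong_AE)
    (rule AE_I2, simp add: g_def zext_def, rule L2D(1)[OF L2_diff[OF FL L2_subset(1)[OF gL sets_Omega]]], rule L2D(1)[OF L2_diff[OF FL GL]])
  then show "\<forall>k. nrm (%x. F k i x - G x $ i) <= L2_norm UNIV (%x. F k i x - g i x)"
   using L2_subset(2)[OF L2_diff[OF FU[of _ i] gL[of i]] sets_Omega] by simp
 qed simp
 have aC: "C1_on UNIV (a i) (da i)" for i by (rule C1c_C1_on[OF a])
 define E where "E k x = (SU i j. 2 * (da j i x * (F k i x * F k j x)))
  - (SU j i. da j j x * (F k i x * F k i x))" for k x
 have dai: "integrable MO (%x. da j l x * (f x * h x))" if "f \<in> L2O" "h \<in> L2O" for j l f h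
  using L2_integrable_mult[OF C1_on_mult_L2[OF continuous_on_subset[OF C1_onD(2)[OF aC] subset_UNIV] that(1)] that(2)]
  by (simp add: mult.assoc)
 have expand: "(LI x. (SU i j. 2 * (da j i x * (f i x * f j x)))
  - (SU j i. da j j x * (f i x * f i x)))
  = (SU i j. 2 * inr (%x. da j i x * f i x) (f j))
  - (SU j i. inr (%x. da j j x * f i x) (f i))" if f: "!!i. f i \<in> L2O" for f
 proof -
  note i = dai[OF f f]
  have "(LI x. (SU i j. 2 * (da j i x * (f i x * f j x)))) = (SU i j. 2 * inr (%x. da j i x * f i x) (f j))"
   by (subst B_sum, intro Bi_sum integrable_mult_right i,
     intro sum.cong[OF refl], subst B_sum, intro integrable_mult_right i)
    (simp add: L2_inner_def mult.assoc)
  moreover have "(LI x. (SU j i. da j j x * (f i x * f i x))) = (SU j i. inr (%x. da j j x * f i x) (f i))"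
   by (subst B_sum, intro Bi_sum i,
     intro sum.cong[OF refl], subst B_sum, intro i)
    (simp add: L2_inner_def mult.assoc)
  ultimately show ?thesis
   by (subst B_diff) (intro Bi_sum integrable_mult_right i, intro Bi_sum i, simp)
 qed
 have E0: "(LI x. E k x) = 0" for k
 proof -
  define P where "P i x = (SU j. a j x * (F k i x * F k j x))" for i x
  define dP where "dP i l x = (SU j. a j x * (F k i x * dF k j l x + dF k i l x * F k j x) + da j l x * (F k i x * F k j x))" for i l x
  define Q where "Q i x = a i x * (SU j. F k j x * F k j x)" for i x
  define dQ where "dQ i l x = a i x * (SU j. F k j x * dF k j l x + dF k j l x * F k j x) + da i l x * (SU j. F k j x * F k j x)" for i l x
  have "C1_on UNIV (P i) (dP i)" for i
   unfolding P_def[abs_def] dP_def[abs_def] by (intro C1_on_sum C1_on_mult aC FC)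
  then have CP: "C1c UNIV (P i) (dP i)" for i
   unfolding C1c_def by (intro conjI exI[of _ K] K) (auto simp: P_def z)
  have "C1_on UNIV (Q i) (dQ i)" for i
   unfolding Q_def[abs_def] dQ_def[abs_def] by (intro C1_on_sum C1_on_mult aC FC)
  then have CQ: "C1c UNIV (Q i) (dQ i)" for i
   unfolding C1c_def by (intro conjI exI[of _ K] K) (auto simp: Q_def z)
  have Pi: "integrable lebesgue (dP i l)" "integrable lebesgue (dQ i l)" for i l
   by (rule continuous_compact_support_integrable(2)[OF C1_onD(2)[OF C1c_C1_on[OF CP]] K(1)], simp add: dP_def z,
     rule continuous_compact_support_integrable(2)[OF C1_onD(2)[OF C1c_C1_on[OF CQ]] K(1)], simp add: dQ_def z)
  have Ex: "E k x = (SU i. 2 * dP i i x - dQ i i x)" for x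
  proof (cases "x \<in> K")
   case False then show ?thesis by (simp add: E_def dP_def dQ_def z)
  next
   case True
   have "cball x (e k) \<subseteq> Om" by (rule order_trans[OF subset_cball[OF less_imp_le[OF ed]] d(2)[OF True]])
   note mf = mollified_field[OF G tt this]
   have cu: "dF k i l x = dF k l i x" for i l unfolding dF_def g_def by (rule mf(1))
   have dv: "(SU i. dF k i i x) = 0" unfolding dF_def g_def by (rule mf(2))
   have "(SU i. 2 * dP i i x - dQ i i x)
    = (SU i j. 2 * (a j x * F k i x * dF k j i x)) + (SU i j. 2 * (a j x * F k j x) * dF k i i x)
    + (SU i j. 2 * (da j i x * (F k i x * F k j x)))
    - (SU i j. 2 * (a i x * F k j x * dF k j i x)) - (SU j i. da j j x * (F k i x * F k i x))"
    unfolding dP_def dQ_def sum_distrib_left sum_subtractf[symmetric] sum.distrib[symmetric]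
    by (intro sum.cong[OF refl]) (simp add: sum_distrib_left sum_subtractf[symmetric] sum.distrib[symmetric] algebra_simps)
   \<comment> \<open>Vanishing curl turns this sum into the one that comes from \<open>dQ\<close>,
     so the two cancel; the next sum contains the divergence as a factor.\<close>
   also have "(SU i j. 2 * (a j x * F k i x * dF k j i x)) = (SU j i. 2 * (a j x * F k i x * dF k i j x))"
    by (subst sum.swap) (simp only: cu)
   also have "(SU i j. 2 * (a j x * F k j x) * dF k i i x) = (SU j. 2 * (a j x * F k j x)) * (SU i. dF k i i x)"
    by (subst sum.swap) (simp add: sum_product)
   finally show ?thesis by (simp add: E_def dv)
  qed
  have "zext Om (E k) = (%x. SU i. 2 * dP i i x - dQ i i x)"
  proof (rule ext)
   fix x show "zext Om (E k) x = (SU i. 2 * dP i i x - dQ i i x)"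
   proof (cases "x \<in> Om")
    case False
    then have "x \<notin> K" using K(2) by blast
    then show ?thesis using False by (simp add: zext_def dP_def dQ_def z)
   qed (simp add: zext_def Ex)
  qed
  then have "(LI x. E k x) = (LE x. (SU i. 2 * dP i i x - dQ i i x))"
   by (simp add: zext_integral)
  also have "... = (SU i. 2 * (LE x. dP i i x) - (LE x. dQ i i x))"
   by (simp add: B_sum B_diff Pi)
  finally show ?thesis
   by (simp add: integral_partial_derivative_zero[OF CP] integral_partial_derivative_zero[OF CQ])
 qed
 have I: "(%k. inr (%x. da j l x * F k p x) (F k q)) ~~> inr (%x. da j l x * G x $ p) (%x. G x $ q)" for j l p q
  by (rule L2_tendsto_inner_both[OF L2_tendsto_cmult[OF C1_onD(2)[OF aC] FL GL Fl] FL GL Fl])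
 have "(%k. LI x. E k x) ~~> (LI x. (SU i j. 2 * (da j i x * (G x $ i * G x $ j)))
  - (SU j i. da j j x * (G x $ i * G x $ i)))"
  unfolding E_def expand[OF FL] expand[OF GL] by (intro tendsto_diff tendsto_sum tendsto_mult_left I)
 then show ?thesis unfolding E0 by (rule LIMSEQ_unique[OF _ tendsto_const])
qed

end

lemma norm_vec_power2: "(norm x)^2 = (SU i. (x $ i)^2)" for x :: "real^'n::finite"
 by (simp add: norm_vec_def L2_set_def sum_nonneg)

section \<open>Tangential energy of a harmonic field near the boundary\<close>

context strip_domain
begin

text \<open>Equal to 1 on the boundary and at most \<open>s / rr\<close> inside, so
  \<open>rr * xi <= s\<close>. As a function of \<open>rr\<close> the product \<open>rr * xi\<close>
  has derivative \<open>xi^2\<close>; this is where the weight \<open>xi^2\<close> of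
  \<open>weight_bound\<close> comes from.\<close>

definition xi :: "real => 'n fn" where "xi s x = s * inverse (s + rr x)"

lemma xi_bounds:
 assumes "s > 0" "x \<in> closure Om"
 shows "0 <= xi s x" "xi s x <= 1" "rr x * xi s x <= s" "rr x * (xi s x)^2 <= s" "s + rr x > 0" "1 - xi s x = rr x * inverse (s + rr x)"
proof -
 have r: "0 <= rr x" by (rule rho_closure[OF assms(2)])
 then show p: "s + rr x > 0" using assms(1) by simp
 show 0: "0 <= xi s x" using assms(1) p by (simp add: xi_def)
 show 1: "xi s x <= 1" using p r by (simp add: xi_def field_simps)
 have "s * rr x <= s * (s + rr x)" using assms(1) by simp
 then show 2: "rr x * xi s x <= s" using p by (simp add: xi_def field_simps)
 have "rr x * xi s x * xi s x <= s * 1" by (rule mult_mono[OF 2 1]) (use 0 assms(1) in auto)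
 then show "rr x * (xi s x)^2 <= s" by (simp add: power2_eq_square mult.assoc)
 show "1 - xi s x = rr x * inverse (s + rr x)" using p by (simp add: xi_def field_simps)
qed

lemma s_rho_C1: "C1_on S (%x. s + rr x) (%i x. 0 + N i x)"
 by (rule C1_on_subset[OF C1_on_add[OF C1_on_const rho_C1] subset_UNIV])

lemma q_nz: "x \<in> closure Om ==> q x ~= 0"
 using q_pos[of x] by simp

lemma iq_C1: "\<exists>d. C1_on (closure Om) (%x. inverse (q x)) d"
 using C1_on_inverse[OF C1_on_subset[OF q_C1 subset_UNIV] q_nz] by blast

lemma weighted_energy_measurable:
 assumes "G \<in> L2O"
 shows "integrable MO (%x. (norm (G x))^2)"
  "s > 0 ==> integrable MO (%x. (xi s x)^2 * (norm (G x))^2)"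
  "s > 0 ==> integrable MO (%x. (xi s x)^2 * ((SU i. G x $ i * N i x)^2 * inverse (q x)))"
proof -
 show g: "integrable MO (%x. (norm (G x))^2)" by (rule L2D(2)[OF assms])
 have [measurable]: "G \<in> borel_measurable MO" by (rule L2D(1)[OF assms])
 have [measurable]: "N i \<in> borel_measurable MO" "q \<in> borel_measurable MO" for i
  by (rule measurable_Omega[OF N_cont], rule measurable_Omega[OF q_cont])
 have [measurable]: "(%x. G x $ i) \<in> borel_measurable MO" for i
  by (rule L2D(1)[OF L2_nth[OF assms]])
 have [measurable]: "xi s \<in> borel_measurable MO" for s unfolding xi_def[abs_def] by measurable
 assume s: "s > 0"
 have x1: "(xi s x)^2 <= 1" if "x \<in> Om" for x
  using xi_bounds(1,2)[OF s subsetD[OF closure_subset that]] by (simp add: power_le_one)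
 show "integrable MO (%x. (xi s x)^2 * (norm (G x))^2)"
 proof (rule Bi_bound[OF g])
  show "AEO x. norm ((xi s x)^2 * (norm (G x))^2) <= norm ((norm (G x))^2)"
   by (rule AE_I2) (use mult_right_mono[OF x1] in simp)
 qed measurable
 show "integrable MO (%x. (xi s x)^2 * ((SU i. G x $ i * N i x)^2 * inverse (q x)))"
 proof (rule Bi_bound[OF g])
  show "AEO x. norm ((xi s x)^2 * ((SU i. G x $ i * N i x)^2 * inverse (q x))) <= norm ((norm (G x))^2)"
  proof (rule AE_I2)
   fix x assume "x \<in> space MO"
   then have x: "x \<in> Om" by simp
   note qx = q_pos[OF subsetD[OF closure_subset x]]
   have "(SU i. G x $ i * N i x)^2 <= (SU i. (G x $ i)^2) * (SU i. (N i x)^2)" by (rule Cauchy_Schwarz_ineq_sum)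
   also have "... <= (norm (G x))^2 * q x" unfolding norm_vec_power2
    using N_square_le_q[OF x] by (intro mult_left_mono) (simp_all add: sum_nonneg power2_eq_square)
   finally have p: "(SU i. G x $ i * N i x)^2 * inverse (q x) <= (norm (G x))^2"
    using qx by (simp add: field_simps)
   have "(xi s x)^2 * ((SU i. G x $ i * N i x)^2 * inverse (q x)) <= 1 * (norm (G x))^2"
    by (rule mult_mono[OF x1[OF x] p]) (use qx in simp_all)
   then show "norm ((xi s x)^2 * ((SU i. G x $ i * N i x)^2 * inverse (q x))) <= norm ((norm (G x))^2)"
    using qx by (simp add: abs_mult)
  qed
 qed measurable
qed

text \<open>The Pohozaev identity for the vector field \<open>rr * xi * N / q\<close>, whose
  gradient is \<open>xi^2 * N * N / q\<close> up to terms of size \<open>s\<close>. It shows that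
  the weighted energy of \<open>G\<close> is at most twice its normal part, up to an error of size
  \<open>s\<close>; so without the normal part at most about half of the energy remains.\<close>

lemma weight_bound:
 "\<exists>K>0. \<forall>s>0. \<forall>G. hfield G -->
  (LI x. (xi s x)^2 * (norm (G x))^2 - (xi s x)^2 * ((SU i. G x $ i * N i x)^2 * inverse (q x)))
  <= (1 / 2 + K * s) * (nrm G)^2"
proof -
 obtain diq where iq: "C1_on (closure Om) (%x. inverse (q x)) diq" using iq_C1 by (rule exE)
 define n where "n i x = N i x * inverse (q x)" for i x
 define dn where "dn i l x = N i x * diq l x + H i l x * inverse (q x)" for i l x
 have nC: "C1_on (closure Om) (n i) (dn i)" for i
  unfolding n_def[abs_def] dn_def[abs_def] by (rule C1_on_mult[OF C1_on_subset[OF N_C1 subset_UNIV] iq])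
 have "\<forall>i. \<exists>B>0. \<forall>x\<in>closure Om. \<bar>n i x\<bar> <= B & (\<forall>l. \<bar>dn i l x\<bar> <= B)"
  using C1_on_imp_bounded[OF nC compact_closure_Omega] by (rule allI)
 from choice[OF this] obtain Bi where Bi: "\<forall>i. Bi i > 0 & (\<forall>x\<in>closure Om. \<bar>n i x\<bar> <= Bi i & (\<forall>l. \<bar>dn i l x\<bar> <= Bi i))"
  by (rule exE)
 define B where "B = (SU i. Bi i)"
 have BB: "Bi i <= B" for i unfolding B_def by (rule member_le_sum) (use Bi[rule_format, THEN conjunct1, THEN less_imp_le] in auto)
 have dnB: "\<bar>dn i l x\<bar> <= B" if "x \<in> Om" for i l x
  using Bi[rule_format, THEN conjunct2, rule_format, OF subsetD[OF closure_subset that], THEN conjunct2, rule_format, of i l] BB[of i] by linarith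
 have B0: "B >= 0" using dnB BB Bi by (meson less_eq_real_def order_less_le_trans)
 obtain c where c: "c > 0 & (\<forall>x\<in>closure Om. c <= q x)" using q_lower by blast
 define d where "d = real CARD('n)"
 \<comment> \<open>The first two terms bound the derivatives of \<open>N / q\<close> in the Pohozaev
   integrand, with \<open>d\<close> the dimension; \<open>1 / c\<close> pays for the difference
   \<open>rr\<close> between \<open>q\<close> and the squared gradient.\<close>
 define K where "K = 2 * d * d * B + d * B + 1 / c"
 have K0: "K > 0" using c B0 by (simp add: K_def d_def add_nonneg_pos)
 have main: "(LI x. (xi s x)^2 * (norm (G x))^2 - (xi s x)^2 * ((SU i. G x $ i * N i x)^2 * inverse (q x)))
  <= (1 / 2 + K * s) * (nrm G)^2" if s: "s > 0" and G: "hfield G" for s G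
 proof -
  define h where "h x = rr x * (s * inverse (s + rr x))" for x
  define dh where "dh l x = rr x * (s * (- (inverse (s + rr x) * inverse (s + rr x)) * (0 + N l x)) + 0 * inverse (s + rr x)) + N l x * (s * inverse (s + rr x))" for l x
  have hC: "C1_on Om h dh" unfolding h_def[abs_def] dh_def[abs_def]
   by (intro C1_on_mult C1_on_const C1_on_inverse s_rho_C1 C1_on_subset[OF rho_C1 subset_UNIV])
    (use xi_bounds(5)[OF s subsetD[OF closure_subset]] in force)
  have dh: "dh l x = (xi s x)^2 * N l x" if "x \<in> Om" for l x
  proof -
   define r where "r = inverse (s + rr x)"
   have "s * r + rr x * r = 1"
    using xi_bounds(5)[OF s subsetD[OF closure_subset that]] by (simp add: r_def distrib_right[symmetric])
   then have "1 - rr x * r = s * r" by linarith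
   moreover have "dh l x = s * r * N l x * (1 - rr x * r)" by (simp add: dh_def r_def algebra_simps)
   ultimately have "dh l x = s * r * N l x * (s * r)" by (simp only:)
   then show ?thesis by (simp add: xi_def r_def[symmetric] power2_eq_square)
  qed
  define a where "a m i x = cut (m * rr x) * (h x * n i x)" for m i x
  define da where "da m i l x = (if x \<in> Om then cut (m * rr x) * (h x * dn i l x + dh l x * n i x) + m * cut' (m * rr x) * N l x * (h x * n i x) else 0)" for m i l x
  have aC: "C1c Om (a m i) (da m i)" if "m > 0" for m i
   unfolding a_def[abs_def] da_def[abs_def]
   by (rule C1c_mult_local[OF cut_C1c[OF that] C1_on_mult[OF hC C1_on_subset[OF nC closure_subset]] open_Omega])
  define g where "g x = (norm (G x))^2" for x
  define P where "P x = (SU i. G x $ i * N i x)^2 * inverse (q x)" for x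
  define w where "w x = (xi s x)^2" for x
  note I = weighted_energy_measurable[OF hfieldD(1)[OF G]]
  have Ig: "integrable MO g" "integrable MO (%x. w x * g x)" "integrable MO (%x. w x * P x)"
   unfolding g_def w_def P_def by (rule I(1), rule I(2)[OF s], rule I(3)[OF s])
  have gn: "(LI x. g x) = (nrm G)^2" by (simp add: g_def L2_norm_power2)
  define lg where "lg m x = (SU i. (loc (2 / m) (%x. G x $ i) x)^2)" for m x
  have lgi: "integrable MO (lg m)" for m unfolding lg_def[abs_def]
   by (intro Bi_sum L2_integrable_power2 loc_L2(1) hfieldD(2)[OF G])
  define Y where "Y x = w x * g x - 2 * (w x * P x)" for x
  have Yi: "integrable MO Y" unfolding Y_def[abs_def]
   by (intro Bi_diff integrable_mult_right Ig)
  have step: "(LI x. cut (m * rr x) * Y x) <= K * s * (nrm G)^2 + 16 * (LI x. lg m x)"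
   if m: "m > 0" for m
  proof -
   define S where "S x = (SU i j. 2 * (da m j i x * (G x $ i * G x $ j))) - (SU j i. da m j j x * (G x $ i * G x $ i))" for x
   have S0: "(LI x. S x) = 0" unfolding S_def by (rule Pohozaev_identity[OF G aC[OF m]])
   have dai: "integrable MO (%x. da m j l x * (G x $ p * G x $ r))" for j l p r
    using L2_integrable_mult[OF C1_on_mult_L2[OF continuous_on_subset[OF C1_onD(2)[OF C1c_C1_on[OF aC[OF m]]] subset_UNIV] hfieldD(2)[OF G]] hfieldD(2)[OF G]]
    by (simp add: mult.assoc)
   have Si: "integrable MO S" unfolding S_def[abs_def]
    by (intro Bi_diff Bi_sum integrable_mult_right dai)
   have "(LI x. cut (m * rr x) * Y x + S x) <= (LI x. K * s * g x + 16 * lg m x)"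
   proof (rule integral_mono)
    fix x assume "x \<in> space MO"
    then have x: "x \<in> Om" by simp
    note xc = subsetD[OF closure_subset x]
    note xb = xi_bounds[OF s xc]
    have rp: "rr x > 0" using x rho_pos by blast
    have qx: "q x > 0" "c <= q x" using q_pos[OF xc] c xc by auto
    define k where "k = cut (m * rr x)"
    have k: "0 <= k" "k <= 1" unfolding k_def by (rule cut_bounds)+
    define v where "v = m * cut' (m * rr x) * h x"
    define GN where "GN = (SU i. G x $ i * N i x)"
    define NN where "NN = (SU i. N i x * N i x)"
    have gx: "g x = (SU i. G x $ i * G x $ i)" unfolding g_def norm_vec_power2 by (simp add: power2_eq_square)
    have g0: "0 <= g x" by (simp add: g_def)
    have Px: "P x = GN * GN * inverse (q x)" by (simp add: P_def GN_def power2_eq_square)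
    define R where "R = (SU i j. 2 * (dn j i x * (G x $ i * G x $ j))) - (SU j. dn j j x) * g x"
    have Gij: "\<bar>G x $ i * G x $ j\<bar> <= g x" for i j
     unfolding abs_mult g_def power2_eq_square by (intro mult_mono component_le_norm_cart) auto
    have "\<bar>SU i j. 2 * (dn j i x * (G x $ i * G x $ j))\<bar> <= (\<Sum>i\<in>(UNIV::'n set). \<Sum>j\<in>(UNIV::'n set). 2 * (B * g x))"
    proof (rule order_trans[OF sum_abs], rule sum_mono, rule order_trans[OF sum_abs], rule sum_mono)
     fix i j show "\<bar>2 * (dn j i x * (G x $ i * G x $ j))\<bar> <= 2 * (B * g x)"
      using mult_mono[OF dnB[OF x, of j i] Gij[of i j]] B0 by (simp add: abs_mult)
    qed
    then have R1: "\<bar>SU i j. 2 * (dn j i x * (G x $ i * G x $ j))\<bar> <= 2 * d * d * B * g x" by (simp add: d_def)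
    have "\<bar>SU j. dn j j x\<bar> <= (\<Sum>j\<in>(UNIV::'n set). B)"
     by (rule order_trans[OF sum_abs], rule sum_mono, rule dnB[OF x])
    then have "\<bar>SU j. dn j j x\<bar> <= d * B" by (simp add: d_def)
    from mult_right_mono[OF this g0] have "\<bar>(SU j. dn j j x) * g x\<bar> <= d * B * g x" using g0 by (simp add: abs_mult)
    then have R: "\<bar>R\<bar> <= (2 * d * d * B + d * B) * g x" using R1 unfolding R_def by (simp add: distrib_right)
    \<comment> \<open>The gradient of the vector field splits into a regular part with factor
      \<open>h\<close> and a rank one part along \<open>N\<close>; the factor
      \<open>k * w x + v\<close> of the latter is the derivative of \<open>cut (m * rr) * h\<close>
      as a function of \<open>rr\<close>.\<close>
    have Sx: "S x = k * (h x * R) + (k * w x + v) * (2 * P x - NN * inverse (q x) * g x)"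
    proof -
     have e: "da m j l x = k * h x * dn j l x + (k * w x + v) * inverse (q x) * (N l x * N j x)" for j l
      using x by (simp add: da_def dh w_def v_def k_def n_def algebra_simps)
     have "S x = (SU i j. k * h x * (2 * (dn j i x * (G x $ i * G x $ j))) + 2 * ((k * w x + v) * inverse (q x)) * ((G x $ i * N i x) * (G x $ j * N j x)))
      - (SU j i. (k * h x * dn j j x + (k * w x + v) * inverse (q x) * (N j x * N j x)) * (G x $ i * G x $ i))"
      unfolding S_def e by (intro arg_cong2[where f = "(-)"] sum.cong refl) (simp_all add: algebra_simps)
     also have "... = k * h x * (SU i j. 2 * (dn j i x * (G x $ i * G x $ j))) + 2 * ((k * w x + v) * inverse (q x)) * (GN * GN)
      - (k * h x * (SU j. dn j j x) + (k * w x + v) * inverse (q x) * NN) * g x"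
      unfolding GN_def NN_def gx sum_product
      by (simp only: sum.distrib sum_distrib_left[symmetric] sum_distrib_right[symmetric] sum_product[symmetric])
     finally show ?thesis unfolding R_def Px by (simp add: algebra_simps)
    qed
    have hx: "0 <= h x" "h x <= s" "h x <= rr x"
     using rp xb(1,2,3) mult_left_mono[OF xb(2), of "rr x"] by (simp_all add: h_def xi_def)
    have "k * h x <= 1 * s" by (rule mult_mono) (use k hx in auto)
    then have t1: "k * (h x * R) <= (2 * d * d * B + d * B) * s * g x"
    proof -
     have "k * (h x * R) <= (k * h x) * \<bar>R\<bar>" using k hx mult_left_mono[of R "\<bar>R\<bar>" "k * h x"] by (simp add: mult.assoc)
     also have "... <= s * ((2 * d * d * B + d * B) * g x)"
      by (rule mult_mono) (use \<open>k * h x <= 1 * s\<close> R s in auto)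
     finally show ?thesis by (simp add: mult_ac)
    qed
    have NNq: "NN = q x - rr x" by (simp add: NN_def q_def)
    have P0: "0 <= P x" using qx by (simp add: P_def)
    have Pg: "P x <= g x"
    proof -
     have "(SU i. G x $ i * N i x)^2 <= (SU i. (G x $ i)^2) * (SU i. (N i x)^2)" by (rule Cauchy_Schwarz_ineq_sum)
     also have "... <= g x * q x" unfolding g_def norm_vec_power2
      using N_square_le_q[OF x] by (intro mult_left_mono) (simp_all add: sum_nonneg power2_eq_square)
     finally show ?thesis using qx by (simp add: P_def field_simps)
    qed
    \<comment> \<open>The derivative of the cutoff is of size \<open>m\<close> but meets
      \<open>h <= rr < 2 / m\<close>, so the product stays bounded; it acts only on a strip where
      the energy of \<open>G\<close> tends to zero.\<close>
    have v0: "0 <= v" "v <= 8" "\<not> rr x < 2 / m ==> v = 0"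
    proof -
     show "0 <= v" using m hx cut_bounds(7)[of "m * rr x"] by (simp add: v_def)
     show z: "v = 0" if "\<not> rr x < 2 / m"
      using that m cut_bounds(6)[of "m * rr x"] by (simp add: v_def field_simps)
     show "v <= 8"
     proof (cases "rr x < 2 / m")
      case True
      then have "m * rr x <= 2" using m by (simp add: field_simps)
      then have "m * h x <= 2" using mult_left_mono[OF hx(3), of m] m by linarith
      moreover have "cut' (m * rr x) <= 4" using cut_bounds(5)[of "m * rr x"] by linarith
      ultimately have "cut' (m * rr x) * (m * h x) <= 4 * 2"
       by (intro mult_mono) (use m hx in auto)
      then show ?thesis by (simp add: v_def mult_ac)
     qed (simp add: z)
    qed
    have t2: "v * (2 * P x - NN * inverse (q x) * g x) <= 16 * lg m x"
    proof (cases "rr x < 2 / m")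
     case True
     have "0 <= NN * inverse (q x) * g x" using qx g0 by (simp add: NN_def sum_nonneg)
     then have "v * (2 * P x - NN * inverse (q x) * g x) <= v * (2 * g x)" using Pg v0(1) by (intro mult_left_mono) auto
     also have "... <= 8 * (2 * g x)" using v0 g0 by (intro mult_right_mono) auto
     also have "... = 16 * lg m x" using True by (simp add: lg_def loc_def gx power2_eq_square)
     finally show ?thesis .
    qed (simp add: v0(3) lg_def sum_nonneg)
    have t3: "k * (w x * (rr x * inverse (q x) * g x)) <= 1 / c * s * g x"
    proof -
     have "w x * rr x <= s" using xb(4) by (simp add: w_def mult.commute)
     moreover have "inverse (q x) <= 1 / c" using le_imp_inverse_le[OF qx(2)] c by (simp add: inverse_eq_divide)
     ultimately have "(w x * rr x) * inverse (q x) <= s * (1 / c)" by (rule mult_mono) (use s qx in auto)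
     from mult_right_mono[OF this g0] have A: "w x * (rr x * inverse (q x) * g x) <= 1 / c * s * g x" by (simp add: mult_ac)
     have "0 <= w x * (rr x * inverse (q x) * g x)" using rp qx g0 by (simp add: w_def)
     from mult_right_mono[OF k(2) this] A show ?thesis by simp
    qed
    have "cut (m * rr x) * Y x + S x = k * (h x * R) + k * (w x * (rr x * inverse (q x) * g x)) + v * (2 * P x - NN * inverse (q x) * g x)"
     unfolding Sx Y_def k_def[symmetric] NNq using qx(1) by (simp add: field_simps)
    also have "... <= (2 * d * d * B + d * B) * s * g x + 1 / c * s * g x + 16 * lg m x"
     using t1 t2 t3 by linarith
    also have "... = K * s * g x + 16 * lg m x" by (simp add: K_def algebra_simps)
    finally show "cut (m * rr x) * Y x + S x <= K * s * g x + 16 * lg m x" .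
   qed (intro Bi_add integrable_mult_right cut_integral_tendsto(2)[OF Yi] Si Ig(1) lgi)+
   then show ?thesis
    by (simp add: B_add cut_integral_tendsto(2)[OF Yi] Si Ig(1) lgi S0 gn)
  qed
  have "(%m. SU i. (nrm (loc (2 / real (Suc m)) (%x. G x $ i)))^2) ~~> (\<Sum>i\<in>(UNIV::'n set). 0^2)"
   by (intro tendsto_sum tendsto_power loc_tendsto hfieldD(2)[OF G])
  moreover have "(LI x. lg m x) = (SU i. (nrm (loc (2 / m) (%x. G x $ i)))^2)" for m
   unfolding lg_def L2_norm_power2_real
   by (rule B_sum) (intro L2_integrable_power2 loc_L2(1) hfieldD(2)[OF G])
  ultimately have lgl: "(%m. LI x. lg (real (Suc m)) x) ~~> 0" by simp
  have yl: "(LI x. Y x) <= K * s * (nrm G)^2 + 16 * 0"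
  proof (rule LIMSEQ_le[OF cut_integral_tendsto(1)[OF Yi]])
   show "(%m. K * s * (nrm G)^2 + 16 * (LI x. lg (real (Suc m)) x)) ~~> K * s * (nrm G)^2 + 16 * 0"
    by (intro tendsto_add tendsto_const tendsto_mult_left lgl)
   show "\<exists>M. \<forall>m\<ge>M. (LI x. cut (real (Suc m) * rr x) * Y x) <= K * s * (nrm G)^2 + 16 * (LI x. lg (real (Suc m)) x)"
    by (intro exI[of _ 0] allI impI step) simp
  qed
  have y: "(LI x. Y x) = (LI x. w x * g x) - 2 * (LI x. w x * P x)"
   unfolding Y_def using Ig(2,3) by simp
  have wg: "(LI x. w x * g x) <= (LI x. g x)"
  proof (rule integral_mono[OF Ig(2,1)])
   fix x assume "x \<in> space MO"
   then have "x \<in> closure Om" using closure_subset by auto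
   from xi_bounds(1,2)[OF s this] have "w x <= 1" by (simp add: w_def power_le_one)
   from mult_right_mono[OF this, of "g x"] show "w x * g x <= g x" by (simp add: g_def)
  qed
  \<comment> \<open>Half the sum of the bounds \<open>yl\<close> and \<open>wg\<close>; half of the
    error term is given away.\<close>
  have "(LI x. w x * g x) - (LI x. w x * P x) <= (1 / 2) * (nrm G)^2 + K * s * (nrm G)^2"
  proof -
   have "0 <= K * s * (nrm G)^2" using K0 s by simp
   then show ?thesis using yl y wg gn by linarith
  qed
  then show ?thesis
   unfolding g_def[symmetric] P_def[symmetric] w_def[symmetric]
   by (simp add: B_diff[OF Ig(2,3)] distrib_right)
 qed
 show ?thesis by (intro exI[of _ K] conjI allI impI K0 main)
qed

end

subsection \<open>The commutator estimate\<close>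

text \<open>Second derivatives are only asserted to exist: later arguments use their continuity,
  which bounds them on the compact closure, and not their values.\<close>

definition C2_on :: "(real^'n::finite) set => 'n fn => ('n => 'n fn) => bool" where
 "C2_on S c dc \<longleftrightarrow> C1_on S c dc & (\<forall>i. \<exists>dd. C1_on S (dc i) dd)"

lemma C2_onD:
 assumes "C2_on S c dc" shows "C1_on S c dc" "\<exists>dd. C1_on S (dc i) dd"
 using assms by (auto simp: C2_on_def)

lemma C2_on_const: "C2_on S (%x. c) (%i x. 0)"
 unfolding C2_on_def by (rule conjI[OF C1_on_const]) (rule allI, rule exI, rule C1_on_const)

lemma C2_on_mult:
 assumes "C2_on S c dc" "C2_on S d dd"
 shows "C2_on S (%x. c x * d x) (%i x. c x * dd i x + dc i x * d x)"
 unfolding C2_on_def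
proof (intro conjI allI)
 note c = C2_onD(1)[OF assms(1)] and d = C2_onD(1)[OF assms(2)]
 show "C1_on S (%x. c x * d x) (%i x. c x * dd i x + dc i x * d x)" by (rule C1_on_mult[OF c d])
 fix i
 obtain ddc ddd where e: "C1_on S (dc i) ddc" "C1_on S (dd i) ddd"
  using C2_onD(2)[OF assms(1), of i] C2_onD(2)[OF assms(2), of i] by (elim exE)
 show "\<exists>e. C1_on S (%x. c x * dd i x + dc i x * d x) e"
  by (rule exI, rule C1_on_add[OF C1_on_mult[OF c e(2)] C1_on_mult[OF e(1) d]])
qed

lemma C2_on_diff:
 assumes "C2_on S c dc" "C2_on S d dd"
 shows "C2_on S (%x. c x - d x) (%i x. dc i x - dd i x)"
 unfolding C2_on_def
proof (intro conjI allI)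
 show "C1_on S (%x. c x - d x) (%i x. dc i x - dd i x)"
  by (rule C1_on_diff[OF C2_onD(1)[OF assms(1)] C2_onD(1)[OF assms(2)]])
 fix i
 obtain ddc ddd where e: "C1_on S (dc i) ddc" "C1_on S (dd i) ddd"
  using C2_onD(2)[OF assms(1), of i] C2_onD(2)[OF assms(2), of i] by (elim exE)
 show "\<exists>e. C1_on S (%x. dc i x - dd i x) e" by (rule exI, rule C1_on_diff[OF e])
qed

lemma C2_on_inverse:
 assumes c: "C2_on S c dc" and nz: "!!x. x \<in> S ==> c x ~= 0"
 shows "C2_on S (%x. inverse (c x)) (%i x. - (inverse (c x) * inverse (c x)) * dc i x)"
 unfolding C2_on_def
proof (intro conjI allI)
 show i: "C1_on S (%x. inverse (c x)) (%i x. - (inverse (c x) * inverse (c x)) * dc i x)"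
  by (rule C1_on_inverse[OF C2_onD(1)[OF c] nz])
 fix l
 obtain ddc where e: "C1_on S (dc l) ddc" using C2_onD(2)[OF c, of l] by (elim exE)
 show "\<exists>e. C1_on S (%x. - (inverse (c x) * inverse (c x)) * dc l x) e"
  by (rule exI, rule C1_on_mult[OF C1_on_uminus[OF C1_on_mult[OF i i]] e])
qed

context bounded_open
begin

lemma h2_mult:
 assumes f: "h1 f df" "!!l. h1 (df l) (ddf l)" and c: "C1_on (closure Om) c dc" "!!l. C1_on (closure Om) (dc l) (ddc l)"
 shows "h1 (%x. c x * f x) (%l x. c x * df l x + dc l x * f x)"
  "h1 (%x. c x * df l x + dc l x * f x) (%m x. (c x * ddf l m x + dc m x * df l x) + (dc l x * df m x + ddc l m x * f x))"
 by (rule h1_mult[OF f(1) c(1)], rule h1_add[OF h1_mult[OF f(2) c(1)] h1_mult[OF f(1) c(2)]])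

end

context strip_domain
begin

text \<open>The derivative of the cutoff is of size \<open>m\<close> on the strip of width
  \<open>2 / m\<close>, where the norm of \<open>f\<close> is of size \<open>1 / m\<close>; there
  remains the norm of \<open>g\<close> on that strip, which tends to zero.\<close>

lemma van_boundary_layer:
 assumes f: "van f" and g: "g \<in> L2O"
 shows "(%m. LI x. g x * (real (Suc m) * cut' (real (Suc m) * rr x) * N l x * f x)) ~~> 0"
proof -
 obtain C where C: "\<forall>s>0. nrm (loc s f) <= C * s" and fL: "f \<in> L2O" using f unfolding van_def by blast
 obtain B where B: "B > 0" "\<forall>x\<in>closure Om. \<bar>N l x\<bar> <= B" using continuous_bounded[OF N_cont] by blast
 have ab: "(%x. \<bar>h x\<bar>) \<in> L2O" "nrm (%x. \<bar>h x\<bar>) = nrm h" if "h \<in> L2O" for h :: "'n fn"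
  by (rule L2_bound[OF that borel_measurable_abs[OF L2D(1)[OF that]]], simp, simp add: L2_norm_def L2_inner_def abs_mult[symmetric])
 have bd: "\<bar>LI x. g x * (m * cut' (m * rr x) * N l x * f x)\<bar> <= 8 * B * C * nrm (loc (2 / m) g)"
  if m: "m > 0" for m
 proof -
  note c = C1_onD(2)[OF cut_rho_C1, of m l]
  have i: "integrable MO (%x. g x * (m * cut' (m * rr x) * N l x * f x))"
   by (rule L2_integrable_mult[OF g C1_on_mult_L2[OF continuous_on_subset[OF c subset_UNIV] fL]])
  have i2: "integrable MO (%x. 4 * m * B * (\<bar>loc (2 / m) g x\<bar> * \<bar>loc (2 / m) f x\<bar>))"
   by (intro integrable_mult_right L2_integrable_mult ab(1) loc_L2(1) g fL)
  have "\<bar>LI x. g x * (m * cut' (m * rr x) * N l x * f x)\<bar> <= (LI x. \<bar>g x * (m * cut' (m * rr x) * N l x * f x)\<bar>)"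
   by (rule integral_abs_bound)
  also have "... <= (LI x. 4 * m * B * (\<bar>loc (2 / m) g x\<bar> * \<bar>loc (2 / m) f x\<bar>))"
  proof (rule integral_mono[OF integrable_abs[OF i] i2])
   fix x assume "x \<in> space MO"
   then have x: "x \<in> closure Om" using closure_subset by auto
   show "\<bar>g x * (m * cut' (m * rr x) * N l x * f x)\<bar> <= 4 * m * B * (\<bar>loc (2 / m) g x\<bar> * \<bar>loc (2 / m) f x\<bar>)"
   proof (cases "rr x < 2 / m")
    case True
    have "\<bar>cut' (m * rr x)\<bar> * \<bar>N l x\<bar> <= 4 * B" by (rule mult_mono) (use cut_bounds(5) B x in auto)
    from mult_left_mono[OF this, of "m * (\<bar>g x\<bar> * \<bar>f x\<bar>)"] m True show ?thesis by (simp add: loc_def abs_mult mult_ac)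
   next
    case False
    then have "2 <= m * rr x" using m by (simp add: field_simps)
    then show ?thesis using False by (simp add: cut_bounds(6) loc_def)
   qed
  qed
  also have "... = 4 * m * B * inr (%x. \<bar>loc (2 / m) g x\<bar>) (%x. \<bar>loc (2 / m) f x\<bar>)" by (simp add: L2_inner_def)
  also have "... <= 4 * m * B * (nrm (loc (2 / m) g) * nrm (loc (2 / m) f))"
   using L2_inner_le[OF ab(1)[OF loc_L2(1)[OF g]] ab(1)[OF loc_L2(1)[OF fL]], of "2 / m" "2 / m"] ab(2)[OF loc_L2(1)[OF g]] ab(2)[OF loc_L2(1)[OF fL]] m B(1)
   by (intro mult_left_mono) auto
  also have "... <= 4 * m * B * (nrm (loc (2 / m) g) * (C * (2 / m)))"
   using C[rule_format, of "2 / m"] m B(1) by (intro mult_left_mono) auto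
  also have "... = 8 * B * C * nrm (loc (2 / m) g)" using m by (simp add: field_simps)
  finally show ?thesis .
 qed
 have "(%m. 8 * B * C * nrm (loc (2 / real (Suc m)) g)) ~~> 8 * B * C * 0"
  by (intro tendsto_mult_left loc_tendsto g)
 then have l: "(%m. 8 * B * C * nrm (loc (2 / real (Suc m)) g)) ~~> 0" by simp
 show ?thesis
  by (rule Lim_null_comparison[OF always_eventually l]) (use bd[of "real (Suc _)"] in simp)
qed

lemma hfield_h1_limit:
 assumes G: "hfield G" and f: "h1 f df" and v: "van f"
 shows "(%m. LI x. G x $ i * (cut (real (Suc m) * rr x) * df j x + real (Suc m) * cut' (real (Suc m) * rr x) * N j x * f x))
  ~~> (LI x. G x $ i * df j x)"
proof -
 note i1 = L2_integrable_mult[OF hfieldD(2)[OF G] h1D(2)[OF f], of i j]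
 have i2: "integrable MO (%x. G x $ i * (m * cut' (m * rr x) * N j x * f x))" for m
  by (rule L2_integrable_mult[OF hfieldD(2)[OF G] C1_on_mult_L2[OF continuous_on_subset[OF C1_onD(2)[OF cut_rho_C1] subset_UNIV] h1D(1)[OF f]]])
 have "(LI x. G x $ i * (cut (m * rr x) * df j x + m * cut' (m * rr x) * N j x * f x))
  = (LI x. cut (m * rr x) * (G x $ i * df j x)) + (LI x. G x $ i * (m * cut' (m * rr x) * N j x * f x))" for m
  unfolding B_add[OF cut_integral_tendsto(2)[OF i1] i2, symmetric]
  by (rule B_cong[OF refl]) (simp add: algebra_simps)
 then show ?thesis
  using tendsto_add[OF cut_integral_tendsto(1)[OF i1] van_boundary_layer[OF v hfieldD(2)[OF G]]] by simp
qed

text \<open>The identity holds with the cutoff \<open>cut (m * rr)\<close> in place, and as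
  \<open>m\<close> grows the boundary layer disappears because \<open>f\<close> vanishes on the
  boundary.\<close>

lemma div_orthogonal:
 assumes G: "hfield G" and f: "h1 f df" and v: "van f"
 shows "(SU i. LI x. G x $ i * df i x) = 0"
proof (rule LIMSEQ_unique)
 show "(%m. SU i. LI x. G x $ i * (cut (real (Suc m) * rr x) * df i x + real (Suc m) * cut' (real (Suc m) * rr x) * N i x * f x))
  ~~> (SU i. LI x. G x $ i * df i x)"
  by (intro tendsto_sum hfield_h1_limit[OF G f v])
 show "(%m. SU i. LI x. G x $ i * (cut (real (Suc m) * rr x) * df i x + real (Suc m) * cut' (real (Suc m) * rr x) * N i x * f x))
  ~~> 0"
  unfolding hfield_h1(2)[OF G f cut_C1c[OF of_nat_0_less_iff[THEN iffD2, OF zero_less_Suc]]] by (rule tendsto_const)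
qed

text \<open>With the cutoff in place, vanishing curl of \<open>G\<close> exchanges the two indices
  and antisymmetry of \<open>A\<close> changes the sign, so the double sum is its own negative. The
  cutoff is removed as in \<open>div_orthogonal\<close>.\<close>

lemma curl_orthogonal:
 assumes G: "hfield G" and A: "!!i j. h1 (A i j) (dA i j)" and v: "!!i j. van (A i j)"
  and anti: "!!i j x. A i j x = - A j i x" "!!i j l x. dA i j l x = - dA j i l x"
 shows "(SU i j. LI x. G x $ i * dA i j j x) = 0"
proof -
 define D where "D m i j l x = cut (real (Suc m) * rr x) * dA i j l x + real (Suc m) * cut' (real (Suc m) * rr x) * N l x * A i j x" for m i j l x
 have sw: "(LI x. G x $ a * D m i j b x) = (LI x. G x $ b * D m i j a x)" for m i j a b
  unfolding D_def by (rule hfield_h1(1)[OF G A cut_C1c]) simp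
 have neg: "(LI x. G x $ a * D m i j b x) = - (LI x. G x $ a * D m j i b x)" for m i j a b
 proof -
  have "D m i j b x = - D m j i b x" for x
   unfolding D_def using anti(1)[of i j x] anti(2)[of i j b x] by simp
  then show ?thesis by simp
 qed
 have "(SU i j. LI x. G x $ i * D m i j j x) = 0" for m
 proof -
  let ?T = "SU i j. LI x. G x $ i * D m i j j x"
  have "?T = (SU i j. - (LI x. G x $ j * D m j i i x))"
   by (intro sum.cong refl) (subst sw, rule neg)
  also have "... = - (SU j i. LI x. G x $ j * D m j i i x)"
   by (subst sum.swap) (simp add: sum_negf)
  finally show ?thesis by simp
 qed
 moreover have "(%m. SU i j. LI x. G x $ i * D m i j j x)
  ~~> (SU i j. LI x. G x $ i * dA i j j x)"
  unfolding D_def by (intro tendsto_sum hfield_h1_limit[OF G A v])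
 ultimately show ?thesis using LIMSEQ_unique[OF _ tendsto_const] by simp
qed

text \<open>On the boundary, where \<open>xi s\<close> is 1 and \<open>q\<close> is the squared
  gradient of \<open>rr\<close>, this matrix is the orthogonal projection to the tangent space;
  \<open>xi\<close> concentrates it near the boundary on the scale \<open>s\<close>.\<close>

definition coef :: "real => 'n => 'n => 'n fn" where
 "coef s i k x = xi s x * ((if i = k then 1 else 0) - N i x * N k x * inverse (q x))"

lemma coef_C2: assumes "s > 0" shows "\<exists>dc. C2_on (closure Om) (coef s i k) dc"
proof -
 have N2: "C2_on (closure Om) (N i) (H i)" for i
  unfolding C2_on_def
  by (rule conjI[OF C1_on_subset[OF N_C1 subset_UNIV]], rule allI, rule exI, rule C1_on_subset[OF H_C1 subset_UNIV])
 have q2: "C2_on (closure Om) q (%l x. (SU i. N i x * H i l x + H i l x * N i x) + N l x)"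
  unfolding C2_on_def
  by (rule conjI[OF C1_on_subset[OF q_C1 subset_UNIV]], rule allI, rule exI, rule C1_on_subset[OF C1_on_add[OF C1_on_sum[OF C1_on_add[OF C1_on_mult[OF N_C1 H_C1] C1_on_mult[OF H_C1 N_C1]]] N_C1] subset_UNIV])
 have r2: "C2_on (closure Om) (%x. s + rr x) (%i x. 0 + N i x)"
  unfolding C2_on_def
  by (rule conjI[OF s_rho_C1], rule allI, rule exI, rule C1_on_subset[OF C1_on_add[OF C1_on_const N_C1] subset_UNIV])
 have rnz: "s + rr x ~= 0" if "x \<in> closure Om" for x using xi_bounds(5)[OF assms that] by simp
 show ?thesis
  unfolding coef_def[abs_def] xi_def
  by (rule exI, rule C2_on_mult[OF C2_on_mult[OF C2_on_const C2_on_inverse[OF r2 rnz]]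
     C2_on_diff[OF C2_on_const C2_on_mult[OF C2_on_mult[OF N2 N2] C2_on_inverse[OF q2 q_nz]]]])
qed

end

context strip_domain
begin

lemma van_cong:
 assumes "van f" "g \<in> L2O" "!!x. x \<in> Om ==> g x = f x" shows "van g"
 by (rule van_bound[OF assms(1,2), where B = 1]) (simp add: assms(3))

lemma coef_sum:
 "(SU k. coef s i k x * X k) = xi s x * (X i - N i x * inverse (q x) * (SU k. N k x * X k))"
proof -
 have "(SU k. coef s i k x * X k) = (SU k. xi s x * ((if i = k then X k else 0) - N i x * inverse (q x) * (N k x * X k)))"
  by (rule sum.cong[OF refl]) (simp add: coef_def algebra_simps)
 also have "... = xi s x * (X i - N i x * inverse (q x) * (SU k. N k x * X k))"
  unfolding sum_distrib_left[symmetric] sum_subtractf by (simp add: sum.delta')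
 finally show ?thesis .
qed

lemma coef_symmetric: "coef s i k = coef s k i"
 by (rule ext) (simp add: coef_def mult_ac eq_commute)

text \<open>For an exact projection the squared length would be the energy minus its normal part;
  since \<open>q\<close> exceeds the squared gradient of \<open>rr\<close> inside, an inequality
  remains.\<close>

lemma tangential_part_norm:
 assumes G: "G \<in> L2O" and s: "s > 0"
 shows "(%x. \<chi> k. SU i. coef s i k x * G x $ i) \<in> L2O"
  "(nrm (%x. \<chi> k. SU i. coef s i k x * G x $ i))^2
  <= (LI x. (xi s x)^2 * (norm (G x))^2 - (xi s x)^2 * ((SU i. G x $ i * N i x)^2 * inverse (q x)))"
proof -
 let ?T = "%x. \<chi> k. SU i. coef s i k x * G x $ i"
 have cont: "continuous_on (closure Om) (coef s i k)" for i k
 proof -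
  obtain dc where "C2_on (closure Om) (coef s i k) dc" using coef_C2[OF s] by (rule exE)
  then show ?thesis by (rule C1_on_continuous[OF C2_onD(1)])
 qed
 have "(%x. SU i. coef s i k x * G x $ i) \<in> L2O" for k
  by (intro L2_sum C1_on_mult_L2 cont L2_nth G)
 then show T: "?T \<in> L2O" by (simp add: L2_component_iff)
 show "(nrm ?T)^2 <= (LI x. (xi s x)^2 * (norm (G x))^2 - (xi s x)^2 * ((SU i. G x $ i * N i x)^2 * inverse (q x)))"
  unfolding L2_norm_power2
 proof (rule integral_mono[OF L2D(2)[OF T] Bi_diff[OF weighted_energy_measurable(2)[OF G s] weighted_energy_measurable(3)[OF G s]]])
  fix x assume "x \<in> space MO"
  then have x: "x \<in> Om" by simp
  define GN where "GN = (SU i. G x $ i * N i x)"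
  define NN where "NN = (SU i. N i x * N i x)"
  define r where "r = inverse (q x)"
  have qx: "q x > 0" by (rule q_pos[OF subsetD[OF closure_subset x]])
  then have r: "r > 0" by (simp add: r_def)
  have "NN * r <= q x * r" using N_square_le_q[OF x] r by (intro mult_right_mono) (simp_all add: NN_def)
  then have NN: "NN * r <= 1" using qx by (simp add: r_def)
  have Tk: "?T x $ k = xi s x * (G x $ k - r * GN * N k x)" for k
  proof -
   have "?T x $ k = (SU i. coef s k i x * G x $ i)" by (simp add: coef_symmetric[of _ k])
   then show ?thesis unfolding coef_sum by (simp add: GN_def r_def mult_ac)
  qed
  have "(norm (?T x))^2 = (SU k. (xi s x)^2 * ((G x $ k)^2 - 2 * r * GN * (G x $ k * N k x) + r^2 * GN^2 * (N k x * N k x)))"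
   unfolding norm_vec_power2 Tk by (rule sum.cong[OF refl]) (simp add: power2_eq_square algebra_simps)
  also have "... = (xi s x)^2 * ((norm (G x))^2 - 2 * r * GN * GN + r^2 * GN^2 * NN)"
   unfolding norm_vec_power2
   by (simp only: sum_distrib_left[symmetric] sum.distrib sum_subtractf GN_def[symmetric] NN_def[symmetric])
  also have "... <= (xi s x)^2 * ((norm (G x))^2 - GN^2 * r)"
  proof (rule mult_left_mono)
   have "(GN^2 * r) * (NN * r) <= (GN^2 * r) * 1" using NN r by (intro mult_left_mono) auto
   then show "(norm (G x))^2 - 2 * r * GN * GN + r^2 * GN^2 * NN <= (norm (G x))^2 - GN^2 * r"
    by (simp add: power2_eq_square algebra_simps)
  qed simp
  finally show "(norm (?T x))^2 <= (xi s x)^2 * (norm (G x))^2 - (xi s x)^2 * ((SU i. G x $ i * N i x)^2 * inverse (q x))"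
   by (simp add: GN_def r_def right_diff_distrib)
 qed
qed

text \<open>After one more integration by parts \<open>A\<close> is contracted with the symmetric
  second derivatives of \<open>th\<close>.\<close>

lemma antisymmetric_orthogonal_tests:
 assumes A: "!!i j. h1 (A i j) (dA i j)" and anti: "!!i j x. A i j x = - A j i x" and th: "test_function Om th"
 shows "(SU i j. LI x. dA i j j x * pdiff i th x) = 0"
proof -
 have "Ck 2 th" using th by (simp add: test_function_def)
 then have sym: "pdiff j (pdiff i th) x = pdiff i (pdiff j th) x" for i j x by (rule pdiff_commute)
 let ?T = "%i j. LI x. A i j x * pdiff j (pdiff i th) x"
 have e: "(LI x. dA i j j x * pdiff i th x) = - ?T i j" for i j
  using h1_C1c[OF A[of i j] test_function_C1c[OF test_function_pdiff[OF th, of i]], of j] by linarith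
 have neg: "?T i j = - ?T j i" for i j
 proof -
  have "A i j x * pdiff j (pdiff i th) x = - (A j i x * pdiff i (pdiff j th) x)" for x
   using anti[of i j x] sym[of i x j] by simp
  then show ?thesis by simp
 qed
 have "(SU i j. ?T i j) = (SU i j. - ?T j i)"
  by (rule sum.cong[OF refl sum.cong[OF refl neg]])
 also have "... = - (SU i j. ?T j i)" by (simp only: sum_negf)
 also have "(SU i j. ?T j i) = (SU i j. ?T i j)" by (rule sum.swap)
 finally show ?thesis unfolding e sum_negf by simp
qed

text \<open>Let \<open>tu\<close> be the tangential part of \<open>u\<close>. The curl of
  \<open>u - tu\<close> vanishes on the boundary, so its divergence is orthogonal to
  \<open>G\<close> and \<open>u\<close> may be replaced by \<open>tu\<close>. The divergence of
  \<open>tu\<close> vanishes there too, which removes its gradient (\<open>o4\<close>). There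
  remains the Laplacian of \<open>tu\<close> against \<open>G\<close>: its leading part is the
  Laplacian of \<open>u\<close> against the tangential part \<open>T\<close> of \<open>G\<close>,
  and the rest \<open>R\<close> contains at most first derivatives of \<open>u\<close>.\<close>

lemma commutator_harmonic:
 "\<exists>C\<ge>0. \<forall>u du ddu G. (\<forall>i. h10 (u i) (du i)) --> (\<forall>i l. h1 (du i l) (ddu i l)) --> hfield G -->
  \<bar>SU i j. LI x. G x $ i * (ddu i j j x - ddu j i j x)\<bar>
  <= (sqrt (3 / 4) * nrm (%x. \<chi> k. SU j. ddu k j j x) + C * sqrt (SU i. (gnorm (du i))^2)) * nrm G"
proof -
 obtain K where K: "K > 0 & (\<forall>s>0. \<forall>G. hfield G -->
  (LI x. (xi s x)^2 * (norm (G x))^2 - (xi s x)^2 * ((SU i. G x $ i * N i x)^2 * inverse (q x)))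
  <= (1 / 2 + K * s) * (nrm G)^2)" using weight_bound by (rule exE)
 \<comment> \<open>This makes the factor \<open>1 / 2 + K * s\<close> of \<open>weight_bound\<close>
   equal to 3/4.\<close>
 define s where "s = 1 / (4 * K)"
 have s: "s > 0" "1 / 2 + K * s = 3 / 4" using K by (simp_all add: s_def)
 define c where "c = coef s"
 \<comment> \<open>The derivatives of the coefficients and their bounds are chosen before any
   \<open>u\<close> is considered, so that \<open>C\<close> depends on the domain only.\<close>
 define dc where "dc i k = (SOME dc. C2_on (closure Om) (c i k) dc)" for i k
 have c2: "C2_on (closure Om) (c i k) (dc i k)" for i k
  unfolding dc_def c_def by (rule someI_ex[OF coef_C2[OF s(1)]])
 define ddc where "ddc i k l = (SOME dd. C1_on (closure Om) (dc i k l) dd)" for i k l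
 have cC: "C1_on (closure Om) (c i k) (dc i k)" and dcC: "C1_on (closure Om) (dc i k l) (ddc i k l)" for i k l
  unfolding ddc_def by (rule C2_onD(1)[OF c2], rule someI_ex[OF C2_onD(2)[OF c2]])
 define b where "b i k l = (SOME B. B > 0 & (\<forall>x\<in>closure Om. \<bar>dc i k l x\<bar> <= B & (\<forall>m. \<bar>ddc i k l m x\<bar> <= B)))" for i k l
 have bb: "b i k l > 0 & (\<forall>x\<in>closure Om. \<bar>dc i k l x\<bar> <= b i k l & (\<forall>m. \<bar>ddc i k l m x\<bar> <= b i k l))" for i k l
  unfolding b_def by (rule someI_ex[OF C1_on_imp_bounded[OF dcC compact_closure_Omega]])
 have dcb: "\<bar>dc i k l x\<bar> <= b i k l" "\<bar>ddc i k l m x\<bar> <= b i k l" if "x \<in> Om" for i k l m x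
  using bb[of i k l, THEN conjunct2, rule_format, OF subsetD[OF closure_subset that]] by blast+
 \<comment> \<open>The 2 stems from the two first order terms of the product rule,
   \<open>2 * diam\<close> from Poincare's inequality for the term without derivatives of
   \<open>u\<close>.\<close>
 define C where "C = (SU i j k. b i k j * (2 + 2 * diam))"
 have C0: "C >= 0" unfolding C_def using bb diam(1) by (intro sum_nonneg mult_nonneg_nonneg) (auto intro: less_imp_le)
 have main: "\<bar>SU i j. LI x. G x $ i * (ddu i j j x - ddu j i j x)\<bar>
  <= (sqrt (3 / 4) * nrm (%x. \<chi> k. SU j. ddu k j j x) + C * sqrt (SU i. (gnorm (du i))^2)) * nrm G"
  if u: "!!i. h10 (u i) (du i)" and ddu: "!!i l. h1 (du i l) (ddu i l)" and G: "hfield G" for u du ddu G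
 proof -
  note u1 = h10_h1[OF u]
  define tu where "tu i x = (SU k. c i k x * u k x)" for i x
  define dtu where "dtu i l x = (SU k. c i k x * du k l x + dc i k l x * u k x)" for i l x
  define ddtu where "ddtu i l m x = (SU k. (c i k x * ddu k l m x + dc i k m x * du k l x) + (dc i k l x * du k m x + ddc i k l m x * u k x))" for i l m x
  have t1: "h1 (tu i) (dtu i)" and t2: "h1 (dtu i l) (ddtu i l)" for i l
   unfolding tu_def[abs_def] dtu_def[abs_def] ddtu_def[abs_def]
   by (intro h1_sum h2_mult(1)[OF u1 ddu cC dcC], intro h1_sum h2_mult(2)[OF u1 ddu cC dcC])
  define A where "A i j x = (du i j x - dtu i j x) - (du j i x - dtu j i x)" for i j x
  define dA where "dA i j l x = (ddu i j l x - ddtu i j l x) - (ddu j i l x - ddtu j i l x)" for i j l x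
  have A1: "h1 (A i j) (dA i j)" for i j
   unfolding A_def[abs_def] dA_def[abs_def] by (intro h1_diff ddu t2)
  define ps where "ps x = (SU i. dtu i i x)" for x
  define dps where "dps l x = (SU i. ddtu i i l x)" for l x
  have p1: "h1 ps dps" unfolding ps_def[abs_def] dps_def[abs_def] by (intro h1_sum t2)
  have cN: "continuous_on (closure Om) (N i)" for i by (rule continuous_on_subset[OF N_cont subset_UNIV])
  obtain diq where iq: "C1_on (closure Om) (%x. inverse (q x)) diq" using iq_C1 by (rule exE)
  note ciq = C1_on_continuous[OF iq]
  have cr: "continuous_on (closure Om) (%x. inverse (s + rr x))"
   by (intro continuous_on_inverse C1_on_continuous[OF s_rho_C1]) (use xi_bounds(5)[OF s(1)] in force)
  have cxi: "continuous_on (closure Om) (xi s)"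
   unfolding xi_def[abs_def] by (rule continuous_on_mult[OF continuous_on_const cr])
  have vu: "van (u k)" for k by (rule van_h10[OF u])
  have vt: "van (%x. N i x * du k j x - N j x * du k i x)" for i j k
   by (rule van_tangential[OF u1 ddu vu])
  \<comment> \<open>\<open>u - tu\<close> is \<open>1 - xi = rr / (s + rr)\<close> times
    \<open>u\<close> plus a multiple of \<open>N\<close>. In its curl the first piece keeps the
    factor \<open>rr\<close>, the second reduces to tangential derivatives of \<open>u\<close>, and
    derivatives of the coefficients leave \<open>u\<close> itself; all three vanish on the
    boundary.\<close>
  have vA: "van (A i j)" for i j
  proof (rule van_cong[OF _ h1D(1)[OF A1]])
   let ?f = "%x. (inverse (s + rr x) * (rr x * (du i j x - du j i x))
    + (xi s x * inverse (q x)) * (SU k. N k x * (N i x * du k j x - N j x * du k i x)))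
    - (SU k. (dc i k j x - dc j k i x) * u k x)"
   show "van ?f"
    by (intro van_diff[OF van_add van_sum] van_mult[OF van_rho[OF L2_diff[OF h1D(2)[OF u1] h1D(2)[OF u1]]] cr]
      van_mult[OF van_sum] van_mult[OF vt] van_mult[OF vu] cN continuous_on_mult cxi ciq continuous_on_diff C1_on_continuous[OF dcC])
   fix x assume x: "x \<in> Om"
   have d: "du i j x - dtu i j x = inverse (s + rr x) * (rr x * du i j x) + (xi s x * inverse (q x)) * (SU k. N k x * (N i x * du k j x)) - (SU k. dc i k j x * u k x)" for i j
   proof -
    have "dtu i j x = xi s x * (du i j x - N i x * inverse (q x) * (SU k. N k x * du k j x)) + (SU k. dc i k j x * u k x)"
     unfolding dtu_def sum.distrib c_def coef_sum ..
    moreover have "(SU k. N k x * (N i x * du k j x)) = N i x * (SU k. N k x * du k j x)"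
     by (simp add: sum_distrib_left mult_ac)
    moreover have "du i j x - xi s x * du i j x = inverse (s + rr x) * (rr x * du i j x)"
     using arg_cong[OF xi_bounds(6)[OF s(1) subsetD[OF closure_subset x]], of "%z. z * du i j x"] by (simp add: algebra_simps)
    ultimately show ?thesis by (simp add: algebra_simps)
   qed
   show "A i j x = ?f x" unfolding A_def d[of i j] d[of j i]
    by (simp add: algebra_simps sum_subtractf)
  qed
  \<comment> \<open>\<open>q * D - W\<close>, with \<open>W\<close> the normal derivative of the
    normal component, is \<open>rr * D\<close> plus tangential derivatives of \<open>u\<close>,
    which vanish on the boundary.\<close>
  have vps: "van ps"
  proof (rule van_cong[OF _ h1D(1)[OF p1]])
   let ?f = "%x. (xi s x * inverse (q x)) * (rr x * (SU i. du i i x) + (SU k i. N i x * (N i x * du k k x - N k x * du k i x)))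
    + (SU i k. dc i k i x * u k x)"
   show "van ?f"
    by (intro van_add van_sum van_mult[OF vt] van_mult[OF vu] van_mult[OF van_add] van_rho[OF L2_sum] h1D(2)[OF u1] cN continuous_on_mult cxi ciq C1_on_continuous[OF dcC])
   fix x assume x: "x \<in> Om"
   have qx: "q x * inverse (q x) = 1" using q_pos[OF subsetD[OF closure_subset x]] by simp
   define D where "D = (SU i. du i i x)"
   define W where "W = (SU i. N i x * (SU k. N k x * du k i x))"
   have "ps x = (SU i. xi s x * (du i i x - N i x * inverse (q x) * (SU k. N k x * du k i x))) + (SU i k. dc i k i x * u k x)"
    unfolding ps_def dtu_def sum.distrib c_def coef_sum ..
   also have "(SU i. xi s x * (du i i x - N i x * inverse (q x) * (SU k. N k x * du k i x))) = xi s x * (D - inverse (q x) * W)"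
    unfolding D_def W_def right_diff_distrib sum_subtractf by (simp add: sum_distrib_left mult_ac)
   also have "D - inverse (q x) * W = inverse (q x) * (q x * D - W)" using qx by (simp add: algebra_simps)
   also have "q x * D - W = rr x * D + (SU k i. N i x * (N i x * du k k x - N k x * du k i x))"
   proof -
    have "W = (SU k i. N i x * (N k x * du k i x))"
     unfolding W_def by (subst sum.swap) (simp add: sum_distrib_left)
    moreover have "(SU i. N i x * N i x) * D = (SU k i. N i x * (N i x * du k k x))"
     unfolding D_def by (subst sum.swap) (simp add: sum_product mult.assoc)
    ultimately show ?thesis by (simp add: q_def distrib_right right_diff_distrib sum_subtractf)
   qed
   finally show "ps x = ?f x" by (simp add: D_def mult.assoc)
  qed
  have Gi: "(%x. G x $ i) \<in> L2O" for i by (rule hfieldD(2)[OF G])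
  have du2: "ddu i l m \<in> L2O" "ddtu i l m \<in> L2O" "du i l \<in> L2O" "u i \<in> L2O" for i l m
   by (rule h1D(2)[OF ddu], rule h1D(2)[OF t2], rule h1D(2)[OF u1], rule h1D(1)[OF u1])
  define g where "g i f = (LI x. G x $ i * f x)" for i f
  have gdiff: "g i (%x. f x - h x) = g i f - g i h" if "f \<in> L2O" "h \<in> L2O" for i f h
   unfolding g_def right_diff_distrib
   by (rule B_diff[OF L2_integrable_mult[OF Gi that(1)] L2_integrable_mult[OF Gi that(2)]])
  have gsum: "g i (%x. \<Sum>k\<in>I. f k x) = (\<Sum>k\<in>I. g i (f k))" if "!!k. k \<in> I ==> f k \<in> L2O" for i f and I :: "'n set"
   unfolding g_def sum_distrib_left
   by (rule B_sum[OF L2_integrable_mult[OF Gi that]])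
  have o1: "(SU i j. g i (dA i j j)) = 0"
   unfolding g_def by (rule curl_orthogonal[OF G A1 vA]) (simp_all add: A_def dA_def)
  have o2: "g i (dA i j j) = g i (%x. ddu i j j x - ddu j i j x) - g i (ddtu i j j) + g i (ddtu j i j)" for i j
   unfolding dA_def by (simp add: gdiff du2 L2_diff)
  \<comment> \<open>Both sides contain the same second derivative of \<open>tu j\<close>, taken in
    the two orders.\<close>
  have o3: "g i (ddtu j i j) = g i (ddtu j j i)" for i j
  proof -
   have "AEO x. G x $ i * ddtu j i j x = G x $ i * ddtu j j i x"
    using h1_second_symmetric[OF t1 t2, of j i j] by eventually_elim simp
   then show ?thesis unfolding g_def
    by (intro integral_cong_AE borel_measurable_times L2D(1)[OF Gi] L2D(1)[OF du2(2)])
  qed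
  have o4: "(SU i j. g i (ddtu j j i)) = 0"
   using div_orthogonal[OF G p1 vps] gsum[of UNIV, OF du2(2)] unfolding dps_def g_def by simp
  have "(SU i j. g i (%x. ddu i j j x - ddu j i j x)) - (SU i j. g i (ddtu i j j)) + (SU i j. g i (ddtu j j i)) = 0"
  proof -
   have "(SU i j. g i (ddtu j i j)) = (SU i j. g i (ddtu j j i))"
    by (rule sum.cong[OF refl sum.cong[OF refl o3]])
   then show ?thesis using o1 unfolding o2 sum.distrib sum_subtractf by linarith
  qed
  then have V: "(SU i j. g i (%x. ddu i j j x - ddu j i j x)) = (SU i j. g i (ddtu i j j))"
   unfolding o4 by linarith
  define \<Lambda> :: "real^'n => real^'n" where "\<Lambda> x = (\<chi> k. SU j. ddu k j j x)" for x
  have LL: "\<Lambda> \<in> L2O" by (simp add: L2_component_iff \<Lambda>_def L2_sum du2)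
  define T :: "real^'n => real^'n" where "T x = (\<chi> k. SU i. c i k x * G x $ i)" for x
  have TL: "T \<in> L2O" and "(nrm T)^2 <= 3 / 4 * (nrm G)^2"
   unfolding T_def[abs_def] c_def using tangential_part_norm[OF hfieldD(1)[OF G] s(1)]
    order_trans[OF tangential_part_norm(2)[OF hfieldD(1)[OF G] s(1)] K[THEN conjunct2, rule_format, OF s(1) G]] s(2) by simp_all
  then have "(nrm T)^2 <= (sqrt (3 / 4) * nrm G)^2" by (simp add: power_mult_distrib)
  then have Tn: "nrm T <= sqrt (3 / 4) * nrm G" by (rule power2_le_imp_le) simp
  define D where "D = sqrt (SU i. (gnorm (du i))^2)"
  have gD: "gnorm (du i) <= D" for i
  proof -
   have "(gnorm (du i))^2 <= (SU i. (gnorm (du i))^2)" by (rule member_le_sum) auto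
   from real_sqrt_le_mono[OF this] show ?thesis by (simp add: D_def gnorm_nonneg)
  qed
  have duD: "nrm (du i l) <= D" for i l using L2_norm_le_gnorm[of "du i" l] gD[of i] by linarith
  have uD: "nrm (u i) <= 2 * diam * D" for i
  proof -
   \<comment> \<open>Any direction serves in Poincare's inequality.\<close>
   obtain l :: 'n where True by blast
   have "nrm (u i) <= 2 * diam * nrm (du i l)" by (rule Poincare[OF u])
   also have "... <= 2 * diam * D" using diam(1) by (intro mult_left_mono duD) simp
   finally show ?thesis .
  qed
  define R where "R i j k x = 2 * (dc i k j x * du k j x) + ddc i k j j x * u k x" for i j k x
  have dcm: "dc i k l \<in> borel_measurable MO" "ddc i k l m \<in> borel_measurable MO" for i k l m
   by (rule continuous_imp_measurable_on_sets_lebesgue[OF continuous_on_subset[OF C1_on_continuous[OF dcC] closure_subset] sets_Omega],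
     rule continuous_imp_measurable_on_sets_lebesgue[OF continuous_on_subset[OF C1_onD(2)[OF dcC] closure_subset] sets_Omega])
  have m1: "(%x. dc i k l x * f x) \<in> L2O" "nrm (%x. dc i k l x * f x) <= b i k l * nrm f" 
   "(%x. ddc i k l m x * f x) \<in> L2O" "nrm (%x. ddc i k l m x * f x) <= b i k l * nrm f" if "f \<in> L2O" for i k l m f
  proof -
   have 1: "AEO x. \<bar>dc i k l x\<bar> <= b i k l" by (rule AE_I2) (simp add: dcb)
   have 2: "AEO x. \<bar>ddc i k l m x\<bar> <= b i k l" by (rule AE_I2) (simp add: dcb)
   have b0: "\<bar>b i k l\<bar> = b i k l" using bb[of i k l] by simp
   show "(%x. dc i k l x * f x) \<in> L2O" "nrm (%x. dc i k l x * f x) <= b i k l * nrm f"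
    using L2_mult_bounded[OF that dcm(1) 1] by (simp_all add: b0)
   show "(%x. ddc i k l m x * f x) \<in> L2O" "nrm (%x. ddc i k l m x * f x) <= b i k l * nrm f"
    using L2_mult_bounded[OF that dcm(2) 2] by (simp_all add: b0)
  qed
  have RL: "R i j k \<in> L2O" for i j k
   unfolding R_def[abs_def] by (intro L2_add L2_cmult m1 du2)
  have Rn: "nrm (R i j k) <= b i k j * (2 + 2 * diam) * D" for i j k
  proof -
   have "nrm (R i j k) <= nrm (%x. 2 * (dc i k j x * du k j x)) + nrm (%x. ddc i k j j x * u k x)"
    unfolding R_def[abs_def] by (intro L2_norm_triangle L2_cmult m1 du2)
   also have "... <= 2 * (b i k j * nrm (du k j)) + b i k j * nrm (u k)"
    unfolding L2_norm_cmult using m1(2)[OF du2(3)[of k j], of i k j] m1(4)[OF du2(4)[of k], of i k j j] by simp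
   also have "... <= 2 * (b i k j * D) + b i k j * (2 * diam * D)"
    using bb[of i k j] by (intro add_mono mult_left_mono duD uD) auto
   finally show ?thesis by (simp add: algebra_simps)
  qed
  have "(SU i j. g i (ddtu i j j)) = inr T \<Lambda> + (SU i j k. g i (R i j k))"
  proof -
   have cd: "(%x. c i k x * ddu k l m x) \<in> L2O" for i k l m
    by (rule C1_on_mult_L2[OF C1_on_continuous[OF cC] du2(1)])
   have "g i (ddtu i j j) = (SU k. g i (%x. c i k x * ddu k j j x)) + (SU k. g i (R i j k))" for i j
   proof -
    have eq: "G x $ i * ddtu i j j x = (SU k. G x $ i * (c i k x * ddu k j j x)) + (SU k. G x $ i * R i j k x)" for x
     unfolding ddtu_def R_def sum.distrib[symmetric] sum_distrib_left by (rule sum.cong[OF refl]) (simp add: algebra_simps)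
    show ?thesis unfolding g_def eq
     by (subst B_add, intro Bi_sum L2_integrable_mult Gi cd,
       intro Bi_sum L2_integrable_mult Gi RL, subst B_sum,
       intro L2_integrable_mult Gi cd, subst B_sum, intro L2_integrable_mult Gi RL, rule refl)
   qed
   moreover have "inr T \<Lambda> = (SU i j k. g i (%x. c i k x * ddu k j j x))"
   proof -
    have eq: "T x \<bullet> \<Lambda> x = (SU i j k. G x $ i * (c i k x * ddu k j j x))" for x
    proof -
     have "T x \<bullet> \<Lambda> x = (SU k i j. G x $ i * (c i k x * ddu k j j x))"
      unfolding inner_vec_def T_def \<Lambda>_def
      by (simp only: vec_lambda_beta inner_real_def sum_product) (intro sum.cong refl, simp only: mult_ac)
     also have "... = (SU i k j. G x $ i * (c i k x * ddu k j j x))" by (rule sum.swap)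
     also have "... = (SU i j k. G x $ i * (c i k x * ddu k j j x))" by (rule sum.cong[OF refl sum.swap])
     finally show ?thesis .
    qed
    note i = L2_integrable_mult[OF Gi cd]
    show ?thesis unfolding L2_inner_def eq g_def
     by (subst B_sum, intro Bi_sum i, rule sum.cong[OF refl],
      subst B_sum, intro Bi_sum i, rule sum.cong[OF refl],
      subst B_sum, intro i, rule refl)
   qed
   ultimately show ?thesis by (simp add: sum.distrib)
  qed
  moreover have "\<bar>inr T \<Lambda>\<bar> <= sqrt (3 / 4) * nrm \<Lambda> * nrm G"
  proof -
   have "\<bar>inr T \<Lambda>\<bar> <= nrm T * nrm \<Lambda>" by (rule L2_Cauchy_Schwarz[OF TL LL])
   also have "... <= (sqrt (3 / 4) * nrm G) * nrm \<Lambda>" by (rule mult_right_mono[OF Tn]) simp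
   finally show ?thesis by (simp only: mult_ac)
  qed
  moreover have "\<bar>SU i j k. g i (R i j k)\<bar> <= C * D * nrm G"
  proof -
   have "\<bar>g i (R i j k)\<bar> <= b i k j * (2 + 2 * diam) * (D * nrm G)" for i j k
   proof -
    have "\<bar>g i (R i j k)\<bar> <= nrm (%x. G x $ i) * nrm (R i j k)"
     using L2_Cauchy_Schwarz[OF Gi RL, of i i j k] by (simp add: L2_inner_def g_def)
    also have "... <= nrm G * (b i k j * (2 + 2 * diam) * D)"
     by (rule mult_mono[OF L2_norm_component_le[OF hfieldD(1)[OF G]] Rn]) simp_all
    finally show ?thesis by (simp only: mult_ac)
   qed
   then have "\<bar>SU i j k. g i (R i j k)\<bar> <= (SU i j k. b i k j * (2 + 2 * diam) * (D * nrm G))"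
    by (intro order_trans[OF sum_abs] sum_mono)
   also have "... = C * D * nrm G" unfolding C_def by (simp only: sum_distrib_right mult.assoc)
   finally show ?thesis .
  qed
  ultimately show ?thesis unfolding V[unfolded g_def] g_def \<Lambda>_def[symmetric] D_def[symmetric]
   by (simp add: distrib_right g_def[symmetric])
 qed
 show ?thesis
 proof (intro exI[of _ C] conjI allI impI C0)
  fix u :: "'n => 'n fn" and du :: "'n => 'n => 'n fn" and ddu :: "'n => 'n => 'n => 'n fn" and G assume a: "\<forall>i. h10 (u i) (du i)" "\<forall>i l. h1 (du i l) (ddu i l)" "hfield G"
  show "\<bar>SU i j. LI x. G x $ i * (ddu i j j x - ddu j i j x)\<bar>
   <= (sqrt (3 / 4) * nrm (%x. \<chi> k. SU j. ddu k j j x) + C * sqrt (SU i. (gnorm (du i))^2)) * nrm G"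
   by (rule main[OF a(1)[rule_format] a(2)[rule_format] a(3)])
 qed
qed

text \<open>\<open>V\<close> is the divergence of an antisymmetric matrix, hence orthogonal to
  gradients of test functions, and \<open>harmonic_part\<close> supplies a field \<open>G\<close> of
  no larger norm for \<open>commutator_harmonic\<close>.\<close>

lemma commutator_estimate:
 "\<exists>C\<ge>0. \<forall>u du ddu ph dph. (\<forall>i. h10 (u i) (du i)) --> (\<forall>i l. h1 (du i l) (ddu i l)) --> h1 ph dph -->
  \<bar>inr (%x. \<chi> i. SU j. ddu i j j x - ddu j i j x) (%x. \<chi> i. dph i x)\<bar>
  <= (sqrt (3 / 4) * nrm (%x. \<chi> k. SU j. ddu k j j x) + C * sqrt (SU i. (gnorm (du i))^2)) * gnorm dph"
proof -
 obtain C where C: "C >= 0 & (\<forall>u du ddu G. (\<forall>i. h10 (u i) (du i)) --> (\<forall>i l. h1 (du i l) (ddu i l)) --> hfield G -->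
  \<bar>SU i j. LI x. G x $ i * (ddu i j j x - ddu j i j x)\<bar>
  <= (sqrt (3 / 4) * nrm (%x. \<chi> k. SU j. ddu k j j x) + C * sqrt (SU i. (gnorm (du i))^2)) * nrm G)"
  using commutator_harmonic by (rule exE)
 have main: "\<bar>inr (%x. \<chi> i. SU j. ddu i j j x - ddu j i j x) (%x. \<chi> i. dph i x)\<bar>
  <= (sqrt (3 / 4) * nrm (%x. \<chi> k. SU j. ddu k j j x) + C * sqrt (SU i. (gnorm (du i))^2)) * gnorm dph"
  if u: "!!i. h10 (u i) (du i)" and ddu: "!!i l. h1 (du i l) (ddu i l)" and ph: "h1 ph dph" for u du ddu ph dph
 proof -
  obtain G where G: "hfield G & nrm G <= gnorm dph &
  (\<forall>F. F \<in> L2O --> (\<forall>th. test_function Om th --> inr F (gr th) = 0) -->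
   inr F (%x. \<chi> i. dph i x) = inr F G)" using harmonic_part[OF ph] by (rule exE)
  define V :: "real^'n => real^'n" where "V x = (\<chi> i. SU j. ddu i j j x - ddu j i j x)" for x
  note dL = h1D(2)[OF ddu]
  have VL: "V \<in> L2O" by (simp add: L2_component_iff V_def L2_sum L2_diff dL)
  have ip: "inr V F = (SU i j. LI x. F x $ i * (ddu i j j x - ddu j i j x))" if F: "F \<in> L2O" for F
  proof -
   have "(LI x. V x $ i * F x $ i) = (SU j. LI x. F x $ i * (ddu i j j x - ddu j i j x))" for i
   proof -
    have "(LI x. V x $ i * F x $ i) = (LI x. (SU j. F x $ i * (ddu i j j x - ddu j i j x)))"
     by (rule B_cong[OF refl]) (simp add: V_def sum_distrib_left mult.commute)
    also have "... = (SU j. LI x. F x $ i * (ddu i j j x - ddu j i j x))"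
     by (rule B_sum) (intro L2_integrable_mult L2_nth F L2_diff dL)
    finally show ?thesis .
   qed
   then show ?thesis using L2_inner_component[OF VL F] by simp
  qed
  have "inr V (gr th) = 0" if th: "test_function Om th" for th
   using antisymmetric_orthogonal_tests[where A = "%i j x. du i j x - du j i x" and dA = "%i j l x. ddu i j l x - ddu j i l x", OF h1_diff[OF ddu ddu] _ th]
   by (simp add: ip[OF gr_L2[OF th]] mult.commute)
  then have "inr V (%x. \<chi> i. dph i x) = inr V G" using G VL by blast
  then have "\<bar>inr V (%x. \<chi> i. dph i x)\<bar> <= (sqrt (3 / 4) * nrm (%x. \<chi> k. SU j. ddu k j j x) + C * sqrt (SU i. (gnorm (du i))^2)) * nrm G"
   using C[THEN conjunct2, rule_format, OF u ddu G[THEN conjunct1]] ip[OF hfieldD(1)[OF G[THEN conjunct1]]] by simp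
  also have "... <= (sqrt (3 / 4) * nrm (%x. \<chi> k. SU j. ddu k j j x) + C * sqrt (SU i. (gnorm (du i))^2)) * gnorm dph"
   by (rule mult_left_mono[OF G[THEN conjunct2, THEN conjunct1]]) (use C in "simp add: sum_nonneg")
  finally show ?thesis by (simp add: V_def[abs_def])
 qed
 show ?thesis
 proof (intro exI[of _ C] conjI allI impI)
  fix u :: "'n => 'n fn" and du :: "'n => 'n => 'n fn" and ddu :: "'n => 'n => 'n => 'n fn" and ph dph assume a: "\<forall>i. h10 (u i) (du i)" "\<forall>i l. h1 (du i l) (ddu i l)" "h1 ph dph"
  show "\<bar>inr (%x. \<chi> i. SU j. ddu i j j x - ddu j i j x) (%x. \<chi> i. dph i x)\<bar>
  <= (sqrt (3 / 4) * nrm (%x. \<chi> k. SU j. ddu k j j x) + C * sqrt (SU i. (gnorm (du i))^2)) * gnorm dph"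
   by (rule main[OF a(1)[rule_format] a(2)[rule_format] a(3)])
 qed (use C in simp)
qed

end

subsection \<open>Time averages\<close>

lemma L2_nn_integral:
 fixes g :: "'a::euclidean_space => 'b::euclidean_space"
 assumes S: "S \<in> sets lebesgue"
 shows "g \<in> L2 S ==> (NI x. ennreal ((norm (g x))^2) * indicator S x) = ennreal ((L2_norm S g)^2)"
  "g \<in> borel_measurable (lebesgue_on S) ==> (NI x. ennreal ((norm (g x))^2) * indicator S x) < \<infinity> ==> g \<in> L2 S"
proof -
 have e: "(NI x. ennreal ((norm (g x))^2) * indicator S x) = (\<integral>\<^sup>+x. ennreal ((norm (g x))^2) \<partial>lebesgue_on S)"
  using S by (simp add: nn_integral_restrict_space nn_integral_completion)
 show "(NI x. ennreal ((norm (g x))^2) * indicator S x) = ennreal ((L2_norm S g)^2)" if "g \<in> L2 S"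
  unfolding e L2_norm_power2 by (rule nn_integral_eq_integral[OF L2D(2)[OF that]]) simp
 assume m: "g \<in> borel_measurable (lebesgue_on S)" and f: "(NI x. ennreal ((norm (g x))^2) * indicator S x) < \<infinity>"
 have "integrable (lebesgue_on S) (%x. (norm (g x))^2)"
  by (rule integrableI_nonneg) (use m f in "simp_all add: e")
 then show "g \<in> L2 S" using m by (simp add: L2_def)
qed

text \<open>Sections of a Lebesgue measurable function need not be measurable, sections of a Borel
  function are. The representative is built component by component.\<close>

lemma L2_borel_version:
 fixes F :: "'a::euclidean_space => 'b::euclidean_space"
 assumes F: "F \<in> L2 S" and S: "S \<in> sets lebesgue"
 shows "\<exists>g\<in>borel_measurable borel. AE x in lborel. x \<in> S --> F x = g x"
proof -
 have m: "(%x. if x \<in> S then F x else 0) \<in> borel_measurable lebesgue"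
  by (rule borel_measurable_if_I[OF L2D(1)[OF F] S])
 have "\<forall>b. \<exists>h. h \<in> borel_measurable lborel & (AE x in lborel. (if x \<in> S then F x else 0) \<bullet> b = h x)"
 proof
  fix b
  have "(%x. (if x \<in> S then F x else 0) \<bullet> b) \<in> borel_measurable lebesgue" using m by measurable
  from completion_ex_borel_measurable_real[OF this]
  show "\<exists>h. h \<in> borel_measurable lborel & (AE x in lborel. (if x \<in> S then F x else 0) \<bullet> b = h x)"
   by (simp add: Bex_def)
 qed
 from choice[OF this] obtain h where h: "\<forall>b. h b \<in> borel_measurable lborel & (AE x in lborel. (if x \<in> S then F x else 0) \<bullet> b = h b x)"
  by (rule exE)
 define g where "g x = (\<Sum>b\<in>Basis. h b x *\<^sub>R b)" for x
 have "g \<in> borel_measurable borel" unfolding g_def[abs_def]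
  by (intro borel_measurable_sum borel_measurable_scaleR borel_measurable_const h[rule_format, THEN conjunct1, simplified])
 moreover have "AE x in lborel. \<forall>b\<in>Basis. (if x \<in> S then F x else 0) \<bullet> b = h b x"
  by (intro eventually_ball_finite ballI h[rule_format, THEN conjunct2]) simp
 then have "AE x in lborel. x \<in> S --> F x = g x"
 proof eventually_elim
  case (elim x)
  show ?case
  proof
   assume x: "x \<in> S"
   have "F x = (\<Sum>b\<in>Basis. (F x \<bullet> b) *\<^sub>R b)" by (simp only: euclidean_representation)
   also have "... = g x" unfolding g_def using elim x by (intro sum.cong) simp_all
   finally show "F x = g x" .
  qed
 qed
 ultimately show ?thesis by (intro bexI[of _ g])
qed

text \<open>The Cauchy-Schwarz inequality in time against the constant 1, whose squared norm is the
  length \<open>d\<close> of the interval.\<close>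

lemma average_bound:
 fixes h :: "real => 'b::euclidean_space"
 assumes h: "h \<in> L2 {a<..<b}" and d: "d > 0" "b - a = d"
 shows "d * (norm ((1 / d) *\<^sub>R (LINT t|lebesgue_on {a<..<b}. h t)))^2 <= (L2_norm {a<..<b} h)^2"
proof -
 let ?I = "{a<..<b}"
 have nh: "(%t. norm (h t)) \<in> L2 ?I"
  by (rule L2_bound[OF h measurable_compose[OF L2D(1)[OF h] borel_measurable_norm]]) simp
 have one: "(%t. 1 :: real) \<in> L2 ?I" and n1: "(L2_norm ?I (%t. 1 :: real))^2 = d"
  using d finite_measure.integrable_const[OF finite_measureI, of "lebesgue_on {a<..<b}" "1 :: real"]
  by (simp_all add: L2_def L2_norm_power2 measure_restrict_space emeasure_restrict_space)
 have "norm (LINT t|lebesgue_on ?I. h t) <= (LINT t|lebesgue_on ?I. norm (h t))" by (rule integral_norm_bound)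
 also have "... = L2_inner ?I (%t. norm (h t)) (%t. 1)" by (simp add: L2_inner_def)
 also have "... <= L2_norm ?I (%t. norm (h t)) * L2_norm ?I (%t. 1 :: real)" by (rule L2_inner_le[OF nh one])
 also have "L2_norm ?I (%t. norm (h t)) = L2_norm ?I h" by (simp add: L2_norm_def L2_inner_def dot_square_norm power2_eq_square)
 finally have "(norm (LINT t|lebesgue_on ?I. h t))^2 <= (L2_norm ?I h * L2_norm ?I (%t. 1 :: real))^2"
  by (rule power_mono) simp
 then have "(norm (LINT t|lebesgue_on ?I. h t))^2 <= (L2_norm ?I h)^2 * d" by (simp add: power_mult_distrib n1)
 then show ?thesis using d by (simp add: power_mult_distrib power_divide power2_eq_square field_simps)
qed

text \<open>The averages are formed pointwise in space and the norm of the data pointwise in time,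
  so the null set \<open>Z\<close> where \<open>f\<close> differs from its Borel version
  \<open>g\<close> must be negligible in both families of sections. Then
  \<open>average_bound\<close> holds for almost every \<open>x\<close>, and Tonelli's theorem and
  the disjointness of the time intervals give the sum.\<close>

lemma time_average_bound:
 fixes f :: "real => real^'n::finite => real^'n"
 assumes Om: "open Om" and f: "f \<in> L2_L2 T Om" and dt: "dt > 0" and nT: "real n * dt <= T"
 shows "k < n ==> time_avg f dt k \<in> L2 Om"
  "(\<Sum>k<n. dt * (L2_norm Om (time_avg f dt k))^2) <= (LINT t|lebesgue_on {0<..<T}. (L2_norm Om (f t))^2)"
proof -
 define S where "S = {0<..<T} \<times> Om"
 have So: "open S" unfolding S_def by (intro open_Times Om open_greaterThanLessThan)
 then have S: "S \<in> sets lebesgue" "S \<in> sets borel" and Oms: "Om \<in> sets lebesgue" using Om by auto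
 have F: "(%(t, x). f t x) \<in> L2 S" using f by (simp add: L2_L2_def S_def)
 obtain g where gm [measurable]: "g \<in> borel_measurable borel" and gae: "AE z in lborel. z \<in> S --> (%(t, x). f t x) z = g z"
  using L2_borel_version[OF F S(1)] by blast
 obtain Z where Z: "!!z. z \<in> space lborel - Z ==> z \<in> S --> (%(t, x). f t x) z = g z" "Z \<in> null_sets lborel"
  using AE_E3[OF gae] by blast
 have fg: "f t x = g (t, x)" if "(t, x) \<notin> Z" "(t, x) \<in> S" for t x using Z(1)[of "(t, x)"] that by simp
 define W where "W z = ennreal ((norm (g z))^2) * indicator S z" for z
 have Wm [measurable]: "W \<in> borel_measurable borel" unfolding W_def[abs_def] using S(2) by measurable
 have Wp: "W \<in> borel_measurable (lborel \<Otimes>\<^sub>M lborel)" by (simp add: lborel_prod)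
 have gL: "g \<in> L2 S"
  by (rule L2_cong_AE_iff[OF S(1) _ F]) (use AE_completion[OF gae] S(1) in "simp add: AE_restrict_space_iff")
 have Wfin: "integral\<^sup>N (lborel \<Otimes>\<^sub>M lborel) W < \<infinity>"
  unfolding lborel_prod W_def L2_nn_integral(1)[OF S(1) gL] by simp
 have "AE z in lborel \<Otimes>\<^sub>M lborel. z \<notin> Z" unfolding lborel_prod by (rule AE_not_in[OF Z(2)])
 from lborel_pair.AE_pair[OF this] have Zt: "AE t in lborel. AE x in lborel. (t, x) \<notin> Z" .
 have "Z \<in> sets (borel :: (real \<times> (real^'n)) measure)" using Z(2) by auto
 then have "- Z \<in> sets (borel :: (real \<times> (real^'n)) measure)" by (rule borel_comp)
 then have "- Z \<in> sets (lborel \<Otimes>\<^sub>M lborel)" unfolding lborel_prod by simp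
 with Zt have Zx: "AE x in lborel. AE t in lborel. (t, x) \<notin> Z"
  by (subst lborel_pair.AE_commute[symmetric]) (simp_all add: space_pair_measure Compl_eq[symmetric])
 have W2: "(NI t. NI x. W (t, x)) = integral\<^sup>N (lborel \<Otimes>\<^sub>M lborel) W"
  by (rule lborel.nn_integral_fst[OF Wp])
 have W1: "(NI x. NI t. W (t, x)) = integral\<^sup>N (lborel \<Otimes>\<^sub>M lborel) W"
  unfolding lborel_pair.Fubini[OF Wp] by (rule W2)
 have fx: "AE x in lborel. (NI t. W (t, x)) ~= \<infinity>"
  by (rule nn_integral_PInf_AE) (use W1 Wfin in auto)
 have ft: "AE t in lborel. (NI x. W (t, x)) ~= \<infinity>"
  by (rule nn_integral_PInf_AE) (use W2 Wfin in auto)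
 define J where "J k = {real k * dt<..<real (k + 1) * dt}" for k
 have Js: "J k \<in> sets lebesgue" "J k \<in> sets borel" for k by (simp_all add: J_def)
 have JT: "t \<in> {0<..<T}" if "k < n" "t \<in> J k" for k t
 proof -
  have "real (k + 1) * dt <= real n * dt" using that(1) dt by (intro mult_right_mono) auto
  moreover have "0 <= real k * dt" using dt by simp
  ultimately show ?thesis using that(2) nT unfolding J_def by simp
 qed
 define A where "A k x = (1 / dt) *\<^sub>R (LINT t|lebesgue_on (J k). g (t, x))" for k x
 have Am: "A k \<in> borel_measurable borel" for k
 proof -
  have "(LINT t|lebesgue_on (J k). g (t, x)) = (LB t. indicator (J k) t *\<^sub>R g (t, x))" for x
   using Js(2)[of k] Js(1)[of k] by (simp add: integral_restrict_space integral_completion)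
  then show ?thesis unfolding A_def using Js(2)[of k] by simp
 qed
 have AmO: "A k \<in> borel_measurable (lebesgue_on Om)" for k
  by (rule measurable_restrict_space1) (use Am in "simp add: measurable_completion")
 have key: "AE x in lborel. x \<in> Om --> time_avg f dt k x = A k x & ennreal (dt * (norm (A k x))^2) <= (NI t. W (t, x) * indicator (J k) t)"
  if k: "k < n" for k
  using Zx fx
 proof eventually_elim
  case (elim x)
  show ?case
  proof
   assume x: "x \<in> Om"
   have SJ: "(t, x) \<in> S" if "t \<in> J k" for t using JT[OF k that] x by (simp add: S_def)
   have ae: "AE t in lebesgue_on (J k). g (t, x) = f t x"
    using AE_completion[OF elim(1)] fg[symmetric] SJ Js(1)[of k]
    by (simp add: AE_restrict_space_iff) (erule eventually_mono, simp)
   have gm': "(%t. g (t, x)) \<in> borel_measurable (lebesgue_on (J k))"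
    by (rule measurable_restrict_space1) (simp add: measurable_completion)
   have ta: "time_avg f dt k x = A k x"
    unfolding time_avg_def A_def J_def[symmetric]
     integral_cong_AE[OF gm' AE_measurable_lebesgue_on[OF Js(1) gm' ae] ae] ..
   have Weq: "(NI t. ennreal ((norm (g (t, x)))^2) * indicator (J k) t) = (NI t. W (t, x) * indicator (J k) t)"
    by (rule nn_integral_cong) (use SJ in "auto simp: W_def indicator_def")
   have "(NI t. W (t, x) * indicator (J k) t) <= (NI t. W (t, x))"
    by (rule nn_integral_mono) (simp add: indicator_def)
   then have "(NI t. W (t, x) * indicator (J k) t) < \<infinity>" using elim(2) by (auto simp: less_top[symmetric] top_unique)
   then have L: "(%t. g (t, x)) \<in> L2 (J k)" by (intro L2_nn_integral(2)[OF Js(1) gm']) (simp add: Weq)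
   have "dt * (norm (A k x))^2 <= (L2_norm (J k) (%t. g (t, x)))^2"
    unfolding A_def J_def by (rule average_bound[OF L[unfolded J_def] dt]) (simp add: algebra_simps)
   then have "ennreal (dt * (norm (A k x))^2) <= (NI t. W (t, x) * indicator (J k) t)"
    unfolding Weq[symmetric] L2_nn_integral(1)[OF Js(1) L] by (rule ennreal_leI)
   with ta show "time_avg f dt k x = A k x & ennreal (dt * (norm (A k x))^2) <= (NI t. W (t, x) * indicator (J k) t)" by (rule conjI)
  qed
 qed
 define E where "E k = (NI x. NI t. W (t, x) * indicator (J k) t)" for k
 have WJm: "(%x. NI t. W (t, x) * indicator (J k) t) \<in> borel_measurable lborel" for k
  using Js(2)[of k] by measurable
 have Efin: "E k < \<infinity>" for k
 proof -
  have "E k <= (NI x. NI t. W (t, x))"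
   unfolding E_def by (intro nn_integral_mono) (simp add: indicator_def)
  then show ?thesis using W1 Wfin by simp
 qed
 have AE': "ennreal dt * (NI x. ennreal ((norm (A k x))^2) * indicator Om x) <= E k" if k: "k < n" for k
 proof -
  have "ennreal dt * (NI x. ennreal ((norm (A k x))^2) * indicator Om x) = (NI x. ennreal dt * (ennreal ((norm (A k x))^2) * indicator Om x))"
   by (rule nn_integral_cmult[symmetric]) (use Am[of k] borel_open[OF Om] in measurable)
  also have "... <= E k" unfolding E_def
   by (rule nn_integral_mono_AE, use key[OF k] in eventually_elim) (use dt in "auto simp: indicator_def ennreal_mult")
  finally show ?thesis .
 qed
 have ta: "AE x in lebesgue_on Om. A k x = time_avg f dt k x" if "k < n" for k
 proof -
  have "AE x in lebesgue. x \<in> Om --> A k x = time_avg f dt k x"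
   by (rule eventually_mono[OF AE_completion[OF key[OF that]]]) simp
  then show ?thesis using Oms by (simp add: AE_restrict_space_iff)
 qed
 have AL: "A k \<in> L2 Om" if "k < n" for k
 proof (rule L2_nn_integral(2)[OF Oms AmO])
  have "ennreal dt * (NI x. ennreal ((norm (A k x))^2) * indicator Om x) < \<infinity>"
   using AE'[OF that] Efin[of k] by (rule le_less_trans)
  then show "(NI x. ennreal ((norm (A k x))^2) * indicator Om x) < \<infinity>"
   using dt by (auto simp: ennreal_mult_less_top)
 qed
 show tL: "time_avg f dt k \<in> L2 Om" if "k < n" for k by (rule L2_cong_AE_iff[OF Oms ta[OF that] AL[OF that]])
 define L where "L t = (L2_norm Om (f t))^2" for t
 define h where "h t = (NI x. W (t, x))" for t
 have hm [measurable]: "h \<in> borel_measurable borel" unfolding h_def[abs_def] using Wp by simp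
 \<comment> \<open>This also yields measurability in time of the spatial norm \<open>L\<close>, by
   comparison with the Borel function \<open>h\<close>.\<close>
 have hL: "AE t in lborel. h t = ennreal (L t) * indicator {0<..<T} t" using Zt ft
 proof eventually_elim
  case (elim t)
  show ?case
  proof (cases "t \<in> {0<..<T}")
   case True
   have St: "(t, x) \<in> S \<longleftrightarrow> x \<in> Om" for x using True by (simp add: S_def)
   have hW: "h t = (NI x. ennreal ((norm (g (t, x)))^2) * indicator Om x)"
    unfolding h_def W_def by (rule nn_integral_cong) (simp add: indicator_def St)
   have gt: "(%x. g (t, x)) \<in> L2 Om"
    by (rule L2_nn_integral(2)[OF Oms measurable_restrict_space1])
     (simp add: measurable_completion, use elim(2) in "simp add: hW[symmetric] h_def less_top[symmetric]")
   have ae: "AE x in lebesgue_on Om. g (t, x) = f t x"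
    using AE_completion[OF elim(1)] fg[symmetric] St Oms
    by (simp add: AE_restrict_space_iff) (erule eventually_mono, simp)
   have "L2_norm Om (%x. g (t, x)) = L2_norm Om (f t)"
    by (rule L2_norm_cong_AE[OF ae L2D(1)[OF gt] L2D(1)[OF L2_cong_AE_iff[OF Oms ae gt]]])
   then show ?thesis using True by (simp add: hW L2_nn_integral(1)[OF Oms gt] L_def)
  next
   case False
   then have "W (t, x) = 0" for x by (auto simp: W_def S_def)
   then show ?thesis using False by (simp add: h_def)
  qed
 qed
 have Ts: "{0<..<T} \<in> sets lebesgue" by simp
 have Lm: "L \<in> borel_measurable (lebesgue_on {0<..<T})"
 proof (rule AE_measurable_lebesgue_on[OF Ts])
  show "(%t. enn2real (h t)) \<in> borel_measurable (lebesgue_on {0<..<T})"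
   by (rule measurable_restrict_space1) (simp add: measurable_completion)
  show "AE t in lebesgue_on {0<..<T}. enn2real (h t) = L t"
   using AE_completion[OF hL] by (simp add: AE_restrict_space_iff) (erule eventually_mono, simp add: L_def)
 qed
 have hT: "(NI t. h t) = (\<integral>\<^sup>+t. ennreal (L t) \<partial>lebesgue_on {0<..<T})"
  using nn_integral_cong_AE[OF hL] by (simp add: nn_integral_restrict_space nn_integral_completion)
 have Li: "integrable (lebesgue_on {0<..<T}) L"
  by (rule integrableI_nonneg[OF Lm]) (use hT W2 Wfin in "simp_all add: L_def h_def")
 have "ennreal (\<Sum>k<n. dt * (L2_norm Om (time_avg f dt k))^2) = (\<Sum>k<n. ennreal dt * (NI x. ennreal ((norm (A k x))^2) * indicator Om x))"
 proof -
  have "L2_norm Om (time_avg f dt k) = L2_norm Om (A k)" if "k < n" for k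
   by (rule sym[OF L2_norm_cong_AE[OF ta[OF that] AmO L2D(1)[OF tL[OF that]]]])
  then show ?thesis using dt
   by (subst sum_ennreal[symmetric]) (auto simp: L2_nn_integral(1)[OF Oms AL] ennreal_mult intro!: sum.cong)
 qed
 also have "... <= (\<Sum>k<n. E k)" by (intro sum_mono AE') simp
 also have "... = (NI x. (\<Sum>k<n. NI t. W (t, x) * indicator (J k) t))"
  unfolding E_def by (rule nn_integral_sum[symmetric, OF WJm])
 also have "... = (NI x. NI t. (\<Sum>k<n. W (t, x) * indicator (J k) t))"
  by (intro nn_integral_cong nn_integral_sum[symmetric]) (use Js(2) in measurable)
 also have "... <= (NI x. NI t. W (t, x))"
 proof (intro nn_integral_mono)
  fix x t
  have d: "k = l" if "t \<in> J k" "t \<in> J l" for k l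
  proof -
   have "real k * dt < real (l + 1) * dt" "real l * dt < real (k + 1) * dt" using that unfolding J_def by auto
   then have "real k < real (l + 1)" "real l < real (k + 1)" using dt by (simp_all only: mult_less_cancel_right_pos)
   then show ?thesis by linarith
  qed
  show "(\<Sum>k<n. W (t, x) * indicator (J k) t) <= W (t, x)"
  proof (cases "\<exists>k<n. t \<in> J k")
   case True
   then obtain k where k: "k < n" "t \<in> J k" by blast
   have "(\<Sum>l<n. W (t, x) * indicator (J l) t) = (\<Sum>l<n. if l = k then W (t, x) else 0)"
   proof (rule sum.cong[OF refl])
    show "W (t, x) * indicator (J l) t = (if l = k then W (t, x) else 0)" for l
     using d[OF _ k(2), of l] k(2) by (cases "t \<in> J l") auto
   qed
   then show ?thesis using k(1) by simp
  next
   case False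
   then have "(\<Sum>k<n. W (t, x) * indicator (J k) t) = 0" by (intro sum.neutral ballI) (simp only: lessThan_iff, simp)
   then show ?thesis by (simp only: zero_le)
  qed
 qed
 also have "... = (NI t. h t)" unfolding h_def W1 W2 ..
 also have "... = ennreal (LINT t|lebesgue_on {0<..<T}. L t)"
  unfolding hT by (rule nn_integral_eq_integral[OF Li]) (simp add: L_def)
 finally show "(\<Sum>k<n. dt * (L2_norm Om (time_avg f dt k))^2) <= (LINT t|lebesgue_on {0<..<T}. (L2_norm Om (f t))^2)"
  by (subst (asm) ennreal_le_iff) (simp_all add: L_def[abs_def])
qed

subsection \<open>The discrete energy estimate\<close>

text \<open>\<open>R\<close> exceeds the bound for the initial energy plus the forcing by 1. While
  \<open>e k <= R\<close>, a step adds at most \<open>dt * (c * (R + R ^ 3))\<close> besides the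
  forcing, and the time is so short that these additions sum to at most 1; hence the bound
  reproduces itself.\<close>

lemma discrete_energy_bound:
 fixes e b F :: "nat => real"
 assumes step: "!!k. k < n ==> e (Suc k) + \<mu> * (dt * b k) <= e k + dt * c * (e k + e k ^ 3) + c * (dt * F k)"
  and nn: "!!k. k <= n ==> 0 <= e k" "!!k. 0 <= b k" "!!k. 0 <= F k" "0 < dt" "0 <= c" "0 <= \<mu>" "0 <= M"
  and e0: "e 0 <= E0" and F: "(\<Sum>k<n. dt * F k) <= M"
  and R: "R = E0 + c * M + 1" and T: "real n * dt * (c * (R + R ^ 3)) <= 1" and k: "k <= n"
 shows "e k + \<mu> * (\<Sum>j<k. dt * b j) <= R"
proof -
 have R0: "0 <= R" using nn(1)[of 0] e0 nn(5,7) by (simp add: R)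
 have Fk: "(\<Sum>j<k. dt * F j) <= M" if "k <= n" for k
  by (rule order_trans[OF sum_mono2 F]) (use that nn in auto)
 \<comment> \<open>The accumulated dissipation and forcing are part of the induction hypothesis,
   since \<open>e k <= R\<close> alone would not be inductive.\<close>
 have "k <= n ==> e k + \<mu> * (\<Sum>j<k. dt * b j) <= E0 + c * (\<Sum>j<k. dt * F j) + real k * dt * (c * (R + R ^ 3))" for k
 proof (induction k)
  case (Suc k)
  have IH: "e k + \<mu> * (\<Sum>j<k. dt * b j) <= E0 + c * (\<Sum>j<k. dt * F j) + real k * dt * (c * (R + R ^ 3))"
   using Suc by simp
  have "0 <= \<mu> * (\<Sum>j<k. dt * b j)" using nn by (intro mult_nonneg_nonneg sum_nonneg) auto
  moreover have "c * (\<Sum>j<k. dt * F j) <= c * M" using Fk[of k] Suc.prems nn(5) by (intro mult_left_mono) auto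
  moreover have "real k * dt * (c * (R + R ^ 3)) <= real n * dt * (c * (R + R ^ 3))"
   using Suc.prems nn(4,5) R0 by (intro mult_right_mono) auto
  ultimately have ek: "e k <= R" using IH T by (simp add: R)
  have e0: "0 <= e k" using nn(1) Suc.prems by simp
  have "e k + e k ^ 3 <= R + R ^ 3" by (intro add_mono ek power_mono e0)
  then have "dt * c * (e k + e k ^ 3) <= dt * c * (R + R ^ 3)" using nn(4,5) by (intro mult_left_mono) auto
  then show ?case using step[of k] IH Suc.prems by (simp add: algebra_simps)
 qed (use e0 in simp)
 from this[OF k] have "e k + \<mu> * (\<Sum>j<k. dt * b j) <= E0 + c * M + real n * dt * (c * (R + R ^ 3))"
 proof -
  have "real k * dt * (c * (R + R ^ 3)) <= real n * dt * (c * (R + R ^ 3))"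
   using k nn(4,5) R0 by (intro mult_right_mono) auto
  then show ?thesis using \<open>e k + _ <= _\<close> mult_left_mono[OF Fk[OF k] nn(5)] by linarith
 qed
 then show ?thesis using T by (simp add: R)
qed

lemma young: "0 < d ==> x * y <= d * y^2 + x^2 / (4 * d)" for x y d :: real
proof -
 assume d: "0 < d"
 have "0 <= (x - 2 * d * y)^2 / (4 * d)" using d by simp
 also have "... = d * y^2 + x^2 / (4 * d) - x * y" using d by (simp add: field_simps power2_eq_square)
 finally show ?thesis by simp
qed

text \<open>Here \<open>A, B, A', B'\<close> are the norms of the gradient and of the Laplacian before and after
 a step; \<open>th < 1\<close> is what makes the explicit treatment of the pressure stable.\<close>

lemma energy_step:
 fixes nu th C C1 :: real
 assumes nu: "0 < nu" and th: "0 < th" "th < 1" and C: "0 <= C" "0 <= C1"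
 defines "de \<equiv> nu * (1 - th) / 4"
 shows "\<exists>c>0. \<forall>dt A B A' B' Fn Q. 0 < dt --> 0 <= A --> 0 <= B --> 0 <= B' --> Q^2 <= C1 * (A ^ 3 * B) -->
  (A'^2 - A^2) / (2 * dt) + nu * B'^2 <= (nu * th * B + nu * C * A + 2 * Fn + 2 * Q) * B' -->
  A'^2 + 2 * (nu * (1 - th / 2) - de) * dt * B'^2 + nu * (1 - th) * (dt * B^2)
   <= A^2 + 2 * (nu * (1 - th / 2) - de) * dt * B^2 + dt * c * (A^2 + (A^2) ^ 3) + c * (dt * Fn^2)"
proof -
 have d: "de > 0" using nu th by (simp add: de_def)
 define K1 where "K1 = 3 * (nu * C)^2 / (4 * de)"
 define K2 where "K2 = 3 / de"
 define K3 where "K3 = (K2 * C1)^2 / (4 * de)"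
 have K: "0 <= K1" "0 < K2" "0 <= K3" using d by (simp_all add: K1_def K2_def K3_def)
 define c where "c = 2 * (K1 + K2 + K3)"
 have "A'^2 + 2 * (nu * (1 - th / 2) - de) * dt * B'^2 + nu * (1 - th) * (dt * B^2)
   <= A^2 + 2 * (nu * (1 - th / 2) - de) * dt * B^2 + dt * c * (A^2 + (A^2) ^ 3) + c * (dt * Fn^2)"
  if dt: "0 < dt" and A: "0 <= A" "0 <= B" "0 <= B'" and Q: "Q^2 <= C1 * (A ^ 3 * B)"
   and h: "(A'^2 - A^2) / (2 * dt) + nu * B'^2 <= (nu * th * B + nu * C * A + 2 * Fn + 2 * Q) * B'" for dt A B A' B' Fn Q
 proof -
  \<comment> \<open>The explicit pressure term is split evenly between the old and the new step;
    together the two halves use the fraction \<open>th < 1\<close> of the viscosity.\<close>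
  have "0 <= nu * th / 2 * (B - B')^2" using nu th by simp
  then have 1: "nu * th * B * B' <= nu * th / 2 * B^2 + nu * th / 2 * B'^2"
   by (simp add: power2_eq_square algebra_simps)
  define Z where "Z = nu * C * A + 2 * Fn + 2 * Q"
  have 2: "Z * B' <= de * B'^2 + Z^2 / (4 * de)" by (rule young[OF d])
  have "0 <= (nu * C * A - 2 * Fn)^2 + (nu * C * A - 2 * Q)^2 + (2 * Fn - 2 * Q)^2" by simp
  then have "Z^2 <= 3 * ((nu * C)^2 * A^2 + 4 * Fn^2 + 4 * Q^2)"
   by (simp add: Z_def power2_eq_square algebra_simps)
  then have "Z^2 / (4 * de) <= 3 * ((nu * C)^2 * A^2 + 4 * Fn^2 + 4 * Q^2) / (4 * de)"
   using d by (intro divide_right_mono) auto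
  also have "... = K1 * A^2 + K2 * Fn^2 + K2 * Q^2" using d by (simp add: K1_def K2_def field_simps)
  finally have 3: "Z^2 / (4 * de) <= K1 * A^2 + K2 * Fn^2 + K2 * Q^2" .
  \<comment> \<open>The bound for the squared convection norm is linear in \<open>B\<close>, so
    Young's inequality trades it for a small multiple of \<open>B^2\<close> and the sixth power of
    \<open>A\<close>.\<close>
  have "K2 * Q^2 <= (K2 * C1 * A ^ 3) * B" using mult_left_mono[OF Q, of K2] K by (simp add: mult_ac)
  also have "... <= de * B^2 + (K2 * C1 * A ^ 3)^2 / (4 * de)" by (rule young[OF d])
  also have "(K2 * C1 * A ^ 3)^2 / (4 * de) = K3 * (A^2) ^ 3"
   by (simp add: K3_def power_mult_distrib power_mult[symmetric])
  finally have 4: "K2 * Q^2 <= de * B^2 + K3 * (A^2) ^ 3" .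
  have "(nu * th * B + nu * C * A + 2 * Fn + 2 * Q) * B' = nu * th * B * B' + Z * B'" by (simp add: Z_def algebra_simps)
  then have "(A'^2 - A^2) / (2 * dt) + (nu * (1 - th / 2) - de) * B'^2 <= (nu * th / 2 + de) * B^2 + (K1 * A^2 + K3 * (A^2) ^ 3 + K2 * Fn^2)"
   using h 1 2 3 4 by (simp add: algebra_simps)
  from mult_left_mono[OF this, of "2 * dt"] dt
  have 5: "A'^2 - A^2 + 2 * dt * ((nu * (1 - th / 2) - de) * B'^2) <= 2 * dt * ((nu * th / 2 + de) * B^2) + dt * (2 * (K1 * A^2 + K3 * (A^2) ^ 3 + K2 * Fn^2))"
   by (simp add: distrib_left)
  have "2 * (K1 * A^2 + K3 * (A^2) ^ 3 + K2 * Fn^2) <= c * (A^2 + (A^2) ^ 3) + c * Fn^2"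
  proof -
   have "2 * K1 * A^2 <= c * A^2" "2 * K3 * (A^2) ^ 3 <= c * (A^2) ^ 3" "2 * K2 * Fn^2 <= c * Fn^2"
    using K by (auto simp: c_def intro!: mult_right_mono)
   then show ?thesis by (simp add: algebra_simps)
  qed
  from mult_left_mono[OF this, of dt] dt
  have 6: "dt * (2 * (K1 * A^2 + K3 * (A^2) ^ 3 + K2 * Fn^2)) <= dt * c * (A^2 + (A^2) ^ 3) + c * (dt * Fn^2)"
   by (simp add: algebra_simps)
  \<comment> \<open>The coefficient of \<open>B'^2\<close> exceeds that of \<open>B^2\<close> by
    \<open>nu * (1 - th) - 2 * de\<close>, which is \<open>nu * (1 - th) / 2\<close> by the choice
    of \<open>de\<close>; the factor \<open>2 * dt\<close> turns it into the dissipation on the left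
    of the claim.\<close>
  have 7: "2 * (nu * (1 - th / 2) - de) * dt * B^2 - nu * (1 - th) * (dt * B^2) = 2 * dt * ((nu * th / 2 + de) * B^2)"
   by (simp add: de_def algebra_simps)
  show ?thesis using 5 6 7 by (simp add: algebra_simps)
 qed
 moreover have "c > 0" using K by (simp add: c_def)
 ultimately show ?thesis by blast
qed

lemma L2_matrix:
 fixes F :: "'a::euclidean_space => real^'n::finite ^ 'm::finite"
 assumes F: "!!i. (%x. F x $ i) \<in> L2 S"
 shows "F \<in> L2 S" "(L2_norm S F)^2 = (SU i. (L2_norm S (%x. F x $ i))^2)"
proof -
 let ?e = "%i j. axis i (axis j 1) :: real^'n ^ 'm"
 have "(%x. SU i j. (F x $ i $ j) *\<^sub>R ?e i j) \<in> L2 S"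
 proof (intro L2_sum)
  fix i :: 'm and j :: 'n
  have h: "(%x. norm (?e i j) * F x $ i $ j) \<in> L2 S" by (rule L2_cmult[OF L2_nth[OF F]])
  show "(%x. (F x $ i $ j) *\<^sub>R ?e i j) \<in> L2 S"
   by (rule L2_bound[OF h borel_measurable_scaleR[OF L2D(1)[OF L2_nth[OF F]] borel_measurable_const]]) (simp add: abs_mult)
 qed
 moreover have "(SU i j. (F x $ i $ j) *\<^sub>R ?e i j) = F x" for x
 proof -
  have "(SU i j. (F x $ i $ j) *\<^sub>R ?e i j) $ k $ l = F x $ k $ l" for k l
  proof -
   have "(SU i j. (F x $ i $ j) *\<^sub>R ?e i j) $ k $ l = (SU i. if i = k then (SU j. if j = l then F x $ i $ j else 0) else 0)"
    unfolding sum_component by (intro sum.cong refl) (auto simp: axis_def if_distrib[where f = "%c. _ * c"] cong: if_cong)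
   then show ?thesis by simp
  qed
  then show ?thesis unfolding vec_eq_iff by blast
 qed
 ultimately show L: "F \<in> L2 S" by simp
 have n: "(norm (F x))^2 = (SU i. (norm (F x $ i))^2)" for x
  by (simp add: norm_vec_def L2_set_def[of _ UNIV] sum_nonneg)
 show "(L2_norm S F)^2 = (SU i. (L2_norm S (%x. F x $ i))^2)"
  unfolding L2_norm_power2 n by (rule B_sum[OF L2D(2)[OF F]])
qed

section \<open>Finite element functions as Sobolev functions\<close>

context bounded_open
begin

lemma h10_linear:
 assumes f: "h10 f df" and g: "h10 g dg"
 shows "h10 (%x. a * f x + b * g x) (%i x. a * df i x + b * dg i x)"
proof -
 note fd = f[unfolded h10_def] and gd = g[unfolded h10_def]
 obtain ph where ph0: "(\<forall>k::nat. test_function Om (ph k)) & (%k. nrm (%x. ph k x - f x)) ~~> 0 &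
  (\<forall>i. (%k. nrm (%x. pdiff i (ph k) x - df i x)) ~~> 0)" using fd[THEN conjunct2] by (rule exE)
 obtain ps where ps0: "(\<forall>k::nat. test_function Om (ps k)) & (%k. nrm (%x. ps k x - g x)) ~~> 0 &
  (\<forall>i. (%k. nrm (%x. pdiff i (ps k) x - dg i x)) ~~> 0)" using gd[THEN conjunct2] by (rule exE)
 note ph = ph0[THEN conjunct1, rule_format] ph0[THEN conjunct2, THEN conjunct1] ph0[THEN conjunct2, THEN conjunct2, rule_format]
 note ps = ps0[THEN conjunct1, rule_format] ps0[THEN conjunct2, THEN conjunct1] ps0[THEN conjunct2, THEN conjunct2, rule_format]
 have lim: "(%k. nrm (%x. (a * F k x + b * G k x) - (a * f x + b * g x))) ~~> 0"
  if "!!k. F k \<in> L2O" "f \<in> L2O" "!!k. G k \<in> L2O" "g \<in> L2O"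
   and l: "(%k. nrm (%x. F k x - f x)) ~~> 0" "(%k. nrm (%x. G k x - g x)) ~~> 0"
  for F G :: "nat => 'n fn" and f g
 proof (rule tendsto_sandwich[OF always_eventually always_eventually tendsto_const])
  show "(%k. \<bar>a\<bar> * nrm (%x. F k x - f x) + \<bar>b\<bar> * nrm (%x. G k x - g x)) ~~> 0"
   using tendsto_add[OF tendsto_mult_left[OF l(1), of "\<bar>a\<bar>"] tendsto_mult_left[OF l(2), of "\<bar>b\<bar>"]] by simp
  have "nrm (%x. a * (F k x - f x) + b * (G k x - g x)) <= \<bar>a\<bar> * nrm (%x. F k x - f x) + \<bar>b\<bar> * nrm (%x. G k x - g x)" for k
   unfolding L2_norm_cmult[symmetric] by (intro L2_norm_triangle L2_cmult L2_diff that(1-4))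
  then show "\<forall>k. nrm (%x. (a * F k x + b * G k x) - (a * f x + b * g x)) <= \<bar>a\<bar> * nrm (%x. F k x - f x) + \<bar>b\<bar> * nrm (%x. G k x - g x)"
   by (simp add: algebra_simps)
 qed simp
 note f1 = fd[THEN conjunct1] and g1 = gd[THEN conjunct1]
 note T = C1c_L2_Omega[OF test_function_C1c[OF ph(1)]] and U = C1c_L2_Omega[OF test_function_C1c[OF ps(1)]]
 have pd: "pdiff i (%x. a * ph k x + b * ps k x) x = a * pdiff i (ph k) x + b * pdiff i (ps k) x" for i k x
  using arg_cong[OF test_function_linear(2)[OF ph(1)[of k] ps(1)[of k], of a b x], of "%v. v $ i"] by simp
 show ?thesis unfolding h10_def
 proof (intro conjI exI[of _ "%k x. a * ph k x + b * ps k x"] allI)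
  show "h1 (%x. a * f x + b * g x) (%i x. a * df i x + b * dg i x)" by (intro h1_add h1_cmult f1 g1)
  show "test_function Om (%x. a * ph k x + b * ps k x)" for k by (rule test_function_linear(1)[OF ph(1) ps(1)])
  show "(%k. nrm (%x. (a * ph k x + b * ps k x) - (a * f x + b * g x))) ~~> 0"
   by (rule lim[OF T(1) h1D(1)[OF f1] U(1) h1D(1)[OF g1] ph(2) ps(2)])
  show "(%k. nrm (%x. pdiff i (%x. a * ph k x + b * ps k x) x - (a * df i x + b * dg i x))) ~~> 0" for i
   unfolding pd by (rule lim[OF T(2) h1D(2)[OF f1] U(2) h1D(2)[OF g1] ph(3) ps(3)])
 qed
qed

lemma h10_cong_AE:
 assumes f: "h10 f df" and ae: "AEO x. f x = f' x" "!!i. AEO x. df i x = df' i x"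
 shows "h10 f' df'"
proof -
 have c: "nrm (%x. ph x - f x) = nrm (%x. ph x - f' x)"
  if "ph \<in> L2O" "f \<in> L2O" "AEO x. f x = f' x" for ph f f' :: "'n fn"
 proof (rule L2_norm_cong_AE)
  show "AEO x. ph x - f x = ph x - f' x" using that(3) by eventually_elim simp
 qed (intro L2D(1)[OF L2_diff[OF that(1)]] that(2) L2_cong_AE_iff[OF sets_Omega that(3,2)])+
 note fd = f[unfolded h10_def]
 obtain ph where ph0: "(\<forall>k::nat. test_function Om (ph k)) & (%k. nrm (%x. ph k x - f x)) ~~> 0 &
  (\<forall>i. (%k. nrm (%x. pdiff i (ph k) x - df i x)) ~~> 0)" using fd[THEN conjunct2] by (rule exE)
 note ph = ph0[THEN conjunct1, rule_format] ph0[THEN conjunct2, THEN conjunct1] ph0[THEN conjunct2, THEN conjunct2, rule_format]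
 note T = C1c_L2_Omega[OF test_function_C1c[OF ph(1)]] and f1 = fd[THEN conjunct1]
 show ?thesis unfolding h10_def
  by (intro conjI exI[of _ ph] allI h1_cong_AE[OF f1 ae] ph(1) ph(2)[unfolded c[OF T(1) h1D(1)[OF f1] ae(1)]]
    ph(3)[unfolded c[OF T(2) h1D(2)[OF f1] ae(2)]])
qed

text \<open>H2 intersected with H10, stated for the chosen weak derivatives because the scheme is
  written with them.\<close>

definition h20 :: "'n fn => bool" where
 "h20 f \<longleftrightarrow> h10 f (%i. weak_pderiv Om i f) & (\<forall>i. h1 (weak_pderiv Om i f) (%j. weak_pderiv Om j (weak_pderiv Om i f)))"

lemma h20D:
 assumes "h20 f"
 shows "h10 f (%i. weak_pderiv Om i f)" "h1 (weak_pderiv Om i f) (%j. weak_pderiv Om j (weak_pderiv Om i f))"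
 using assms unfolding h20_def by (rule conjunct1, elim conjE) (erule spec)

text \<open>Any gradient data will do, also for a function that agrees only almost everywhere, since
  weak derivatives are unique up to null sets.\<close>

lemma h20I:
 assumes f: "h10 f df" and d: "!!i. h1 (df i) (ddf i)" and ae: "AEO x. f x = f' x"
 shows "h20 f'"
proof -
 have "h1 f' df" by (rule h1_cong_AE[OF h10_h1[OF f] ae]) simp
 note w = h1_weak_pderiv_AE[OF this]
 have "h1 (weak_pderiv Om i f') (ddf i)" for i by (rule h1_cong_AE[OF d w]) simp
 then show ?thesis unfolding h20_def by (intro conjI allI h10_cong_AE[OF f ae w] h1_weak_pderiv)
qed

lemma h20_linear:
 assumes "h20 f" "h20 g" shows "h20 (%x. a * f x + b * g x)"
 by (rule h20I[OF h10_linear[OF h20D(1)[OF assms(1)] h20D(1)[OF assms(2)], where a = a and b = b] h1_add[OF h1_cmult[OF h20D(2)[OF assms(1)]] h1_cmult[OF h20D(2)[OF assms(2)]]]]) simp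

lemma h20_zero: "h20 (%x. 0)"
proof -
 have t: "test_function Om (%x. 0)" by (rule test_functionI[OF Ck_const, of "{}"]) auto
 have "pdiff i (%x. 0) x = 0" for i :: 'n and x using test_function_linear(2)[OF t t, of 0 0 x] by (simp add: vec_eq_iff)
 then have "h10 (%x. 0) (%i x. 0)" unfolding h10_def using t h1_zero by (intro conjI exI[of _ "%k x. 0"]) simp_all
 then show ?thesis by (rule h20I[OF _ h1_zero]) simp
qed

lemma velocity_h20:
 assumes X: "fin_dim_subspace_mod (null_functions Om) (velocity_space Om) X" and u: "u \<in> X"
 shows "h20 (%x. u x $ i)"
proof -
 obtain B where B: "finite B & B \<subseteq> velocity_space Om & X = {(%x. (\<Sum>b\<in>B. c b *\<^sub>R b x) + z x) | c z. z \<in> null_functions Om}"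
  using X unfolding fin_dim_subspace_mod_def by (rule exE)
 then obtain c z where uz: "u = (%x. (\<Sum>b\<in>B. c b *\<^sub>R b x) + z x)" and z: "AEO x. z x = 0"
  using u by (auto simp: null_functions_def)
 have b: "h20 (%x. b x $ i)" if "b \<in> B" for b
 proof -
  have "(%x. b x $ i) \<in> sobolev Om 2" "(%x. b x $ i) \<in> H1_0 Om" using that B by (auto simp: velocity_space_def)
  then show ?thesis unfolding h20_def by (intro conjI allI H1_0_h10 sobolev_2_h1(2))
 qed
 have "finite B'==> B' \<subseteq> B ==> h20 (%x. \<Sum>b\<in>B'. c b * b x $ i)" for B'
 proof (induction B' rule: finite_induct)
  case (insert b B')
  then show ?case using h20_linear[OF b[of b], of "%x. \<Sum>b\<in>B'. c b * b x $ i" "c b" 1] by simp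
 qed (simp add: h20_zero)
 then have s: "h20 (%x. \<Sum>b\<in>B. c b * b x $ i)" using B by simp
 have "AEO x. (\<Sum>b\<in>B. c b * b x $ i) = u x $ i"
  using z by eventually_elim (simp add: uz)
 then show ?thesis by (rule h20I[OF h20D(1)[OF s] h20D(2)[OF s]])
qed

text \<open>Modulo constants only the gradient matters, and the constant \<open>d\<close> of the
  representative contributes zero to it.\<close>

lemma pressure_h1:
 assumes Y: "fin_dim_subspace_mod (constant_functions Om) (sobolev Om 1) Y" and p: "p \<in> Y"
 shows "h1 p (%i. weak_pderiv Om i p)"
proof -
 obtain B where B: "finite B & B \<subseteq> sobolev Om 1 & Y = {(%x. (\<Sum>b\<in>B. c b *\<^sub>R b x) + z x) | c z. z \<in> constant_functions Om}"
  using Y unfolding fin_dim_subspace_mod_def by (rule exE)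
 then obtain c z d where pz: "p = (%x. (\<Sum>b\<in>B. c b *\<^sub>R b x) + z x)" and z: "AEO x. z x = d"
  using p by (auto simp: constant_functions_def)
 have "h1 b (%i. weak_pderiv Om i b)" if "b \<in> B" for b
  by (rule sobolev_1_h1) (use that B in auto)
 then have s: "h1 (%x. (\<Sum>b\<in>B. c b * b x) + d * 1) (%i x. (\<Sum>b\<in>B. c b * weak_pderiv Om i b x) + d * 0)"
  by (intro h1_add h1_sum h1_cmult h1_one)
 have "AEO x. (\<Sum>b\<in>B. c b * b x) + d * 1 = p x"
  using z by eventually_elim (simp add: pz)
 then have "h1 p (%i x. (\<Sum>b\<in>B. c b * weak_pderiv Om i b x) + d * 0)" by (rule h1_cong_AE[OF s]) simp
 then show ?thesis by (rule h1_weak_pderiv)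
qed

lemma velocity_norms:
 assumes u: "!!i. h20 (%x. u x $ i)"
 shows "vgrad Om u \<in> L2O" "vlaplace Om u \<in> L2O"
  "(nrm (vgrad Om u))^2 = (SU i. (gnorm (%j. weak_pderiv Om j (%x. u x $ i)))^2)"
  "gnorm (%j. weak_pderiv Om j (%x. u x $ i)) <= nrm (vgrad Om u)"
proof -
 note d = h1D(2)[OF h10_h1[OF h20D(1)[OF u]]] and dd = h1D(2)[OF h20D(2)[OF u]]
 have r: "(%x. vgrad Om u x $ i) \<in> L2O" for i by (simp add: vgrad_def grad_def L2_component_iff d)
 show "vgrad Om u \<in> L2O" by (rule L2_matrix(1)[OF r])
 show "vlaplace Om u \<in> L2O" by (simp add: vlaplace_def laplace_def L2_component_iff L2_sum dd)
 have "(gnorm (%j. weak_pderiv Om j (%x. u x $ i)))^2 = (nrm (%x. vgrad Om u x $ i))^2" for i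
  unfolding L2_norm_component[OF r] by (simp add: gnorm_def sum_nonneg vgrad_def grad_def)
 then show n: "(nrm (vgrad Om u))^2 = (SU i. (gnorm (%j. weak_pderiv Om j (%x. u x $ i)))^2)"
  unfolding L2_matrix(2)[OF r] by simp
 have "(gnorm (%j. weak_pderiv Om j (%x. u x $ i)))^2 <= (nrm (vgrad Om u))^2"
  unfolding n by (rule member_le_sum) auto
 then show "gnorm (%j. weak_pderiv Om j (%x. u x $ i)) <= nrm (vgrad Om u)" by (rule power2_le_imp_le) simp
qed

end

context sobolev_domain
begin

text \<open>Each summand falls under \<open>weighted_gradient_mixed\<close> with two components of
  \<open>u\<close> as \<open>a\<close> and \<open>b\<close>; the full norms \<open>A\<close> and
  \<open>B\<close> bound both Laplacians and both cubes. The dimension occurs squared from the sum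
  inside a component and once more from the sum over components.\<close>

lemma convection_bound:
 assumes u: "!!i. h20 (%x. u x $ i)"
 shows "convect Om u u \<in> L2O"
  "(nrm (convect Om u u))^2 <= (real CARD('n) * (real CARD('n) * (real CARD('n) * (6 * (64 + 18 * diam))))) * (nrm (vgrad Om u) ^ 3 * nrm (vlaplace Om u))"
proof -
 define A where "A = nrm (vgrad Om u)"
 define B where "B = nrm (vlaplace Om u)"
 define M where "M = 6 * (B * ((64 + 18 * diam) * A ^ 3))"
 let ?c = "%i j x. u x $ j * weak_pderiv Om j (%x. u x $ i) x"
 note vn = velocity_norms[OF u]
 have La: "nrm (%x. SU l. weak_pderiv Om l (weak_pderiv Om l (%x. u x $ i)) x) <= B" for i
  using L2_norm_component_le[OF vn(2), of i] by (simp add: vlaplace_def laplace_def B_def)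
 have Xa: "nrm (%x. (u x $ i) ^ 3) <= (64 + 18 * diam) * A ^ 3" for i
  unfolding A_def
  by (rule order_trans[OF Sobolev_h10(2)[OF h20D(1)[OF u[of i]]] mult_left_mono[OF power_mono[OF vn(4) gnorm_nonneg]]])
   (use diam(1) in simp)
 note w = weighted_gradient_mixed[OF h20D(1)[OF u] h20D(1)[OF u] h20D(2)[OF u] h20D(2)[OF u] La La Xa Xa]
 have cL: "?c i j \<in> L2O" for i j by (rule w(1))
 have cn: "(nrm (?c i j))^2 <= M" for i j
 proof -
  have "(nrm (?c i j))^2 <= (SU l. (nrm (%x. u x $ j * weak_pderiv Om l (%x. u x $ i) x))^2)"
   by (rule member_le_sum[of j UNIV "%l. (nrm (%x. u x $ j * weak_pderiv Om l (%x. u x $ i) x))^2"]) auto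
  also have "... <= M" unfolding M_def by (rule w(2))
  finally show ?thesis .
 qed
 have M0: "0 <= M" using cn[of undefined undefined] zero_le_power2 by (rule order_trans[rotated])
 have comp: "(%x. convect Om u u x $ i) = (%x. SU j. ?c i j x)" for i by (simp add: convect_def)
 show L: "convect Om u u \<in> L2O" unfolding L2_component_iff comp by (intro allI L2_sum cL)
 have "(nrm (%x. convect Om u u x $ i))^2 <= (real CARD('n) * sqrt M)^2" for i
 proof (rule power_mono)
  have "nrm (?c i j) <= sqrt M" for j by (rule real_le_rsqrt[OF cn])
  then have "(SU j. nrm (?c i j)) <= (\<Sum>j\<in>(UNIV::'n set). sqrt M)" by (intro sum_mono)
  then show "nrm (%x. convect Om u u x $ i) <= real CARD('n) * sqrt M"
   unfolding comp using L2_norm_triangle_sum[of UNIV "?c i", OF cL] by simp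
 qed simp
 then have "(SU i. (nrm (%x. convect Om u u x $ i))^2) <= (\<Sum>i\<in>(UNIV::'n set). (real CARD('n) * sqrt M)^2)"
  by (intro sum_mono)
 also have "... = real CARD('n) * (real CARD('n) * (real CARD('n) * M))"
  using M0 by (simp add: power_mult_distrib power2_eq_square)
 also have "M = 6 * (64 + 18 * diam) * (A ^ 3 * B)" by (simp only: M_def mult_ac)
 finally show "(nrm (convect Om u u))^2 <= (real CARD('n) * (real CARD('n) * (real CARD('n) * (6 * (64 + 18 * diam))))) * (nrm (vgrad Om u) ^ 3 * nrm (vlaplace Om u))"
  unfolding L2_norm_component[OF L] A_def[symmetric] B_def[symmetric] by (simp only: mult.assoc)
qed

end

context strip_domain
begin

text \<open>The pressure itself is admissible in the pressure equation and the new velocity in the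
  velocity equation. The first bounds the norm \<open>P\<close> of the pressure gradient by the
  commutator, the force and the convection; inserted into the second, force and convection occur a
  second time, hence the factors 2.\<close>

lemma scheme_step:
 assumes hC: "\<forall>u du ddu ph dph. (\<forall>i. h10 (u i) (du i)) --> (\<forall>i l. h1 (du i l) (ddu i l)) --> h1 ph dph -->
   \<bar>inr (%x. \<chi> i. SU j. ddu i j j x - ddu j i j x) (%x. \<chi> i. dph i x)\<bar>
   <= (sqrt (3 / 4) * nrm (%x. \<chi> k. SU j. ddu k j j x) + C * sqrt (SU i. (gnorm (du i))^2)) * gnorm dph"
  and nu: "nu > 0" and dt: "dt > 0" and fn: "fn \<in> L2O"
  and u: "!!i. h20 (%x. u x $ i)" and u': "!!i. h20 (%x. u' x $ i)" and p: "h1 p (%i. weak_pderiv Om i p)"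
  and C0: "C >= 0" and Y: "pressure_eq Om nu Y fn u p" "p \<in> Y" and X: "velocity_eq Om nu dt X fn u p u'" "u' \<in> X"
 shows "((nrm (vgrad Om u'))^2 - (nrm (vgrad Om u))^2) / (2 * dt) + nu * (nrm (vlaplace Om u'))^2
  <= (nu * sqrt (3 / 4) * nrm (vlaplace Om u) + nu * C * nrm (vgrad Om u) + 2 * nrm fn + 2 * nrm (convect Om u u))
   * nrm (vlaplace Om u')"
proof -
 define U where "U i x = u x $ i" for i x
 define du where "du i j = weak_pderiv Om j (U i)" for i j
 define ddu where "ddu i j l = weak_pderiv Om l (du i j)" for i j l
 have U10: "h10 (U i) (du i)" and ddu1: "h1 (du i j) (ddu i j)" for i j
  unfolding ddu_def[abs_def] du_def[abs_def] using h20D[OF u[of i]] by (simp_all add: U_def[abs_def])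
 define V :: "real^'n => real^'n" where "V x = (\<chi> i. SU j. ddu i j j x - ddu j i j x)" for x
 have lap: "vlaplace Om u = (%x. \<chi> k. SU j. ddu k j j x)"
  by (rule ext) (simp add: vlaplace_def laplace_def ddu_def du_def U_def[abs_def])
 note vn = velocity_norms[OF u] and vn' = velocity_norms[OF u']
 have A: "nrm (vgrad Om u) = sqrt (SU i. (gnorm (du i))^2)"
  using vn(3) by (simp add: du_def[abs_def] U_def[abs_def] real_sqrt_unique)
 define gp where "gp = grad Om p"
 have gp: "gp = (%x. \<chi> i. weak_pderiv Om i p x)" by (rule ext) (simp add: gp_def grad_def)
 have gpL: "gp \<in> L2O" unfolding gp by (simp add: L2_component_iff h1D(2)[OF p])
 have gpn: "gnorm (%i. weak_pderiv Om i p) = nrm gp"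
  unfolding gnorm_def using L2_norm_component[OF gpL] by (simp add: gp real_sqrt_unique)
 have VL: "V \<in> L2O" by (simp add: L2_component_iff V_def L2_sum L2_diff h1D(2)[OF ddu1])
 have Vp: "\<bar>inr V gp\<bar> <= (sqrt (3 / 4) * nrm (vlaplace Om u) + C * nrm (vgrad Om u)) * nrm gp"
  using hC[rule_format, where u = U and du = du and ddu = ddu, OF U10 ddu1 p] unfolding V_def[symmetric] lap[symmetric] A[symmetric] gpn gp[symmetric] .
 define cv where "cv = convect Om u u"
 have cvL: "cv \<in> L2O" unfolding cv_def by (rule convection_bound(1)[OF u])
 \<comment> \<open>The divergence contributes second derivatives \<open>ddu i i l\<close>;
   exchanging their order turns them into those in \<open>V\<close>, so the viscous terms of the
   pressure equation combine to \<open>- nu * V\<close>.\<close>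
 have gd: "AEO x. grad Om (diverg Om u) x = vlaplace Om u x - V x"
 proof -
  have "h1 (%x. SU i. du i i x) (%l x. SU i. ddu i i l x)" by (intro h1_sum ddu1)
  moreover have "diverg Om u = (%x. SU i. du i i x)" by (rule ext) (simp add: diverg_def du_def U_def[abs_def])
  ultimately have "h1 (diverg Om u) (%l x. SU i. ddu i i l x)" by simp
  then have "AEO x. \<forall>l\<in>UNIV. (SU i. ddu i i l x) = weak_pderiv Om l (diverg Om u) x"
   by (intro eventually_ball_finite ballI finite h1_weak_pderiv_AE)
  moreover have "AEO x. \<forall>i\<in>UNIV. \<forall>j\<in>UNIV. ddu i i j x = ddu i j i x"
   by (intro eventually_ball_finite ballI finite h1_second_symmetric[OF h10_h1[OF U10] ddu1])
  ultimately show ?thesis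
  proof eventually_elim
   case (elim x)
   have "grad Om (diverg Om u) x $ l = (vlaplace Om u x - V x) $ l" for l
   proof -
    have "grad Om (diverg Om u) x $ l = (SU i. ddu i l i x)" using elim by (simp add: grad_def)
    then show ?thesis by (simp add: lap V_def sum_subtractf)
   qed
   then show ?case by (simp add: vec_eq_iff)
  qed
 qed
 define P where "P = nrm gp"
 have P: "P <= nu * (sqrt (3 / 4) * nrm (vlaplace Om u) + C * nrm (vgrad Om u)) + nrm fn + nrm cv"
 proof -
  have "inr (%x. gp x + nu *\<^sub>R grad Om (diverg Om u) x - nu *\<^sub>R vlaplace Om u x + cv x - fn x) gp = 0"
   using Y unfolding pressure_eq_def gp_def cv_def by blast
  moreover have "inr (%x. gp x + nu *\<^sub>R grad Om (diverg Om u) x - nu *\<^sub>R vlaplace Om u x + cv x - fn x) gp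
   = inr (%x. gp x - nu *\<^sub>R V x + cv x - fn x) gp"
  proof -
   have R: "(%x. gp x - nu *\<^sub>R V x + cv x - fn x) \<in> L2O" by (intro L2_add L2_diff L2_scaleR gpL VL cvL fn)
   have ae: "AEO x. gp x - nu *\<^sub>R V x + cv x - fn x = gp x + nu *\<^sub>R grad Om (diverg Om u) x - nu *\<^sub>R vlaplace Om u x + cv x - fn x"
    using gd by eventually_elim (simp add: scaleR_diff_right)
   have "AEO x. (gp x + nu *\<^sub>R grad Om (diverg Om u) x - nu *\<^sub>R vlaplace Om u x + cv x - fn x) \<bullet> gp x
    = (gp x - nu *\<^sub>R V x + cv x - fn x) \<bullet> gp x" using ae by eventually_elim (simp only:)
   then show ?thesis unfolding L2_inner_def
    by (intro integral_cong_AE borel_measurable_inner L2D(1) L2_cong_AE_iff[OF sets_Omega ae R] R gpL)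
  qed
  moreover have "inr (%x. gp x - nu *\<^sub>R V x + cv x - fn x) gp = P^2 - nu * inr V gp + inr cv gp - inr fn gp"
   by (simp add: L2_inner_diff_left L2_inner_add_left L2_inner_scaleR_left L2_add L2_diff L2_scaleR gpL VL cvL fn P_def L2_norm_inner)
  ultimately have "P^2 = nu * inr V gp - inr cv gp + inr fn gp" by linarith
  also have "... <= nu * ((sqrt (3 / 4) * nrm (vlaplace Om u) + C * nrm (vgrad Om u)) * P) + nrm cv * P + nrm fn * P"
   using mult_left_mono[OF order_trans[OF abs_ge_self Vp], of nu] nu L2_Cauchy_Schwarz[OF cvL gpL] L2_inner_le[OF fn gpL]
   unfolding P_def by linarith
  also have "... = (nu * (sqrt (3 / 4) * nrm (vlaplace Om u) + C * nrm (vgrad Om u)) + nrm fn + nrm cv) * P"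
   by (simp add: algebra_simps)
  finally have le: "P * P <= (nu * (sqrt (3 / 4) * nrm (vlaplace Om u) + C * nrm (vgrad Om u)) + nrm fn + nrm cv) * P"
   by (simp add: power2_eq_square)
  show ?thesis
  proof (cases "P = 0")
   case False
   then have "P > 0" by (simp add: P_def order_less_le)
   then show ?thesis using le by (rule mult_right_le_imp_le[rotated])
  qed (use nu C0 in simp)
 qed
 define G G' B' where "G = vgrad Om u" and "G' = vgrad Om u'" and "B' = vlaplace Om u'"
 have L: "G \<in> L2O" "G' \<in> L2O" "B' \<in> L2O" unfolding G_def G'_def B'_def by (rule vn(1) vn'(1) vn'(2))+
 have "inr (%x. (1 / dt) *\<^sub>R (G' x - G x)) G' + inr (%x. nu *\<^sub>R B' x) B' = inr (%x. gp x + cv x - fn x) B'"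
  using X unfolding velocity_eq_def G_def G'_def B'_def gp_def cv_def by blast
 then have "((nrm G')^2 - inr G G') / dt + nu * (nrm B')^2 = inr gp B' + inr cv B' - inr fn B'"
  by (simp only: L2_inner_scaleR_left L2_inner_diff_left[OF L(2) L(1) L(2)] L2_inner_diff_left[OF L2_add[OF gpL cvL] fn L(3)]
    L2_inner_add_left[OF gpL cvL L(3)] L2_norm_inner) simp
 also have "... <= (P + nrm cv + nrm fn) * nrm B'"
  using L2_inner_le[OF gpL L(3)] L2_inner_le[OF cvL L(3)] L2_Cauchy_Schwarz[OF fn L(3)] by (simp add: P_def algebra_simps)
 also have "... <= (nu * sqrt (3 / 4) * nrm (vlaplace Om u) + nu * C * nrm (vgrad Om u) + 2 * nrm fn + 2 * nrm cv) * nrm B'"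
  by (rule mult_right_mono) (use P in "simp_all add: algebra_simps")
 finally have main: "((nrm G')^2 - inr G G') / dt + nu * (nrm B')^2 <= ..." .
 \<comment> \<open>The stability of the implicit step: half the increment of the squared norm is at
   most the increment tested with the new gradient.\<close>
 have "2 * inr G G' <= (nrm G)^2 + (nrm G')^2"
  using L2_norm_diff_power2[OF L(1,2), of 1] zero_le_power2[of "nrm (%x. G x - 1 *\<^sub>R G' x)"] by simp
 then have "((nrm G')^2 - (nrm G)^2) / 2 <= (nrm G')^2 - inr G G'" by simp
 then have "((nrm G')^2 - (nrm G)^2) / 2 / dt <= ((nrm G')^2 - inr G G') / dt"
  using dt by (intro divide_right_mono) auto
 then have "((nrm G')^2 - (nrm G)^2) / (2 * dt) <= ((nrm G')^2 - inr G G') / dt" by simp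
 with main show ?thesis unfolding G_def G'_def B'_def cv_def by linarith
qed

end

section \<open>Stability of the scheme on a time interval fixed by the data\<close>

theorem theorem3:
  fixes \<Omega> :: "(real ^ 'n::finite) set" and \<nu> :: real
  assumes "CARD('n) = 2 \<or> CARD('n) = 3"
    and "bounded_domain \<Omega>" and "Ck_boundary 3 \<Omega>"
    and "\<nu> > 0"
  shows "\<exists>(Tstar :: real \<Rightarrow> real) (C4 :: real \<Rightarrow> real).
    (\<forall>M. Tstar M > 0 \<and> C4 M > 0) \<and>
    (\<forall>(X :: (real ^ 'n \<Rightarrow> real ^ 'n) set) (Y :: (real ^ 'n \<Rightarrow> real) set)
       (T :: real) (f :: real \<Rightarrow> real ^ 'n \<Rightarrow> real ^ 'n) (dt :: real)
       (u :: nat \<Rightarrow> real ^ 'n \<Rightarrow> real ^ 'n) (p :: nat \<Rightarrow> real ^ 'n \<Rightarrow> real) (n :: nat).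
       fin_dim_subspace_mod (null_functions \<Omega>) (velocity_space \<Omega>) X \<longrightarrow>
       fin_dim_subspace_mod (constant_functions \<Omega>) (sobolev \<Omega> 1) Y \<longrightarrow>
       T > 0 \<longrightarrow> f \<in> L2_L2 T \<Omega> \<longrightarrow> dt > 0 \<longrightarrow>
       fem_scheme \<Omega> \<nu> X Y T f dt u p \<longrightarrow>
       real n * dt \<le> Tstar (M0h \<Omega> \<nu> T f dt (u 0)) \<longrightarrow> real n * dt \<le> T \<longrightarrow>
       (SUP k\<in>{0..n}. (L2_norm \<Omega> (vgrad \<Omega> (u k)))\<^sup>2)
         + (\<Sum>k=0..n. (L2_norm \<Omega> (vlaplace \<Omega> (u k)))\<^sup>2 * dt)
       \<le> C4 (M0h \<Omega> \<nu> T f dt (u 0)))"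
proof -
 have op: "open \<Omega>" and bdd: "bounded \<Omega>" using assms(2) by (auto simp: bounded_domain_def)
 obtain rr where rr: "Ck 3 rr" "\<forall>x. rr x > 0 \<longleftrightarrow> x \<in> \<Omega>" "\<forall>x\<in>frontier \<Omega>. \<exists>i. pdiff i rr x ~= 0"
  using defining_function_exists[OF op bdd assms(3)] by (elim exE conjE)
 interpret strip_domain \<Omega> rr
  by unfold_locales (rule op, rule bdd, rule assms(1), rule rr(1), rule rr(2)[rule_format], rule rr(3)[rule_format])
 obtain C where C: "C >= 0 & (\<forall>u du ddu ph dph. (\<forall>i. h10 (u i) (du i)) --> (\<forall>i l. h1 (du i l) (ddu i l)) --> h1 ph dph -->
   \<bar>L2_inner \<Omega> (%x. \<chi> i. SU j. ddu i j j x - ddu j i j x) (%x. \<chi> i. dph i x)\<bar>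
   <= (sqrt (3 / 4) * L2_norm \<Omega> (%x. \<chi> k. SU j. ddu k j j x) + C * sqrt (SU i. (gnorm (du i))^2)) * gnorm dph)"
  using commutator_estimate by (rule exE)
 define th where "th = sqrt (3 / 4 :: real)"
 have th: "0 < th" "th < 1" by (simp_all add: th_def)
 define C1 where "C1 = real CARD('n) * (real CARD('n) * (real CARD('n) * (6 * (64 + 18 * diam))))"
 have C1: "0 <= C1" using diam(1) by (simp add: C1_def)
 \<comment> \<open>\<open>\<alpha>\<close> is the weight of \<open>dt * b k\<close> in the discrete
   energy \<open>e\<close>, twice the coefficient that \<open>energy_step\<close> leaves to the new
   Laplacian. The bound \<open>\<alpha> <= 2 * \<nu>\<close> makes the initial energy at most
   \<open>2 * M\<close>.\<close>
 define \<alpha> where "\<alpha> = 2 * (\<nu> * (1 - th / 2) - \<nu> * (1 - th) / 4)"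
 define \<mu> where "\<mu> = \<nu> * (1 - th)"
 have \<alpha>: "0 < \<alpha>" "\<alpha> <= 2 * \<nu>" and \<mu>: "0 < \<mu>"
 proof -
  have a: "\<alpha> = \<nu> * (3 / 2 - th / 2)" by (simp add: \<alpha>_def field_simps)
  show "0 < \<alpha>" "0 < \<mu>" unfolding a \<mu>_def using th assms(4) by simp_all
  have "\<nu> * (3 / 2 - th / 2) <= \<nu> * 2" using th assms(4) by (intro mult_left_mono) auto
  then show "\<alpha> <= 2 * \<nu>" by (simp add: a)
 qed
 obtain c where c: "c > 0" and step: "!!dt A B A' B' Fn Q. 0 < dt ==> 0 <= A ==> 0 <= B ==> 0 <= B' ==> Q^2 <= C1 * (A ^ 3 * B) ==>
  (A'^2 - A^2) / (2 * dt) + \<nu> * B'^2 <= (\<nu> * th * B + \<nu> * C * A + 2 * Fn + 2 * Q) * B' ==>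
  A'^2 + \<alpha> * dt * B'^2 + \<mu> * (dt * B^2) <= A^2 + \<alpha> * dt * B^2 + dt * c * (A^2 + (A^2) ^ 3) + c * (dt * Fn^2)"
  using energy_step[OF assms(4) th C[THEN conjunct1] C1] unfolding \<alpha>_def \<mu>_def by blast
 \<comment> \<open>\<open>Tstar\<close> and \<open>C4\<close> must be positive for every real
   argument, hence the absolute values. For the nonnegative \<open>M\<close> that occurs,
   \<open>R M\<close> is the level of \<open>discrete_energy_bound\<close> with
   \<open>E0 = 2 * M\<close>.\<close>
 define R where "R M = 2 * \<bar>M\<bar> + c * \<bar>M\<bar> + 1" for M
 have R: "R M >= 1" for M using c by (simp add: R_def)
 \<comment> \<open>The time at which the additions counted in \<open>discrete_energy_bound\<close>
   may reach 1.\<close>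
 define Tstar where "Tstar M = 1 / (c * (R M + R M ^ 3))" for M
 \<comment> \<open>One term each for the gradients, for the Laplacians at the indices before
   \<open>n\<close>, and for the Laplacian at \<open>n\<close>.\<close>
 define C4 where "C4 M = R M + R M / \<mu> + R M / \<alpha>" for M
 have pos: "Tstar M > 0 & C4 M > 0" for M
  using R[of M] c \<mu> \<alpha>(1) by (simp add: Tstar_def C4_def add_pos_pos)
 have main: "(SUP k\<in>{0..n}. (L2_norm \<Omega> (vgrad \<Omega> (u k)))^2) + (\<Sum>k=0..n. (L2_norm \<Omega> (vlaplace \<Omega> (u k)))^2 * dt) <= C4 (M0h \<Omega> \<nu> T f dt (u 0))"
  if X: "fin_dim_subspace_mod (null_functions \<Omega>) (velocity_space \<Omega>) X"
   and Y: "fin_dim_subspace_mod (constant_functions \<Omega>) (sobolev \<Omega> 1) Y"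
   and f: "f \<in> L2_L2 T \<Omega>" and dt: "dt > 0" and s: "fem_scheme \<Omega> \<nu> X Y T f dt u p"
   and nT: "real n * dt <= Tstar (M0h \<Omega> \<nu> T f dt (u 0))" "real n * dt <= T"
  for X Y T f dt u p n
 proof -
  define M where "M = M0h \<Omega> \<nu> T f dt (u 0)"
  define a where "a k = (L2_norm \<Omega> (vgrad \<Omega> (u k)))^2" for k
  define b where "b k = (L2_norm \<Omega> (vlaplace \<Omega> (u k)))^2" for k
  define F where "F k = (L2_norm \<Omega> (time_avg f dt k))^2" for k
  define e where "e k = a k + \<alpha> * dt * b k" for k
  have nn: "0 <= a k" "0 <= b k" "0 <= F k" "0 <= e k" for k
   using \<alpha>(1) dt by (simp_all add: a_def b_def F_def e_def)
  note tav = time_average_bound[OF op f dt nT(2)]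
  have I: "0 <= (LINT t|lebesgue_on {0<..<T}. (L2_norm \<Omega> (f t))^2)" by (rule B_nonneg) simp
  have Meq: "M = a 0 + \<nu> * dt * b 0 + (LINT t|lebesgue_on {0<..<T}. (L2_norm \<Omega> (f t))^2)"
   by (simp add: M_def M0h_def a_def b_def)
  have vb: "0 <= \<nu> * dt * b 0" using assms(4) dt nn by simp
  have M0: "0 <= M" using Meq I nn(1)[of 0] vb by linarith
  \<comment> \<open>Step \<open>k\<close> averages the force up to time \<open>(k + 1) * dt\<close>,
    which does not exceed \<open>T\<close> for \<open>k < n\<close>.\<close>
  have sn: "p k \<in> Y" "u (k + 1) \<in> X" "pressure_eq \<Omega> \<nu> Y (time_avg f dt k) (u k) (p k)"
   "velocity_eq \<Omega> \<nu> dt X (time_avg f dt k) (u k) (p k) (u (k + 1))" if "k < n" for k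
  proof -
   have "real (k + 1) * dt <= real n * dt" using that dt by (intro mult_right_mono) auto
   then have "real (k + 1) * dt <= T" using nT(2) by linarith
   with s show "p k \<in> Y" "u (k + 1) \<in> X" "pressure_eq \<Omega> \<nu> Y (time_avg f dt k) (u k) (p k)"
    "velocity_eq \<Omega> \<nu> dt X (time_avg f dt k) (u k) (p k) (u (k + 1))" unfolding fem_scheme_def by blast+
  qed
  have uX: "u k \<in> X" if "k <= n" for k
  proof (cases k)
   case 0 then show ?thesis using s by (simp add: fem_scheme_def)
  next
   case (Suc m) then show ?thesis using sn(2)[of m] that by simp
  qed
  have h: "h20 (%x. u k x $ i)" if "k <= n" for k i by (rule velocity_h20[OF X uX[OF that]])
  have es: "e (Suc k) + \<mu> * (dt * b k) <= e k + dt * c * (e k + e k ^ 3) + c * (dt * F k)" if k: "k < n" for k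
  proof -
   have k1: "k <= n" "k + 1 <= n" using k by simp_all
   have "a (k + 1) + \<alpha> * dt * b (k + 1) + \<mu> * (dt * b k) <= a k + \<alpha> * dt * b k + dt * c * (a k + a k ^ 3) + c * (dt * F k)"
    unfolding a_def b_def F_def
   proof (rule step[OF dt _ _ _ convection_bound(2)[OF h[OF k1(1)], folded C1_def]])
    show "((L2_norm \<Omega> (vgrad \<Omega> (u (k + 1))))^2 - (L2_norm \<Omega> (vgrad \<Omega> (u k)))^2) / (2 * dt) + \<nu> * (L2_norm \<Omega> (vlaplace \<Omega> (u (k + 1))))^2
     <= (\<nu> * th * L2_norm \<Omega> (vlaplace \<Omega> (u k)) + \<nu> * C * L2_norm \<Omega> (vgrad \<Omega> (u k)) + 2 * L2_norm \<Omega> (time_avg f dt k)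
      + 2 * L2_norm \<Omega> (convect \<Omega> (u k) (u k))) * L2_norm \<Omega> (vlaplace \<Omega> (u (k + 1)))"
     unfolding th_def
     by (rule scheme_step[OF C[THEN conjunct2] assms(4) dt tav(1)[OF k] h[OF k1(1)] h[OF k1(2)] pressure_h1[OF Y sn(1)[OF k]] C[THEN conjunct1]
       sn(3)[OF k] sn(1)[OF k] sn(4)[OF k] sn(2)[OF k]])
   qed simp_all
   moreover have "a k + a k ^ 3 <= e k + e k ^ 3"
   proof -
    have "a k <= e k" using nn(2)[of k] \<alpha>(1) dt by (simp add: e_def)
    then show ?thesis using nn(1) by (intro add_mono power_mono)
   qed
   from mult_left_mono[OF this, of "dt * c"] dt c have "dt * c * (a k + a k ^ 3) <= dt * c * (e k + e k ^ 3)" by simp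
   ultimately show ?thesis by (simp add: e_def)
  qed
  have e0: "e 0 <= 2 * M"
  proof -
   have "\<alpha> * dt * b 0 <= 2 * \<nu> * dt * b 0" using \<alpha>(2) dt nn by (intro mult_right_mono) auto
   then have "\<alpha> * dt * b 0 <= 2 * (\<nu> * dt * b 0)" by (simp only: mult.assoc)
   then show ?thesis using Meq I nn(1)[of 0] unfolding e_def by linarith
  qed
  have FM: "(\<Sum>k<n. dt * F k) <= M"
   using tav(2) Meq nn(1)[of 0] vb unfolding F_def by linarith
  have RM: "R M = 2 * M + c * M + 1" using M0 by (simp add: R_def)
  have D: "0 < c * (R M + R M ^ 3)" using c R[of M] by (simp add: add_pos_pos)
  have TR: "real n * dt * (c * (R M + R M ^ 3)) <= 1"
   using mult_right_mono[OF nT(1)[folded M_def], of "c * (R M + R M ^ 3)"] D by (simp add: Tstar_def split: if_splits)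
  have bound: "e k + \<mu> * (\<Sum>j<k. dt * b j) <= R M" if "k <= n" for k
   by (rule discrete_energy_bound[where n = n and F = F, OF es nn(4) nn(2) nn(3) dt less_imp_le[OF c] less_imp_le[OF \<mu>] M0 e0 FM RM TR that])
  have sb: "0 <= \<mu> * (\<Sum>j<k. dt * b j)" for k using \<mu> dt nn by (intro mult_nonneg_nonneg sum_nonneg) auto
  have "(SUP k\<in>{0..n}. a k) <= R M"
  proof (rule cSUP_least)
   fix k assume "k \<in> {0..n}"
   then have "e k <= R M" using bound[of k] sb[of k] by simp
   moreover have "a k <= e k" using nn(2)[of k] \<alpha>(1) dt by (simp add: e_def)
   ultimately show "a k <= R M" by linarith
  qed simp
  moreover have "(\<Sum>j<n. dt * b j) <= R M / \<mu>"
   using bound[of n] nn(4)[of n] \<mu> by (simp add: pos_le_divide_eq mult.commute)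
  \<comment> \<open>The dissipation controls only the indices \<open>j < n\<close>; the last summand
    is contained in the energy \<open>e n\<close>.\<close>
  moreover have "dt * b n <= R M / \<alpha>"
  proof -
   have "\<alpha> * (dt * b n) <= R M" using bound[of n] sb[of n] nn(1)[of n] by (simp add: e_def mult.assoc)
   then show ?thesis using \<alpha>(1) by (simp add: pos_le_divide_eq mult.commute)
  qed
  moreover have "(\<Sum>k=0..n. b k * dt) = (\<Sum>j<n. dt * b j) + dt * b n"
   by (simp add: atLeast0AtMost lessThan_Suc_atMost[symmetric] mult.commute)
  ultimately show ?thesis unfolding C4_def M_def[symmetric] a_def[symmetric] b_def[symmetric] by linarith
 qed
 show ?thesis
  by (intro exI[of _ Tstar] exI[of _ C4] conjI allI impI pos[THEN conjunct1] pos[THEN conjunct2]) (rule main)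
qed
end
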